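(* Let $\pi\colon E\to I$ be a fibred site as in the context, $V$ an object of $E$, $c=\pi(V)$, $\varpi\colon E_{/V}\to I_{/c}$ the fibred site induced by $\pi$, and $\gamma_V\colon E_{/V}\to E$ the canonical functor. Equip $E_{/V}$ with the co-evanescent topology relative to $\varpi$. Then the co-evanescent topology of $E_{/V}$ is induced by that of $E$ via the functor $\gamma_V$. In particular, the topos of sheaves of $\mathbb U$-sets on $E_{/V}$ is canonically equivalent to $\widetilde E_{/\varepsilon(V)}$. The restriction functor to $\widetilde E_{/\varepsilon(V)}$ is isomorphic to the functor $$\widetilde E\to\widetilde E_{/\varepsilon(V)},\qquad \{i\mapsto F_i\}\mapsto\{(i,f)\mapsto F_i\times f^*(V)\},$$ where $(i,f)$ denotes an object of $I_{/c}$, i.e. $f\colon i\to c$ is a morphism of $I$.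
   Context: Fix a universe $\mathbb U$ containing an element of infinite cardinality; sheaves are of $\mathbb U$-sets. Let $I$ be a $\mathbb U$-site and $\pi\colon E\to I$ a cleaved and normalized fibred category over the category underlying $I$, such that: (i) finite limits are representable in $I$; (ii) for every $i\in\mathrm{Ob}(I)$, the fibre category $E_i$ is equipped with a topology making it a $\mathbb U$-site, and finite limits are representable in $E_i$; $\widetilde E_i$ is the topos of sheaves on $E_i$; (iii) for every morphism $f\colon i\to j$ of $I$, the inverse image functor $f^+\colon E_j\to E_i$ is continuous and left exact; it defines a morphism of topoi $f\colon\widetilde E_i\to\widetilde E_j$. The co-evanescent topology on $E$ is the topology generated by the families $(V_n\to V)_{n\in\Sigma}$ of the following two types: (v) there is $i\in \mathrm{Ob}(I)$ such that $(V_n\to V)_{n\in\Sigma}$ is a covering family of $E_i$; (c) there is a covering family $(f_n\colon i_n\to i)_{n\in\Sigma}$ of $I$, with $i=\pi(V)$, such that $V_n$ is isomorphic to $f_n^+(V)$ for all $n$ (with $V_n\to V$ the canonical morphism). This definition makes sense (for any such fibred site) when $I$ only has fibre products. $\widetilde E$ is the topos of sheaves on $E$ and $\varepsilon\colon E\to\widetilde E$ the canonical functor (sheaf associated to the represented presheaf). A sheaf $F$ on $E$ is written $\{i\mapsto F_i\}$, where $F_i=F|_{E_i}\in\widetilde E_i$, with transition morphisms $F_j\to f_*(F_i)$ for $f\colon i\to j$. For $f\colon i\to c$ in $I$, the fibre of $\varpi$ over $(i,f)\in\mathrm{Ob}(I_{/c})$ is canonically equivalent to $(E_i)_{/f^+(V)}$.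 One gives $I_{/c}$ the topology induced by $I$ and each $(E_i)_{/f^+(V)}$ the topology induced by $E_i$; then $\varpi$ is a fibred site to which the definition of the co-evanescent topology applies. The topos of sheaves on $(E_i)_{/f^+(V)}$ is identified with $(\widetilde E_i)_{/f^*(V)}$, where $f^*(V)$ denotes the inverse image by $f\colon \widetilde E_i\to\widetilde E_c$ of the sheaf on $E_c$ associated to $V$ (i.e. the sheaf on $E_i$ associated to $f^+(V)$); $F_i\times f^*(V)$ is viewed as an object of it by the second projection. Given a functor $u\colon C'\to C$ into a site $C$, the topology induced on $C'$ is the finest topology for which $u$ is continuous. *)

theory Defs
  imports "HOL-Library.FuncSet"
begin

section \<open>Universes\<close>

text \<open>A universe is given by the type \<open>'u\<close> of its elements and the map \<open>el\<close> sending an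
  element (which is itself a set) to the set of its elements. The conditions are those of SGA 4, I.0;
  every subset of \<open>el x\<close> is required to be an element of the universe, so that \<open>p\<close> below is
  the full power set of \<open>x\<close>. A \<open>\<U>\<close>-set is a member of \<open>range el\<close>.\<close>

definition universe :: "('u \<Rightarrow> 'u set) \<Rightarrow> bool" where
  "universe el \<longleftrightarrow>
     inj el \<and>
     (\<forall>x y. \<exists>z. el z = {x, y}) \<and>
     (\<forall>x S. S \<subseteq> el x \<longrightarrow> S \<in> range el) \<and>
     (\<forall>x. \<exists>p. el p = {y. el y \<subseteq> el x}) \<and>
     (\<forall>x g. \<exists>u. el u = (\<Union>y\<in>el x. el (g y))) \<and>
     (\<exists>x. infinite (el x))"

definition U_small :: "('u \<Rightarrow> 'u set) \<Rightarrow> 'a set \<Rightarrow> bool" where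
  "U_small el A \<longleftrightarrow> (\<exists>x h. bij_betw h A (el x))"

definition upair :: "('u \<Rightarrow> 'u set) \<Rightarrow> 'u \<Rightarrow> 'u \<Rightarrow> 'u" where
  "upair el x y = inv el {x, y}"

definition kpair :: "('u \<Rightarrow> 'u set) \<Rightarrow> 'u \<Rightarrow> 'u \<Rightarrow> 'u" where
  "kpair el x y = upair el (upair el x x) (upair el x y)"

definition ufst :: "('u \<Rightarrow> 'u set) \<Rightarrow> 'u \<Rightarrow> 'u" where
  "ufst el z = (THE x. \<exists>y. z = kpair el x y)"

definition usnd :: "('u \<Rightarrow> 'u set) \<Rightarrow> 'u \<Rightarrow> 'u" where
  "usnd el z = (THE y. \<exists>x. z = kpair el x y)"


section \<open>Categories and functors\<close>

text \<open>\<open>cmp C g f\<close> is the composite ``\<open>g\<close> after \<open>f\<close>''.\<close>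

record ('o, 'm) cat =
  Ob :: "'o set"
  Ar :: "'m set"
  src :: "'m \<Rightarrow> 'o"
  tgt :: "'m \<Rightarrow> 'o"
  ide :: "'o \<Rightarrow> 'm"
  cmp :: "'m \<Rightarrow> 'm \<Rightarrow> 'm"

definition hom :: "('o, 'm) cat \<Rightarrow> 'o \<Rightarrow> 'o \<Rightarrow> 'm set" where
  "hom C X Y = {m \<in> Ar C. src C m = X \<and> tgt C m = Y}"

definition category :: "('o, 'm) cat \<Rightarrow> bool" where
  "category C \<longleftrightarrow>
     (\<forall>m\<in>Ar C. src C m \<in> Ob C \<and> tgt C m \<in> Ob C) \<and>
     (\<forall>X\<in>Ob C. ide C X \<in> hom C X X) \<and>
     (\<forall>m\<in>Ar C. \<forall>n\<in>Ar C. tgt C m = src C n \<longrightarrow> cmp C n m \<in> hom C (src C m) (tgt C n)) \<and>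
     (\<forall>m\<in>Ar C. cmp C m (ide C (src C m)) = m \<and> cmp C (ide C (tgt C m)) m = m) \<and>
     (\<forall>l\<in>Ar C. \<forall>m\<in>Ar C. \<forall>n\<in>Ar C. tgt C l = src C m \<and> tgt C m = src C n \<longrightarrow>
        cmp C n (cmp C m l) = cmp C (cmp C n m) l)"

definition is_iso :: "('o, 'm) cat \<Rightarrow> 'm \<Rightarrow> bool" where
  "is_iso C m \<longleftrightarrow> m \<in> Ar C \<and>
     (\<exists>n \<in> hom C (tgt C m) (src C m).
        cmp C n m = ide C (src C m) \<and> cmp C m n = ide C (tgt C m))"

record ('o, 'm, 'p, 'n) func =
  fob :: "'o \<Rightarrow> 'p"
  far :: "'m \<Rightarrow> 'n"

definition is_functor :: "('o, 'm) cat \<Rightarrow> ('p, 'n) cat \<Rightarrow> ('o, 'm, 'p, 'n) func \<Rightarrow> bool" where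
  "is_functor C D F \<longleftrightarrow> category C \<and> category D \<and>
     (\<forall>X\<in>Ob C. fob F X \<in> Ob D) \<and>
     (\<forall>m\<in>Ar C. far F m \<in> hom D (fob F (src C m)) (fob F (tgt C m))) \<and>
     (\<forall>X\<in>Ob C. far F (ide C X) = ide D (fob F X)) \<and>
     (\<forall>m\<in>Ar C. \<forall>n\<in>Ar C. tgt C m = src C n \<longrightarrow>
        far F (cmp C n m) = cmp D (far F n) (far F m))"

definition comp_func :: "('p, 'n, 'q, 'r) func \<Rightarrow> ('o, 'm, 'p, 'n) func \<Rightarrow> ('o, 'm, 'q, 'r) func" where
  "comp_func G F = \<lparr>fob = \<lambda>X. fob G (fob F X), far = \<lambda>m. far G (far F m)\<rparr>"

definition idfunc :: "('o, 'm, 'o, 'm) func" where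
  "idfunc = \<lparr>fob = \<lambda>X. X, far = \<lambda>m. m\<rparr>"

definition isomorphic_functors ::
    "('o, 'm) cat \<Rightarrow> ('p, 'n) cat \<Rightarrow> ('o, 'm, 'p, 'n) func \<Rightarrow> ('o, 'm, 'p, 'n) func \<Rightarrow> bool" where
  "isomorphic_functors C D F G \<longleftrightarrow> is_functor C D F \<and> is_functor C D G \<and>
     (\<exists>\<tau>. (\<forall>X\<in>Ob C. \<tau> X \<in> hom D (fob F X) (fob G X) \<and> is_iso D (\<tau> X)) \<and>
          (\<forall>m\<in>Ar C. cmp D (\<tau> (tgt C m)) (far F m) = cmp D (far G m) (\<tau> (src C m))))"

definition quasi_inverse ::
    "('o, 'm) cat \<Rightarrow> ('p, 'n) cat \<Rightarrow> ('o, 'm, 'p, 'n) func \<Rightarrow> ('p, 'n, 'o, 'm) func \<Rightarrow> bool" where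
  "quasi_inverse C D F G \<longleftrightarrow> is_functor C D F \<and> is_functor D C G \<and>
     isomorphic_functors C C (comp_func G F) idfunc \<and>
     isomorphic_functors D D (comp_func F G) idfunc"

text \<open>An object of \<open>C\<^bsub>/V\<^esub>\<close> is an arrow \<open>w\<close> with target \<open>V\<close>; an arrow \<open>w \<rightarrow> w'\<close> is a triple
  \<open>(w, w', m)\<close> with \<open>w' \<circ> m = w\<close>.\<close>

definition slice :: "('o, 'm) cat \<Rightarrow> 'o \<Rightarrow> ('m, 'm \<times> 'm \<times> 'm) cat" where
  "slice C V = \<lparr>
     Ob = {w \<in> Ar C. tgt C w = V},
     Ar = {(w, w', m). w \<in> Ar C \<and> w' \<in> Ar C \<and> tgt C w = V \<and> tgt C w' = V \<and>
             m \<in> hom C (src C w) (src C w') \<and> cmp C w' m = w},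
     src = (\<lambda>(w, w', m). w),
     tgt = (\<lambda>(w, w', m). w'),
     ide = (\<lambda>w. (w, w, ide C (src C w))),
     cmp = (\<lambda>(b1, b2, n) (a1, a2, m). (a1, b2, cmp C n m))\<rparr>"

definition slice_forget :: "('o, 'm) cat \<Rightarrow> ('m, 'm \<times> 'm \<times> 'm, 'o, 'm) func" where
  "slice_forget C = \<lparr>fob = src C, far = \<lambda>(w, w', m). m\<rparr>"


subsection \<open>Finite limits\<close>

definition cone :: "('a, 'b) cat \<Rightarrow> ('o, 'm) cat \<Rightarrow> ('a, 'b, 'o, 'm) func \<Rightarrow> 'o \<Rightarrow> ('a \<Rightarrow> 'm) \<Rightarrow> bool" where
  "cone D C F L p \<longleftrightarrow> L \<in> Ob C \<and> (\<forall>j\<in>Ob D. p j \<in> hom C L (fob F j)) \<and>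
     (\<forall>a\<in>Ar D. cmp C (far F a) (p (src D a)) = p (tgt D a))"

definition limit_cone :: "('a, 'b) cat \<Rightarrow> ('o, 'm) cat \<Rightarrow> ('a, 'b, 'o, 'm) func \<Rightarrow> 'o \<Rightarrow> ('a \<Rightarrow> 'm) \<Rightarrow> bool" where
  "limit_cone D C F L p \<longleftrightarrow> cone D C F L p \<and>
     (\<forall>L' p'. cone D C F L' p' \<longrightarrow> (\<exists>!h. h \<in> hom C L' L \<and> (\<forall>j\<in>Ob D. cmp C (p j) h = p' j)))"

text \<open>Every finite category is isomorphic to one with objects and arrows in \<open>nat\<close>.\<close>

definition finite_category :: "(nat, nat) cat \<Rightarrow> bool" where
  "finite_category D \<longleftrightarrow> category D \<and> finite (Ob D) \<and> finite (Ar D)"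

definition has_finite_limits :: "('o, 'm) cat \<Rightarrow> bool" where
  "has_finite_limits C \<longleftrightarrow>
     (\<forall>D F. finite_category D \<and> is_functor D C F \<longrightarrow> (\<exists>L p. limit_cone D C F L p))"

definition left_exact :: "('o, 'm) cat \<Rightarrow> ('p, 'n) cat \<Rightarrow> ('o, 'm, 'p, 'n) func \<Rightarrow> bool" where
  "left_exact C C' u \<longleftrightarrow> is_functor C C' u \<and>
     (\<forall>D F L p. finite_category D \<and> is_functor D C F \<and> limit_cone D C F L p \<longrightarrow>
        limit_cone D C' (comp_func u F) (fob u L) (\<lambda>j. far u (p j)))"


section \<open>Presheaves\<close>

text \<open>Presheaves of sets of elements of an arbitrary type; \<open>\<U>\<close>-presheaves are singled out by
  \<open>upresheaf\<close>. Sections and restrictions are extensional, so that equality of records is equality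
  of presheaves.\<close>

record ('o, 'm, 's) psh =
  sec :: "'o \<Rightarrow> 's set"
  res :: "'m \<Rightarrow> 's \<Rightarrow> 's"

definition presheaf :: "('o, 'm) cat \<Rightarrow> ('o, 'm, 's) psh \<Rightarrow> bool" where
  "presheaf C F \<longleftrightarrow>
     sec F \<in> extensional (Ob C) \<and> res F \<in> extensional (Ar C) \<and>
     (\<forall>m\<in>Ar C. res F m \<in> sec F (tgt C m) \<rightarrow>\<^sub>E sec F (src C m)) \<and>
     (\<forall>X\<in>Ob C. \<forall>x\<in>sec F X. res F (ide C X) x = x) \<and>
     (\<forall>m\<in>Ar C. \<forall>n\<in>Ar C. tgt C m = src C n \<longrightarrow>
        (\<forall>x\<in>sec F (tgt C n). res F (cmp C n m) x = res F m (res F n x)))"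

definition upresheaf :: "('u \<Rightarrow> 'u set) \<Rightarrow> ('o, 'm) cat \<Rightarrow> ('o, 'm, 'u) psh \<Rightarrow> bool" where
  "upresheaf el C F \<longleftrightarrow> presheaf C F \<and> (\<forall>X\<in>Ob C. sec F X \<in> range el)"

definition psh_mor :: "('o, 'm) cat \<Rightarrow> ('o, 'm, 's) psh \<Rightarrow> ('o, 'm, 't) psh \<Rightarrow> ('o \<Rightarrow> 's \<Rightarrow> 't) \<Rightarrow> bool" where
  "psh_mor C F G \<alpha> \<longleftrightarrow>
     \<alpha> \<in> (\<Pi>\<^sub>E X\<in>Ob C. sec F X \<rightarrow>\<^sub>E sec G X) \<and>
     (\<forall>m\<in>Ar C. \<forall>x\<in>sec F (tgt C m). \<alpha> (src C m) (res F m x) = res G m (\<alpha> (tgt C m) x))"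

definition represented :: "('o, 'm) cat \<Rightarrow> 'o \<Rightarrow> ('o, 'm, 'm) psh" where
  "represented C V = \<lparr>
     sec = (\<lambda>W\<in>Ob C. hom C W V),
     res = (\<lambda>m\<in>Ar C. \<lambda>w\<in>hom C (tgt C m) V. cmp C w m)\<rparr>"

definition psh_pull :: "('o, 'm) cat \<Rightarrow> ('o, 'm, 'p, 'n) func \<Rightarrow> ('p, 'n, 's) psh \<Rightarrow> ('o, 'm, 's) psh" where
  "psh_pull C u F = \<lparr>
     sec = (\<lambda>X\<in>Ob C. sec F (fob u X)),
     res = (\<lambda>m\<in>Ar C. res F (far u m))\<rparr>"

definition psh_prod :: "('u \<Rightarrow> 'u set) \<Rightarrow> ('o, 'm) cat \<Rightarrow> ('o, 'm, 'u) psh \<Rightarrow> ('o, 'm, 'u) psh \<Rightarrow> ('o, 'm, 'u) psh" where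
  "psh_prod el C F G = \<lparr>
     sec = (\<lambda>X\<in>Ob C. {kpair el x y | x y. x \<in> sec F X \<and> y \<in> sec G X}),
     res = (\<lambda>m\<in>Ar C. \<lambda>z\<in>{kpair el x y | x y. x \<in> sec F (tgt C m) \<and> y \<in> sec G (tgt C m)}.
              kpair el (res F m (ufst el z)) (res G m (usnd el z)))\<rparr>"

definition psh_snd :: "('u \<Rightarrow> 'u set) \<Rightarrow> ('o, 'm) cat \<Rightarrow> ('o, 'm, 'u) psh \<Rightarrow> ('o, 'm, 'u) psh \<Rightarrow> 'o \<Rightarrow> 'u \<Rightarrow> 'u" where
  "psh_snd el C F G = (\<lambda>X\<in>Ob C. \<lambda>z\<in>sec (psh_prod el C F G) X. usnd el z)"


section \<open>Sites and sheaves\<close>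

definition sieve :: "('o, 'm) cat \<Rightarrow> 'o \<Rightarrow> 'm set \<Rightarrow> bool" where
  "sieve C X R \<longleftrightarrow> R \<subseteq> {m \<in> Ar C. tgt C m = X} \<and>
     (\<forall>m\<in>R. \<forall>g\<in>Ar C. tgt C g = src C m \<longrightarrow> cmp C m g \<in> R)"

definition sieve_pull :: "('o, 'm) cat \<Rightarrow> 'm set \<Rightarrow> 'm \<Rightarrow> 'm set" where
  "sieve_pull C R f = {g \<in> Ar C. tgt C g = src C f \<and> cmp C f g \<in> R}"

definition topology :: "('o, 'm) cat \<Rightarrow> ('o \<Rightarrow> 'm set set) \<Rightarrow> bool" where
  "topology C J \<longleftrightarrow>
     (\<forall>X. X \<notin> Ob C \<longrightarrow> J X = {}) \<and>
     (\<forall>X\<in>Ob C. (\<forall>R\<in>J X. sieve C X R) \<and> {m \<in> Ar C. tgt C m = X} \<in> J X \<and>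
        (\<forall>R\<in>J X. \<forall>f\<in>Ar C. tgt C f = X \<longrightarrow> sieve_pull C R f \<in> J (src C f)) \<and>
        (\<forall>R\<in>J X. \<forall>R'. sieve C X R' \<and> (\<forall>f\<in>R. sieve_pull C R' f \<in> J (src C f)) \<longrightarrow> R' \<in> J X))"

text \<open>A family of arrows with common target is represented by the set of its members: whether it
  is covering depends only on the sieve it generates.\<close>

definition covering_family :: "('o, 'm) cat \<Rightarrow> ('o \<Rightarrow> 'm set set) \<Rightarrow> 'o \<Rightarrow> 'm set \<Rightarrow> bool" where
  "covering_family C J X S \<longleftrightarrow> X \<in> Ob C \<and> S \<subseteq> {m \<in> Ar C. tgt C m = X} \<and>
     {cmp C m g | m g. m \<in> S \<and> g \<in> Ar C \<and> tgt C g = src C m} \<in> J X"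

definition generated_topology :: "('o, 'm) cat \<Rightarrow> ('o \<times> 'm set) set \<Rightarrow> 'o \<Rightarrow> 'm set set" where
  "generated_topology C K X = {R. X \<in> Ob C \<and> sieve C X R \<and>
     (\<forall>J. topology C J \<and> (\<forall>(Y, S)\<in>K. covering_family C J Y S) \<longrightarrow> R \<in> J X)}"

definition U_site :: "('u \<Rightarrow> 'u set) \<Rightarrow> ('o, 'm) cat \<Rightarrow> ('o \<Rightarrow> 'm set set) \<Rightarrow> bool" where
  "U_site el C J \<longleftrightarrow> category C \<and> topology C J \<and>
     (\<forall>X\<in>Ob C. \<forall>Y\<in>Ob C. U_small el (hom C X Y)) \<and>
     (\<exists>G\<subseteq>Ob C. U_small el G \<and>
        (\<forall>X\<in>Ob C. \<exists>S. covering_family C J X S \<and> src C ` S \<subseteq> G))"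

definition matching :: "('o, 'm) cat \<Rightarrow> ('o, 'm, 's) psh \<Rightarrow> 'm set \<Rightarrow> ('m \<Rightarrow> 's) \<Rightarrow> bool" where
  "matching C F R s \<longleftrightarrow> (\<forall>m\<in>R. s m \<in> sec F (src C m)) \<and>
     (\<forall>m\<in>R. \<forall>g\<in>Ar C. tgt C g = src C m \<longrightarrow> s (cmp C m g) = res F g (s m))"

definition sheaf :: "('u \<Rightarrow> 'u set) \<Rightarrow> ('o, 'm) cat \<Rightarrow> ('o \<Rightarrow> 'm set set) \<Rightarrow> ('o, 'm, 'u) psh \<Rightarrow> bool" where
  "sheaf el C J F \<longleftrightarrow> upresheaf el C F \<and>
     (\<forall>X\<in>Ob C. \<forall>R\<in>J X. \<forall>s. matching C F R s \<longrightarrow>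
        (\<exists>!x. x \<in> sec F X \<and> (\<forall>m\<in>R. res F m x = s m)))"

type_synonym ('o, 'm, 'u) psh_arrow =
  "('o, 'm, 'u) psh \<times> ('o, 'm, 'u) psh \<times> ('o \<Rightarrow> 'u \<Rightarrow> 'u)"

definition Sh :: "('u \<Rightarrow> 'u set) \<Rightarrow> ('o, 'm) cat \<Rightarrow> ('o \<Rightarrow> 'm set set) \<Rightarrow>
    (('o, 'm, 'u) psh, ('o, 'm, 'u) psh_arrow) cat" where
  "Sh el C J = \<lparr>
     Ob = {F. sheaf el C J F},
     Ar = {(F, G, \<alpha>). sheaf el C J F \<and> sheaf el C J G \<and> psh_mor C F G \<alpha>},
     src = (\<lambda>(F, G, \<alpha>). F),
     tgt = (\<lambda>(F, G, \<alpha>). G),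
     ide = (\<lambda>F. (F, F, \<lambda>X\<in>Ob C. \<lambda>x\<in>sec F X. x)),
     cmp = (\<lambda>(G1, G2, \<beta>) (F1, F2, \<alpha>). (F1, G2, \<lambda>X\<in>Ob C. compose (sec F1 X) (\<beta> X) (\<alpha> X)))\<rparr>"

definition is_assoc_sheaf :: "('u \<Rightarrow> 'u set) \<Rightarrow> ('o, 'm) cat \<Rightarrow> ('o \<Rightarrow> 'm set set) \<Rightarrow> ('o, 'm, 's) psh \<Rightarrow>
    ('o, 'm, 'u) psh \<Rightarrow> ('o \<Rightarrow> 's \<Rightarrow> 'u) \<Rightarrow> bool" where
  "is_assoc_sheaf el C J P A \<eta> \<longleftrightarrow> sheaf el C J A \<and> psh_mor C P A \<eta> \<and>
     (\<forall>F \<zeta>. sheaf el C J F \<and> psh_mor C P F \<zeta> \<longrightarrow>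
        (\<exists>!\<phi>. psh_mor C A F \<phi> \<and> (\<forall>X\<in>Ob C. \<forall>x\<in>sec P X. \<phi> X (\<eta> X x) = \<zeta> X x)))"

text \<open>\<open>\<epsilon>(V)\<close> together with the canonical morphism to it from the presheaf represented by \<open>V\<close>.\<close>

definition assoc_sheaf :: "('u \<Rightarrow> 'u set) \<Rightarrow> ('o, 'm) cat \<Rightarrow> ('o \<Rightarrow> 'm set set) \<Rightarrow> ('o, 'm, 's) psh \<Rightarrow>
    ('o, 'm, 'u) psh \<times> ('o \<Rightarrow> 's \<Rightarrow> 'u)" where
  "assoc_sheaf el C J P = (SOME (A, \<eta>). is_assoc_sheaf el C J P A \<eta>)"

definition eps :: "('u \<Rightarrow> 'u set) \<Rightarrow> ('o, 'm) cat \<Rightarrow> ('o \<Rightarrow> 'm set set) \<Rightarrow> 'o \<Rightarrow> ('o, 'm, 'u) psh" where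
  "eps el C J V = fst (assoc_sheaf el C J (represented C V))"

definition eps_unit :: "('u \<Rightarrow> 'u set) \<Rightarrow> ('o, 'm) cat \<Rightarrow> ('o \<Rightarrow> 'm set set) \<Rightarrow> 'o \<Rightarrow> 'o \<Rightarrow> 'm \<Rightarrow> 'u" where
  "eps_unit el C J V = snd (assoc_sheaf el C J (represented C V))"


subsection \<open>Continuous functors and induced topologies\<close>

definition continuous :: "('u \<Rightarrow> 'u set) \<Rightarrow> ('o, 'm) cat \<Rightarrow> ('o \<Rightarrow> 'm set set) \<Rightarrow>
    ('p, 'n) cat \<Rightarrow> ('p \<Rightarrow> 'n set set) \<Rightarrow> ('o, 'm, 'p, 'n) func \<Rightarrow> bool" where
  "continuous el C J C' J' u \<longleftrightarrow> is_functor C C' u \<and>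
     (\<forall>F. sheaf el C' J' F \<longrightarrow> sheaf el C J (psh_pull C u F))"

definition is_induced_topology :: "('u \<Rightarrow> 'u set) \<Rightarrow> ('o, 'm) cat \<Rightarrow>
    ('p, 'n) cat \<Rightarrow> ('p \<Rightarrow> 'n set set) \<Rightarrow> ('o, 'm, 'p, 'n) func \<Rightarrow> ('o \<Rightarrow> 'm set set) \<Rightarrow> bool" where
  "is_induced_topology el C' C J u J' \<longleftrightarrow>
     topology C' J' \<and> continuous el C' J' C J u \<and>
     (\<forall>J''. topology C' J'' \<and> continuous el C' J'' C J u \<longrightarrow> (\<forall>X. J'' X \<subseteq> J' X))"

definition induced_topology :: "('u \<Rightarrow> 'u set) \<Rightarrow> ('o, 'm) cat \<Rightarrow>
    ('p, 'n) cat \<Rightarrow> ('p \<Rightarrow> 'n set set) \<Rightarrow> ('o, 'm, 'p, 'n) func \<Rightarrow> 'o \<Rightarrow> 'm set set" where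
  "induced_topology el C' C J u = (THE J'. is_induced_topology el C' C J u J')"


section \<open>Fibred categories\<close>

definition fibre :: "('o, 'm) cat \<Rightarrow> ('p, 'n) cat \<Rightarrow> ('o, 'm, 'p, 'n) func \<Rightarrow> 'p \<Rightarrow> ('o, 'm) cat" where
  "fibre E I \<pi> i = E\<lparr>Ob := {V \<in> Ob E. fob \<pi> V = i}, Ar := {m \<in> Ar E. far \<pi> m = ide I i}\<rparr>"

text \<open>Cartesian arrows in the sense of SGA 1, VI.5.\<close>

definition cartesian :: "('o, 'm) cat \<Rightarrow> ('p, 'n) cat \<Rightarrow> ('o, 'm, 'p, 'n) func \<Rightarrow> 'm \<Rightarrow> bool" where
  "cartesian E I \<pi> m \<longleftrightarrow> m \<in> Ar E \<and>
     (\<forall>n\<in>Ar E. far \<pi> n = far \<pi> m \<and> tgt E n = tgt E m \<longrightarrow>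
        (\<exists>!h. h \<in> hom (fibre E I \<pi> (fob \<pi> (src E m))) (src E n) (src E m) \<and> cmp E m h = n))"

definition fibred_category :: "('o, 'm) cat \<Rightarrow> ('p, 'n) cat \<Rightarrow> ('o, 'm, 'p, 'n) func \<Rightarrow> bool" where
  "fibred_category E I \<pi> \<longleftrightarrow> is_functor E I \<pi> \<and>
     (\<forall>f\<in>Ar I. \<forall>V\<in>Ob E. fob \<pi> V = tgt I f \<longrightarrow>
        (\<exists>m. cartesian E I \<pi> m \<and> far \<pi> m = f \<and> tgt E m = V)) \<and>
     (\<forall>m n. cartesian E I \<pi> m \<and> cartesian E I \<pi> n \<and> tgt E m = src E n \<longrightarrow>
        cartesian E I \<pi> (cmp E n m))"

text \<open>\<open>cl f V\<close> is the chosen cartesian arrow \<open>f\<^sup>+(V) \<rightarrow> V\<close> over \<open>f\<close>.\<close>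

definition normalized_cleavage ::
    "('o, 'm) cat \<Rightarrow> ('p, 'n) cat \<Rightarrow> ('o, 'm, 'p, 'n) func \<Rightarrow> ('n \<Rightarrow> 'o \<Rightarrow> 'm) \<Rightarrow> bool" where
  "normalized_cleavage E I \<pi> cl \<longleftrightarrow>
     (\<forall>f\<in>Ar I. \<forall>V\<in>Ob E. fob \<pi> V = tgt I f \<longrightarrow>
        cartesian E I \<pi> (cl f V) \<and> far \<pi> (cl f V) = f \<and> tgt E (cl f V) = V) \<and>
     (\<forall>V\<in>Ob E. cl (ide I (fob \<pi> V)) V = ide E V)"

text \<open>The factorization of \<open>m: W \<rightarrow> V\<close> over \<open>f\<close> through an arrow \<open>W \<rightarrow> f\<^sup>+(V)\<close> of the fibre.\<close>

definition vfac :: "('o, 'm) cat \<Rightarrow> ('p, 'n) cat \<Rightarrow> ('o, 'm, 'p, 'n) func \<Rightarrow> ('n \<Rightarrow> 'o \<Rightarrow> 'm) \<Rightarrow> 'm \<Rightarrow> 'm" where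
  "vfac E I \<pi> cl m = (let k = cl (far \<pi> m) (tgt E m) in
     THE h. h \<in> hom (fibre E I \<pi> (fob \<pi> (src E m))) (src E m) (src E k) \<and> cmp E k h = m)"

definition pull :: "('o, 'm) cat \<Rightarrow> ('p, 'n) cat \<Rightarrow> ('o, 'm, 'p, 'n) func \<Rightarrow> ('n \<Rightarrow> 'o \<Rightarrow> 'm) \<Rightarrow> 'n \<Rightarrow>
    ('o, 'm, 'o, 'm) func" where
  "pull E I \<pi> cl f = \<lparr>
     fob = \<lambda>V. src E (cl f V),
     far = \<lambda>m. vfac E I \<pi> cl (cmp E m (cl f (src E m)))\<rparr>"


section \<open>Fibred sites and the co-evanescent topology\<close>

record ('o, 'm, 'p, 'n) fsite =
  tot :: "('o, 'm) cat"
  bas :: "('p, 'n) cat"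
  prj :: "('o, 'm, 'p, 'n) func"
  clv :: "'n \<Rightarrow> 'o \<Rightarrow> 'm"
  btop :: "'p \<Rightarrow> 'n set set"
  ftop :: "'p \<Rightarrow> 'o \<Rightarrow> 'm set set"

abbreviation fib :: "('o, 'm, 'p, 'n) fsite \<Rightarrow> 'p \<Rightarrow> ('o, 'm) cat" where
  "fib X \<equiv> fibre (tot X) (bas X) (prj X)"

abbreviation fpull :: "('o, 'm, 'p, 'n) fsite \<Rightarrow> 'n \<Rightarrow> ('o, 'm, 'o, 'm) func" where
  "fpull X \<equiv> pull (tot X) (bas X) (prj X) (clv X)"

abbreviation fvfac :: "('o, 'm, 'p, 'n) fsite \<Rightarrow> 'm \<Rightarrow> 'm" where
  "fvfac X \<equiv> vfac (tot X) (bas X) (prj X) (clv X)"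

definition fibred_site :: "('u \<Rightarrow> 'u set) \<Rightarrow> ('o, 'm, 'p, 'n) fsite \<Rightarrow> bool" where
  "fibred_site el X \<longleftrightarrow>
     U_site el (bas X) (btop X) \<and>
     fibred_category (tot X) (bas X) (prj X) \<and>
     normalized_cleavage (tot X) (bas X) (prj X) (clv X) \<and>
     has_finite_limits (bas X) \<and>
     (\<forall>i\<in>Ob (bas X). U_site el (fib X i) (ftop X i) \<and> has_finite_limits (fib X i)) \<and>
     (\<forall>f\<in>Ar (bas X).
        continuous el (fib X (tgt (bas X) f)) (ftop X (tgt (bas X) f))
                      (fib X (src (bas X) f)) (ftop X (src (bas X) f)) (fpull X f) \<and>
        left_exact (fib X (tgt (bas X) f)) (fib X (src (bas X) f)) (fpull X f))"

definition vertical_families :: "('o, 'm, 'p, 'n) fsite \<Rightarrow> ('o \<times> 'm set) set" where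
  "vertical_families X =
     {(V, S). \<exists>i\<in>Ob (bas X). covering_family (fib X i) (ftop X i) V S}"

text \<open>The members of such a family are the composites \<open>V\<^sub>n \<cong> f\<^sub>n\<^sup>+(V) \<rightarrow> V\<close>, the isomorphism being one of
  the fibre over the source of \<open>f\<^sub>n\<close>; \<open>f\<^sub>n\<close> is recovered as the image of the composite under \<open>\<pi>\<close>.\<close>

definition cartesian_families :: "('o, 'm, 'p, 'n) fsite \<Rightarrow> ('o \<times> 'm set) set" where
  "cartesian_families X =
     {(V, S). V \<in> Ob (tot X) \<and> S \<subseteq> {m \<in> Ar (tot X). tgt (tot X) m = V} \<and>
        covering_family (bas X) (btop X) (fob (prj X) V) (far (prj X) ` S) \<and>
        (\<forall>m\<in>S. \<exists>\<phi>. let f = far (prj X) m in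
            is_iso (fib X (src (bas X) f)) \<phi> \<and>
            src (tot X) \<phi> = src (tot X) m \<and> tgt (tot X) \<phi> = src (tot X) (clv X f V) \<and>
            m = cmp (tot X) (clv X f V) \<phi>)}"

definition coev :: "('o, 'm, 'p, 'n) fsite \<Rightarrow> 'o \<Rightarrow> 'm set set" where
  "coev X = generated_topology (tot X) (vertical_families X \<union> cartesian_families X)"


section \<open>The fibred site \<open>\<varpi>: E\<^bsub>/V\<^esub> \<rightarrow> I\<^bsub>/c\<^esub>\<close>\<close>

definition slice_proj :: "('o, 'm, 'p, 'n) fsite \<Rightarrow> ('m, 'm \<times> 'm \<times> 'm, 'n, 'n \<times> 'n \<times> 'n) func" where
  "slice_proj X = \<lparr>
     fob = far (prj X),
     far = \<lambda>(w, w', m). (far (prj X) w, far (prj X) w', far (prj X) m)\<rparr>"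

text \<open>For \<open>w: W \<rightarrow> V\<close> over \<open>f\<^sub>2\<close> and \<open>g: f\<^sub>1 \<rightarrow> f\<^sub>2\<close> in \<open>I\<^bsub>/c\<^esub>\<close>, the inverse image of \<open>w\<close> is
  \<open>g\<^sup>+(W) \<rightarrow> W \<rightarrow> V\<close>.\<close>

definition slice_clv :: "('o, 'm, 'p, 'n) fsite \<Rightarrow> 'n \<times> 'n \<times> 'n \<Rightarrow> 'm \<Rightarrow> 'm \<times> 'm \<times> 'm" where
  "slice_clv X = (\<lambda>(f1, f2, g) w. let k = clv X g (src (tot X) w) in (cmp (tot X) w k, w, k))"

text \<open>The canonical equivalence from the fibre of \<open>\<varpi>\<close> over \<open>(i, f)\<close> to \<open>(E\<^sub>i)\<^bsub>/f\<^sup>+(V)\<^esub>\<close>.\<close>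

definition fibre_to_slice :: "('o, 'm, 'p, 'n) fsite \<Rightarrow> ('m, 'm \<times> 'm \<times> 'm, 'm, 'm \<times> 'm \<times> 'm) func" where
  "fibre_to_slice X = \<lparr>
     fob = fvfac X,
     far = \<lambda>(w, w', m). (fvfac X w, fvfac X w', m)\<rparr>"

definition slice_ftop :: "('u \<Rightarrow> 'u set) \<Rightarrow> ('o, 'm, 'p, 'n) fsite \<Rightarrow> 'o \<Rightarrow> 'n \<Rightarrow> 'm \<Rightarrow> ('m \<times> 'm \<times> 'm) set set" where
  "slice_ftop el X V f =
    (let i = src (bas X) f; D = slice (fib X i) (fob (fpull X f) V) in
     induced_topology el
       (fibre (slice (tot X) V) (slice (bas X) (fob (prj X) V)) (slice_proj X) f) D
       (induced_topology el D (fib X i) (ftop X i) (slice_forget (fib X i)))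
       (fibre_to_slice X))"

definition slice_fsite :: "('u \<Rightarrow> 'u set) \<Rightarrow> ('o, 'm, 'p, 'n) fsite \<Rightarrow> 'o \<Rightarrow>
    ('m, 'm \<times> 'm \<times> 'm, 'n, 'n \<times> 'n \<times> 'n) fsite" where
  "slice_fsite el X V = (let c = fob (prj X) V in \<lparr>
     tot = slice (tot X) V,
     bas = slice (bas X) c,
     prj = slice_proj X,
     clv = slice_clv X,
     btop = induced_topology el (slice (bas X) c) (bas X) (btop X) (slice_forget (bas X)),
     ftop = slice_ftop el X V\<rparr>)"


section \<open>Localization of the topos of sheaves\<close>

text \<open>For \<open>\<eta>\<close> a morphism from the presheaf represented by \<open>V\<close> to \<open>A\<close>, and \<open>p: H \<rightarrow> A\<close>: the presheaf
  on \<open>C\<^bsub>/V\<^esub>\<close> whose sections over \<open>w: W \<rightarrow> V\<close> are the sections of \<open>H\<close> over \<open>W\<close> lying above \<open>\<eta>(w)\<close>.\<close>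

definition slice_psh :: "('o, 'm) cat \<Rightarrow> 'o \<Rightarrow> ('o \<Rightarrow> 'm \<Rightarrow> 'u) \<Rightarrow> ('o, 'm, 'u) psh_arrow \<Rightarrow>
    ('m, 'm \<times> 'm \<times> 'm, 'u) psh" where
  "slice_psh C V \<eta> = (\<lambda>(H, A, p).
     let S = (\<lambda>w\<in>Ob (slice C V). {h \<in> sec H (src C w). p (src C w) h = \<eta> (src C w) w}) in
     \<lparr>sec = S, res = (\<lambda>t\<in>Ar (slice C V). case t of (w, w', m) \<Rightarrow> restrict (res H m) (S w'))\<rparr>)"

text \<open>The functor \<open>\<E>\<^bsub>/\<epsilon>(V)\<^esub> \<rightarrow> Sh(C\<^bsub>/V\<^esub>)\<close>, \<open>\<E>\<close> being the topos of sheaves on \<open>C\<close>: the quasi-inverse of the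
  canonical equivalence of SGA 4, III.5.4.\<close>

definition slice_sections :: "('u \<Rightarrow> 'u set) \<Rightarrow> ('o, 'm) cat \<Rightarrow> ('o \<Rightarrow> 'm set set) \<Rightarrow> 'o \<Rightarrow>
    (('o, 'm, 'u) psh_arrow, ('o, 'm, 'u) psh_arrow \<times> ('o, 'm, 'u) psh_arrow \<times> ('o, 'm, 'u) psh_arrow,
     ('m, 'm \<times> 'm \<times> 'm, 'u) psh, ('m, 'm \<times> 'm \<times> 'm, 'u) psh_arrow) func" where
  "slice_sections el C J V = (let K = slice_psh C V (eps_unit el C J V) in \<lparr>
     fob = K,
     far = \<lambda>(p, q, (H, H', \<alpha>)).
       (K p, K q, \<lambda>w\<in>Ob (slice C V). restrict (\<alpha> (src C w)) (sec (K p) w))\<rparr>)"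

text \<open>\<open>F \<mapsto> (F \<times> A \<rightarrow> A)\<close>, the restriction (localization) functor to the topos over \<open>A\<close>.\<close>

definition localize :: "('u \<Rightarrow> 'u set) \<Rightarrow> ('o, 'm) cat \<Rightarrow> ('o, 'm, 'u) psh \<Rightarrow>
    (('o, 'm, 'u) psh, ('o, 'm, 'u) psh_arrow,
     ('o, 'm, 'u) psh_arrow, ('o, 'm, 'u) psh_arrow \<times> ('o, 'm, 'u) psh_arrow \<times> ('o, 'm, 'u) psh_arrow) func" where
  "localize el C A = (let j = (\<lambda>F. (psh_prod el C F A, A, psh_snd el C F A)) in \<lparr>
     fob = j,
     far = \<lambda>(F, G, \<alpha>). (j F, j G,
       (psh_prod el C F A, psh_prod el C G A,
        \<lambda>X\<in>Ob C. \<lambda>z\<in>sec (psh_prod el C F A) X. kpair el (\<alpha> X (ufst el z)) (usnd el z)))\<rparr>)"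

definition pull_functor :: "('o, 'm) cat \<Rightarrow> ('o, 'm, 'p, 'n) func \<Rightarrow>
    (('p, 'n, 'u) psh, ('p, 'n, 'u) psh_arrow, ('o, 'm, 'u) psh, ('o, 'm, 'u) psh_arrow) func" where
  "pull_functor C u = \<lparr>
     fob = psh_pull C u,
     far = \<lambda>(F, G, \<alpha>). (psh_pull C u F, psh_pull C u G, \<lambda>X\<in>Ob C. \<alpha> (fob u X))\<rparr>"


section \<open>The functor \<open>{i \<mapsto> F\<^sub>i} \<mapsto> {(i, f) \<mapsto> F\<^sub>i \<times> f\<^sup>*(V)}\<close>\<close>

text \<open>The presheaf \<open>{i \<mapsto> F\<^sub>i}\<close> on the total category with transition morphisms
  \<open>\<theta> g: F\<^sub>j \<rightarrow> g\<^sub>*(F\<^sub>i)\<close> for \<open>g: i \<rightarrow> j\<close>, where \<open>g\<^sub>*(F\<^sub>i) = F\<^sub>i \<circ> g\<^sup>+\<close>.\<close>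

definition glue :: "('o, 'm, 'p, 'n) fsite \<Rightarrow> ('p \<Rightarrow> ('o, 'm, 'u) psh) \<Rightarrow> ('n \<Rightarrow> 'o \<Rightarrow> 'u \<Rightarrow> 'u) \<Rightarrow>
    ('o, 'm, 'u) psh" where
  "glue X Fs \<theta> = \<lparr>
     sec = (\<lambda>W\<in>Ob (tot X). sec (Fs (fob (prj X) W)) W),
     res = (\<lambda>m\<in>Ar (tot X). \<lambda>x\<in>sec (Fs (fob (prj X) (tgt (tot X) m))) (tgt (tot X) m).
        res (Fs (fob (prj X) (src (tot X) m))) (fvfac X m)
          (\<theta> (far (prj X) m) (tgt (tot X) m) x))\<rparr>"

definition restr_fib :: "('o, 'm, 'p, 'n) fsite \<Rightarrow> ('o, 'm, 'u) psh \<Rightarrow> 'p \<Rightarrow> ('o, 'm, 'u) psh" where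
  "restr_fib X F i = psh_pull (fib X i) idfunc F"

text \<open>\<open>f\<^sup>*(V)\<close>, the sheaf on \<open>E\<^sub>i\<close> associated to \<open>f\<^sup>+(V)\<close>.\<close>

definition inv_im :: "('u \<Rightarrow> 'u set) \<Rightarrow> ('o, 'm, 'p, 'n) fsite \<Rightarrow> 'o \<Rightarrow> 'n \<Rightarrow> ('o, 'm, 'u) psh" where
  "inv_im el X V f =
     (let i = src (bas X) f in eps el (fib X i) (ftop X i) (fob (fpull X f) V))"

definition inv_im_unit :: "('u \<Rightarrow> 'u set) \<Rightarrow> ('o, 'm, 'p, 'n) fsite \<Rightarrow> 'o \<Rightarrow> 'n \<Rightarrow> 'o \<Rightarrow> 'm \<Rightarrow> 'u" where
  "inv_im_unit el X V f =
     (let i = src (bas X) f in eps_unit el (fib X i) (ftop X i) (fob (fpull X f) V))"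

text \<open>For \<open>g: (i\<^sub>1, f\<^sub>1) \<rightarrow> (i\<^sub>2, f\<^sub>2)\<close> in \<open>I\<^bsub>/c\<^esub>\<close>, the canonical morphism \<open>f\<^sub>2\<^sup>*(V) \<rightarrow> g\<^sub>*(f\<^sub>1\<^sup>*(V))\<close>, adjoint to
  \<open>g\<^sup>*(f\<^sub>2\<^sup>*(V)) \<cong> f\<^sub>1\<^sup>*(V)\<close>. On an arrow \<open>v: W \<rightarrow> f\<^sub>2\<^sup>+(V)\<close> it is
  \<open>g\<^sup>+(v): g\<^sup>+(W) \<rightarrow> g\<^sup>+(f\<^sub>2\<^sup>+(V)) \<cong> f\<^sub>1\<^sup>+(V)\<close>, that is, the factorization of
  \<open>g\<^sup>+(W) \<rightarrow> W \<rightarrow> f\<^sub>2\<^sup>+(V) \<rightarrow> V\<close>.\<close>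

definition inv_im_trans :: "('u \<Rightarrow> 'u set) \<Rightarrow> ('o, 'm, 'p, 'n) fsite \<Rightarrow> 'o \<Rightarrow> 'n \<times> 'n \<times> 'n \<Rightarrow> 'o \<Rightarrow> 'u \<Rightarrow> 'u" where
  "inv_im_trans el X V = (\<lambda>(f1, f2, g). let C = fib X (tgt (bas X) g); E = tot X in
     THE \<theta>. psh_mor C (inv_im el X V f2) (psh_pull C (fpull X g) (inv_im el X V f1)) \<theta> \<and>
       (\<forall>W\<in>Ob C. \<forall>v\<in>hom C W (fob (fpull X f2) V).
          \<theta> W (inv_im_unit el X V f2 W v) =
          inv_im_unit el X V f1 (fob (fpull X g) W)
            (fvfac X (cmp E (cmp E (clv X f2 V) v) (clv X g W)))))"

text \<open>The sheaf on the fibre of \<open>\<varpi>\<close> over \<open>(i, f)\<close> corresponding to the object \<open>F\<^sub>i \<times> f\<^sup>*(V) \<rightarrow> f\<^sup>*(V)\<close>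
  of the topos of \<open>E\<^sub>i\<close> localized at \<open>f\<^sup>*(V)\<close>.\<close>

definition prod_component :: "('u \<Rightarrow> 'u set) \<Rightarrow> ('o, 'm, 'p, 'n) fsite \<Rightarrow> 'o \<Rightarrow> ('o, 'm, 'u) psh \<Rightarrow> 'n \<Rightarrow>
    ('m, 'm \<times> 'm \<times> 'm, 'u) psh" where
  "prod_component el X V F f = (let i = src (bas X) f in
     psh_pull (fib (slice_fsite el X V) f) (fibre_to_slice X)
       (fob (slice_sections el (fib X i) (ftop X i) (fob (fpull X f) V))
         (fob (localize el (fib X i) (inv_im el X V f)) (restr_fib X F i))))"

definition prod_trans :: "('u \<Rightarrow> 'u set) \<Rightarrow> ('o, 'm, 'p, 'n) fsite \<Rightarrow> 'o \<Rightarrow> ('o, 'm, 'u) psh \<Rightarrow>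
    'n \<times> 'n \<times> 'n \<Rightarrow> 'm \<Rightarrow> 'u \<Rightarrow> 'u" where
  "prod_trans el X V F = (\<lambda>(f1, f2, g) w z. let W = src (tot X) w in
     kpair el (res F (clv X g W) (ufst el z)) (inv_im_trans el X V (f1, f2, g) W (usnd el z)))"

definition prod_functor :: "('u \<Rightarrow> 'u set) \<Rightarrow> ('o, 'm, 'p, 'n) fsite \<Rightarrow> 'o \<Rightarrow>
    (('o, 'm, 'u) psh, ('o, 'm, 'u) psh_arrow,
     ('m, 'm \<times> 'm \<times> 'm, 'u) psh, ('m, 'm \<times> 'm \<times> 'm, 'u) psh_arrow) func" where
  "prod_functor el X V =
    (let P = (\<lambda>F. glue (slice_fsite el X V) (prod_component el X V F) (prod_trans el X V F)) in \<lparr>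
     fob = P,
     far = \<lambda>(F, G, \<alpha>). (P F, P G,
       \<lambda>w\<in>Ob (slice (tot X) V). \<lambda>z\<in>sec (P F) w.
         kpair el (\<alpha> (src (tot X) w) (ufst el z)) (usnd el z))\<rparr>)"

end

theory Submission
  imports Defs
begin

text \<open>Sheaves detect coverings: a sieve for which every sheaf is separated is covering. As the functors
  \<open>C\<^bsub>/V\<^esub> \<rightarrow> C\<close> are discrete fibrations, the topology induced on \<open>C\<^bsub>/V\<^esub>\<close> therefore consists of the sieves
  whose image in \<open>C\<close> is covering. To see that such a sieve of \<open>E\<^bsub>/V\<^esub>\<close> is covering for the co-evanescent
  topology of \<open>E\<^bsub>/V\<^esub>\<close>, consider on \<open>E\<close> the sieves all of whose pullbacks become covering when lifted
  to \<open>E\<^bsub>/V\<^esub>\<close>. They form a topology, for which the vertical and the cartesian families are covering.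

  The functor \<open>\<E>\<^bsub>/\<epsilon>(V)\<^esub> \<rightarrow> Sh(E\<^bsub>/V\<^esub>)\<close> is fully faithful because a sheaf \<open>H\<close> over \<open>\<epsilon>(V)\<close> is the sheaf
  associated to \<open>H \<times>\<^bsub>\<epsilon>(V)\<^esub> V\<close>, and essentially surjective because \<open>F\<close> is recovered from the sheaf
  associated to \<open>W \<mapsto> \<Coprod>\<^bsub>v: W \<rightarrow> V\<^esub> F(v)\<close>. It sends \<open>F \<times> \<epsilon>(V)\<close> to the presheaf of pairs consisting of a
  section of \<open>F\<close> over \<open>W\<close> and the section defined by \<open>w: W \<rightarrow> V\<close>; the presheaf
  \<open>{(i, f) \<mapsto> F\<^sub>i \<times> f\<^sup>*(V)}\<close> has the same form.\<close>


section \<open>Small sets\<close>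

text \<open>\<open>continuous\<close> and \<open>is_induced_topology\<close> quantify only over
  sheaves with values in the universe, so a sieve can be shown to be covering only by producing such
  sheaves. Sheafification is therefore constructed in full, together with a bound on its size. The
  bound rests on a small generating set of objects, which is why \<open>E\<close> has to be shown to
  be a site of the universe before the maximality of the induced topology can be proved. Secondly,
  \<open>eps\<close> is an arbitrary choice among associated sheaves; what the localization uses is
  that its unit is locally injective and locally surjective, and this is extracted from the
  universal property by comparison with the constructed sheaf. Thirdly, a generated topology is
  accessible only as the smallest topology containing its families. Hence the harder comparison of
  topologies is turned into a topology on \<open>E\<close>, whose axioms and generators can be
  checked, instead of an analysis of an unknown covering sieve.\<close>

lemma universe_subset:
  assumes "universe el" "A \<in> range el" "B \<subseteq> A" shows "B \<in> range el"
  using assms unfolding universe_def by (metis imageE)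

lemma universe_pair: assumes "universe el" shows "{x, y} \<in> range el"
  using assms unfolding universe_def by (metis rangeI)

lemma universe_UN:
  assumes "universe el" "A \<in> range el" "\<And>a. a \<in> A \<Longrightarrow> B a \<in> range el"
  shows "(\<Union>a\<in>A. B a) \<in> range el"
proof -
  obtain x where x: "A = el x" using assms(2) by auto
  \<comment> \<open>The union axiom takes a family of elements; \<open>inv el\<close> turns the
    family of sets \<open>B\<close> into one.\<close>
  have "(\<Union>a\<in>A. B a) = (\<Union>a\<in>el x. el (inv el (B a)))"
    using assms(3) by (simp add: x f_inv_into_f)
  moreover obtain u where "el u = (\<Union>a\<in>el x. el (inv el (B a)))"
    using assms(1) unfolding universe_def by meson
  ultimately show ?thesis by (metis rangeI)
qed

lemma universe_image: assumes "universe el" "A \<in> range el" shows "f ` A \<in> range el"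
proof -
  have "f ` A = (\<Union>a\<in>A. {f a})" by auto
  then show ?thesis using universe_UN[OF assms, of "\<lambda>a. {f a}"] universe_pair[OF assms(1), of "f a" "f a" for a] by simp
qed

lemma el_upair: "universe el \<Longrightarrow> el (upair el x y) = {x, y}"
  by (simp add: upair_def f_inv_into_f universe_pair)

lemma upair_eq_iff: "universe el \<Longrightarrow> upair el x y = upair el x' y' \<longleftrightarrow> {x, y} = {x', y'}"
  by (metis el_upair upair_def)

lemma kpair_eq_iff [simp]:
  "universe el \<Longrightarrow> kpair el x y = kpair el x' y' \<longleftrightarrow> x = x' \<and> y = y'"
  unfolding kpair_def upair_eq_iff by (auto simp: doubleton_eq_iff upair_eq_iff)

lemma ufst_kpair [simp]: "universe el \<Longrightarrow> ufst el (kpair el x y) = x"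
  unfolding ufst_def by (rule the_equality) auto

lemma usnd_kpair [simp]: "universe el \<Longrightarrow> usnd el (kpair el x y) = y"
  unfolding usnd_def by (rule the_equality) auto

lemma universe_kpairs:
  assumes "universe el" "A \<in> range el" "\<And>a. a \<in> A \<Longrightarrow> B a \<in> range el"
  shows "{kpair el x y | x y. x \<in> A \<and> y \<in> B x} \<in> range el"
proof -
  have "{kpair el x y | x y. x \<in> A \<and> y \<in> B x} = (\<Union>x\<in>A. kpair el x ` B x)" by auto
  then show ?thesis using universe_UN[OF assms(1,2), of "\<lambda>x. kpair el x ` B x"] universe_image[OF assms(1)] assms(3) by simp
qed

lemma U_small_range_el: "A \<in> range el \<Longrightarrow> U_small el A"
  unfolding U_small_def by (metis bij_betw_id imageE)

lemma U_small_inj: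
  assumes "universe el" "U_small el B" "inj_on f A" "f ` A \<subseteq> B" shows "U_small el A"
proof -
  obtain h x where h: "bij_betw h B (el x)" using assms(2) by (auto simp: U_small_def)
  have "inj_on (h \<circ> f) A"
    using h assms(3,4) by (meson bij_betw_def comp_inj_on inj_on_subset)
  moreover have "(h \<circ> f) ` A \<in> range el"
    by (rule universe_subset[OF assms(1), of "el x"]) (use h assms(4) in \<open>auto simp: bij_betw_def\<close>)
  ultimately show ?thesis unfolding U_small_def bij_betw_def by (metis imageE)
qed

lemma U_small_subset: "universe el \<Longrightarrow> U_small el B \<Longrightarrow> A \<subseteq> B \<Longrightarrow> U_small el A"
  by (rule U_small_inj[of el B id A]) auto

lemma U_small_image: assumes "universe el" "U_small el A" shows "U_small el (f ` A)"
  by (rule U_small_inj[OF assms, of "inv_into A f"]) (auto intro: inj_on_inv_into inv_into_into)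

text \<open>A subset of \<open>A\<close> is coded by the element whose set is its image under the
  chosen bijection. Such an element exists because every subset of \<open>el x\<close> is again in
  \<open>range el\<close>.\<close>

lemma U_small_Pow: assumes "universe el" "U_small el A" shows "U_small el (Pow A)"
proof -
  obtain h x where h: "bij_betw h A (el x)" using assms(2) by (auto simp: U_small_def)
  obtain p where p: "el p = {y. el y \<subseteq> el x}" using assms(1) unfolding universe_def by meson
  have sub: "el (inv el (h ` B)) = h ` B" if "B \<subseteq> A" for B
    by (rule f_inv_into_f, rule universe_subset[OF assms(1), of "el x"])
       (use h that in \<open>auto simp: bij_betw_def\<close>)
  show ?thesis
  proof (rule U_small_inj[OF assms(1) U_small_range_el[OF rangeI, of el p], of "\<lambda>B. inv el (h ` B)"])
    show "inj_on (\<lambda>B. inv el (h ` B)) (Pow A)"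
    proof (rule inj_onI)
      fix B B' assume B: "B \<in> Pow A" "B' \<in> Pow A" "inv el (h ` B) = inv el (h ` B')"
      then have "h ` B = h ` B'" using sub by (metis PowD)
      then show "B = B'" using h B by (metis PowD bij_betw_def inj_on_image_eq_iff)
    qed
    show "(\<lambda>B. inv el (h ` B)) ` Pow A \<subseteq> el p"
      using h sub unfolding p bij_betw_def by (fastforce simp: image_subset_iff)
  qed
qed

lemma U_small_Sigma:
  assumes "universe el" "U_small el A" "\<And>a. a \<in> A \<Longrightarrow> U_small el (B a)"
  shows "U_small el (Sigma A B)"
proof -
  obtain h x where h: "bij_betw h A (el x)" using assms(2) by (auto simp: U_small_def)
  have "\<forall>a\<in>A. \<exists>k y. bij_betw k (B a) (el y)" using assms(3) unfolding U_small_def by blast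
  then obtain k where "\<forall>a\<in>A. \<exists>y. bij_betw (k a) (B a) (el y)" by (rule bchoice[THEN exE])
  then obtain y where k: "\<And>a. a \<in> A \<Longrightarrow> bij_betw (k a) (B a) (el (y a))" by (metis bchoice)
  \<comment> \<open>The fibre belonging to a code \<open>s\<close> is found by going back along
    \<open>h\<close>; injectivity of \<open>h\<close> makes this the right fibre on codes of members
    of \<open>A\<close>.\<close>
  let ?P = "{kpair el s t | s t. s \<in> el x \<and> t \<in> el (y (inv_into A h s))}"
  show ?thesis
  proof (rule U_small_inj[OF assms(1) U_small_range_el, of ?P "\<lambda>(a, b). kpair el (h a) (k a b)"])
    show "?P \<in> range el" by (rule universe_kpairs[OF assms(1)]) auto
    show "inj_on (\<lambda>(a, b). kpair el (h a) (k a b)) (Sigma A B)"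
    proof (rule inj_onI, clarify)
      fix a b a' b' assume ab: "a \<in> A" "b \<in> B a" "a' \<in> A" "b' \<in> B a'"
        "kpair el (h a) (k a b) = kpair el (h a') (k a' b')"
      then have "h a = h a'" "k a b = k a' b'" by (simp_all add: assms(1))
      moreover from this have "a = a'" using h ab by (auto simp: bij_betw_def inj_on_def)
      ultimately show "a = a' \<and> b = b'" using k[OF ab(1)] ab by (auto simp: bij_betw_def inj_on_def)
    qed
    show "(\<lambda>(a, b). kpair el (h a) (k a b)) ` Sigma A B \<subseteq> ?P"
    proof clarify
      fix a b assume ab: "a \<in> A" "b \<in> B a"
      have "h a \<in> el x" "k a b \<in> el (y a)" "inv_into A h (h a) = a"
        using h k[OF ab(1)] ab by (auto simp: bij_betw_def)
      then show "\<exists>s t. kpair el (h a) (k a b) = kpair el s t \<and> s \<in> el x \<and> t \<in> el (y (inv_into A h s))"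
        by metis
    qed
  qed
qed

lemma U_small_UN:
  assumes "universe el" "U_small el A" "\<And>a. a \<in> A \<Longrightarrow> U_small el (B a)"
  shows "U_small el (\<Union>a\<in>A. B a)"
proof -
  have "(\<Union>a\<in>A. B a) = snd ` Sigma A B" by force
  then show ?thesis using U_small_image[OF assms(1) U_small_Sigma[OF assms], where f = snd] by simp
qed

section \<open>Categories\<close>

lemma hom_iff: "m \<in> hom C X Y \<longleftrightarrow> m \<in> Ar C \<and> src C m = X \<and> tgt C m = Y"
  by (simp add: hom_def)

lemma category_simps [simp]:
  assumes "category C"
  shows "m \<in> Ar C \<Longrightarrow> src C m \<in> Ob C" "m \<in> Ar C \<Longrightarrow> tgt C m \<in> Ob C"
    "X \<in> Ob C \<Longrightarrow> ide C X \<in> Ar C" "X \<in> Ob C \<Longrightarrow> src C (ide C X) = X" "X \<in> Ob C \<Longrightarrow> tgt C (ide C X) = X"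
    "m \<in> Ar C \<Longrightarrow> n \<in> Ar C \<Longrightarrow> tgt C m = src C n \<Longrightarrow> cmp C n m \<in> Ar C"
    "m \<in> Ar C \<Longrightarrow> n \<in> Ar C \<Longrightarrow> tgt C m = src C n \<Longrightarrow> src C (cmp C n m) = src C m"
    "m \<in> Ar C \<Longrightarrow> n \<in> Ar C \<Longrightarrow> tgt C m = src C n \<Longrightarrow> tgt C (cmp C n m) = tgt C n"
    "m \<in> Ar C \<Longrightarrow> src C m = X \<Longrightarrow> cmp C m (ide C X) = m"
    "m \<in> Ar C \<Longrightarrow> tgt C m = X \<Longrightarrow> cmp C (ide C X) m = m"
proof -
  note c = assms[unfolded category_def hom_def mem_Collect_eq]
  show "m \<in> Ar C \<Longrightarrow> src C m \<in> Ob C" "m \<in> Ar C \<Longrightarrow> tgt C m \<in> Ob C"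
    "X \<in> Ob C \<Longrightarrow> ide C X \<in> Ar C" "X \<in> Ob C \<Longrightarrow> src C (ide C X) = X" "X \<in> Ob C \<Longrightarrow> tgt C (ide C X) = X"
    "m \<in> Ar C \<Longrightarrow> n \<in> Ar C \<Longrightarrow> tgt C m = src C n \<Longrightarrow> cmp C n m \<in> Ar C"
    "m \<in> Ar C \<Longrightarrow> n \<in> Ar C \<Longrightarrow> tgt C m = src C n \<Longrightarrow> src C (cmp C n m) = src C m"
    "m \<in> Ar C \<Longrightarrow> n \<in> Ar C \<Longrightarrow> tgt C m = src C n \<Longrightarrow> tgt C (cmp C n m) = tgt C n"
    "m \<in> Ar C \<Longrightarrow> src C m = X \<Longrightarrow> cmp C m (ide C X) = m"
    "m \<in> Ar C \<Longrightarrow> tgt C m = X \<Longrightarrow> cmp C (ide C X) m = m"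
    using c by blast+
qed

lemma cmp_assoc:
  assumes "category C" "l \<in> Ar C" "m \<in> Ar C" "n \<in> Ar C" "tgt C l = src C m" "tgt C m = src C n"
  shows "cmp C (cmp C n m) l = cmp C n (cmp C m l)"
  using assms unfolding category_def by metis

lemma functor_simps:
  assumes "is_functor C D F"
  shows "category C" "category D" "X \<in> Ob C \<Longrightarrow> fob F X \<in> Ob D"
    "m \<in> Ar C \<Longrightarrow> far F m \<in> Ar D" "m \<in> Ar C \<Longrightarrow> src D (far F m) = fob F (src C m)"
    "m \<in> Ar C \<Longrightarrow> tgt D (far F m) = fob F (tgt C m)"
    "X \<in> Ob C \<Longrightarrow> far F (ide C X) = ide D (fob F X)"
    "m \<in> Ar C \<Longrightarrow> n \<in> Ar C \<Longrightarrow> tgt C m = src C n \<Longrightarrow> far F (cmp C n m) = cmp D (far F n) (far F m)"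
  using assms unfolding is_functor_def hom_def by auto

lemma is_functorI:
  assumes "category C" "category D" "\<And>X. X \<in> Ob C \<Longrightarrow> fob F X \<in> Ob D"
    "\<And>m. m \<in> Ar C \<Longrightarrow> far F m \<in> hom D (fob F (src C m)) (fob F (tgt C m))"
    "\<And>X. X \<in> Ob C \<Longrightarrow> far F (ide C X) = ide D (fob F X)"
    "\<And>m n. m \<in> Ar C \<Longrightarrow> n \<in> Ar C \<Longrightarrow> tgt C m = src C n \<Longrightarrow>
       far F (cmp C n m) = cmp D (far F n) (far F m)"
  shows "is_functor C D F"
  using assms by (simp add: is_functor_def)

lemma is_functor_comp: "is_functor C D F \<Longrightarrow> is_functor D B G \<Longrightarrow> is_functor C B (comp_func G F)"
  by (rule is_functorI) (simp_all add: comp_func_def hom_iff functor_simps(1)[of C D F]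
      functor_simps(2)[of D B G] functor_simps(3-8)[of C D F] functor_simps(3-8)[of D B G])

lemma is_functor_id: "category C \<Longrightarrow> is_functor C C idfunc"
  by (rule is_functorI) (simp_all add: idfunc_def hom_iff)

lemma slice_simps [simp]:
  "w \<in> Ob (slice C V) \<longleftrightarrow> w \<in> Ar C \<and> tgt C w = V"
  "(w, w', m) \<in> Ar (slice C V) \<longleftrightarrow> w \<in> Ar C \<and> w' \<in> Ar C \<and> tgt C w = V \<and> tgt C w' = V \<and>
     m \<in> Ar C \<and> src C w = src C m \<and> tgt C m = src C w' \<and> cmp C w' m = w"
  "src (slice C V) (w, w', m) = w" "tgt (slice C V) (w, w', m) = w'"
  "ide (slice C V) w = (w, w, ide C (src C w))"
  "cmp (slice C V) (b1, b2, n) (a1, a2, m) = (a1, b2, cmp C n m)"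
  by (auto simp: slice_def hom_def)

lemma slice_forget_simps [simp]:
  "fob (slice_forget C) = src C" "far (slice_forget C) (w, w', m) = m"
  by (simp_all add: slice_forget_def)

lemma category_slice:
  assumes "category C" shows "category (slice C V)"
  unfolding category_def
proof (intro conjI ballI impI, goal_cases)
  case (4 m n)
  then show ?case using assms
    by (cases m; cases n) (simp add: hom_iff, metis cmp_assoc)
qed (use assms in \<open>auto simp: hom_iff cmp_assoc\<close>)

lemma is_functor_slice_forget: "category C \<Longrightarrow> is_functor (slice C V) C (slice_forget C)"
  by (rule is_functorI) (auto simp: category_slice hom_iff split_paired_all)

lemma fibre_simps [simp]:
  "X \<in> Ob (fibre E I \<pi> i) \<longleftrightarrow> X \<in> Ob E \<and> fob \<pi> X = i"
  "m \<in> Ar (fibre E I \<pi> i) \<longleftrightarrow> m \<in> Ar E \<and> far \<pi> m = ide I i"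
  "src (fibre E I \<pi> i) = src E" "tgt (fibre E I \<pi> i) = tgt E"
  "ide (fibre E I \<pi> i) = ide E" "cmp (fibre E I \<pi> i) = cmp E"
  by (simp_all add: fibre_def)

lemma category_fibre: 
  assumes "is_functor E I \<pi>" "i \<in> Ob I"
  shows "category (fibre E I \<pi> i)" 
proof -
  \<comment> \<open>An arrow of the fibre is only required to lie over the identity of
    \<open>i\<close>; that both its ends lie over \<open>i\<close> is read off from the ends of that
    identity.\<close>
  have a: "fob \<pi> (src E m) = i" "fob \<pi> (tgt E m) = i" if "m \<in> Ar E" "far \<pi> m = ide I i" for m
    using assms that by (metis category_simps(4) functor_simps(2,5), metis category_simps(5) functor_simps(2,6))
  show ?thesis unfolding category_def using assms functor_simps(1,2)[OF assms(1)]
    by (auto simp: hom_iff a cmp_assoc functor_simps(7,8)[OF assms(1)])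
qed

section \<open>Presheaves and topologies\<close>

lemma presheaf_simps:
  assumes "presheaf C F"
  shows "m \<in> Ar C \<Longrightarrow> x \<in> sec F (tgt C m) \<Longrightarrow> res F m x \<in> sec F (src C m)"
    "X \<in> Ob C \<Longrightarrow> x \<in> sec F X \<Longrightarrow> res F (ide C X) x = x"
    "m \<in> Ar C \<Longrightarrow> n \<in> Ar C \<Longrightarrow> tgt C m = src C n \<Longrightarrow> x \<in> sec F (tgt C n) \<Longrightarrow>
       res F (cmp C n m) x = res F m (res F n x)"
  using assms unfolding presheaf_def by (blast dest: PiE_mem)+

lemma psh_mor_simps:
  assumes "psh_mor C F G \<alpha>"
  shows "X \<in> Ob C \<Longrightarrow> x \<in> sec F X \<Longrightarrow> \<alpha> X x \<in> sec G X"
    "m \<in> Ar C \<Longrightarrow> x \<in> sec F (tgt C m) \<Longrightarrow> \<alpha> (src C m) (res F m x) = res G m (\<alpha> (tgt C m) x)"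
  using assms unfolding psh_mor_def by (blast dest: PiE_mem)+

lemma psh_mor_ext:
  assumes "psh_mor C F G \<alpha>" "psh_mor C F G \<beta>"
    "\<And>X x. X \<in> Ob C \<Longrightarrow> x \<in> sec F X \<Longrightarrow> \<alpha> X x = \<beta> X x"
  shows "\<alpha> = \<beta>"
proof
  fix X
  show "\<alpha> X = \<beta> X"
  proof (cases "X \<in> Ob C")
    case True
    then have "\<alpha> X \<in> sec F X \<rightarrow>\<^sub>E sec G X" "\<beta> X \<in> sec F X \<rightarrow>\<^sub>E sec G X"
      using assms(1,2) unfolding psh_mor_def by (blast dest: PiE_mem)+
    then show ?thesis using assms(3)[OF True] by (rule PiE_ext)
  next
    case False
    then have "\<alpha> X = undefined" "\<beta> X = undefined"
      using assms(1,2) unfolding psh_mor_def by (blast intro: PiE_arb)+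
    then show ?thesis by simp
  qed
qed

text \<open>Naturality is asked together with stability under restriction, because the extensional
  function takes its intended value at \<open>res F m x\<close> only if that is a section of
  \<open>F\<close>.\<close>

lemma psh_morI:
  assumes "\<And>X x. X \<in> Ob C \<Longrightarrow> x \<in> sec F X \<Longrightarrow> f X x \<in> sec G X"
    "\<And>m x. m \<in> Ar C \<Longrightarrow> src C m \<in> Ob C \<Longrightarrow> tgt C m \<in> Ob C \<Longrightarrow> x \<in> sec F (tgt C m) \<Longrightarrow>
       res F m x \<in> sec F (src C m) \<and> f (src C m) (res F m x) = res G m (f (tgt C m) x)"
    "category C"
  shows "psh_mor C F G (\<lambda>X\<in>Ob C. \<lambda>x\<in>sec F X. f X x)"
  unfolding psh_mor_def using assms by auto

section \<open>Sieves, local agreement of sections, and the sheaf condition without size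
  restriction\<close>

lemma sieveD:
  assumes "sieve C X R"
  shows "m \<in> R \<Longrightarrow> m \<in> Ar C" "m \<in> R \<Longrightarrow> tgt C m = X"
    "m \<in> R \<Longrightarrow> g \<in> Ar C \<Longrightarrow> tgt C g = src C m \<Longrightarrow> cmp C m g \<in> R"
  using assms unfolding sieve_def by auto

definition agreement :: "('o, 'm) cat \<Rightarrow> ('o, 'm, 's) psh \<Rightarrow> 'o \<Rightarrow> 's \<Rightarrow> 's \<Rightarrow> 'm set" where
  "agreement C F X p q = {m \<in> Ar C. tgt C m = X \<and> res F m p = res F m q}"

text \<open>The sheaf condition for presheaves of sets that need not belong to the universe.\<close>

definition glues :: "('o, 'm) cat \<Rightarrow> ('o \<Rightarrow> 'm set set) \<Rightarrow> ('o, 'm, 's) psh \<Rightarrow> bool" where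
  "glues C J F \<longleftrightarrow> presheaf C F \<and>
     (\<forall>X\<in>Ob C. \<forall>R\<in>J X. \<forall>s. matching C F R s \<longrightarrow>
        (\<exists>!x. x \<in> sec F X \<and> (\<forall>m\<in>R. res F m x = s m)))"

lemma sheaf_iff_glues: "sheaf el C J F \<longleftrightarrow> glues C J F \<and> (\<forall>X\<in>Ob C. sec F X \<in> range el)"
  unfolding sheaf_def upresheaf_def glues_def by blast

lemma glues_presheaf: "glues C J F \<Longrightarrow> presheaf C F"
  by (simp add: glues_def)

text \<open>These are the bicovering morphisms, locally injective and locally surjective: the ones
  that become isomorphisms after sheafification. Unlike the universal property of an associated
  sheaf, the condition can be checked on sieves and is stable under base change.\<close>

definition loc_bij ::
    "('o, 'm) cat \<Rightarrow> ('o \<Rightarrow> 'm set set) \<Rightarrow> ('o, 'm, 's) psh \<Rightarrow> ('o, 'm, 't) psh \<Rightarrow> ('o \<Rightarrow> 's \<Rightarrow> 't) \<Rightarrow> bool" where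
  "loc_bij C J P A \<eta> \<longleftrightarrow> psh_mor C P A \<eta> \<and>
     (\<forall>X\<in>Ob C. \<forall>p\<in>sec P X. \<forall>q\<in>sec P X. \<eta> X p = \<eta> X q \<longrightarrow> agreement C P X p q \<in> J X) \<and>
     (\<forall>X\<in>Ob C. \<forall>a\<in>sec A X.
        {m \<in> Ar C. tgt C m = X \<and> (\<exists>p\<in>sec P (src C m). \<eta> (src C m) p = res A m a)} \<in> J X)"

lemma loc_bijD:
  assumes "loc_bij C J P A \<eta>"
  shows "psh_mor C P A \<eta>"
    "X \<in> Ob C \<Longrightarrow> p \<in> sec P X \<Longrightarrow> q \<in> sec P X \<Longrightarrow> \<eta> X p = \<eta> X q \<Longrightarrow> agreement C P X p q \<in> J X"
    "X \<in> Ob C \<Longrightarrow> a \<in> sec A X \<Longrightarrow>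
       {m \<in> Ar C. tgt C m = X \<and> (\<exists>p\<in>sec P (src C m). \<eta> (src C m) p = res A m a)} \<in> J X"
  using assms unfolding loc_bij_def by blast+

locale site =
  fixes C :: "('o, 'm) cat" and J :: "'o \<Rightarrow> 'm set set"
  assumes cat: "category C" and top: "topology C J"
begin

lemmas c_simps [simp] = category_simps[OF cat]
lemmas assoc = cmp_assoc[OF cat]

lemma cover_sieve: "R \<in> J X \<Longrightarrow> sieve C X R"
  and cover_Ob: "R \<in> J X \<Longrightarrow> X \<in> Ob C"
  and max_cover: "X \<in> Ob C \<Longrightarrow> {m \<in> Ar C. tgt C m = X} \<in> J X"
  and pull_cover: "R \<in> J X \<Longrightarrow> f \<in> Ar C \<Longrightarrow> tgt C f = X \<Longrightarrow> sieve_pull C R f \<in> J (src C f)"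
  using top unfolding topology_def by blast+

lemma trans_cover:
  "R \<in> J X \<Longrightarrow> sieve C X R' \<Longrightarrow> (\<And>f. f \<in> R \<Longrightarrow> sieve_pull C R' f \<in> J (src C f)) \<Longrightarrow> R' \<in> J X"
  using top cover_Ob unfolding topology_def by blast

lemma sieve_sieve_pull: "sieve C X R \<Longrightarrow> f \<in> Ar C \<Longrightarrow> tgt C f = X \<Longrightarrow> sieve C (src C f) (sieve_pull C R f)"
  unfolding sieve_def sieve_pull_def by (auto simp: assoc[symmetric])

lemma superset_cover:
  assumes "R \<in> J X" "sieve C X R'" "R \<subseteq> R'" shows "R' \<in> J X"
proof (rule trans_cover[OF assms(1,2)])
  fix f assume f: "f \<in> R"
  then have "f \<in> Ar C" "sieve_pull C R' f = {m \<in> Ar C. tgt C m = src C f}"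
    using assms sieveD[OF assms(2)] unfolding sieve_pull_def by auto
  then show "sieve_pull C R' f \<in> J (src C f)" using max_cover by simp
qed

text \<open>Transitivity in the form in which it is applied: for each member only some covering
  sieve landing in \<open>R'\<close> has to be exhibited, and \<open>superset_cover\<close> enlarges
  it to the whole pullback.\<close>

lemma local_cover:
  assumes "R \<in> J X" "sieve C X R'"
    "\<And>f. f \<in> R \<Longrightarrow> f \<in> Ar C \<Longrightarrow> tgt C f = X \<Longrightarrow> \<exists>T\<in>J (src C f). \<forall>g\<in>T. cmp C f g \<in> R'"
  shows "R' \<in> J X"
proof (rule trans_cover[OF assms(1,2)])
  fix f assume f: "f \<in> R"
  note s = sieveD[OF cover_sieve[OF assms(1)]]
  obtain T where T: "T \<in> J (src C f)" "\<forall>g\<in>T. cmp C f g \<in> R'"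
    using assms(3) f s by blast
  show "sieve_pull C R' f \<in> J (src C f)"
    by (rule superset_cover[OF T(1) sieve_sieve_pull[OF assms(2)]])
       (use s f T sieveD[OF cover_sieve[OF T(1)]] in \<open>auto simp: sieve_pull_def\<close>)
qed

lemma inter_cover:
  assumes "R \<in> J X" "R' \<in> J X" shows "R \<inter> R' \<in> J X"
proof (rule local_cover[OF assms(1)])
  note s = sieveD[OF cover_sieve[OF assms(1)]] sieveD[OF cover_sieve[OF assms(2)]]
  show "sieve C X (R \<inter> R')"
    using cover_sieve[OF assms(1)] cover_sieve[OF assms(2)] unfolding sieve_def by blast
  fix f assume f: "f \<in> R" "f \<in> Ar C" "tgt C f = X"
  show "\<exists>T\<in>J (src C f). \<forall>g\<in>T. cmp C f g \<in> R \<inter> R'"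
    by (rule bexI[OF _ pull_cover[OF assms(2) f(2,3)]]) (use s f in \<open>auto simp: sieve_pull_def\<close>)
qed

lemma sieve_agreement: "presheaf C F \<Longrightarrow> p \<in> sec F X \<Longrightarrow> q \<in> sec F X \<Longrightarrow> sieve C X (agreement C F X p q)"
  unfolding sieve_def agreement_def by (auto simp: presheaf_simps(3))

lemma agreement_pull:
  "presheaf C F \<Longrightarrow> f \<in> Ar C \<Longrightarrow> p \<in> sec F (tgt C f) \<Longrightarrow> q \<in> sec F (tgt C f) \<Longrightarrow>
   sieve_pull C (agreement C F (tgt C f) p q) f = agreement C F (src C f) (res F f p) (res F f q)"
  unfolding sieve_pull_def agreement_def by (auto simp: presheaf_simps(3))

lemma glues_separated:
  assumes "glues C J F" "R \<in> J X" "x \<in> sec F X" "y \<in> sec F X" "\<And>m. m \<in> R \<Longrightarrow> res F m x = res F m y"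
  shows "x = y"
proof -
  note s = sieveD[OF cover_sieve[OF assms(2)]] and p = presheaf_simps[OF glues_presheaf[OF assms(1)]]
  have "matching C F R (\<lambda>m. res F m x)"
    unfolding matching_def using s p assms(3) by auto
  then have "\<exists>!z. z \<in> sec F X \<and> (\<forall>m\<in>R. res F m z = res F m x)"
    using assms(1,2) cover_Ob unfolding glues_def by blast
  then show ?thesis using assms(3-5) by metis
qed

lemma glues_glue:
  assumes "glues C J F" "R \<in> J X" "\<And>m. m \<in> R \<Longrightarrow> s m \<in> sec F (src C m)"
    "\<And>m g. m \<in> R \<Longrightarrow> g \<in> Ar C \<Longrightarrow> tgt C g = src C m \<Longrightarrow> s (cmp C m g) = res F g (s m)"
  obtains x where "x \<in> sec F X" "\<And>m. m \<in> R \<Longrightarrow> res F m x = s m"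
proof -
  have "matching C F R s" unfolding matching_def using assms(3,4) by auto
  then have "\<exists>!z. z \<in> sec F X \<and> (\<forall>m\<in>R. res F m z = s m)"
    using assms(1,2) cover_Ob unfolding glues_def by blast
  then show ?thesis using that by auto
qed

lemma gluesI:
  assumes "presheaf C F"
    "\<And>X R x y. R \<in> J X \<Longrightarrow> X \<in> Ob C \<Longrightarrow> x \<in> sec F X \<Longrightarrow> y \<in> sec F X \<Longrightarrow>
       (\<And>m. m \<in> R \<Longrightarrow> res F m x = res F m y) \<Longrightarrow> x = y"
    "\<And>X R s. R \<in> J X \<Longrightarrow> X \<in> Ob C \<Longrightarrow> (\<And>m. m \<in> R \<Longrightarrow> s m \<in> sec F (src C m)) \<Longrightarrow>
       (\<And>m g. m \<in> R \<Longrightarrow> g \<in> Ar C \<Longrightarrow> tgt C g = src C m \<Longrightarrow> s (cmp C m g) = res F g (s m)) \<Longrightarrow>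
       \<exists>x\<in>sec F X. \<forall>m\<in>R. res F m x = s m"
  shows "glues C J F"
  unfolding glues_def
proof (intro conjI ballI allI impI)
  fix X R s assume a: "X \<in> Ob C" "R \<in> J X" "matching C F R s"
  obtain x where x: "x \<in> sec F X" "\<forall>m\<in>R. res F m x = s m"
    using assms(3)[OF a(2,1), of s] a(3) unfolding matching_def by blast
  show "\<exists>!x. x \<in> sec F X \<and> (\<forall>m\<in>R. res F m x = s m)"
  proof (rule ex1I[of _ x])
    fix y assume "y \<in> sec F X \<and> (\<forall>m\<in>R. res F m y = s m)"
    then show "y = x" using assms(2)[OF a(2,1), of y x] x by simp
  qed (use x in simp)
qed (fact assms(1))

subsection \<open>Universality of locally bijective morphisms\<close>

text \<open>Sections identified by \<open>\<eta>\<close> agree on a covering sieve, by local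
  injectivity; their images under \<open>\<zeta>\<close> agree there too, and \<open>F\<close> is
  separated.\<close>

lemma loc_bij_eq:
  assumes "loc_bij C J P A \<eta>" "presheaf C P" "glues C J F" "psh_mor C P F \<zeta>"
    "X \<in> Ob C" "p \<in> sec P X" "q \<in> sec P X" "\<eta> X p = \<eta> X q"
  shows "\<zeta> X p = \<zeta> X q"
proof (rule glues_separated[OF assms(3) loc_bijD(2)[OF assms(1,5-8)]])
  note z = psh_mor_simps[OF assms(4)]
  show "\<zeta> X p \<in> sec F X" "\<zeta> X q \<in> sec F X" using z assms by auto
  fix m assume "m \<in> agreement C P X p q"
  then show "res F m (\<zeta> X p) = res F m (\<zeta> X q)"
    using z(2)[of m] assms(6,7) unfolding agreement_def by (metis (lifting) mem_Collect_eq)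
qed

text \<open>A section \<open>a\<close> of \<open>A\<close> lifts to \<open>P\<close> on a covering
  sieve, by local surjectivity. The images of the lifts under \<open>\<zeta>\<close> depend only on
  \<open>a\<close>, by \<open>loc_bij_eq\<close>, and glue in \<open>F\<close> to the value at
  \<open>a\<close>.\<close>

lemma loc_bij_extend:
  assumes lb: "loc_bij C J P A \<eta>" and P: "presheaf C P" and A: "presheaf C A"
    and F: "glues C J F" and z: "psh_mor C P F \<zeta>"
  shows "\<exists>!\<phi>. psh_mor C A F \<phi> \<and> (\<forall>X\<in>Ob C. \<forall>x\<in>sec P X. \<phi> X (\<eta> X x) = \<zeta> X x)"
proof -
  \<comment> \<open>The value at \<open>a\<close> is characterized by all local lifts of
    \<open>a\<close> at once. No choice of lifts enters, so uniqueness later yields naturality and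
    the extension property.\<close>
  define Q where "Q X a x \<longleftrightarrow> x \<in> sec F X \<and>
    (\<forall>m\<in>Ar C. tgt C m = X \<longrightarrow> (\<forall>p\<in>sec P (src C m). \<eta> (src C m) p = res A m a \<longrightarrow> res F m x = \<zeta> (src C m) p))"
    for X a x
  define D where "D X a = {m \<in> Ar C. tgt C m = X \<and> (\<exists>p\<in>sec P (src C m). \<eta> (src C m) p = res A m a)}" for X a
  have D: "D X a \<in> J X" if "X \<in> Ob C" "a \<in> sec A X" for X a
    using loc_bijD(3)[OF lb that] by (simp add: D_def)
  note e = psh_mor_simps[OF loc_bijD(1)[OF lb]] and zs = psh_mor_simps[OF z]
  note Ps = presheaf_simps[OF P] and As = presheaf_simps[OF A] and Fs = presheaf_simps[OF glues_presheaf[OF F]]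
  have Q_unique: "x = y" if "Q X a x" "Q X a y" "X \<in> Ob C" "a \<in> sec A X" for X a x y
  proof (rule glues_separated[OF F D[OF that(3,4)]])
    fix m assume "m \<in> D X a"
    then show "res F m x = res F m y" using that unfolding D_def Q_def by (auto; metis)
  qed (use that in \<open>simp_all add: Q_def\<close>)
  have Q_ex: "\<exists>x. Q X a x" if X: "X \<in> Ob C" "a \<in> sec A X" for X a
  proof -
    define c where "c m = (SOME p. p \<in> sec P (src C m) \<and> \<eta> (src C m) p = res A m a)" for m
    have c: "c m \<in> sec P (src C m)" "\<eta> (src C m) (c m) = res A m a" if "m \<in> D X a" for m
      using someI_ex[of "\<lambda>p. p \<in> sec P (src C m) \<and> \<eta> (src C m) p = res A m a"] that
      unfolding c_def D_def by blast+
    have Dm: "m \<in> Ar C" "tgt C m = X" if "m \<in> D X a" for m using that by (simp_all add: D_def)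
    \<comment> \<open>The lifts \<open>c m\<close> are chosen independently and need not be
      compatible in \<open>P\<close>; after applying \<open>\<zeta>\<close> they are, by
      \<open>loc_bij_eq\<close>.\<close>
    obtain x where x: "x \<in> sec F X" "\<And>m. m \<in> D X a \<Longrightarrow> res F m x = \<zeta> (src C m) (c m)"
    proof (rule glues_glue[OF F D[OF X], of "\<lambda>m. \<zeta> (src C m) (c m)"])
      fix m assume m: "m \<in> D X a"
      then show "\<zeta> (src C m) (c m) \<in> sec F (src C m)" using c zs Dm by simp
      fix g assume g: "g \<in> Ar C" "tgt C g = src C m"
      have mg: "cmp C m g \<in> D X a" using sieveD(3)[OF cover_sieve[OF D[OF X]] m g] .
      have "\<eta> (src C g) (c (cmp C m g)) = \<eta> (src C g) (res P g (c m))"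
        using c[OF mg] c[OF m] e(2)[OF g(1), of "c m"] g Dm[OF m] As(3)[of g m a] X by simp
      then have "\<zeta> (src C g) (c (cmp C m g)) = \<zeta> (src C g) (res P g (c m))"
        using c[OF mg] c[OF m] g Dm[OF m] Ps(1)[of g] by (intro loc_bij_eq[OF lb P F z]) auto
      then show "\<zeta> (src C (cmp C m g)) (c (cmp C m g)) = res F g (\<zeta> (src C m) (c m))"
        using zs(2)[OF g(1), of "c m"] c[OF m] g Dm[OF m] by simp
    qed blast
    have "Q X a x" unfolding Q_def
    proof (intro conjI ballI impI)
      fix m p assume m: "m \<in> Ar C" "tgt C m = X" "p \<in> sec P (src C m)" "\<eta> (src C m) p = res A m a"
      then have mD: "m \<in> D X a" by (auto simp: D_def)
      show "res F m x = \<zeta> (src C m) p"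
        unfolding x(2)[OF mD] using c[OF mD] m by (intro loc_bij_eq[OF lb P F z]) auto
    qed (fact x)
    then show ?thesis by blast
  qed
  define f where "f X a = (THE x. Q X a x)" for X a
  have f: "Q X a (f X a)" if "X \<in> Ob C" "a \<in> sec A X" for X a
    unfolding f_def by (rule theI') (use Q_ex[OF that] Q_unique that in blast)
  have f_eq: "f X a = x" if "Q X a x" "X \<in> Ob C" "a \<in> sec A X" for X a x
    using Q_unique[OF f that(1)] that by simp
  define \<phi> where "\<phi> = (\<lambda>X\<in>Ob C. \<lambda>a\<in>sec A X. f X a)"
  have phi: "psh_mor C A F \<phi>" unfolding \<phi>_def
  proof (rule psh_morI)
    show "f X a \<in> sec F X" if "X \<in> Ob C" "a \<in> sec A X" for X a using f[OF that] by (simp add: Q_def)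
    fix g a assume g: "g \<in> Ar C" "src C g \<in> Ob C" "tgt C g \<in> Ob C" "a \<in> sec A (tgt C g)"
    have q: "Q (tgt C g) a (f (tgt C g) a)" using f g by simp
    \<comment> \<open>A lift of the restriction of \<open>a\<close> along \<open>g\<close> is a lift
      of \<open>a\<close> itself along a composite, so the restricted value satisfies the same
      characterization.\<close>
    have "Q (src C g) (res A g a) (res F g (f (tgt C g) a))"
      unfolding Q_def
    proof (intro conjI ballI impI)
      show "res F g (f (tgt C g) a) \<in> sec F (src C g)" using q g Fs(1) by (simp add: Q_def)
      fix m p assume m: "m \<in> Ar C" "tgt C m = src C g" "p \<in> sec P (src C m)"
        "\<eta> (src C m) p = res A m (res A g a)"
      then have "res F (cmp C g m) (f (tgt C g) a) = \<zeta> (src C m) p"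
        using q g As(3)[of m g a] unfolding Q_def by (metis c_simps(6-8))
      then show "res F m (res F g (f (tgt C g) a)) = \<zeta> (src C m) p"
        using q m g Fs(3)[of m g] by (simp add: Q_def)
    qed
    then show "res A g a \<in> sec A (src C g) \<and> f (src C g) (res A g a) = res F g (f (tgt C g) a)"
      using f_eq As(1) g by blast
  qed (rule cat)
  have ext: "\<phi> X (\<eta> X p) = \<zeta> X p" if X: "X \<in> Ob C" "p \<in> sec P X" for X p
  proof -
    have "Q X (\<eta> X p) (\<zeta> X p)" unfolding Q_def
    proof (intro conjI ballI impI)
      show "\<zeta> X p \<in> sec F X" using zs X by simp
      fix m q assume m: "m \<in> Ar C" "tgt C m = X" "q \<in> sec P (src C m)" "\<eta> (src C m) q = res A m (\<eta> X p)"
      then have "\<zeta> (src C m) q = \<zeta> (src C m) (res P m p)"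
        using X e(2)[of m p] Ps(1)[of m p] by (intro loc_bij_eq[OF lb P F z]) auto
      then show "res F m (\<zeta> X p) = \<zeta> (src C m) q" using zs(2)[of m p] m X by simp
    qed
    then show ?thesis using f_eq e(1) X by (simp add: \<phi>_def)
  qed
  show ?thesis
  proof (rule ex1I[of _ \<phi>])
    fix \<psi> assume psi: "psh_mor C A F \<psi> \<and> (\<forall>X\<in>Ob C. \<forall>x\<in>sec P X. \<psi> X (\<eta> X x) = \<zeta> X x)"
    note ps = psh_mor_simps[OF psi[THEN conjunct1]] and ph = psh_mor_simps[OF phi]
    show "\<psi> = \<phi>"
    proof (rule psh_mor_ext[OF psi[THEN conjunct1] phi])
      fix X a assume X: "X \<in> Ob C" "a \<in> sec A X"
      show "\<psi> X a = \<phi> X a"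
      proof (rule glues_separated[OF F D[OF X]])
        show "\<psi> X a \<in> sec F X" "\<phi> X a \<in> sec F X" using ps ph X by auto
        fix m assume "m \<in> D X a"
        then obtain p where m: "m \<in> Ar C" "tgt C m = X" "p \<in> sec P (src C m)" "\<eta> (src C m) p = res A m a"
          by (auto simp: D_def)
        then show "res F m (\<psi> X a) = res F m (\<phi> X a)"
          using ps(2)[of m a] ph(2)[of m a] X ext[of "src C m" p] psi c_simps(1)[OF m(1)] by metis
      qed
    qed
  qed (use phi ext in blast)
qed

end

lemma loc_bij_is_assoc_sheaf:
  fixes C :: "('o, 'm) cat" and P :: "('o, 'm, 's) psh" and A :: "('o, 'm, 'u) psh"
  assumes "category C" "topology C J" "loc_bij C J P A \<eta>" "presheaf C P" "sheaf el C J A"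
  shows "is_assoc_sheaf el C J P A \<eta>"
proof -
  interpret site C J by unfold_locales (fact assms)+
  show ?thesis unfolding is_assoc_sheaf_def
  proof (intro conjI allI impI)
    fix F :: "('o, 'm, 'u) psh" and \<zeta>
    assume "sheaf el C J F \<and> psh_mor C P F \<zeta>"
    then show "\<exists>!\<phi>. psh_mor C A F \<phi> \<and> (\<forall>X\<in>Ob C. \<forall>x\<in>sec P X. \<phi> X (\<eta> X x) = \<zeta> X x)"
      using assms(5) by (intro loc_bij_extend[OF assms(3,4)]) (auto simp: sheaf_iff_glues glues_presheaf)
  qed (use assms(5) loc_bijD(1)[OF assms(3)] in auto)
qed

section \<open>Isomorphisms of presheaves and transport into the universe\<close>

lemma psh_mor_id: "category C \<Longrightarrow> presheaf C F \<Longrightarrow> psh_mor C F F (\<lambda>X\<in>Ob C. \<lambda>x\<in>sec F X. x)"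
  by (rule psh_morI) (auto simp: presheaf_simps)

lemma psh_mor_comp:
  assumes "category C" "presheaf C F" "psh_mor C F G \<alpha>" "psh_mor C G H \<beta>"
  shows "psh_mor C F H (\<lambda>X\<in>Ob C. \<lambda>x\<in>sec F X. \<beta> X (\<alpha> X x))"
  by (rule psh_morI)
    (auto simp: assms(1) presheaf_simps[OF assms(2)] psh_mor_simps[OF assms(3)] psh_mor_simps[OF assms(4)])

lemma presheafI:
  assumes "category C"
    "\<And>m x. m \<in> Ar C \<Longrightarrow> src C m \<in> Ob C \<Longrightarrow> tgt C m \<in> Ob C \<Longrightarrow> x \<in> S (tgt C m) \<Longrightarrow> r m x \<in> S (src C m)"
    "\<And>X x. X \<in> Ob C \<Longrightarrow> x \<in> S X \<Longrightarrow> r (ide C X) x = x"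
    "\<And>m n x. m \<in> Ar C \<Longrightarrow> n \<in> Ar C \<Longrightarrow> tgt C m = src C n \<Longrightarrow> tgt C n \<in> Ob C \<Longrightarrow> x \<in> S (tgt C n) \<Longrightarrow>
       r (cmp C n m) x = r m (r n x)"
  shows "presheaf C \<lparr>sec = \<lambda>X\<in>Ob C. S X, res = \<lambda>m\<in>Ar C. \<lambda>x\<in>S (tgt C m). r m x\<rparr>"
  unfolding presheaf_def using assms(2)[OF _ category_simps(1,2)[OF assms(1)]] assms
  by (auto simp: category_simps[OF assms(1)])

lemma psh_mor_inverse:
  assumes "category C" "presheaf C F" "presheaf C G" "psh_mor C F G h"
    "\<And>X. X \<in> Ob C \<Longrightarrow> bij_betw (h X) (sec F X) (sec G X)"
  shows "psh_mor C G F (\<lambda>X\<in>Ob C. \<lambda>y\<in>sec G X. inv_into (sec F X) (h X) y)"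
proof (rule psh_morI)
  note b = assms(5)[unfolded bij_betw_def]
  show 1: "inv_into (sec F X) (h X) y \<in> sec F X" if "X \<in> Ob C" "y \<in> sec G X" for X y
    using b[OF that(1)] that(2) by (metis inv_into_into)
  fix m y assume m: "m \<in> Ar C" "src C m \<in> Ob C" "tgt C m \<in> Ob C" "y \<in> sec G (tgt C m)"
  let ?x = "inv_into (sec F (tgt C m)) (h (tgt C m)) y"
  have x: "?x \<in> sec F (tgt C m)" "h (tgt C m) ?x = y"
    using 1 b[OF m(3)] m(3,4) by (auto simp: f_inv_into_f)
  then have "h (src C m) (res F m ?x) = res G m y" using psh_mor_simps(2)[OF assms(4) m(1) x(1)] by simp
  then have "inv_into (sec F (src C m)) (h (src C m)) (res G m y) = res F m ?x"
    using b[OF m(2)] presheaf_simps(1)[OF assms(2) m(1) x(1)] by (metis inv_into_f_f)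
  then show "res G m y \<in> sec G (src C m) \<and>
      inv_into (sec F (src C m)) (h (src C m)) (res G m y) = res F m ?x"
    using presheaf_simps(1)[OF assms(3)] m by blast
qed (fact assms(1))

text \<open>Constructions such as the sheaf of germs live in a type of their own. A presheaf with
  small values is moved to an isomorphic one valued in the universe by conjugating its restrictions
  with chosen bijections.\<close>

lemma upresheaf_transport:
  fixes F :: "('o, 'm, 's) psh"
  assumes "category C" "presheaf C F" "\<And>X. X \<in> Ob C \<Longrightarrow> U_small el (sec F X)"
  obtains G :: "('o, 'm, 'u) psh" and h where "presheaf C G" "\<And>X. X \<in> Ob C \<Longrightarrow> sec G X \<in> range el" "psh_mor C F G h"
    "\<And>X. X \<in> Ob C \<Longrightarrow> bij_betw (h X) (sec F X) (sec G X)"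
proof -
  note c = category_simps[OF assms(1)] and f = presheaf_simps[OF assms(2)]
  have "\<forall>X\<in>Ob C. \<exists>g. \<exists>u. bij_betw g (sec F X) (el u)"
    using assms(3) unfolding U_small_def by blast
  then obtain g where "\<forall>X\<in>Ob C. \<exists>u. bij_betw (g X) (sec F X) (el u)" by (rule bchoice[THEN exE])
  then obtain u where g: "\<And>X. X \<in> Ob C \<Longrightarrow> bij_betw (g X) (sec F X) (el (u X))" by (metis bchoice)
  define k where "k X = inv_into (sec F X) (g X)" for X
  have k1: "k X (g X x) = x" "g X x \<in> el (u X)" if "X \<in> Ob C" "x \<in> sec F X" for X x
    using g[OF that(1)] that(2) by (auto simp: k_def bij_betw_def)
  have k2: "g X (k X y) = y" "k X y \<in> sec F X" if "X \<in> Ob C" "y \<in> el (u X)" for X y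
    using g[OF that(1)] that(2) unfolding k_def bij_betw_def by (metis f_inv_into_f, metis inv_into_into)
  define G where "G = \<lparr>sec = \<lambda>X\<in>Ob C. el (u X),
    res = \<lambda>m\<in>Ar C. \<lambda>y\<in>el (u (tgt C m)). g (src C m) (res F m (k (tgt C m) y))\<rparr>"
  define h where "h = (\<lambda>X\<in>Ob C. \<lambda>x\<in>sec F X. g X x)"
  have "presheaf C G" unfolding G_def
    by (rule presheafI) (auto simp: k1 k2 f c assms(1))
  moreover have "psh_mor C F G h" unfolding h_def
    by (rule psh_morI) (auto simp: k1 k2 f c G_def assms(1))
  moreover have "bij_betw (h X) (sec F X) (sec G X)" "sec G X \<in> range el" if "X \<in> Ob C" for X
  proof -
    have "bij_betw (h X) (sec F X) (el (u X))"
      using g[OF that] by (subst bij_betw_cong[of _ _ "g X"]) (simp_all add: h_def that)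
    then show "bij_betw (h X) (sec F X) (sec G X)" "sec G X \<in> range el"
      using that by (simp_all add: G_def)
  qed
  ultimately show thesis using that by blast
qed

context site begin

lemma glues_iso:
  assumes F: "glues C J F" and G: "presheaf C G" and h: "psh_mor C F G h"
    "\<And>X. X \<in> Ob C \<Longrightarrow> bij_betw (h X) (sec F X) (sec G X)"
  shows "glues C J G"
proof (rule gluesI[OF G])
  note fp = glues_presheaf[OF F]
  define k where "k = (\<lambda>X\<in>Ob C. \<lambda>y\<in>sec G X. inv_into (sec F X) (h X) y)"
  have k: "psh_mor C G F k" unfolding k_def by (rule psh_mor_inverse[OF cat fp G h])
  note ks = psh_mor_simps[OF k] and hs = psh_mor_simps[OF h(1)]
  have hk: "h X (k X y) = y" if "X \<in> Ob C" "y \<in> sec G X" for X y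
    using h(2)[OF that(1)] that by (simp add: k_def bij_betw_def f_inv_into_f)
  fix X R assume R: "R \<in> J X" "X \<in> Ob C"
  note s = sieveD[OF cover_sieve[OF R(1)]]
  show "x = y" if xy: "x \<in> sec G X" "y \<in> sec G X" "\<And>m. m \<in> R \<Longrightarrow> res G m x = res G m y" for x y
  proof -
    have "k X x = k X y"
    proof (rule glues_separated[OF F R(1)])
      fix m assume m: "m \<in> R"
      show "res F m (k X x) = res F m (k X y)"
        using ks(2)[of m x] ks(2)[of m y] s[OF m] xy(1,2) xy(3)[OF m] by simp
    qed (use xy R ks in auto)
    then show ?thesis using hk[OF R(2)] xy by metis
  qed
  fix t assume t: "\<And>m. m \<in> R \<Longrightarrow> t m \<in> sec G (src C m)"
    "\<And>m g. m \<in> R \<Longrightarrow> g \<in> Ar C \<Longrightarrow> tgt C g = src C m \<Longrightarrow> t (cmp C m g) = res G g (t m)"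
  obtain x where x: "x \<in> sec F X" "\<And>m. m \<in> R \<Longrightarrow> res F m x = k (src C m) (t m)"
  proof (rule glues_glue[OF F R(1), of "\<lambda>m. k (src C m) (t m)"])
    fix m assume m: "m \<in> R"
    then show "k (src C m) (t m) \<in> sec F (src C m)" using ks s t by simp
    fix g assume g: "g \<in> Ar C" "tgt C g = src C m"
    show "k (src C (cmp C m g)) (t (cmp C m g)) = res F g (k (src C m) (t m))"
      using ks(2)[of g "t m"] t m g s(1)[OF m] by simp
  qed blast
  have "res G m (h X x) = t m" if "m \<in> R" for m
    using hs(2)[of m x] s[OF that] x hk t(1)[OF that] that by simp
  then show "\<exists>x\<in>sec G X. \<forall>m\<in>R. res G m x = t m" using hs(1) x R by blast
qed

lemma loc_bij_comp_iso:
  assumes P: "presheaf C P" and A: "presheaf C A" and lb: "loc_bij C J P A \<eta>" and h: "psh_mor C A B h"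
    "\<And>X. X \<in> Ob C \<Longrightarrow> bij_betw (h X) (sec A X) (sec B X)"
  shows "loc_bij C J P B (\<lambda>X\<in>Ob C. \<lambda>p\<in>sec P X. h X (\<eta> X p))"
proof -
  note e = psh_mor_simps[OF loc_bijD(1)[OF lb]] and hs = psh_mor_simps[OF h(1)]
  show ?thesis unfolding loc_bij_def
  proof (intro conjI ballI impI)
    show "psh_mor C P B (\<lambda>X\<in>Ob C. \<lambda>p\<in>sec P X. h X (\<eta> X p))"
      by (rule psh_mor_comp[OF cat P loc_bijD(1)[OF lb] h(1)])
    fix X assume X: "X \<in> Ob C"
    note b = h(2)[OF X, unfolded bij_betw_def]
    show "agreement C P X p q \<in> J X" if "p \<in> sec P X" "q \<in> sec P X"
      "(\<lambda>X\<in>Ob C. \<lambda>p\<in>sec P X. h X (\<eta> X p)) X p = (\<lambda>X\<in>Ob C. \<lambda>p\<in>sec P X. h X (\<eta> X p)) X q" for p q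
      using that X e(1)[OF X] b by (intro loc_bijD(2)[OF lb X]) (auto simp: inj_on_eq_iff)
    fix y assume "y \<in> sec B X"
    then obtain a where a: "a \<in> sec A X" "y = h X a" using b by auto
    have "{m \<in> Ar C. tgt C m = X \<and> (\<exists>p\<in>sec P (src C m). \<eta> (src C m) p = res A m a)} =
      {m \<in> Ar C. tgt C m = X \<and> (\<exists>p\<in>sec P (src C m). (\<lambda>X\<in>Ob C. \<lambda>p\<in>sec P X. h X (\<eta> X p)) (src C m) p = res B m y)}"
    proof (rule Collect_cong, intro conj_cong refl bex_cong)
      fix m p assume m: "m \<in> Ar C" "tgt C m = X" "p \<in> sec P (src C m)"
      have "h (src C m) (res A m a) = res B m y" using hs(2)[of m a] m a by simp
      moreover have "res A m a \<in> sec A (src C m)" "\<eta> (src C m) p \<in> sec A (src C m)"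
        using presheaf_simps(1)[OF A] m a e by simp_all
      ultimately show "(\<eta> (src C m) p = res A m a) =
         ((\<lambda>X\<in>Ob C. \<lambda>p\<in>sec P X. h X (\<eta> X p)) (src C m) p = res B m y)"
        using inj_on_eq_iff[of "h (src C m)" "sec A (src C m)" "\<eta> (src C m) p" "res A m a"]
          h(2)[of "src C m"] m by (simp add: bij_betw_def)
    qed
    then show "{m \<in> Ar C. tgt C m = X \<and> (\<exists>p\<in>sec P (src C m).
       (\<lambda>X\<in>Ob C. \<lambda>p\<in>sec P X. h X (\<eta> X p)) (src C m) p = res B m y)} \<in> J X"
      using loc_bijD(3)[OF lb X a(1)] by simp
  qed
qed

end

subsection \<open>Existence of associated sheaves\<close>

text \<open>A section over \<open>X\<close> of the sheaf associated to \<open>P\<close> is described at once, without iterating the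
  plus construction: it is the set of all pairs \<open>(f, p)\<close> such that its restriction along \<open>f\<close> is the
  image of \<open>p\<close>.\<close>

definition germs :: "('o, 'm) cat \<Rightarrow> ('o \<Rightarrow> 'm set set) \<Rightarrow> ('o, 'm, 's) psh \<Rightarrow> 'o \<Rightarrow> ('m \<times> 's) set set" where
  "germs C J P X = {S.
     (\<forall>f p. (f, p) \<in> S \<longrightarrow> f \<in> Ar C \<and> tgt C f = X \<and> p \<in> sec P (src C f)) \<and>
     (\<forall>f p g. (f, p) \<in> S \<and> g \<in> Ar C \<and> tgt C g = src C f \<longrightarrow> (cmp C f g, res P g p) \<in> S) \<and>
     (\<forall>f p R. f \<in> Ar C \<and> tgt C f = X \<and> p \<in> sec P (src C f) \<and> R \<in> J (src C f) \<and>
        (\<forall>g\<in>R. (cmp C f g, res P g p) \<in> S) \<longrightarrow> (f, p) \<in> S) \<and>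
     (\<forall>f p q. (f, p) \<in> S \<and> (f, q) \<in> S \<longrightarrow> agreement C P (src C f) p q \<in> J (src C f)) \<and>
     {f. \<exists>p. (f, p) \<in> S} \<in> J X}"

text \<open>(1)-(3) are typing and (4) is stability under restriction. (5) is saturation: all
  representatives that belong locally are included, so a section has exactly one such set and no
  quotient is formed. (6) says that two representatives along the same arrow agree locally, and (7)
  that representatives exist locally.\<close>

lemma germsD:
  assumes "S \<in> germs C J P X"
  shows "(f, p) \<in> S \<Longrightarrow> f \<in> Ar C" "(f, p) \<in> S \<Longrightarrow> tgt C f = X" "(f, p) \<in> S \<Longrightarrow> p \<in> sec P (src C f)"
    "(f, p) \<in> S \<Longrightarrow> g \<in> Ar C \<Longrightarrow> tgt C g = src C f \<Longrightarrow> (cmp C f g, res P g p) \<in> S"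
    "f \<in> Ar C \<Longrightarrow> tgt C f = X \<Longrightarrow> p \<in> sec P (src C f) \<Longrightarrow> R \<in> J (src C f) \<Longrightarrow>
       (\<And>g. g \<in> R \<Longrightarrow> (cmp C f g, res P g p) \<in> S) \<Longrightarrow> (f, p) \<in> S"
    "(f, p) \<in> S \<Longrightarrow> (f, q) \<in> S \<Longrightarrow> agreement C P (src C f) p q \<in> J (src C f)"
    "{f. \<exists>p. (f, p) \<in> S} \<in> J X"
  using assms unfolding germs_def mem_Collect_eq by blast+

definition germ_res :: "('o, 'm) cat \<Rightarrow> 'm \<Rightarrow> ('m \<times> 's) set \<Rightarrow> ('m \<times> 's) set" where
  "germ_res C m S = {(f, p). f \<in> Ar C \<and> tgt C f = src C m \<and> (cmp C m f, p) \<in> S}"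

definition germ_psh :: "('o, 'm) cat \<Rightarrow> ('o \<Rightarrow> 'm set set) \<Rightarrow> ('o, 'm, 's) psh \<Rightarrow> ('o, 'm, ('m \<times> 's) set) psh" where
  "germ_psh C J P = \<lparr>sec = \<lambda>X\<in>Ob C. germs C J P X,
     res = \<lambda>m\<in>Ar C. \<lambda>S\<in>germs C J P (tgt C m). germ_res C m S\<rparr>"

definition germ_unit :: "('o, 'm) cat \<Rightarrow> ('o \<Rightarrow> 'm set set) \<Rightarrow> ('o, 'm, 's) psh \<Rightarrow> 'o \<Rightarrow> 's \<Rightarrow> ('m \<times> 's) set" where
  "germ_unit C J P X p = {(f, q). f \<in> Ar C \<and> tgt C f = X \<and> q \<in> sec P (src C f) \<and>
     agreement C P (src C f) q (res P f p) \<in> J (src C f)}"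

locale site_presheaf = site +
  fixes P
  assumes P: "presheaf C P"
begin

lemmas p_simps [simp] = presheaf_simps[OF P]

lemma agreement_refl: "p \<in> sec P X \<Longrightarrow> X \<in> Ob C \<Longrightarrow> agreement C P X p p \<in> J X"
  using max_cover unfolding agreement_def by simp

lemma agreement_sym: "agreement C P X p q = agreement C P X q p"
  unfolding agreement_def by metis

lemma agreement_trans:
  assumes "agreement C P X p q \<in> J X" "agreement C P X q r \<in> J X" "p \<in> sec P X" "r \<in> sec P X"
  shows "agreement C P X p r \<in> J X"
  by (rule superset_cover[OF inter_cover[OF assms(1,2)] sieve_agreement[OF P assms(3,4)]])
    (auto simp: agreement_def)

lemma agreement_res:
  "agreement C P (tgt C f) p q \<in> J (tgt C f) \<Longrightarrow> f \<in> Ar C \<Longrightarrow> p \<in> sec P (tgt C f) \<Longrightarrow> q \<in> sec P (tgt C f) \<Longrightarrow>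
   agreement C P (src C f) (res P f p) (res P f q) \<in> J (src C f)"
  using pull_cover[of "agreement C P (tgt C f) p q" "tgt C f" f] agreement_pull[OF P, of f p q] by simp

lemma germ_res_germs:
  assumes S: "S \<in> germs C J P (tgt C m)" and m: "m \<in> Ar C"
  shows "germ_res C m S \<in> germs C J P (src C m)"
proof -
  note g = germsD[OF S]
  have dom: "{f. \<exists>p. (f, p) \<in> germ_res C m S} \<in> J (src C m)"
  proof -
    have "{f. \<exists>p. (f, p) \<in> germ_res C m S} = sieve_pull C {f. \<exists>p. (f, p) \<in> S} m"
      by (auto simp: sieve_pull_def germ_res_def)
    then show ?thesis using pull_cover[OF g(7) m] by simp
  qed
  show ?thesis unfolding germs_def mem_Collect_eq
  proof (intro conjI allI impI; (elim conjE)?)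
    fix f p assume f: "(f, p) \<in> germ_res C m S"
    then have f': "f \<in> Ar C" "tgt C f = src C m" "(cmp C m f, p) \<in> S" by (auto simp: germ_res_def)
    then show "f \<in> Ar C" "tgt C f = src C m" "p \<in> sec P (src C f)" using g(3)[OF f'(3)] m by auto
    show "(cmp C f g, res P g p) \<in> germ_res C m S" if "g \<in> Ar C" "tgt C g = src C f" for g
      using g(4)[OF f'(3), of g] f' m that by (simp add: germ_res_def assoc)
    show "agreement C P (src C f) p q \<in> J (src C f)" if "(f, q) \<in> germ_res C m S" for q
      using g(6)[OF f'(3), of q] f' m that by (simp add: germ_res_def)
  next
    fix f p R assume f: "f \<in> Ar C" "tgt C f = src C m" "p \<in> sec P (src C f)" "R \<in> J (src C f)"
      "\<forall>g\<in>R. (cmp C f g, res P g p) \<in> germ_res C m S"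
    have "(cmp C m f, p) \<in> S"
    proof (rule g(5))
      fix h assume "h \<in> R"
      then show "(cmp C (cmp C m f) h, res P h p) \<in> S"
        using f m sieveD[OF cover_sieve[OF f(4)]] by (auto simp: germ_res_def assoc)
    qed (use f m in auto)
    then show "(f, p) \<in> germ_res C m S" using f by (simp add: germ_res_def)
  qed (fact dom)
qed

lemma germ_simps [simp]:
  "X \<in> Ob C \<Longrightarrow> sec (germ_psh C J P) X = germs C J P X"
  "m \<in> Ar C \<Longrightarrow> S \<in> germs C J P (tgt C m) \<Longrightarrow> res (germ_psh C J P) m S = germ_res C m S"
  by (simp_all add: germ_psh_def)

lemma germ_psh_presheaf: "presheaf C (germ_psh C J P)"
  unfolding germ_psh_def
proof (rule presheafI[OF cat])
  fix X S assume X: "X \<in> Ob C" "S \<in> germs C J P X"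
  note g = germsD[OF X(2)]
  have "(f, p) \<in> germ_res C (ide C X) S \<longleftrightarrow> (f, p) \<in> S" for f p
  proof (cases "f \<in> Ar C \<and> tgt C f = X")
    case False
    then show ?thesis using g(1,2)[of f p] X(1) by (auto simp: germ_res_def)
  qed (use X(1) in \<open>simp add: germ_res_def\<close>)
  then show "germ_res C (ide C X) S = S" by auto
next
  fix m n S assume "m \<in> Ar C" "n \<in> Ar C" "tgt C m = src C n" "tgt C n \<in> Ob C" "S \<in> germs C J P (tgt C n)"
  then show "germ_res C (cmp C n m) S = germ_res C m (germ_res C n S)"
    by (auto simp: germ_res_def assoc)
qed (rule germ_res_germs)

text \<open>An inclusion, to be used in both directions. A pair of \<open>S\<close> is restricted to
  the covering sieve of arrows carrying it into \<open>R\<close>; there it lies in \<open>T\<close>,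
  and saturation of \<open>T\<close> brings it back.\<close>

lemma germs_eqI:
  assumes S: "S \<in> germs C J P X" and T: "T \<in> germs C J P X" and R: "R \<in> J X"
    "\<And>m f p. m \<in> R \<Longrightarrow> f \<in> Ar C \<Longrightarrow> tgt C f = src C m \<Longrightarrow> (cmp C m f, p) \<in> S \<Longrightarrow> (cmp C m f, p) \<in> T"
  shows "S \<subseteq> T"
proof clarify
  fix f p assume f: "(f, p) \<in> S"
  note g = germsD[OF S]
  show "(f, p) \<in> T"
  proof (rule germsD(5)[OF T g(1-3)[OF f]])
    show "sieve_pull C R f \<in> J (src C f)" using pull_cover[OF R(1)] g(1,2)[OF f] by simp
    fix h assume h: "h \<in> sieve_pull C R f"
    then have "(cmp C f h, res P h p) \<in> S" using g(4)[OF f] by (simp add: sieve_pull_def)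
    then show "(cmp C f h, res P h p) \<in> T"
      using R(2)[of "cmp C f h" "ide C (src C h)"] g(1)[OF f] h by (simp add: sieve_pull_def)
  qed
qed

lemma germ_psh_glues: "glues C J (germ_psh C J P)"
proof (rule gluesI[OF germ_psh_presheaf])
  fix X R assume R: "R \<in> J X" "X \<in> Ob C"
  note s = sieveD[OF cover_sieve[OF R(1)]]
  show "S = T" if S: "S \<in> sec (germ_psh C J P) X" and T: "T \<in> sec (germ_psh C J P) X"
    and e: "\<And>m. m \<in> R \<Longrightarrow> res (germ_psh C J P) m S = res (germ_psh C J P) m T" for S T
  proof -
    have ST: "S \<in> germs C J P X" "T \<in> germs C J P X" using S T R by simp_all
    have e': "(cmp C m f, p) \<in> S \<longleftrightarrow> (cmp C m f, p) \<in> T" if "m \<in> R" "f \<in> Ar C" "tgt C f = src C m" for m f p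
    proof -
      have "germ_res C m S = germ_res C m T" using e[OF that(1)] s[OF that(1)] ST by simp
      then show ?thesis using that by (auto simp: germ_res_def set_eq_iff)
    qed
    show ?thesis by (intro equalityI germs_eqI[OF ST(1,2) R(1)] germs_eqI[OF ST(2,1) R(1)]) (simp_all add: e')
  qed
  fix t assume "\<And>m. m \<in> R \<Longrightarrow> t m \<in> sec (germ_psh C J P) (src C m)"
    and "\<And>m g. m \<in> R \<Longrightarrow> g \<in> Ar C \<Longrightarrow> tgt C g = src C m \<Longrightarrow> t (cmp C m g) = res (germ_psh C J P) g (t m)"
  then have t: "t m \<in> germs C J P (src C m)" and
    tr: "g \<in> Ar C \<Longrightarrow> tgt C g = src C m \<Longrightarrow> t (cmp C m g) = germ_res C g (t m)" if "m \<in> R" for m g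
    using that s by auto
  \<comment> \<open>A pair \<open>(ide C Y, p)\<close> in a germ over \<open>Y\<close> says that
    \<open>p\<close> represents that germ on all of \<open>Y\<close>. So \<open>(f, p)\<close> is
    put into \<open>S\<close> when \<open>p\<close> represents the prescribed germ after every
    \<open>g\<close> that carries \<open>f\<close> into \<open>R\<close>.\<close>
  define S where "S = {(f, p). f \<in> Ar C \<and> tgt C f = X \<and> p \<in> sec P (src C f) \<and>
    (\<forall>g\<in>sieve_pull C R f. (ide C (src C g), res P g p) \<in> t (cmp C f g))}"
  \<comment> \<open>On members of \<open>R\<close> the set \<open>S\<close> restricts to the given
    germs. This translates the required clauses for \<open>S\<close> into those for
    \<open>t m\<close>.\<close>
  have tS: "(cmp C m f, p) \<in> S \<longleftrightarrow> (f, p) \<in> t m" if m: "m \<in> R" and f: "f \<in> Ar C" "tgt C f = src C m" for m f p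
  proof
    assume p: "(f, p) \<in> t m"
    have "(ide C (src C g), res P g p) \<in> t (cmp C (cmp C m f) g)" if g: "g \<in> Ar C" "tgt C g = src C f" for g
      using germsD(4)[OF t[OF m] p g] tr[OF m, of "cmp C f g"] m f g s by (simp add: germ_res_def assoc)
    then show "(cmp C m f, p) \<in> S"
      using m f s germsD(3)[OF t[OF m] p] by (auto simp: S_def sieve_pull_def)
  next
    assume "(cmp C m f, p) \<in> S"
    then have p: "p \<in> sec P (src C f)" and "\<forall>g\<in>sieve_pull C R (cmp C m f). (ide C (src C g), res P g p) \<in> t (cmp C (cmp C m f) g)"
      using m f s by (auto simp: S_def)
    moreover have "ide C (src C f) \<in> sieve_pull C R (cmp C m f)"
      using m f s by (auto simp: sieve_pull_def)
    ultimately have "(ide C (src C f), p) \<in> t (cmp C m f)" using m f s by fastforce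
    then show "(f, p) \<in> t m" using tr[OF m f] f by (simp add: germ_res_def)
  qed
  have pull: "cmp C f g \<in> R" "g \<in> Ar C" "tgt C g = src C f" if "g \<in> sieve_pull C R f" for f g
    using that by (simp_all add: sieve_pull_def)
  have Sd: "f \<in> Ar C" "tgt C f = X" "p \<in> sec P (src C f)"
    "\<And>g. g \<in> sieve_pull C R f \<Longrightarrow> (cmp C f g, res P g p) \<in> S" if f: "(f, p) \<in> S" for f p
  proof -
    show f': "f \<in> Ar C" "tgt C f = X" "p \<in> sec P (src C f)" using f by (auto simp: S_def)
    fix g assume g: "g \<in> sieve_pull C R f"
    have "(ide C (src C g), res P g p) \<in> t (cmp C f g)" using f g by (auto simp: S_def)
    then show "(cmp C f g, res P g p) \<in> S"
      using tS[OF pull(1)[OF g], of "ide C (src C g)" "res P g p"] pull[OF g] f' by simp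
  qed
  \<comment> \<open>Saturation of \<open>S\<close>: over each \<open>g\<close> carrying
    \<open>f\<close> into \<open>R\<close>, the sieve \<open>T\<close> is pulled back along
    \<open>g\<close> and saturation of the germ \<open>t (cmp C f g)\<close> applies.\<close>
  have Si: "(f, p) \<in> S" if f: "f \<in> Ar C" "tgt C f = X" "p \<in> sec P (src C f)"
    and T: "T \<in> J (src C f)" "\<And>g. g \<in> T \<Longrightarrow> (cmp C f g, res P g p) \<in> S" for f p T
  proof -
    have "(ide C (src C g), res P g p) \<in> t (cmp C f g)" if g: "g \<in> sieve_pull C R f" for g
    proof -
      note pg = pull[OF g]
      show ?thesis
      proof (rule germsD(5)[OF t[OF pg(1)], of _ _ "sieve_pull C T g"])
        show "sieve_pull C T g \<in> J (src C (ide C (src C g)))" using pull_cover[OF T(1)] pg by simp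
        fix h assume h: "h \<in> sieve_pull C T g"
        then have h': "h \<in> Ar C" "tgt C h = src C g" "(cmp C f (cmp C g h), res P (cmp C g h) p) \<in> S"
          using T(2) by (auto simp: sieve_pull_def)
        then have "(cmp C (cmp C f g) h, res P h (res P g p)) \<in> S" using f pg by (simp add: assoc)
        then show "(cmp C (ide C (src C g)) h, res P h (res P g p)) \<in> t (cmp C f g)"
          using tS[OF pg(1)] h' pg f by simp
      qed (use pg f in auto)
    qed
    then show ?thesis using f by (simp add: S_def)
  qed
  have Sr: "(cmp C f g, res P g p) \<in> S" if f: "(f, p) \<in> S" and g: "g \<in> Ar C" "tgt C g = src C f" for f p g
  proof -
    note d = Sd[OF f]
    show ?thesis
    proof (rule Si)
      show "sieve_pull C R (cmp C f g) \<in> J (src C (cmp C f g))"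
        using pull_cover[OF R(1), of "cmp C f g"] d g by simp
      fix h assume "h \<in> sieve_pull C R (cmp C f g)"
      then have h: "h \<in> Ar C" "tgt C h = src C g" "cmp C (cmp C f g) h \<in> R" using d g by (auto simp: sieve_pull_def)
      then have "cmp C g h \<in> sieve_pull C R f" using d g by (simp add: sieve_pull_def assoc)
      then show "(cmp C (cmp C f g) h, res P h (res P g p)) \<in> S" using d(4) d(1-3) h g by (fastforce simp: assoc)
    qed (use d g in auto)
  qed
  have S: "S \<in> germs C J P X" unfolding germs_def mem_Collect_eq
  proof (intro conjI allI impI; (elim conjE)?)
    fix f p assume f: "(f, p) \<in> S"
    note d = Sd[OF f]
    show "f \<in> Ar C" "tgt C f = X" "p \<in> sec P (src C f)" by (fact d)+
    have pc: "sieve_pull C R f \<in> J (src C f)" using pull_cover[OF R(1)] d by simp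
    show "(cmp C f g, res P g p) \<in> S" if "g \<in> Ar C" "tgt C g = src C f" for g by (rule Sr[OF f that])
    show "agreement C P (src C f) p q \<in> J (src C f)" if q: "(f, q) \<in> S" for q
    proof (rule local_cover[OF pc sieve_agreement[OF P d(3) Sd(3)[OF q]]])
      fix g assume g: "g \<in> sieve_pull C R f"
      note pg = pull[OF g]
      have "(ide C (src C g), res P g p) \<in> t (cmp C f g)" "(ide C (src C g), res P g q) \<in> t (cmp C f g)"
        using f q g by (auto simp: S_def)
      then have "agreement C P (src C g) (res P g p) (res P g q) \<in> J (src C g)"
        using germsD(6)[OF t[OF pg(1)]] pg by fastforce
      then show "\<exists>T\<in>J (src C g). \<forall>h\<in>T. cmp C g h \<in> agreement C P (src C f) p q"
        by (rule bexI[rotated]) (use pg d Sd(3)[OF q] in \<open>auto simp: agreement_def\<close>)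
    qed
  next
    show "(f, p) \<in> S" if "f \<in> Ar C" "tgt C f = X" "p \<in> sec P (src C f)" "T \<in> J (src C f)"
      "\<forall>g\<in>T. (cmp C f g, res P g p) \<in> S" for f p T using Si that by blast
    show "{f. \<exists>p. (f, p) \<in> S} \<in> J X"
    proof (rule local_cover[OF R(1)])
      show "sieve C X {f. \<exists>p. (f, p) \<in> S}" unfolding sieve_def using Sd(1,2) Sr by blast
      fix m assume m: "m \<in> R" "m \<in> Ar C" "tgt C m = X"
      show "\<exists>T\<in>J (src C m). \<forall>g\<in>T. cmp C m g \<in> {f. \<exists>p. (f, p) \<in> S}"
        by (rule bexI[OF _ germsD(7)[OF t[OF m(1)]]])
          (use tS[OF m(1)] germsD(1,2)[OF t[OF m(1)]] in blast)
    qed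
  qed
  show "\<exists>S\<in>sec (germ_psh C J P) X. \<forall>m\<in>R. res (germ_psh C J P) m S = t m"
  proof (intro bexI ballI)
    fix m assume m: "m \<in> R"
    have "germ_res C m S = t m"
      using tS[OF m] germsD(1,2)[OF t[OF m]] by (fastforce simp: germ_res_def)
    then show "res (germ_psh C J P) m S = t m" using S s[OF m] by simp
  qed (use S R in simp)
qed

lemma germ_unit_germs:
  assumes X: "X \<in> Ob C" "p \<in> sec P X" shows "germ_unit C J P X p \<in> germs C J P X"
proof -
  have closed: "(cmp C f g, res P g q) \<in> germ_unit C J P X p"
    if "(f, q) \<in> germ_unit C J P X p" "g \<in> Ar C" "tgt C g = src C f" for f q g
    using that X agreement_res[of g q "res P f p"] by (auto simp: germ_unit_def)
  have all: "(f, res P f p) \<in> germ_unit C J P X p" if "f \<in> Ar C" "tgt C f = X" for f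
    using X that agreement_refl by (simp add: germ_unit_def)
  show ?thesis unfolding germs_def mem_Collect_eq
  proof (intro conjI allI impI; (elim conjE)?)
    fix f q assume f: "(f, q) \<in> germ_unit C J P X p"
    then show "f \<in> Ar C" "tgt C f = X" "q \<in> sec P (src C f)" by (auto simp: germ_unit_def)
    show "agreement C P (src C f) q r \<in> J (src C f)" if "(f, r) \<in> germ_unit C J P X p" for r
      using f that X agreement_trans[of "src C f" q "res P f p" r] agreement_sym[of "src C f" r "res P f p"]
      by (auto simp: germ_unit_def)
  next
    fix f q R assume f: "f \<in> Ar C" "tgt C f = X" "q \<in> sec P (src C f)" "R \<in> J (src C f)"
      "\<forall>g\<in>R. (cmp C f g, res P g q) \<in> germ_unit C J P X p"
    have "agreement C P (src C f) q (res P f p) \<in> J (src C f)"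
    proof (rule local_cover[OF f(4) sieve_agreement[OF P]])
      fix g assume g: "g \<in> R" "g \<in> Ar C" "tgt C g = src C f"
      then have "agreement C P (src C g) (res P g q) (res P g (res P f p)) \<in> J (src C g)"
        using f X by (auto simp: germ_unit_def)
      then show "\<exists>T\<in>J (src C g). \<forall>h\<in>T. cmp C g h \<in> agreement C P (src C f) q (res P f p)"
        by (rule bexI[rotated]) (use g f X in \<open>auto simp: agreement_def\<close>)
    qed (use f X in auto)
    then show "(f, q) \<in> germ_unit C J P X p" using f by (simp add: germ_unit_def)
  next
    have "{f. \<exists>q. (f, q) \<in> germ_unit C J P X p} = {m \<in> Ar C. tgt C m = X}"
      using all by (auto simp: germ_unit_def)
    then show "{f. \<exists>q. (f, q) \<in> germ_unit C J P X p} \<in> J X" using max_cover X by simp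
  qed (use closed in blast)
qed

text \<open>So \<open>(f, p) \<in> S\<close> means that \<open>p\<close> represents the restriction
  of \<open>S\<close> along \<open>f\<close>. One inclusion is local agreement of representatives,
  the other is saturation; naturality and local surjectivity of the unit both come from this
  equality.\<close>

lemma germ_res_unit:
  assumes S: "S \<in> germs C J P (tgt C f)" and f: "(f, p) \<in> S"
  shows "germ_res C f S = germ_unit C J P (src C f) p"
proof -
  note d = germsD[OF S]
  note df = d(1-3)[OF f]
  have "(cmp C f g, q) \<in> S \<longleftrightarrow> q \<in> sec P (src C g) \<and> agreement C P (src C g) q (res P g p) \<in> J (src C g)"
    if g: "g \<in> Ar C" "tgt C g = src C f" for g q
  proof (intro iffI conjI)
    assume "(cmp C f g, q) \<in> S"
    then show "q \<in> sec P (src C g)" "agreement C P (src C g) q (res P g p) \<in> J (src C g)"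
      using d(3)[of "cmp C f g" q] d(6)[OF _ d(4)[OF f g], of q] df g by auto
  next
    assume q: "q \<in> sec P (src C g) \<and> agreement C P (src C g) q (res P g p) \<in> J (src C g)"
    show "(cmp C f g, q) \<in> S"
    proof (rule d(5))
      show "agreement C P (src C g) q (res P g p) \<in> J (src C (cmp C f g))" using q df g by simp
      fix h assume "h \<in> agreement C P (src C g) q (res P g p)"
      then have h: "h \<in> Ar C" "tgt C h = src C g" "res P h q = res P h (res P g p)" by (auto simp: agreement_def)
      show "(cmp C (cmp C f g) h, res P h q) \<in> S"
        using d(4)[OF f, of "cmp C g h"] df g h by (simp add: assoc)
    qed (use q df g in auto)
  qed
  then show ?thesis by (auto simp: germ_res_def germ_unit_def)
qed

text \<open>Local injectivity is read off from the pair at the identity arrow. For local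
  surjectivity, the arrows along which \<open>S\<close> comes from \<open>P\<close> are exactly
  those occurring in \<open>S\<close>, and these cover by definition of a germ.\<close>

lemma germ_unit_loc_bij:
  "loc_bij C J P (germ_psh C J P) (\<lambda>X\<in>Ob C. \<lambda>p\<in>sec P X. germ_unit C J P X p)"
  unfolding loc_bij_def
proof (intro conjI ballI impI)
  have self: "(ide C X, p) \<in> germ_unit C J P X p" if "X \<in> Ob C" "p \<in> sec P X" for X p
    using that agreement_refl by (simp add: germ_unit_def)
  show "psh_mor C P (germ_psh C J P) (\<lambda>X\<in>Ob C. \<lambda>p\<in>sec P X. germ_unit C J P X p)"
  proof (rule psh_morI)
    fix m p assume m: "m \<in> Ar C" "src C m \<in> Ob C" "tgt C m \<in> Ob C" "p \<in> sec P (tgt C m)"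
    have "(m, res P m p) \<in> germ_unit C J P (tgt C m) p"
      using m agreement_refl by (simp add: germ_unit_def)
    then show "res P m p \<in> sec P (src C m) \<and>
      germ_unit C J P (src C m) (res P m p) = res (germ_psh C J P) m (germ_unit C J P (tgt C m) p)"
      using germ_res_unit[OF germ_unit_germs] m germ_unit_germs by simp
  qed (use germ_unit_germs cat in auto)
  fix X assume X: "X \<in> Ob C"
  show "agreement C P X p q \<in> J X" if p: "p \<in> sec P X" "q \<in> sec P X"
    "(\<lambda>X\<in>Ob C. \<lambda>p\<in>sec P X. germ_unit C J P X p) X p = (\<lambda>X\<in>Ob C. \<lambda>p\<in>sec P X. germ_unit C J P X p) X q" for p q
  proof -
    have "(ide C X, p) \<in> germ_unit C J P X q" using self[OF X p(1)] p X by simp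
    then show ?thesis using X p by (simp add: germ_unit_def)
  qed
  fix S assume "S \<in> sec (germ_psh C J P) X"
  then have S: "S \<in> germs C J P X" using X by simp
  have "{m \<in> Ar C. tgt C m = X \<and> (\<exists>p\<in>sec P (src C m).
      (\<lambda>X\<in>Ob C. \<lambda>p\<in>sec P X. germ_unit C J P X p) (src C m) p = res (germ_psh C J P) m S)} = {f. \<exists>p. (f, p) \<in> S}"
  proof (intro Collect_cong iffI)
    fix f assume "\<exists>p. (f, p) \<in> S"
    then obtain p where f: "(f, p) \<in> S" ..
    show "f \<in> Ar C \<and> tgt C f = X \<and> (\<exists>p\<in>sec P (src C f).
      (\<lambda>X\<in>Ob C. \<lambda>p\<in>sec P X. germ_unit C J P X p) (src C f) p = res (germ_psh C J P) f S)"
      using germsD(1-3)[OF S f] germ_res_unit[of S f p] S f by (intro conjI bexI[of _ p]) auto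
  next
    fix f assume "f \<in> Ar C \<and> tgt C f = X \<and> (\<exists>p\<in>sec P (src C f).
      (\<lambda>X\<in>Ob C. \<lambda>p\<in>sec P X. germ_unit C J P X p) (src C f) p = res (germ_psh C J P) f S)"
    then obtain p where f: "f \<in> Ar C" "tgt C f = X" "p \<in> sec P (src C f)"
      "germ_unit C J P (src C f) p = res (germ_psh C J P) f S" by auto
    then have "(ide C (src C f), p) \<in> germ_res C f S" using self[of "src C f" p] S by simp
    then show "\<exists>p. (f, p) \<in> S" using f by (auto simp: germ_res_def)
  qed
  then show "{m \<in> Ar C. tgt C m = X \<and> (\<exists>p\<in>sec P (src C m).
      (\<lambda>X\<in>Ob C. \<lambda>p\<in>sec P X. germ_unit C J P X p) (src C m) p = res (germ_psh C J P) m S)} \<in> J X"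
    using germsD(7)[OF S] by simp
qed

text \<open>A germ is determined by its pairs \<open>(f, p)\<close> with the source of
  \<open>f\<close> in the generating set \<open>G\<close>: any other source is covered from
  \<open>G\<close>, and saturation recovers the pair. Germs over \<open>X\<close> thus embed into
  the subsets of one small set.\<close>

lemma germs_small:
  assumes u: "universe el" and G: "U_small el G" "G \<subseteq> Ob C"
    "\<And>X. X \<in> Ob C \<Longrightarrow> \<exists>S. covering_family C J X S \<and> src C ` S \<subseteq> G"
    and hom: "\<And>X Y. X \<in> Ob C \<Longrightarrow> Y \<in> Ob C \<Longrightarrow> U_small el (hom C X Y)"
    and sm: "\<And>X. X \<in> Ob C \<Longrightarrow> U_small el (sec P X)" and X: "X \<in> Ob C"
  shows "U_small el (germs C J P X)"
proof -
  define D where "D = (SIGMA f : (\<Union>g\<in>G. hom C g X). sec P (src C f))"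
  have "U_small el D" unfolding D_def
    by (intro U_small_Sigma U_small_UN u G(1)) (use G(2) hom X sm in \<open>auto simp: hom_iff\<close>)
  moreover have "inj_on (\<lambda>S. S \<inter> D) (germs C J P X)"
  proof -
    have "S \<subseteq> T" if S: "S \<in> germs C J P X" and T: "T \<in> germs C J P X" and e: "S \<inter> D = T \<inter> D" for S T
    proof clarify
      fix f p assume f: "(f, p) \<in> S"
      note d = germsD(1-3)[OF S f]
      obtain K where K: "covering_family C J (src C f) K" "src C ` K \<subseteq> G"
        using G(3)[OF c_simps(1)[OF d(1)]] by blast
      have *: "(cmp C f m, res P m p) \<in> T" if "m \<in> K" for m
      proof -
        have m: "m \<in> Ar C" "tgt C m = src C f" using K that by (auto simp: covering_family_def)
        then have "(cmp C f m, res P m p) \<in> S \<inter> D"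
          using germsD(4)[OF S f] d K(2) that by (fastforce simp: D_def hom_iff)
        then show ?thesis using e by blast
      qed
      show "(f, p) \<in> T"
      proof (rule germsD(5)[OF T d])
        show "{cmp C m g | m g. m \<in> K \<and> g \<in> Ar C \<and> tgt C g = src C m} \<in> J (src C f)"
          using K by (simp add: covering_family_def)
        fix h assume "h \<in> {cmp C m g | m g. m \<in> K \<and> g \<in> Ar C \<and> tgt C g = src C m}"
        then obtain m g where h: "h = cmp C m g" "m \<in> K" "g \<in> Ar C" "tgt C g = src C m" by blast
        moreover have "m \<in> Ar C" "tgt C m = src C f" using K h by (auto simp: covering_family_def)
        ultimately show "(cmp C f h, res P h p) \<in> T"
          using germsD(4)[OF T *[OF h(2)], of g] d by (simp add: assoc)
      qed
    qed
    then show ?thesis unfolding inj_on_def by blast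
  qed
  ultimately show ?thesis
    using U_small_inj[OF u U_small_Pow[OF u], of D "\<lambda>S. S \<inter> D" "germs C J P X"] by blast
qed

end

lemma U_site_site: "U_site el C J \<Longrightarrow> site C J"
  by (simp add: U_site_def site_def)

theorem associated_sheaf_exists:
  fixes P :: "('o, 'm, 's) psh" and el :: "'u \<Rightarrow> 'u set"
  assumes u: "universe el" and C: "U_site el C J" and P: "presheaf C P"
    and sm: "\<And>X. X \<in> Ob C \<Longrightarrow> U_small el (sec P X)"
  obtains A :: "('o, 'm, 'u) psh" and \<eta> where "sheaf el C J A" "loc_bij C J P A \<eta>"
proof -
  interpret site C J by (rule U_site_site[OF C])
  interpret site_presheaf C J P by unfold_locales (rule P)
  obtain G where G: "G \<subseteq> Ob C" "U_small el G"
    "\<forall>X\<in>Ob C. \<exists>S. covering_family C J X S \<and> src C ` S \<subseteq> G" using C unfolding U_site_def by blast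
  have small: "U_small el (sec (germ_psh C J P) X)" if "X \<in> Ob C" for X
    using germs_small[OF u G(2,1) _ _ sm that] G(3) C that by (simp add: U_site_def)
  obtain A :: "('o, 'm, 'u) psh" and h where A: "presheaf C A" "\<And>X. X \<in> Ob C \<Longrightarrow> sec A X \<in> range el"
    "psh_mor C (germ_psh C J P) A h" "\<And>X. X \<in> Ob C \<Longrightarrow> bij_betw (h X) (sec (germ_psh C J P) X) (sec A X)"
    using upresheaf_transport[OF cat germ_psh_presheaf small] by blast
  have "sheaf el C J A"
    using glues_iso[OF germ_psh_glues A(1,3,4)] A(2) by (simp add: sheaf_iff_glues)
  then show thesis
    by (rule that[OF _ loc_bij_comp_iso[OF P germ_psh_presheaf germ_unit_loc_bij A(3,4)]])
qed

text \<open>The universal property says nothing directly about sieves. It does give an isomorphism,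
  compatible with the units, with the sheaf of germs, and local bijectivity is carried along
  it.\<close>

lemma is_assoc_sheaf_loc_bij:
  fixes P :: "('o, 'm, 's) psh" and el :: "'u \<Rightarrow> 'u set"
  assumes u: "universe el" and C: "U_site el C J" and P: "presheaf C P"
    and sm: "\<And>X. X \<in> Ob C \<Longrightarrow> U_small el (sec P X)" and A: "is_assoc_sheaf el C J P A \<eta>"
  shows "loc_bij C J P A \<eta>"
proof -
  interpret site C J by (rule U_site_site[OF C])
  obtain B :: "('o, 'm, 'u) psh" and \<theta> where B: "sheaf el C J B" "loc_bij C J P B \<theta>"
    using associated_sheaf_exists[OF u C P sm] by blast
  have B': "is_assoc_sheaf el C J P B \<theta>" by (rule loc_bij_is_assoc_sheaf[OF cat top B(2) P B(1)])
  have Bp: "presheaf C B" and Ap: "presheaf C A" and As: "sheaf el C J A"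
    using B(1) A by (auto simp: sheaf_iff_glues glues_presheaf is_assoc_sheaf_def)
  note e = psh_mor_simps[of C P A \<eta>] and t = psh_mor_simps[OF loc_bijD(1)[OF B(2)]]
  have e0: "psh_mor C P A \<eta>" using A by (simp add: is_assoc_sheaf_def)
  obtain \<phi> where ph: "psh_mor C B A \<phi>" "\<forall>X\<in>Ob C. \<forall>x\<in>sec P X. \<phi> X (\<theta> X x) = \<eta> X x"
    using B' As e0 unfolding is_assoc_sheaf_def by blast
  obtain \<psi> where ps: "psh_mor C A B \<psi>" "\<forall>X\<in>Ob C. \<forall>x\<in>sec P X. \<psi> X (\<eta> X x) = \<theta> X x"
    using A B(1) loc_bijD(1)[OF B(2)] unfolding is_assoc_sheaf_def by blast
  have unique: "\<alpha> = \<beta>" if "is_assoc_sheaf el C J P D \<delta>" "psh_mor C D D \<alpha>" "psh_mor C D D \<beta>"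
    "\<forall>X\<in>Ob C. \<forall>x\<in>sec P X. \<alpha> X (\<delta> X x) = \<delta> X x" "\<forall>X\<in>Ob C. \<forall>x\<in>sec P X. \<beta> X (\<delta> X x) = \<delta> X x" for D \<delta> \<alpha> \<beta>
  proof -
    have "\<exists>!\<phi>. psh_mor C D D \<phi> \<and> (\<forall>X\<in>Ob C. \<forall>x\<in>sec P X. \<phi> X (\<delta> X x) = \<delta> X x)"
      using that(1) unfolding is_assoc_sheaf_def by blast
    then show ?thesis using that by blast
  qed
  have 1: "(\<lambda>X\<in>Ob C. \<lambda>x\<in>sec B X. \<psi> X (\<phi> X x)) = (\<lambda>X\<in>Ob C. \<lambda>x\<in>sec B X. x)"
    by (rule unique[OF B' psh_mor_comp[OF cat Bp ph(1) ps(1)] psh_mor_id[OF cat Bp]])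
      (use t ph ps in auto)
  have 2: "(\<lambda>X\<in>Ob C. \<lambda>x\<in>sec A X. \<phi> X (\<psi> X x)) = (\<lambda>X\<in>Ob C. \<lambda>x\<in>sec A X. x)"
    by (rule unique[OF A psh_mor_comp[OF cat Ap ps(1) ph(1)] psh_mor_id[OF cat Ap]])
      (use e(1)[OF e0] ph ps in auto)
  have "bij_betw (\<phi> X) (sec B X) (sec A X)" if X: "X \<in> Ob C" for X
  proof (rule bij_betw_byWitness[of _ "\<psi> X"])
    show "\<forall>a\<in>sec B X. \<psi> X (\<phi> X a) = a" "\<forall>a\<in>sec A X. \<phi> X (\<psi> X a) = a"
      using fun_cong[OF 1, of X] fun_cong[OF 2, of X] X by (simp_all add: restrict_def fun_eq_iff) metis+
  qed (use psh_mor_simps(1)[OF ph(1) X] psh_mor_simps(1)[OF ps(1) X] in auto)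
  then have "loc_bij C J P A (\<lambda>X\<in>Ob C. \<lambda>p\<in>sec P X. \<phi> X (\<theta> X p))"
    by (rule loc_bij_comp_iso[OF P Bp B(2) ph(1)])
  moreover have "(\<lambda>X\<in>Ob C. \<lambda>p\<in>sec P X. \<phi> X (\<theta> X p)) = \<eta>"
    by (rule psh_mor_ext[OF psh_mor_comp[OF cat P loc_bijD(1)[OF B(2)] ph(1)] e0]) (use ph in simp)
  ultimately show ?thesis by simp
qed

lemma presheaf_represented: "category C \<Longrightarrow> presheaf C (represented C V)"
  unfolding represented_def by (rule presheafI) (auto simp: hom_iff cmp_assoc)

lemma represented_simps [simp]:
  "W \<in> Ob C \<Longrightarrow> sec (represented C V) W = hom C W V"
  "m \<in> Ar C \<Longrightarrow> w \<in> hom C (tgt C m) V \<Longrightarrow> res (represented C V) m w = cmp C w m"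
  by (simp_all add: represented_def)

lemma
  fixes el :: "'u \<Rightarrow> 'u set"
  assumes "universe el" "U_site el C J" "V \<in> Ob C"
  shows eps_is_assoc_sheaf: "is_assoc_sheaf el C J (represented C V) (eps el C J V) (eps_unit el C J V)" (is ?a)
    and eps_sheaf: "sheaf el C J (eps el C J V)"
    and eps_loc_bij: "loc_bij C J (represented C V) (eps el C J V) (eps_unit el C J V)"
proof -
  have C: "category C" "topology C J" and sm: "\<And>X. X \<in> Ob C \<Longrightarrow> U_small el (sec (represented C V) X)"
    using assms(2,3) by (simp_all add: U_site_def)
  note P = presheaf_represented[OF C(1)]
  obtain A :: "('a, 'b, 'u) psh" and \<eta> where "is_assoc_sheaf el C J (represented C V) A \<eta>"
    using associated_sheaf_exists[OF assms(1,2) P sm] loc_bij_is_assoc_sheaf[OF C _ P] by metis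
  then have "\<exists>z :: ('a, 'b, 'u) psh \<times> _. case z of (A, \<eta>) \<Rightarrow> is_assoc_sheaf el C J (represented C V) A \<eta>"
    by auto
  then have "case assoc_sheaf el C J (represented C V) :: ('a, 'b, 'u) psh \<times> _ of (A, \<eta>) \<Rightarrow>
      is_assoc_sheaf el C J (represented C V) A \<eta>"
    unfolding assoc_sheaf_def by (rule someI_ex)
  then show ?a by (simp add: eps_def eps_unit_def case_prod_beta)
  then show "sheaf el C J (eps el C J V)" by (simp add: is_assoc_sheaf_def)
  show "loc_bij C J (represented C V) (eps el C J V) (eps_unit el C J V)"
    by (rule is_assoc_sheaf_loc_bij[OF assms(1,2) P sm \<open>?a\<close>])
qed

lemma U_small_finite: assumes "universe el" "finite A" shows "U_small el A"
proof -
  have "\<exists>x. infinite (el x)" using assms(1) by (simp add: universe_def)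
  then obtain x where x: "infinite (el x)" ..
  obtain B where B: "finite B" "card B = card A" "B \<subseteq> el x"
    using infinite_arbitrarily_large[OF x, of "card A"] by blast
  obtain f where f: "bij_betw f A B" using finite_same_card_bij[OF assms(2) B(1)] B(2) by auto
  show ?thesis
  proof (rule U_small_inj[OF assms(1) U_small_range_el])
    show "el x \<in> range el" by simp
    show "inj_on f A" "f ` A \<subseteq> el x" using f B(3) by (auto simp: bij_betw_def)
  qed
qed

subsection \<open>Covering sieves are detected by sheaves\<close>

text \<open>A converse of \<open>glues_separated\<close>. It is isolated from \<open>U_site\<close>
  so that it can be passed on to induced topologies.\<close>

definition detecting :: "('u \<Rightarrow> 'u set) \<Rightarrow> ('o, 'm) cat \<Rightarrow> ('o \<Rightarrow> 'm set set) \<Rightarrow> bool" where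
  "detecting el C J \<longleftrightarrow> (\<forall>X\<in>Ob C. \<forall>R. sieve C X R \<and>
     (\<forall>F. sheaf el C J F \<longrightarrow> (\<forall>x\<in>sec F X. \<forall>y\<in>sec F X. (\<forall>m\<in>R. res F m x = res F m y) \<longrightarrow> x = y)) \<longrightarrow> R \<in> J X)"

text \<open>Apply the separation hypothesis to the sheaf associated to the presheaf obtained by gluing two
  copies of \<open>X\<close> along the sieve \<open>R\<close>.\<close>

lemma U_site_detecting:
  fixes el :: "'u \<Rightarrow> 'u set" and C :: "('o, 'm) cat"
  assumes u: "universe el" and C: "U_site el C J" shows "detecting el C J"
  unfolding detecting_def
proof (intro ballI allI impI, elim conjE)
  interpret site C J by (rule U_site_site[OF C])
  fix X R assume X: "X \<in> Ob C" and R: "sieve C X R"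
    and sep: "\<forall>F. sheaf el C J F \<longrightarrow> (\<forall>x\<in>sec F X. \<forall>y\<in>sec F X. (\<forall>m\<in>R. res F m x = res F m y) \<longrightarrow> x = y)"
  note s = sieveD[OF R]
  define S where "S Y = {(g, b). g \<in> hom C Y X \<and> (g \<in> R \<longrightarrow> b)}" for Y
  define P where "P = \<lparr>sec = \<lambda>Y\<in>Ob C. S Y,
    res = \<lambda>m\<in>Ar C. \<lambda>z\<in>S (tgt C m). (cmp C (fst z) m, snd z \<or> cmp C (fst z) m \<in> R)\<rparr>"
  have P: "presheaf C P" unfolding P_def
    by (rule presheafI[OF cat]) (auto simp: S_def hom_iff assoc s(3) simp flip: assoc)
  have "U_small el (sec P Y)" if Y: "Y \<in> Ob C" for Y
  proof (rule U_small_subset[OF u])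
    show "U_small el (hom C Y X \<times> (UNIV :: bool set))"
      by (rule U_small_Sigma[OF u _ U_small_finite[OF u]]) (use C X Y in \<open>simp_all add: U_site_def\<close>)
  qed (use Y in \<open>auto simp: P_def S_def\<close>)
  then obtain A :: "('o, 'm, 'u) psh" and \<eta> where A: "sheaf el C J A" and lb: "loc_bij C J P A \<eta>"
    using associated_sheaf_exists[OF u C P] by blast
  note e = psh_mor_simps[OF loc_bijD(1)[OF lb]]
  show "R \<in> J X"
  proof (cases "ide C X \<in> R")
    case True
    have "m \<in> R" if "m \<in> Ar C" "tgt C m = X" for m using s(3)[OF True that(1)] that X by simp
    then show ?thesis using superset_cover[OF max_cover[OF X] R] by blast
  next
    case False
    \<comment> \<open>Here both copies of the identity are sections over \<open>X\<close>. They
      agree only along arrows of \<open>R\<close>, so any covering sieve of agreement lies inside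
      \<open>R\<close>.\<close>
    let ?t = "(ide C X, True)" and ?f = "(ide C X, False)"
    have tf: "?t \<in> sec P X" "?f \<in> sec P X" using X False by (simp_all add: P_def S_def hom_iff)
    have r: "res P m (ide C X, b) = (m, b \<or> m \<in> R)" if "m \<in> Ar C" "tgt C m = X" for m b
      using that X False by (simp add: P_def S_def hom_iff)
    have "\<eta> X ?t = \<eta> X ?f"
    proof -
      have "res A m (\<eta> X ?t) = res A m (\<eta> X ?f)" if "m \<in> R" for m
        using e(2)[of m ?t] e(2)[of m ?f] s[OF that] tf r that by simp
      then show ?thesis using sep A e(1)[OF X] tf by blast
    qed
    then have "agreement C P X ?t ?f \<in> J X" using loc_bijD(2)[OF lb X tf] by blast
    moreover have "agreement C P X ?t ?f \<subseteq> R" using r by (auto simp: agreement_def)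
    ultimately show ?thesis by (rule superset_cover[OF _ R])
  qed
qed

section \<open>Induced topologies along discrete fibrations\<close>

lemma induced_topology_eq:
  assumes "is_induced_topology el C' C J u J'" shows "induced_topology el C' C J u = J'"
  unfolding induced_topology_def
proof (rule the_equality[where P = "is_induced_topology el C' C J u", OF assms])
  fix J'' assume "is_induced_topology el C' C J u J''"
  then have "J'' X = J' X" for X using assms unfolding is_induced_topology_def by (meson subset_antisym)
  then show "J'' = J'" ..
qed

lemma psh_pull_simps [simp]:
  "X \<in> Ob C' \<Longrightarrow> sec (psh_pull C' u F) X = sec F (fob u X)"
  "m \<in> Ar C' \<Longrightarrow> res (psh_pull C' u F) m = res F (far u m)"
  by (simp_all add: psh_pull_def)

lemma presheaf_psh_pull:
  assumes "is_functor C' C u" "presheaf C F" shows "presheaf C' (psh_pull C' u F)"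
proof -
  note f = functor_simps[OF assms(1)] and p = presheaf_simps[OF assms(2)]
  note c = category_simps[OF f(1)]
  have "res F (far u m) \<in> sec F (fob u (tgt C' m)) \<rightarrow>\<^sub>E sec F (fob u (src C' m))" if "m \<in> Ar C'" for m
    using assms(2) f(4-6)[OF that] unfolding presheaf_def by metis
  then show ?thesis
    unfolding presheaf_def using p f c by (auto simp: psh_pull_def)
qed

text \<open>Arrows into \<open>fob u X\<close> lift uniquely to arrows into \<open>X\<close>. Both
  \<open>slice_forget\<close> and \<open>fibre_to_slice\<close> have this property, so a single
  computation handles every induced topology in the definition of the fibred site over
  \<open>V\<close>.\<close>

definition discrete_fibration :: "('p, 'n) cat \<Rightarrow> ('o, 'm) cat \<Rightarrow> ('p, 'n, 'o, 'm) func \<Rightarrow> bool" where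
  "discrete_fibration C' C u \<longleftrightarrow> is_functor C' C u \<and>
     (\<forall>X\<in>Ob C'. bij_betw (far u) {m \<in> Ar C'. tgt C' m = X} {m \<in> Ar C. tgt C m = fob u X})"

text \<open>By unique lifting the image of a sieve is itself a sieve (\<open>image_sieve\<close>),
  so it can be compared with \<open>J\<close> directly.\<close>

definition lift_topology ::
    "('p, 'n) cat \<Rightarrow> ('o \<Rightarrow> 'm set set) \<Rightarrow> ('p, 'n, 'o, 'm) func \<Rightarrow> 'p \<Rightarrow> 'n set set" where
  "lift_topology C' J u X = {R. X \<in> Ob C' \<and> sieve C' X R \<and> far u ` R \<in> J (fob u X)}"

locale discrete_fibration_site = site C J for C :: "('o, 'm) cat" and J +
  fixes C' :: "('p, 'n) cat" and u
  assumes df: "discrete_fibration C' C u"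
begin

lemma u_functor: "is_functor C' C u" using df by (simp add: discrete_fibration_def)

lemmas u_simps [simp] = functor_simps[OF u_functor]
lemmas c'_simps [simp] = category_simps[OF functor_simps(1)[OF u_functor]]
lemmas assoc' = cmp_assoc[OF functor_simps(1)[OF u_functor]]

lemma lift_arrow:
  assumes "n \<in> Ar C" "tgt C n = fob u X" "X \<in> Ob C'"
  obtains m where "m \<in> Ar C'" "tgt C' m = X" "far u m = n"
proof -
  have "n \<in> far u ` {m \<in> Ar C'. tgt C' m = X}"
    using df assms unfolding discrete_fibration_def bij_betw_def by blast
  then show ?thesis using that by blast
qed

lemma far_eq_iff: "m \<in> Ar C' \<Longrightarrow> m' \<in> Ar C' \<Longrightarrow> tgt C' m = tgt C' m' \<Longrightarrow> far u m = far u m' \<longleftrightarrow> m = m'"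
  using df c'_simps(2) unfolding discrete_fibration_def bij_betw_def inj_on_def by blast

lemma mem_image_sieve:
  assumes "sieve C' X R" "m \<in> Ar C'" "tgt C' m = X" shows "far u m \<in> far u ` R \<longleftrightarrow> m \<in> R"
proof
  assume "far u m \<in> far u ` R"
  then obtain m' where "m' \<in> R" "far u m = far u m'" by blast
  then show "m \<in> R" using far_eq_iff[of m m'] sieveD(1,2)[OF assms(1)] assms by auto
qed (rule imageI)

lemma image_sieve:
  assumes "sieve C' X R" shows "sieve C (fob u X) (far u ` R)"
  unfolding sieve_def
proof (intro conjI ballI impI subsetI)
  note s = sieveD[OF assms]
  fix n assume "n \<in> far u ` R"
  then obtain m where m: "m \<in> R" "n = far u m" by blast
  then show "n \<in> {m \<in> Ar C. tgt C m = fob u X}" using s by simp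
  fix g assume g: "g \<in> Ar C" "tgt C g = src C n"
  obtain g' where g': "g' \<in> Ar C'" "tgt C' g' = src C' m" "far u g' = g"
    using lift_arrow[of g "src C' m"] g m s(1) by auto
  then have "cmp C n g = far u (cmp C' m g')" using m s(1) by simp
  then show "cmp C n g \<in> far u ` R" using s(3) m(1) g' by blast
qed

lemma image_sieve_pull:
  assumes R: "sieve C' X R" and f: "f \<in> Ar C'" "tgt C' f = X"
  shows "far u ` sieve_pull C' R f = sieve_pull C (far u ` R) (far u f)"
proof (intro equalityI subsetI)
  note s = sieveD[OF R]
  fix n assume "n \<in> far u ` sieve_pull C' R f"
  then obtain m where "m \<in> Ar C'" "tgt C' m = src C' f" "cmp C' f m \<in> R" "n = far u m"
    by (auto simp: sieve_pull_def)
  then show "n \<in> sieve_pull C (far u ` R) (far u f)"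
    using f by (auto simp: sieve_pull_def simp flip: u_simps(8) intro: imageI)
next
  fix n assume n: "n \<in> sieve_pull C (far u ` R) (far u f)"
  then have n': "n \<in> Ar C" "tgt C n = fob u (src C' f)" "cmp C (far u f) n \<in> far u ` R"
    using f by (auto simp: sieve_pull_def)
  obtain m where m: "m \<in> Ar C'" "tgt C' m = src C' f" "far u m = n"
    using lift_arrow[OF n'(1,2)] f by auto
  then have "far u (cmp C' f m) \<in> far u ` R" using n' f by simp
  moreover have "cmp C' f m \<in> Ar C'" "tgt C' (cmp C' f m) = X" using m f by simp_all
  ultimately have "cmp C' f m \<in> R" using mem_image_sieve[OF R] by blast
  then show "n \<in> far u ` sieve_pull C' R f" using m by (auto simp: sieve_pull_def)
qed

lemma topology_lift: "topology C' (lift_topology C' J u)"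
  unfolding topology_def
proof (intro conjI ballI allI impI; (elim conjE)?)
  fix X assume X: "X \<in> Ob C'"
  show "sieve C' X R" if "R \<in> lift_topology C' J u X" for R
    using that by (simp add: lift_topology_def)
  have "far u ` {m \<in> Ar C'. tgt C' m = X} = {m \<in> Ar C. tgt C m = fob u X}"
    using df X by (simp add: discrete_fibration_def bij_betw_def)
  then show "{m \<in> Ar C'. tgt C' m = X} \<in> lift_topology C' J u X"
    using X max_cover by (simp add: lift_topology_def sieve_def)
  show "sieve_pull C' R f \<in> lift_topology C' J u (src C' f)"
    if R: "R \<in> lift_topology C' J u X" and f: "f \<in> Ar C'" "tgt C' f = X" for R f
  proof -
    have s: "sieve C' X R" and J: "far u ` R \<in> J (fob u X)" using R by (simp_all add: lift_topology_def)
    have "sieve C' (src C' f) (sieve_pull C' R f)"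
      using s f unfolding sieve_def sieve_pull_def by (auto simp flip: assoc')
    then show ?thesis
      using pull_cover[OF J, of "far u f"] f by (simp add: lift_topology_def image_sieve_pull[OF s])
  qed
  show "R' \<in> lift_topology C' J u X" if R: "R \<in> lift_topology C' J u X" "sieve C' X R'"
    and loc: "\<forall>f\<in>R. sieve_pull C' R' f \<in> lift_topology C' J u (src C' f)" for R R'
  proof -
    have s: "sieve C' X R" and J: "far u ` R \<in> J (fob u X)" using R by (simp_all add: lift_topology_def)
    have "far u ` R' \<in> J (fob u X)"
    proof (rule trans_cover[OF J image_sieve[OF R(2)]])
      fix n assume "n \<in> far u ` R"
      then obtain f where f: "f \<in> R" "n = far u f" by blast
      then have "far u ` sieve_pull C' R' f \<in> J (fob u (src C' f))" using loc by (simp add: lift_topology_def)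
      then show "sieve_pull C (far u ` R') n \<in> J (src C n)"
        using image_sieve_pull[OF R(2)] sieveD(1,2)[OF s f(1)] f(2) by simp
    qed
    then show ?thesis using X R(2) by (simp add: lift_topology_def)
  qed
qed (simp add: lift_topology_def)

sublocale lift: site C' "lift_topology C' J u"
  using topology_lift u_simps(1) by unfold_locales

lemma glues_psh_pull:
  assumes F: "glues C J F" shows "glues C' (lift_topology C' J u) (psh_pull C' u F)"
proof (rule lift.gluesI)
  show "presheaf C' (psh_pull C' u F)" by (rule presheaf_psh_pull[OF u_functor glues_presheaf[OF F]])
  fix X R assume R: "R \<in> lift_topology C' J u X" and X: "X \<in> Ob C'"
  have s: "sieve C' X R" and J: "far u ` R \<in> J (fob u X)" using R by (simp_all add: lift_topology_def)
  note sd = sieveD[OF s]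
  show "x = y" if "x \<in> sec (psh_pull C' u F) X" "y \<in> sec (psh_pull C' u F) X"
    "\<And>m. m \<in> R \<Longrightarrow> res (psh_pull C' u F) m x = res (psh_pull C' u F) m y" for x y
    by (rule glues_separated[OF F J]) (use that X sd(1) in auto)
  fix t assume t: "\<And>m. m \<in> R \<Longrightarrow> t m \<in> sec (psh_pull C' u F) (src C' m)"
    "\<And>m g. m \<in> R \<Longrightarrow> g \<in> Ar C' \<Longrightarrow> tgt C' g = src C' m \<Longrightarrow> t (cmp C' m g) = res (psh_pull C' u F) g (t m)"
  have inj: "inj_on (far u) R" using far_eq_iff sd(1,2) by (simp add: inj_on_def)
  obtain x where x: "x \<in> sec F (fob u X)" "\<And>n. n \<in> far u ` R \<Longrightarrow> res F n x = t (inv_into R (far u) n)"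
  proof (rule glues_glue[OF F J, of "\<lambda>n. t (inv_into R (far u) n)"])
    fix n assume "n \<in> far u ` R"
    then obtain m where m: "m \<in> R" "n = far u m" by blast
    then show "t (inv_into R (far u) n) \<in> sec F (src C n)"
      using t(1)[OF m(1)] inj sd(1)[OF m(1)] by simp
    fix g assume g: "g \<in> Ar C" "tgt C g = src C n"
    obtain g' where g': "g' \<in> Ar C'" "tgt C' g' = src C' m" "far u g' = g"
      using lift_arrow[of g "src C' m"] g m sd(1) by auto
    then have "cmp C n g = far u (cmp C' m g')" using m sd(1) by simp
    then show "t (inv_into R (far u) (cmp C n g)) = res F g (t (inv_into R (far u) n))"
      using t(2)[OF m(1) g'(1,2)] m inj g' sd(3)[OF m(1) g'(1,2)] by simp
  qed blast
  then show "\<exists>x\<in>sec (psh_pull C' u F) X. \<forall>m\<in>R. res (psh_pull C' u F) m x = t m"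
    using X inj sd(1) by (intro bexI[of _ x]) auto
qed

lemma sheaf_psh_pull: "sheaf el C J F \<Longrightarrow> sheaf el C' (lift_topology C' J u) (psh_pull C' u F)"
  by (simp add: sheaf_iff_glues glues_psh_pull)

text \<open>For maximality, let \<open>R\<close> be covering for a topology making \<open>u\<close>
  continuous. Pulled back sheaves are separated for \<open>R\<close>, hence all sheaves on
  \<open>C\<close> are separated for the image of \<open>R\<close>, and detection makes the image
  covering.\<close>

lemma is_induced_topology_lift:
  assumes "detecting el C J"
  shows "is_induced_topology el C' C J u (lift_topology C' J u)"
  unfolding is_induced_topology_def
proof (intro conjI allI impI subsetI; (elim conjE)?)
  show "topology C' (lift_topology C' J u)" by (rule topology_lift)
  show "continuous el C' (lift_topology C' J u) C J u"
    by (simp add: continuous_def u_functor sheaf_psh_pull)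
  fix J'' X R assume J'': "topology C' J''" "continuous el C' J'' C J u" and R: "R \<in> J'' X"
  interpret J'': site C' J'' by unfold_locales (simp_all add: J'')
  note s = J''.cover_sieve[OF R] and X = J''.cover_Ob[OF R]
  have "x = y" if F: "sheaf el C J F" and xy: "x \<in> sec F (fob u X)" "y \<in> sec F (fob u X)"
    "\<forall>n\<in>far u ` R. res F n x = res F n y" for F :: "('o, 'm, 'a) psh" and x y
  proof (rule J''.glues_separated[OF _ R])
    show "glues C' J'' (psh_pull C' u F)" using J''(2) F unfolding continuous_def sheaf_iff_glues by blast
  qed (use xy X sieveD(1)[OF s] in auto)
  then have "far u ` R \<in> J (fob u X)"
    using assms image_sieve[OF s] X u_simps(3) unfolding detecting_def by blast
  then show "R \<in> lift_topology C' J u X" using X s by (simp add: lift_topology_def)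
qed

text \<open>The topologies on the fibres over \<open>V\<close> are induced in two steps, through a
  slice. Detection passes to the slice by pulling sheaves back to it, so the second step can use the
  same computation without treating the slice as a site of the universe.\<close>

lemma detecting_lift:
  assumes "detecting el C J" shows "detecting el C' (lift_topology C' J u)"
  unfolding detecting_def
proof (intro ballI allI impI; elim conjE)
  fix X R assume X: "X \<in> Ob C'" and s: "sieve C' X R"
    and sep: "\<forall>F. sheaf el C' (lift_topology C' J u) F \<longrightarrow>
      (\<forall>x\<in>sec F X. \<forall>y\<in>sec F X. (\<forall>m\<in>R. res F m x = res F m y) \<longrightarrow> x = y)"
  have "x = y" if F: "sheaf el C J F" and xy: "x \<in> sec F (fob u X)" "y \<in> sec F (fob u X)"
    "\<forall>n\<in>far u ` R. res F n x = res F n y" for F :: "('o, 'm, 'a) psh" and x y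
  proof -
    have "\<forall>m\<in>R. res (psh_pull C' u F) m x = res (psh_pull C' u F) m y"
      using xy sieveD(1)[OF s] by simp
    then show ?thesis using sep sheaf_psh_pull[OF F] xy X by simp
  qed
  then have "far u ` R \<in> J (fob u X)"
    using assms image_sieve[OF s] X u_simps(3) unfolding detecting_def by blast
  then show "R \<in> lift_topology C' J u X" using X s by (simp add: lift_topology_def)
qed

end

lemma discrete_fibration_slice_forget:
  assumes "category C" shows "discrete_fibration (slice C V) C (slice_forget C)"
  unfolding discrete_fibration_def
proof (intro conjI ballI is_functor_slice_forget assms)
  fix w assume w: "w \<in> Ob (slice C V)"
  show "bij_betw (far (slice_forget C)) {m \<in> Ar (slice C V). tgt (slice C V) m = w}
    {m \<in> Ar C. tgt C m = fob (slice_forget C) w}"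
    \<comment> \<open>The commuting triangle forces the source of the lift of
      \<open>m\<close>.\<close>
    by (rule bij_betw_byWitness[of _ "\<lambda>m. (cmp C w m, w, m)"]) (use w in \<open>auto simp: assms\<close>)
qed

lemma site_slice_discrete_fibration:
  "site C J \<Longrightarrow> discrete_fibration_site C J (slice C V) (slice_forget C)"
  by (simp add: discrete_fibration_site_def discrete_fibration_site_axioms_def
      discrete_fibration_slice_forget site_def)

section \<open>Covering families\<close>

definition generated_sieve :: "('o, 'm) cat \<Rightarrow> 'm set \<Rightarrow> 'm set" where
  "generated_sieve C S = {cmp C m g | m g. m \<in> S \<and> g \<in> Ar C \<and> tgt C g = src C m}"

lemma covering_family_iff:
  "covering_family C J X S \<longleftrightarrow> X \<in> Ob C \<and> S \<subseteq> {m \<in> Ar C. tgt C m = X} \<and> generated_sieve C S \<in> J X"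
  by (simp add: covering_family_def generated_sieve_def)

lemma generated_sieve_least: "sieve C X R \<Longrightarrow> S \<subseteq> R \<Longrightarrow> generated_sieve C S \<subseteq> R"
  unfolding generated_sieve_def sieve_def by blast

lemma sieve_generated_sieve:
  assumes "category C" "S \<subseteq> {m \<in> Ar C. tgt C m = X}" shows "sieve C X (generated_sieve C S)"
  unfolding sieve_def
proof (intro conjI ballI impI subsetI)
  note c = category_simps[OF assms(1)]
  fix n assume "n \<in> generated_sieve C S"
  then obtain m g where m: "n = cmp C m g" "m \<in> S" "g \<in> Ar C" "tgt C g = src C m"
    unfolding generated_sieve_def by blast
  then have m': "m \<in> Ar C" "tgt C m = X" using assms(2) by auto
  show "n \<in> {m \<in> Ar C. tgt C m = X}" using m m' c by simp
  fix h assume h: "h \<in> Ar C" "tgt C h = src C n"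
  then have h': "tgt C h = src C g" using m m' c by simp
  then have "cmp C n h = cmp C m (cmp C g h)" "cmp C g h \<in> Ar C" "tgt C (cmp C g h) = src C m"
    using m m' h c by (simp_all add: cmp_assoc[OF assms(1)])
  then show "cmp C n h \<in> generated_sieve C S" unfolding generated_sieve_def using m(2) by blast
qed

lemma mem_generated_sieve:
  assumes "category C" "m \<in> S" "m \<in> Ar C" shows "m \<in> generated_sieve C S"
proof -
  have "m = cmp C m (ide C (src C m))" "ide C (src C m) \<in> Ar C" "tgt C (ide C (src C m)) = src C m"
    using assms by simp_all
  then show ?thesis unfolding generated_sieve_def using assms(2) by blast
qed

context site begin

lemma covering_family_superset:
  assumes "covering_family C J X S" "sieve C X R" "S \<subseteq> R" shows "R \<in> J X"
  using superset_cover[OF _ assms(2) generated_sieve_least[OF assms(2,3)]] assms(1)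
  by (simp add: covering_family_iff)

lemma covering_family_sieve:
  assumes R: "R \<in> J X" shows "covering_family C J X R"
proof -
  have sub: "R \<subseteq> {m \<in> Ar C. tgt C m = X}" using cover_sieve[OF R] by (simp add: sieve_def)
  have "R \<subseteq> generated_sieve C R" using mem_generated_sieve[OF cat] sub by blast
  then show ?thesis
    using superset_cover[OF R sieve_generated_sieve[OF cat sub]] cover_Ob[OF R] sub
    by (simp add: covering_family_iff)
qed

lemma covering_family_bind:
  assumes "covering_family C J X S" "sieve C X R"
    "\<And>m. m \<in> S \<Longrightarrow> m \<in> Ar C \<Longrightarrow> tgt C m = X \<Longrightarrow> \<exists>T. covering_family C J (src C m) T \<and> (\<forall>g\<in>T. cmp C m g \<in> R)"
  shows "R \<in> J X"
proof -
  have S: "S \<subseteq> {m \<in> Ar C. tgt C m = X}" "generated_sieve C S \<in> J X"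
    using assms(1) by (simp_all add: covering_family_iff)
  show ?thesis
  proof (rule local_cover[OF S(2) assms(2)])
    fix f assume "f \<in> generated_sieve C S"
    then obtain m g where m: "f = cmp C m g" "m \<in> S" "g \<in> Ar C" "tgt C g = src C m"
      unfolding generated_sieve_def by blast
    have m': "m \<in> Ar C" "tgt C m = X" using S(1) m(2) by auto
    obtain T where T: "covering_family C J (src C m) T" "\<forall>g\<in>T. cmp C m g \<in> R" using assms(3) m(2) m' by blast
    have "sieve_pull C R m \<in> J (src C m)"
      by (rule covering_family_superset[OF T(1) sieve_sieve_pull[OF assms(2) m']])
        (use T in \<open>auto simp: sieve_pull_def covering_family_iff\<close>)
    then have "sieve_pull C (sieve_pull C R m) g \<in> J (src C g)" using pull_cover m(3,4) by simp
    moreover have "\<forall>h\<in>sieve_pull C (sieve_pull C R m) g. cmp C f h \<in> R"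
      using m m' by (auto simp: sieve_pull_def assoc)
    moreover have "src C f = src C g" using m m' by simp
    ultimately show "\<exists>T\<in>J (src C f). \<forall>g\<in>T. cmp C f g \<in> R" by metis
  qed
qed

end

text \<open>Continuity is a condition on sheaves only. A sheaf on \<open>C'\<close> pulls back to
  one separated for the family \<open>S\<close>, hence is separated for the sieve generated by the
  image of \<open>S\<close>, and detection turns this into a covering.\<close>

lemma continuous_covering_family:
  fixes el :: "'u \<Rightarrow> 'u set"
  assumes "site C J" "site C' J'" "continuous el C J C' J' u" "detecting el C' J'" "covering_family C J X S"
  shows "covering_family C' J' (fob u X) (far u ` S)"
proof -
  interpret site C J by fact
  interpret C': site C' J' by fact
  have f: "is_functor C C' u" using assms(3) by (simp add: continuous_def)
  note fs = functor_simps[OF f]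
  have S: "X \<in> Ob C" "S \<subseteq> {m \<in> Ar C. tgt C m = X}" "generated_sieve C S \<in> J X"
    using assms(5) by (simp_all add: covering_family_iff)
  have S': "far u ` S \<subseteq> {m \<in> Ar C'. tgt C' m = fob u X}" using S(2) fs by auto
  have "x = y" if F: "sheaf el C' J' F" and xy: "x \<in> sec F (fob u X)" "y \<in> sec F (fob u X)"
    "\<forall>m\<in>generated_sieve C' (far u ` S). res F m x = res F m y" for F :: "('c, 'd, 'u) psh" and x y
  proof (rule glues_separated[OF _ S(3)])
    show g: "glues C J (psh_pull C u F)" using F assms(3) unfolding continuous_def sheaf_iff_glues by blast
    show xy': "x \<in> sec (psh_pull C u F) X" "y \<in> sec (psh_pull C u F) X" using S(1) xy by simp_all
    fix n assume "n \<in> generated_sieve C S"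
    then obtain m g where m: "n = cmp C m g" "m \<in> S" "g \<in> Ar C" "tgt C g = src C m"
      unfolding generated_sieve_def by blast
    then have m': "m \<in> Ar C" "tgt C m = X" using S(2) by auto
    have "far u m \<in> generated_sieve C' (far u ` S)"
      using m(2) m' fs by (intro mem_generated_sieve) auto
    then have "res (psh_pull C u F) m x = res (psh_pull C u F) m y" using xy(3) m' by simp
    then show "res (psh_pull C u F) n x = res (psh_pull C u F) n y"
      using presheaf_simps(3)[OF glues_presheaf[OF g] m(3) m'(1) m(4)] xy' m' m(1) by simp
  qed
  then have "generated_sieve C' (far u ` S) \<in> J' (fob u X)"
    using assms(4) sieve_generated_sieve[OF C'.cat S'] fs(3)[OF S(1)] unfolding detecting_def by blast
  then show ?thesis using S' fs(3)[OF S(1)] by (simp add: covering_family_iff)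
qed

lemma topology_generated:
  assumes "category C" shows "topology C (generated_topology C K)"
  unfolding topology_def
proof (intro conjI ballI allI impI; (elim conjE)?)
  fix X assume X: "X \<in> Ob C"
  show "{m \<in> Ar C. tgt C m = X} \<in> generated_topology C K X"
    using X assms by (auto simp: generated_topology_def topology_def sieve_def)
  fix R assume R: "R \<in> generated_topology C K X"
  show "sieve C X R" using R by (simp add: generated_topology_def)
  show "sieve_pull C R f \<in> generated_topology C K (src C f)" if f: "f \<in> Ar C" "tgt C f = X" for f
    unfolding generated_topology_def mem_Collect_eq
  proof (intro conjI allI impI; (elim conjE)?)
    show "sieve C (src C f) (sieve_pull C R f)"
      using R f unfolding generated_topology_def sieve_def sieve_pull_def
      by (auto simp: assms simp flip: cmp_assoc[OF assms])
    fix J assume J: "topology C J" "\<forall>(Y, S)\<in>K. covering_family C J Y S"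
    then have "R \<in> J X" using R unfolding generated_topology_def by blast
    then show "sieve_pull C R f \<in> J (src C f)" using J(1) X f unfolding topology_def by blast
  qed (use assms f in simp)
  show "R' \<in> generated_topology C K X" if "sieve C X R'"
    "\<forall>f\<in>R. sieve_pull C R' f \<in> generated_topology C K (src C f)" for R'
    unfolding generated_topology_def mem_Collect_eq
  proof (intro conjI allI impI X that(1); (elim conjE)?)
    fix J assume J: "topology C J" "\<forall>(Y, S)\<in>K. covering_family C J Y S"
    then have "R \<in> J X" "\<forall>f\<in>R. sieve_pull C R' f \<in> J (src C f)"
      using R that(2) unfolding generated_topology_def by blast+
    then show "R' \<in> J X" using J(1) X that(1) unfolding topology_def by blast
  qed
qed (simp add: generated_topology_def)

lemma generated_topology_least:
  "R \<in> generated_topology C K X \<Longrightarrow> topology C J \<Longrightarrow> (\<And>Y S. (Y, S) \<in> K \<Longrightarrow> covering_family C J Y S) \<Longrightarrow> R \<in> J X"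
  unfolding generated_topology_def by blast

lemma generated_topology_covering:
  assumes "category C" "(Y, S) \<in> K" "Y \<in> Ob C" "S \<subseteq> {m \<in> Ar C. tgt C m = Y}"
  shows "covering_family C (generated_topology C K) Y S"
  using assms(2-4) sieve_generated_sieve[OF assms(1,4)]
  unfolding covering_family_iff generated_topology_def by blast

section \<open>The co-evanescent site\<close>

locale cleaved_site =
  fixes el :: "'u \<Rightarrow> 'u set" and X :: "('o, 'm, 'p, 'n) fsite"
  assumes u: "universe el" and fs: "fibred_site el X"
begin

abbreviation "E \<equiv> tot X"
abbreviation "I \<equiv> bas X"
abbreviation "p \<equiv> fob (prj X)"
abbreviation "q \<equiv> far (prj X)"
abbreviation "cl \<equiv> clv X"

lemma prj: "is_functor E I (prj X)" and U_site_I: "U_site el I (btop X)"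
  and U_site_fib: "i \<in> Ob I \<Longrightarrow> U_site el (fib X i) (ftop X i)"
  and cleavage: "normalized_cleavage E I (prj X) cl"
  and fcont: "f \<in> Ar I \<Longrightarrow> continuous el (fib X (tgt I f)) (ftop X (tgt I f)) (fib X (src I f)) (ftop X (src I f)) (fpull X f)"
  and cartesian_comp: "cartesian E I (prj X) m \<Longrightarrow> cartesian E I (prj X) n \<Longrightarrow> tgt E m = src E n \<Longrightarrow>
        cartesian E I (prj X) (cmp E n m)"
  using fs unfolding fibred_site_def fibred_category_def by blast+

lemmas catE = functor_simps(1)[OF prj] and catI = functor_simps(2)[OF prj]
lemmas E_simps [simp] = category_simps[OF catE]
lemmas I_simps [simp] = category_simps[OF catI]
lemmas prj_simps [simp] = functor_simps[OF prj]
lemmas E_assoc = cmp_assoc[OF catE]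
lemmas I_assoc = cmp_assoc[OF catI]

sublocale I: site I "btop X" by (rule U_site_site[OF U_site_I])

lemma site_fib: "i \<in> Ob I \<Longrightarrow> site (fib X i) (ftop X i)"
  by (rule U_site_site[OF U_site_fib])

lemma
  assumes "f \<in> Ar I" "V \<in> Ob E" "p V = tgt I f"
  shows cl_cartesian: "cartesian E I (prj X) (cl f V)"
    and cl_Ar [simp]: "cl f V \<in> Ar E" and cl_far [simp]: "q (cl f V) = f" and cl_tgt [simp]: "tgt E (cl f V) = V"
    and cl_src [simp]: "p (src E (cl f V)) = src I f"
proof -
  show "cartesian E I (prj X) (cl f V)" "q (cl f V) = f" "tgt E (cl f V) = V"
    using cleavage assms unfolding normalized_cleavage_def by blast+
  moreover from this show "cl f V \<in> Ar E" by (simp add: cartesian_def)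
  ultimately show "p (src E (cl f V)) = src I f" using prj_simps(5) by metis
qed

lemma vert:
  assumes "h \<in> Ar E" "q h = ide I i" "i \<in> Ob I" shows "p (src E h) = i" "p (tgt E h) = i"
  using prj_simps(5,6)[OF assms(1)] assms(2,3) by simp_all

lemma cartesian_cancel:
  assumes "cartesian E I (prj X) m" "h \<in> Ar E" "h' \<in> Ar E" "q h = ide I (p (src E m))" "q h' = ide I (p (src E m))"
    "tgt E h = src E m" "tgt E h' = src E m" "src E h = src E h'" "cmp E m h = cmp E m h'"
  shows "h = h'"
proof -
  have m: "m \<in> Ar E" using assms(1) by (simp add: cartesian_def)
  have "cmp E m h \<in> Ar E" "q (cmp E m h) = q m" "tgt E (cmp E m h) = tgt E m" "src E (cmp E m h) = src E h"
    using m assms by simp_all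
  then have "\<exists>!k. k \<in> hom (fib X (p (src E m))) (src E h) (src E m) \<and> cmp E m k = cmp E m h"
    using assms(1) unfolding cartesian_def by metis
  then show ?thesis using assms by (auto simp: hom_iff)
qed

lemma cartesian_factor:
  assumes "cartesian E I (prj X) m" "n \<in> Ar E" "q n = q m" "tgt E n = tgt E m"
  obtains h where "h \<in> Ar E" "q h = ide I (p (src E m))" "src E h = src E n" "tgt E h = src E m" "cmp E m h = n"
proof -
  have "\<exists>!h. h \<in> hom (fib X (p (src E m))) (src E n) (src E m) \<and> cmp E m h = n"
    using assms unfolding cartesian_def by metis
  then obtain h where "h \<in> hom (fib X (p (src E m))) (src E n) (src E m) \<and> cmp E m h = n" by blast
  then show thesis using that[of h] by (simp add: hom_iff)
qed

lemma fvfac: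
  assumes m: "m \<in> Ar E"
  shows "fvfac X m \<in> Ar E" "q (fvfac X m) = ide I (p (src E m))" "src E (fvfac X m) = src E m"
    "tgt E (fvfac X m) = src E (cl (q m) (tgt E m))" "cmp E (cl (q m) (tgt E m)) (fvfac X m) = m"
proof -
  let ?k = "cl (q m) (tgt E m)"
  have c: "cartesian E I (prj X) ?k" using m by (intro cl_cartesian) simp_all
  have k: "q ?k = q m" "tgt E ?k = tgt E m" "p (src E ?k) = p (src E m)" using m by simp_all
  have "\<exists>!h. h \<in> hom (fib X (p (src E m))) (src E m) (src E ?k) \<and> cmp E ?k h = m"
    using c k m unfolding cartesian_def by metis
  then have "fvfac X m \<in> hom (fib X (p (src E m))) (src E m) (src E ?k) \<and> cmp E ?k (fvfac X m) = m"
    unfolding vfac_def Let_def by (rule theI')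
  then show "fvfac X m \<in> Ar E" "q (fvfac X m) = ide I (p (src E m))" "src E (fvfac X m) = src E m"
    "tgt E (fvfac X m) = src E ?k" "cmp E ?k (fvfac X m) = m" by (simp_all add: hom_iff)
qed

lemma fvfac_eq:
  assumes "f \<in> Ar I" "V \<in> Ob E" "p V = tgt I f" "h \<in> Ar E" "tgt E h = src E (cl f V)" "q h = ide I (src I f)"
    "m = cmp E (cl f V) h"
  shows "fvfac X m = h"
proof -
  have m: "m \<in> Ar E" "src E m = src E h" "tgt E m = V" "q m = f" using assms by simp_all
  note v = fvfac[OF m(1), unfolded m]
  show ?thesis
    by (rule cartesian_cancel[OF cl_cartesian[OF assms(1-3)]])
      (use v assms vert(1)[OF assms(4,6)] in simp_all)
qed

text \<open>\<open>cartesian\<close> factors only arrows lying over the very same arrow of the base.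
  An arrow over a composite is reached because the composite of the chosen cartesian arrows over
  \<open>f\<close> and \<open>h\<close> is again cartesian.\<close>

lemma cl_factor:
  assumes m: "m \<in> Ar E" "q m = cmp I f h" "f \<in> Ar I" "h \<in> Ar I" "tgt I h = src I f"
  obtains n where "n \<in> Ar E" "q n = h" "src E n = src E m" "tgt E n = src E (cl f (tgt E m))"
    "cmp E (cl f (tgt E m)) n = m"
proof -
  let ?V = "tgt E m"
  have V: "p ?V = tgt I f" using prj_simps(6)[OF m(1)] m by simp
  let ?W = "src E (cl f ?V)"
  let ?k = "cl h ?W"
  have W: "?W \<in> Ob E" "p ?W = tgt I h" using m V by simp_all
  have "cartesian E I (prj X) (cmp E (cl f ?V) ?k)"
    using cartesian_comp[OF cl_cartesian[OF m(4) W] cl_cartesian[OF m(3) _ V]] m V W by simp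
  then obtain r where r: "r \<in> Ar E" "q r = ide I (p (src E (cmp E (cl f ?V) ?k)))" "src E r = src E m"
    "tgt E r = src E (cmp E (cl f ?V) ?k)" "cmp E (cmp E (cl f ?V) ?k) r = m"
    by (rule cartesian_factor[OF _ m(1)]) (use m V W in simp_all)
  show thesis
  proof (rule that[of "cmp E ?k r"])
    show "cmp E (cl f ?V) (cmp E ?k r) = m" using r m V W by (simp add: E_assoc)
  qed (use r m V W in simp_all)
qed

lemma fpull_simps [simp]: "fob (fpull X f) V = src E (cl f V)"
  "far (fpull X f) m = fvfac X (cmp E m (cl f (src E m)))"
  by (simp_all add: pull_def)

text \<open>The last equation is the naturality square of the chosen cartesian arrows; it lets a
  vertical arrow be moved past them.\<close>

lemma fpull_arrow:
  assumes f: "f \<in> Ar I" and m: "m \<in> Ar E" "q m = ide I (tgt I f)"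
  defines "m' \<equiv> fvfac X (cmp E m (cl f (src E m)))"
  shows "m' \<in> Ar E" "q m' = ide I (src I f)" "src E m' = src E (cl f (src E m))" "tgt E m' = src E (cl f (tgt E m))"
    "cmp E (cl f (tgt E m)) m' = cmp E m (cl f (src E m))"
proof -
  have v: "p (src E m) = tgt I f" "p (tgt E m) = tgt I f" using vert[OF m] f by simp_all
  have n: "cmp E m (cl f (src E m)) \<in> Ar E" "src E (cmp E m (cl f (src E m))) = src E (cl f (src E m))"
    "tgt E (cmp E m (cl f (src E m))) = tgt E m" "q (cmp E m (cl f (src E m))) = f"
    using f m v by simp_all
  show "m' \<in> Ar E" "q m' = ide I (src I f)" "src E m' = src E (cl f (src E m))" "tgt E m' = src E (cl f (tgt E m))"
    "cmp E (cl f (tgt E m)) m' = cmp E m (cl f (src E m))"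
    using fvfac[OF n(1)] n f m v unfolding m'_def by simp_all
qed

section \<open>The co-evanescent topology on \<open>E\<close>: its generators and its
  smallness\<close>

lemma topology_coev: "topology E (coev X)"
  unfolding coev_def by (rule topology_generated[OF catE])

sublocale E: site E "coev X"
  by unfold_locales (rule catE, rule topology_coev)

lemma vertical_covering:
  assumes "i \<in> Ob I" "covering_family (fib X i) (ftop X i) V S" shows "covering_family E (coev X) V S"
  unfolding coev_def
proof (rule generated_topology_covering[OF catE])
  show "(V, S) \<in> vertical_families X \<union> cartesian_families X" using assms by (auto simp: vertical_families_def)
qed (use assms(2) in \<open>auto simp: covering_family_def\<close>)

lemma cartesian_covering:
  assumes V: "V \<in> Ob E" and T: "covering_family I (btop X) (p V) T"
  shows "covering_family E (coev X) V ((\<lambda>f. cl f V) ` T)"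
proof -
  have T': "f \<in> Ar I" "tgt I f = p V" if "f \<in> T" for f using T that by (auto simp: covering_family_def)
  have sub: "(\<lambda>f. cl f V) ` T \<subseteq> {m \<in> Ar E. tgt E m = V}" using T' V by auto
  have "q ` (\<lambda>f. cl f V) ` T = T" using T' V by (force simp: image_iff)
  moreover have "\<exists>\<phi>. is_iso (fib X (src I (q m))) \<phi> \<and> src E \<phi> = src E m \<and> tgt E \<phi> = src E (cl (q m) V) \<and>
      m = cmp E (cl (q m) V) \<phi>" if "m \<in> (\<lambda>f. cl f V) ` T" for m
  proof -
    obtain f where f: "f \<in> T" "m = cl f V" using \<open>m \<in> _\<close> by blast
    show ?thesis
      \<comment> \<open>The chosen cartesian arrows themselves form the family, so the isomorphism
        is an identity.\<close>
      by (rule exI[of _ "ide E (src E m)"])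
        (use f T'[OF f(1)] V in \<open>auto simp: is_iso_def hom_iff intro!: bexI[of _ "ide E (src E m)"]\<close>)
  qed
  ultimately have "(V, (\<lambda>f. cl f V) ` T) \<in> cartesian_families X"
    using V T sub by (auto simp: cartesian_families_def Let_def)
  then show ?thesis unfolding coev_def
    by (intro generated_topology_covering[OF catE _ V sub]) simp
qed

text \<open>Arrows are sorted by their image in \<open>I\<close>. Those over a fixed
  \<open>f\<close> inject into a hom set of a fibre by taking the vertical factor.\<close>

lemma hom_small: assumes "V \<in> Ob E" "W \<in> Ob E" shows "U_small el (hom E V W)"
proof -
  have "U_small el {m \<in> hom E V W. q m = f}" if f: "f \<in> hom I (p V) (p W)" for f
  proof (rule U_small_inj[OF u])
    have f': "f \<in> Ar I" "tgt I f = p W" "src I f = p V" using f by (simp_all add: hom_iff)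
    show "U_small el (hom (fib X (p V)) V (src E (cl f W)))"
      using U_site_fib[of "p V"] assms f' by (simp add: U_site_def)
    show "inj_on (fvfac X) {m \<in> hom E V W. q m = f}"
      by (rule inj_onI) (metis (mono_tags, lifting) fvfac(5) hom_iff mem_Collect_eq)
    show "fvfac X ` {m \<in> hom E V W. q m = f} \<subseteq> hom (fib X (p V)) V (src E (cl f W))"
      using fvfac by (auto simp: hom_iff)
  qed
  moreover have "U_small el (hom I (p V) (p W))" using U_site_I assms by (simp add: U_site_def)
  ultimately have "U_small el (\<Union>f\<in>hom I (p V) (p W). {m \<in> hom E V W. q m = f})" by (intro U_small_UN u)
  moreover have "hom E V W \<subseteq> (\<Union>f\<in>hom I (p V) (p W). {m \<in> hom E V W. q m = f})" by (auto simp: hom_iff)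
  ultimately show ?thesis by (rule U_small_subset[OF u])
qed

text \<open>Generators of the fibres over a generating set of \<open>I\<close> suffice: an object is
  first covered by a cartesian family with sources over those generators, and each source then by a
  vertical family. This makes sheafification and detection available on \<open>E\<close>.\<close>

lemma U_site_E: "U_site el E (coev X)"
proof -
  obtain GI where GI: "GI \<subseteq> Ob I" "U_small el GI"
    "\<forall>i\<in>Ob I. \<exists>S. covering_family I (btop X) i S \<and> src I ` S \<subseteq> GI"
    using U_site_I unfolding U_site_def by blast
  have "\<forall>i\<in>Ob I. \<exists>G. G \<subseteq> Ob (fib X i) \<and> U_small el G \<and>
      (\<forall>V\<in>Ob (fib X i). \<exists>S. covering_family (fib X i) (ftop X i) V S \<and> src (fib X i) ` S \<subseteq> G)"
    using U_site_fib unfolding U_site_def by blast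
  then obtain G where G: "\<forall>i\<in>Ob I. G i \<subseteq> Ob (fib X i) \<and> U_small el (G i) \<and>
      (\<forall>V\<in>Ob (fib X i). \<exists>S. covering_family (fib X i) (ftop X i) V S \<and> src (fib X i) ` S \<subseteq> G i)"
    by (rule bchoice[THEN exE])
  let ?G = "\<Union>i\<in>GI. G i"
  have "?G \<subseteq> Ob E" using G GI(1) by fastforce
  moreover have "U_small el ?G" using G GI by (intro U_small_UN u) auto
  moreover have "\<exists>S. covering_family E (coev X) V S \<and> src E ` S \<subseteq> ?G" if V: "V \<in> Ob E" for V
  proof -
    obtain SI where SI: "covering_family I (btop X) (p V) SI" "src I ` SI \<subseteq> GI" using GI(3) V by force
    have SI': "f \<in> Ar I" "tgt I f = p V" "src I f \<in> GI" if "f \<in> SI" for f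
      using SI that by (auto simp: covering_family_def)
    have "\<forall>f\<in>SI. \<exists>T. covering_family (fib X (src I f)) (ftop X (src I f)) (src E (cl f V)) T \<and> src E ` T \<subseteq> G (src I f)"
    proof
      fix f assume f: "f \<in> SI"
      have "src E (cl f V) \<in> Ob (fib X (src I f))" "src I f \<in> Ob I" using SI'[OF f] V by simp_all
      then show "\<exists>T. covering_family (fib X (src I f)) (ftop X (src I f)) (src E (cl f V)) T \<and> src E ` T \<subseteq> G (src I f)"
        using G by (metis fibre_simps(3))
    qed
    then obtain T where T: "\<forall>f\<in>SI. covering_family (fib X (src I f)) (ftop X (src I f)) (src E (cl f V)) (T f) \<and>
      src E ` T f \<subseteq> G (src I f)" by (rule bchoice[THEN exE])
    have Ta: "t \<in> Ar E" "tgt E t = src E (cl f V)" "src E t \<in> G (src I f)" if "f \<in> SI" "t \<in> T f" for f t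
      using T that by (auto simp: covering_family_def)
    let ?S = "{cmp E (cl f V) t | f t. f \<in> SI \<and> t \<in> T f}"
    have sub: "?S \<subseteq> {m \<in> Ar E. tgt E m = V}" using Ta SI' V by auto
    have "generated_sieve E ?S \<in> coev X V"
    \<comment> \<open>Composing the cartesian family with the vertical families chosen over its
      members.\<close>
    proof (rule E.covering_family_bind[OF cartesian_covering[OF V SI(1)] sieve_generated_sieve[OF catE sub]])
      fix m assume "m \<in> (\<lambda>f. cl f V) ` SI"
      then obtain f where f: "f \<in> SI" "m = cl f V" by blast
      have "covering_family E (coev X) (src E m) (T f)"
        using vertical_covering[of "src I f"] T f SI' by simp
      moreover have "cmp E m t \<in> generated_sieve E ?S" if "t \<in> T f" for t
      proof (rule mem_generated_sieve[OF catE])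
        show "cmp E m t \<in> ?S" using f that by blast
        then show "cmp E m t \<in> Ar E" using sub by blast
      qed
      ultimately show "\<exists>T. covering_family E (coev X) (src E m) T \<and> (\<forall>g\<in>T. cmp E m g \<in> generated_sieve E ?S)"
        by blast
    qed
    then have "covering_family E (coev X) V ?S" using V sub by (simp add: covering_family_iff)
    moreover have "src E ` ?S \<subseteq> ?G" using Ta SI' V by fastforce
    ultimately show ?thesis by blast
  qed
  ultimately show ?thesis
    unfolding U_site_def using catE topology_coev hom_small by blast
qed

end

section \<open>Localization of the co-evanescent topology\<close>

locale cleaved_site_over = cleaved_site el X for el :: "'u \<Rightarrow> 'u set" and X :: "('o, 'm, 'p, 'n) fsite" +
  fixes V assumes V: "V \<in> Ob (tot X)"
begin

abbreviation "EV \<equiv> slice E V"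
abbreviation "Ic \<equiv> slice I (p V)"
abbreviation "Y \<equiv> slice_fsite el X V"

lemma Y_simps [simp]:
  "tot Y = EV" "bas Y = Ic" "prj Y = slice_proj X" "clv Y = slice_clv X" "ftop Y = slice_ftop el X V"
  "btop Y = induced_topology el Ic I (btop X) (slice_forget I)"
  by (simp_all add: slice_fsite_def Let_def)

lemma slice_proj_simps [simp]:
  "fob (slice_proj X) = q" "far (slice_proj X) (w, w', m) = (q w, q w', q m)"
  by (simp_all add: slice_proj_def)

lemma fibre_to_slice_simps [simp]:
  "fob (fibre_to_slice X) = fvfac X" "far (fibre_to_slice X) (w, w', m) = (fvfac X w, fvfac X w', m)"
  by (simp_all add: fibre_to_slice_def)

lemma slice_clv_simps [simp]:
  "slice_clv X (f1, f2, g) w = (cmp E w (cl g (src E w)), w, cl g (src E w))"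
  by (simp add: slice_clv_def Let_def)

section \<open>The fibred site over \<open>V\<close> and an explicit description of its
  topologies\<close>

lemma slice_proj_functor: "is_functor EV Ic (slice_proj X)"
proof (rule is_functorI)
  fix w assume "w \<in> Ob EV"
  then show "fob (slice_proj X) w \<in> Ob Ic" by auto
next
  fix t assume "t \<in> Ar EV"
  then show "far (slice_proj X) t \<in> hom Ic (fob (slice_proj X) (src EV t)) (fob (slice_proj X) (tgt EV t))"
    by (cases t) (auto simp: hom_iff simp flip: prj_simps(8))
next
  fix w assume "w \<in> Ob EV"
  then show "far (slice_proj X) (ide EV w) = ide Ic (fob (slice_proj X) w)" by simp
next
  fix s t assume "s \<in> Ar EV" "t \<in> Ar EV" "tgt EV s = src EV t"
  then show "far (slice_proj X) (cmp EV t s) = cmp Ic (far (slice_proj X) t) (far (slice_proj X) s)"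
    by (cases s; cases t) simp
qed (simp_all add: category_slice catE catI)

lemma fvfac_over:
  assumes "w \<in> Ar E" "tgt E w = V"
  shows "fvfac X w \<in> Ar E" "q (fvfac X w) = ide I (src I (q w))" "src E (fvfac X w) = src E w"
    "tgt E (fvfac X w) = src E (cl (q w) V)" "cmp E (cl (q w) V) (fvfac X w) = w"
  using fvfac[OF assms(1)] assms by simp_all

text \<open>Vertical factors are unique, and composing with a vertical arrow on the right leaves the
  base arrow unchanged.\<close>

lemma fvfac_over_comp:
  assumes w: "w \<in> Ar E" "tgt E w = V" and m: "m \<in> Ar E" "tgt E m = src E w" "q m = ide I (src I (q w))"
  shows "fvfac X (cmp E w m) = cmp E (fvfac X w) m"
proof (rule fvfac_eq[of "q w" V])
  note v = fvfac_over[OF w]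
  show "cmp E w m = cmp E (cl (q w) V) (cmp E (fvfac X w) m)"
    using v w m V E_assoc[of m "fvfac X w" "cl (q w) V"] by simp
  have "src I (q w) \<in> Ob I" using w by simp
  then show "q (cmp E (fvfac X w) m) = ide I (src I (q w))" using v w m by simp
qed (use fvfac_over[OF w] w m V in \<open>simp_all\<close>)

text \<open>For the induced topology it is enough that the canonical equivalence lifts arrows
  uniquely. An arrow of the fibre into \<open>w\<close> is determined by its vertical part
  \<open>m\<close>, its source being \<open>cmp E w m\<close>.\<close>

lemma fibre_to_slice_discrete_fibration:
  assumes f: "f \<in> Ar I" "tgt I f = p V"
  shows "discrete_fibration (fib Y f) (slice (fib X (src I f)) (src E (cl f V))) (fibre_to_slice X)"
proof -
  let ?i = "src I f" and ?D = "slice (fib X (src I f)) (src E (cl f V))"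
  have c: "cl f V \<in> Ar E" "q (cl f V) = f" "tgt E (cl f V) = V" "p (src E (cl f V)) = ?i" "?i \<in> Ob I"
    using f V by simp_all
  have cP: "category (fib Y f)" unfolding Y_simps
    by (rule category_fibre[OF slice_proj_functor]) (use f in simp)
  have cD: "category ?D" by (rule category_slice[OF category_fibre[OF prj c(5)]])
  show ?thesis unfolding discrete_fibration_def
  proof (intro conjI ballI)
    show "is_functor (fib Y f) ?D (fibre_to_slice X)"
    proof (rule is_functorI[OF cP cD])
      fix w assume w: "w \<in> Ob (fib Y f)"
      then show "fob (fibre_to_slice X) w \<in> Ob ?D" using fvfac_over[of w] by auto
      show "far (fibre_to_slice X) (ide (fib Y f) w) = ide ?D (fob (fibre_to_slice X) w)"
        using w fvfac_over[of w] by simp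
    next
      fix t assume t: "t \<in> Ar (fib Y f)"
      obtain w w' m where [simp]: "t = (w, w', m)" by (cases t)
      show "far (fibre_to_slice X) t \<in> hom ?D (fob (fibre_to_slice X) (src (fib Y f) t)) (fob (fibre_to_slice X) (tgt (fib Y f) t))"
        using t fvfac_over[of w] fvfac_over[of w'] fvfac_over_comp[of w' m] by (auto simp: hom_iff)
    next
      fix s t assume "s \<in> Ar (fib Y f)" "t \<in> Ar (fib Y f)" "tgt (fib Y f) s = src (fib Y f) t"
      then show "far (fibre_to_slice X) (cmp (fib Y f) t s) = cmp ?D (far (fibre_to_slice X) t) (far (fibre_to_slice X) s)"
        by (cases s; cases t) simp
    qed
    fix w assume "w \<in> Ob (fib Y f)"
    then have w: "w \<in> Ar E" "tgt E w = V" "q w = f" by auto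
    note v = fvfac_over[OF w(1,2), unfolded w(3)]
    show "bij_betw (far (fibre_to_slice X)) {t \<in> Ar (fib Y f). tgt (fib Y f) t = w}
        {m \<in> Ar ?D. tgt ?D m = fob (fibre_to_slice X) w}"
    proof (rule bij_betw_byWitness[of _ "\<lambda>(v', v, m). (cmp E w m, w, m)"])
      show "\<forall>t\<in>{t \<in> Ar (fib Y f). tgt (fib Y f) t = w}.
          (case far (fibre_to_slice X) t of (v', v, m) \<Rightarrow> (cmp E w m, w, m)) = t" by auto
      show "\<forall>t\<in>{m \<in> Ar ?D. tgt ?D m = fob (fibre_to_slice X) w}.
          far (fibre_to_slice X) (case t of (v', v, m) \<Rightarrow> (cmp E w m, w, m)) = t"
        using fvfac_over_comp[OF w(1,2)] v by (auto simp: w)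
      show "far (fibre_to_slice X) ` {t \<in> Ar (fib Y f). tgt (fib Y f) t = w} \<subseteq>
          {m \<in> Ar ?D. tgt ?D m = fob (fibre_to_slice X) w}"
      proof (rule image_subsetI)
        fix t assume t: "t \<in> {t \<in> Ar (fib Y f). tgt (fib Y f) t = w}"
        obtain w1 w2 m where [simp]: "t = (w1, w2, m)" by (cases t)
        show "far (fibre_to_slice X) t \<in> {m \<in> Ar ?D. tgt ?D m = fob (fibre_to_slice X) w}"
        proof -
          have t': "w2 = w" "w1 = cmp E w m" "m \<in> Ar E" "tgt E m = src E w" "q m = ide I ?i" using t by auto
          then show ?thesis using fvfac_over_comp[OF w(1,2) t'(3,4)] v w c(5) by simp
        qed
      qed
      show "(\<lambda>(v', v, m). (cmp E w m, w, m)) ` {m \<in> Ar ?D. tgt ?D m = fob (fibre_to_slice X) w} \<subseteq>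
          {t \<in> Ar (fib Y f). tgt (fib Y f) t = w}"
        using v w c(5) f by auto
    qed
  qed
qed

text \<open>Both induced topologies are lifts along discrete fibrations, and the composite of the
  two functors on arrows keeps only the vertical part \<open>m\<close>. The double induction thus
  collapses to one condition in the fibre of \<open>E\<close>.\<close>

lemma ftop_iff:
  assumes f: "f \<in> Ar I" "tgt I f = p V"
  shows "R \<in> ftop Y f w \<longleftrightarrow> w \<in> Ob (fib Y f) \<and> sieve (fib Y f) w R \<and>
    (\<lambda>(_, _, m). m) ` R \<in> ftop X (src I f) (src E w)"
    and site_fib_over: "site (fib Y f) (ftop Y f)"
proof -
  let ?i = "src I f" and ?D = "slice (fib X (src I f)) (src E (cl f V))"
  have i: "?i \<in> Ob I" using f by simp
  have det: "detecting el (fib X ?i) (ftop X ?i)" by (rule U_site_detecting[OF u U_site_fib[OF i]])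
  interpret d1: discrete_fibration_site "fib X ?i" "ftop X ?i" ?D "slice_forget (fib X ?i)"
    by (rule site_slice_discrete_fibration[OF site_fib[OF i]])
  let ?J = "lift_topology ?D (ftop X ?i) (slice_forget (fib X ?i))"
  interpret d2: discrete_fibration_site ?D ?J "fib Y f" "fibre_to_slice X"
    by unfold_locales (rule fibre_to_slice_discrete_fibration[OF f])
  have ft: "ftop Y f = lift_topology (fib Y f) ?J (fibre_to_slice X)"
    using induced_topology_eq[OF d1.is_induced_topology_lift[OF det]]
      induced_topology_eq[OF d2.is_induced_topology_lift[OF d1.detecting_lift[OF det]]]
    by (simp add: slice_ftop_def Let_def)
  then show "site (fib Y f) (ftop Y f)" using d2.lift.site_axioms by simp
  have im: "far (slice_forget (fib X ?i)) ` far (fibre_to_slice X) ` R = (\<lambda>(_, _, m). m) ` R"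
    by (auto simp: image_image slice_forget_def fibre_to_slice_def case_prod_beta)
  show "R \<in> ftop Y f w \<longleftrightarrow> w \<in> Ob (fib Y f) \<and> sieve (fib Y f) w R \<and>
    (\<lambda>(_, _, m). m) ` R \<in> ftop X (src I f) (src E w)"
  proof (cases "w \<in> Ob (fib Y f) \<and> sieve (fib Y f) w R")
    case True
    then have w: "w \<in> Ar E" "tgt E w = V" "q w = f" by auto
    have "fvfac X w \<in> Ob ?D" using fvfac_over[OF w(1,2)] w by simp
    moreover have "sieve ?D (fvfac X w) (far (fibre_to_slice X) ` R)"
      using d2.image_sieve[of w R] True by simp
    ultimately show ?thesis
      using True im fvfac_over(3)[OF w(1,2)] by (simp only: ft lift_topology_def) simp
  qed (unfold ft lift_topology_def mem_Collect_eq, blast)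
qed

lemma btop_iff: "R \<in> btop Y f \<longleftrightarrow> f \<in> Ob Ic \<and> sieve Ic f R \<and> (\<lambda>(_, _, m). m) ` R \<in> btop X (src I f)"
  and site_bas_over: "site Ic (btop Y)"
proof -
  interpret d: discrete_fibration_site I "btop X" Ic "slice_forget I"
    by (rule site_slice_discrete_fibration[OF I.site_axioms])
  have "btop Y = lift_topology Ic (btop X) (slice_forget I)"
    using induced_topology_eq[OF d.is_induced_topology_lift[OF U_site_detecting[OF u U_site_I]]] by simp
  then show "R \<in> btop Y f \<longleftrightarrow> f \<in> Ob Ic \<and> sieve Ic f R \<and> (\<lambda>(_, _, m). m) ` R \<in> btop X (src I f)"
    "site Ic (btop Y)" using d.lift.site_axioms by (simp_all add: lift_topology_def slice_forget_def)
qed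

sublocale EV: discrete_fibration_site E "coev X" EV "slice_forget E"
  by (rule site_slice_discrete_fibration[OF E.site_axioms])

lemma topology_coev_over: "topology EV (coev Y)"
  unfolding coev_def Y_simps by (rule topology_generated[OF category_slice[OF catE]])

sublocale K: site EV "coev Y"
  by unfold_locales (rule category_slice[OF catE], rule topology_coev_over)

section \<open>Criteria for a sieve on \<open>E\<close> or on the slice over \<open>V\<close> to be
  co-evanescent covering\<close>

lemma coev_vertical:
  assumes "sieve E W R" "W \<in> Ob E" "T \<in> ftop X (p W) W" "T \<subseteq> R" shows "R \<in> coev X W"
proof -
  interpret F: site "fib X (p W)" "ftop X (p W)" by (rule site_fib) (use assms in simp)
  show ?thesis
    by (rule E.covering_family_superset[OF vertical_covering[OF _ F.covering_family_sieve[OF assms(3)]]])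
      (use assms in simp_all)
qed

lemma coev_cartesian:
  assumes "sieve E W R" "W \<in> Ob E" "T \<in> btop X (p W)" "\<And>h. h \<in> T \<Longrightarrow> cl h W \<in> R" shows "R \<in> coev X W"
  by (rule E.covering_family_superset[OF cartesian_covering[OF assms(2) I.covering_family_sieve[OF assms(3)]]])
    (use assms in auto)

text \<open>The lifts of the arrows of \<open>T\<close> form a sieve on \<open>w\<close> in the
  fibre of the slice, covering by \<open>ftop_iff\<close>; they are therefore one of the generating
  vertical families.\<close>

lemma coev_over_vertical:
  assumes w: "w \<in> Ar E" "tgt E w = V" and R: "sieve EV w R" and T: "T \<in> ftop X (p (src E w)) (src E w)"
    and TR: "\<And>t. t \<in> T \<Longrightarrow> (cmp E w t, w, t) \<in> R"
  shows "R \<in> coev Y w"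
proof -
  let ?f = "q w" and ?T = "(\<lambda>t. (cmp E w t, w, t)) ` T"
  have f: "?f \<in> Ar I" "tgt I ?f = p V" and i: "p (src E w) = src I ?f" "src I ?f \<in> Ob I" using w by simp_all
  interpret F: site "fib X (src I ?f)" "ftop X (src I ?f)" by (rule site_fib[OF i(2)])
  interpret Fw: site "fib Y ?f" "ftop Y ?f" by (rule site_fib_over[OF f])
  have Ts: "sieve (fib X (src I ?f)) (src E w) T" using F.cover_sieve T i by simp
  have t: "t \<in> Ar E" "q t = ide I (src I ?f)" "tgt E t = src E w" if "t \<in> T" for t
    using sieveD(1,2)[OF Ts that] by simp_all
  have "sieve (fib Y ?f) w ?T" unfolding sieve_def
  proof (intro conjI ballI impI subsetI)
    fix s assume "s \<in> ?T"
    then obtain t where s: "s = (cmp E w t, w, t)" "t \<in> T" by blast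
    then show "s \<in> {m \<in> Ar (fib Y ?f). tgt (fib Y ?f) m = w}" using t[OF s(2)] w f by simp
    fix g assume g: "g \<in> Ar (fib Y ?f)" "tgt (fib Y ?f) g = src (fib Y ?f) s"
    obtain a b h where gh: "g = (a, b, h)" by (cases g)
    have h: "h \<in> Ar E" "q h = ide I (src I ?f)" "tgt E h = src E t" "a = cmp E (cmp E w t) h" "b = cmp E w t"
      using g t[OF s(2)] w by (auto simp: gh s)
    have "cmp E t h \<in> T" using sieveD(3)[OF Ts s(2), of h] h by simp
    moreover have "cmp (fib Y ?f) s g = (cmp E w (cmp E t h), w, cmp E t h)"
      using h t[OF s(2)] w by (simp add: gh s E_assoc)
    ultimately show "cmp (fib Y ?f) s g \<in> ?T" by blast
  qed
  moreover have "(\<lambda>(_, _, m). m) ` ?T = T" by force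
  moreover have "w \<in> Ob (fib Y ?f)" using w by simp
  moreover have "?T \<in> ftop Y ?f w \<longleftrightarrow> w \<in> Ob (fib Y ?f) \<and> sieve (fib Y ?f) w ?T \<and>
    (\<lambda>(_, _, m). m) ` ?T \<in> ftop X (src I ?f) (src E w)" by (rule ftop_iff[OF f])
  ultimately have "?T \<in> ftop Y ?f w" using T i by (simp only: simp_thms)
  then have "(w, ?T) \<in> vertical_families Y"
    using Fw.covering_family_sieve f unfolding vertical_families_def by (fastforce simp del: Y_simps(5))
  then have "covering_family EV (coev Y) w ?T" unfolding coev_def Y_simps(1)
    by (intro generated_topology_covering) (use w t V in \<open>auto simp: category_slice catE\<close>)
  then show ?thesis by (rule K.covering_family_superset[OF _ R]) (use TR in auto)
qed

text \<open>The cartesian arrows \<open>cl h (src E w)\<close> lift to the chosen cartesian arrows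
  of the slice. Their images in the slice of \<open>I\<close> form the lift of \<open>T\<close>,
  which is covering by \<open>btop_iff\<close>.\<close>

lemma coev_over_cartesian:
  assumes w: "w \<in> Ar E" "tgt E w = V" and R: "sieve EV w R" and T: "T \<in> btop X (p (src E w))"
    and TR: "\<And>h. h \<in> T \<Longrightarrow> (cmp E w (cl h (src E w)), w, cl h (src E w)) \<in> R"
  shows "R \<in> coev Y w"
proof -
  let ?W = "src E w"
  let ?S = "(\<lambda>h. (cmp E w (cl h ?W), w, cl h ?W)) ` T"
  interpret B: site Ic "btop Y" by (rule site_bas_over)
  note Ts = I.cover_sieve[OF T]
  have h: "h \<in> Ar I" "tgt I h = p ?W" if "h \<in> T" for h using sieveD(1,2)[OF Ts that] .
  have c: "cl h ?W \<in> Ar E" "q (cl h ?W) = h" "tgt E (cl h ?W) = ?W" "p (src E (cl h ?W)) = src I h" if "h \<in> T" for h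
    using h[OF that] w by simp_all
  have sub: "?S \<subseteq> {m \<in> Ar EV. tgt EV m = w}" using c w by auto
  have im: "far (slice_proj X) ` ?S = (\<lambda>h. (cmp I (q w) h, q w, h)) ` T"
    unfolding image_image by (rule image_cong) (use c w in simp_all)
  have "sieve Ic (q w) ((\<lambda>h. (cmp I (q w) h, q w, h)) ` T)" unfolding sieve_def
  proof (intro conjI ballI impI subsetI)
    fix s assume "s \<in> (\<lambda>h. (cmp I (q w) h, q w, h)) ` T"
    then obtain t where s: "s = (cmp I (q w) t, q w, t)" "t \<in> T" by blast
    then show "s \<in> {m \<in> Ar Ic. tgt Ic m = q w}" using h[OF s(2)] w by simp
    fix g assume g: "g \<in> Ar Ic" "tgt Ic g = src Ic s"
    obtain a b k where gk: "g = (a, b, k)" by (cases g)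
    have k: "k \<in> Ar I" "tgt I k = src I t" "a = cmp I (cmp I (q w) t) k" "b = cmp I (q w) t"
      using g h[OF s(2)] w by (auto simp: gk s)
    have "cmp I t k \<in> T" using sieveD(3)[OF Ts s(2), of k] k by simp
    moreover have "cmp Ic s g = (cmp I (q w) (cmp I t k), q w, cmp I t k)"
      using k h[OF s(2)] w by (simp add: gk s I_assoc)
    ultimately show "cmp Ic s g \<in> (\<lambda>h. (cmp I (q w) h, q w, h)) ` T" by blast
  qed
  moreover have "(\<lambda>(_, _, m). m) ` (\<lambda>h. (cmp I (q w) h, q w, h)) ` T = T" by force
  ultimately have "(\<lambda>h. (cmp I (q w) h, q w, h)) ` T \<in> btop Y (q w)" using btop_iff w T by simp
  then have cov: "covering_family Ic (btop Y) (q w) (far (slice_proj X) ` ?S)"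
    unfolding im by (rule B.covering_family_sieve)
  have "\<exists>\<phi>. is_iso (fib Y (src Ic (far (slice_proj X) m))) \<phi> \<and> src EV \<phi> = src EV m \<and>
      tgt EV \<phi> = src EV (slice_clv X (far (slice_proj X) m) w) \<and> m = cmp EV (slice_clv X (far (slice_proj X) m) w) \<phi>"
    if m: "m \<in> ?S" for m
  proof -
    obtain k where k: "m = (cmp E w (cl k ?W), w, cl k ?W)" "k \<in> T" using m by blast
    show ?thesis
      by (rule exI[of _ "ide EV (src EV m)"])
        (use c[OF k(2)] w h[OF k(2)] in \<open>auto simp: k is_iso_def hom_iff intro!: bexI[of _ "ide EV (src EV m)"]\<close>)
  qed
  then have "(w, ?S) \<in> cartesian_families Y"
    using cov sub w unfolding cartesian_families_def Let_def by (simp del: Y_simps(6))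
  then have "covering_family EV (coev Y) w ?S" unfolding coev_def Y_simps(1)
    by (intro generated_topology_covering) (use w sub in \<open>auto simp: category_slice catE\<close>)
  then show ?thesis by (rule K.covering_family_superset[OF _ R]) (use TR in auto)
qed

text \<open>One member of a cartesian family over \<open>f\<close> already captures every arrow into
  \<open>W\<close> whose image factors through \<open>f\<close>: such an arrow factors through
  \<open>cl f W\<close>, and inserting \<open>\<phi>\<close> followed by its inverse rewrites it
  through the member.\<close>

lemma sieve_cartesian_mem:
  assumes R: "sieve E W R" and k: "cmp E (cl f W) \<phi> \<in> R" and f: "f \<in> Ar I" "p W = tgt I f" "W \<in> Ob E"
    and i: "\<phi> \<in> Ar E" "\<psi> \<in> Ar E" "tgt E \<phi> = src E (cl f W)" "src E \<psi> = tgt E \<phi>" "tgt E \<psi> = src E \<phi>"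
      "cmp E \<phi> \<psi> = ide E (src E (cl f W))"
    and n: "n \<in> Ar E" "tgt E n = W" "q n = cmp I f h" "h \<in> Ar I" "tgt I h = src I f"
  shows "n \<in> R"
proof -
  obtain r where r: "r \<in> Ar E" "tgt E r = src E (cl f W)" "cmp E (cl f W) r = n"
    using cl_factor[OF n(1,3) f(1) n(4,5)] n(2) by metis
  have c: "cl f W \<in> Ar E" "tgt E (cl f W) = W" using f by simp_all
  \<comment> \<open>The identity of \<open>src E (cl f W)\<close> is written as the composite of
    \<open>\<phi>\<close> and \<open>\<psi>\<close>.\<close>
  have "cmp E \<phi> (cmp E \<psi> r) = cmp E (cmp E \<phi> \<psi>) r"
    using i(1-5) r(1,2) by (intro E_assoc[symmetric]) simp_all
  then have "cmp E (cmp E (cl f W) \<phi>) (cmp E \<psi> r) = cmp E (cl f W) (cmp E (cmp E \<phi> \<psi>) r)"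
    using i(1-5) r(1,2) c by (simp add: E_assoc)
  also have "\<dots> = n" using r i c by simp
  finally have n': "n = cmp E (cmp E (cl f W) \<phi>) (cmp E \<psi> r)" ..
  show ?thesis unfolding n' by (rule sieveD(3)[OF R k]) (use i r c in simp_all)
qed

text \<open>By \<open>ftop_iff\<close> the vertical parts of the sieve generated in the fibre
  already cover the source of \<open>w\<close> there, and the image in \<open>E\<close> of the
  larger sieve generated in the slice contains them.\<close>

lemma vertical_families_lift:
  assumes "(w, S) \<in> vertical_families Y"
  shows "covering_family EV (lift_topology EV (coev X) (slice_forget E)) w S"
proof -
  obtain f where f: "f \<in> Ar I" "tgt I f = p V" and S: "covering_family (fib Y f) (ftop Y f) w S"
    using assms by (auto simp: vertical_families_def simp del: Y_simps(5))
  have S': "w \<in> Ob (fib Y f)" "S \<subseteq> {m \<in> Ar (fib Y f). tgt (fib Y f) m = w}" "generated_sieve (fib Y f) S \<in> ftop Y f w"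
    using S unfolding covering_family_iff by blast+
  have w: "w \<in> Ar E" "tgt E w = V" "q w = f" using S'(1) by auto
  have pw: "p (src E w) = src I f" using prj_simps(5)[OF w(1)] w(3) by simp
  have sub: "S \<subseteq> {m \<in> Ar EV. tgt EV m = w}" using S'(2) by auto
  note sv = sieve_generated_sieve[OF category_slice[OF catE] sub]
  have T: "(\<lambda>(_, _, m). m) ` generated_sieve (fib Y f) S \<in> ftop X (src I f) (src E w)"
    using S'(3) ftop_iff[OF f] by blast
  have "generated_sieve (fib Y f) S \<subseteq> generated_sieve EV S" by (auto simp: generated_sieve_def)
  then have "(\<lambda>(_, _, m). m) ` generated_sieve (fib Y f) S \<subseteq> far (slice_forget E) ` generated_sieve EV S"
    by (simp add: slice_forget_def image_mono)
  moreover have "sieve E (src E w) (far (slice_forget E) ` generated_sieve EV S)"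
    using EV.image_sieve[OF sv] by simp
  ultimately have "far (slice_forget E) ` generated_sieve EV S \<in> coev X (src E w)"
    using coev_vertical T pw w by (metis E_simps(1))
  then show ?thesis using sv sub w by (simp add: covering_family_iff lift_topology_def)
qed

text \<open>It suffices to find in the image sieve the chosen cartesian arrow over each
  \<open>h\<close> of the base sieve. Such an \<open>h\<close> factors through the image of some
  member of \<open>S\<close>, and \<open>sieve_cartesian_mem\<close> applies to that member.\<close>

lemma cartesian_families_lift:
  assumes "(w, S) \<in> cartesian_families Y"
  shows "covering_family EV (lift_topology EV (coev X) (slice_forget E)) w S"
proof -
  have w: "w \<in> Ar E" "tgt E w = V" and sub: "S \<subseteq> {m \<in> Ar EV. tgt EV m = w}"
    and cov: "covering_family Ic (btop Y) (q w) (far (slice_proj X) ` S)"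
    and iso: "\<And>m. m \<in> S \<Longrightarrow> \<exists>\<phi>. is_iso (fib Y (src Ic (far (slice_proj X) m))) \<phi> \<and> src EV \<phi> = src EV m \<and>
      tgt EV \<phi> = src EV (slice_clv X (far (slice_proj X) m) w) \<and> m = cmp EV (slice_clv X (far (slice_proj X) m) w) \<phi>"
    using assms unfolding cartesian_families_def Let_def by (auto simp del: Y_simps(5,6))
  note sv = sieve_generated_sieve[OF category_slice[OF catE] sub]
  let ?W = "src E w" and ?R = "far (slice_forget E) ` generated_sieve EV S"
  have R: "sieve E ?W ?R" using EV.image_sieve[OF sv] by simp
  have "generated_sieve Ic (far (slice_proj X) ` S) \<in> btop Y (q w)" using cov by (simp add: covering_family_iff)
  then have T: "(\<lambda>(_, _, m). m) ` generated_sieve Ic (far (slice_proj X) ` S) \<in> btop X (p ?W)"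
    using btop_iff w by simp
  have "?R \<in> coev X ?W"
  proof (rule coev_cartesian[OF R _ T])
    fix h assume "h \<in> (\<lambda>(_, _, m). m) ` generated_sieve Ic (far (slice_proj X) ` S)"
    then obtain m g where m: "m \<in> S" "g \<in> Ar Ic" "tgt Ic g = src Ic (far (slice_proj X) m)"
      "h = (\<lambda>(_, _, m). m) (cmp Ic (far (slice_proj X) m) g)"
      unfolding generated_sieve_def by blast
    obtain w1 w2 k where k': "m = (w1, w2, k)" by (cases m)
    obtain g1 g2 g3 where g': "g = (g1, g2, g3)" by (cases g)
    have mA: "m \<in> Ar EV" "tgt EV m = w" using sub m(1) by auto
    have k: "w1 \<in> Ar E" "tgt E w1 = V" "k \<in> Ar E" "tgt E k = ?W" "w1 = cmp E w k" "m = (w1, w, k)" "src E w1 = src E k"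
      using mA by (auto simp: k')
    have g: "g3 \<in> Ar I" "tgt I g3 = src I (q k)" "h = cmp I (q k) g3"
      using m(2-4) k w by (auto simp: k(6) g')
    obtain \<phi> where ph: "is_iso (fib Y (src Ic (far (slice_proj X) m))) \<phi>" "src EV \<phi> = src EV m"
      "tgt EV \<phi> = src EV (slice_clv X (far (slice_proj X) m) w)" "m = cmp EV (slice_clv X (far (slice_proj X) m) w) \<phi>"
      using iso[OF m(1)] by blast
    obtain a b f3 where f3: "\<phi> = (a, b, f3)" by (cases \<phi>)
    have c: "cl (q k) ?W \<in> Ar E" "tgt E (cl (q k) ?W) = ?W" using w k by simp_all
    obtain n where n: "n \<in> Ar EV" "src EV n = tgt EV \<phi>" "tgt EV n = src EV \<phi>" "cmp EV \<phi> n = ide EV (tgt EV \<phi>)" and pA: "\<phi> \<in> Ar EV"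
      using ph(1) unfolding is_iso_def by (auto simp: hom_iff)
    obtain n1 n2 n3 where n': "n = (n1, n2, n3)" by (cases n)
    have ab: "a = w1" "b = cmp E w (cl (q k) ?W)" "k = cmp E (cl (q k) ?W) f3"
      using ph(2-4) by (auto simp: f3 k(6))
    have f3': "f3 \<in> Ar E" "tgt E f3 = src E (cl (q k) ?W)" "src E f3 = src E w1" using pA w c ab by (auto simp: f3)
    have n3: "n3 \<in> Ar E" "src E n3 = src E (cl (q k) ?W)" "tgt E n3 = src E w1"
      "cmp E f3 n3 = ide E (src E (cl (q k) ?W))" using n w c ab(1,2) by (auto simp: f3 n')
    have "k \<in> ?R"
    proof -
      have "m \<in> generated_sieve EV S" by (rule mem_generated_sieve[OF category_slice[OF catE] m(1) mA(1)])
      then show ?thesis using k(6) by (force simp: slice_forget_def)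
    qed
    then have kR: "cmp E (cl (q k) ?W) f3 \<in> ?R" using ab(3) by simp
    have hA: "h \<in> Ar I" "tgt I h = p ?W" using g k w by simp_all
    \<comment> \<open>Here \<open>h\<close> is the composite of \<open>q k\<close> and
      \<open>g3\<close>, so \<open>cl h ?W\<close> is an arrow over a composite through the member
      with underlying arrow \<open>k\<close>.\<close>
    show "cl h ?W \<in> ?R"
      by (rule sieve_cartesian_mem[OF R kR, of n3 _ g3]) (use hA g w k f3' n3 in simp_all)
  qed (use w in simp)
  then show ?thesis using sv sub w by (simp add: covering_family_iff lift_topology_def)
qed

text \<open>The topology \<open>descended_topology\<close> contains the families generating the co-evanescent topology of
  \<open>E\<close>; hence a sieve of \<open>E\<^bsub>/V\<^esub>\<close> whose image in \<open>E\<close> is covering is itself covering.\<close>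

definition lifted_sieve :: "'m set \<Rightarrow> 'm \<Rightarrow> 'm \<Rightarrow> ('m \<times> 'm \<times> 'm) set" where
  "lifted_sieve R f v = {(a, b, m). (a, b, m) \<in> Ar EV \<and> b = v \<and> cmp E f m \<in> R}"

definition descended_topology :: "'o \<Rightarrow> 'm set set" where
  "descended_topology W = {R. W \<in> Ob E \<and> sieve E W R \<and>
     (\<forall>f\<in>Ar E. tgt E f = W \<longrightarrow> (\<forall>v\<in>Ar E. src E v = src E f \<and> tgt E v = V \<longrightarrow> lifted_sieve R f v \<in> coev Y v))}"

lemma sieve_lifted_sieve:
  assumes "sieve E W R" "f \<in> Ar E" "tgt E f = W" "v \<in> Ar E" "src E v = src E f" "tgt E v = V"
  shows "sieve EV v (lifted_sieve R f v)"
  unfolding sieve_def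
proof (intro conjI ballI impI subsetI)
  fix s assume s: "s \<in> lifted_sieve R f v"
  obtain a b m where m: "s = (a, b, m)" by (cases s)
  have sA: "(a, b, m) \<in> Ar EV" "b = v" "cmp E f m \<in> R"
    using s unfolding lifted_sieve_def m by blast+
  then show "s \<in> {m \<in> Ar EV. tgt EV m = v}" unfolding m by (simp only: mem_Collect_eq slice_simps(4) simp_thms)
  fix g assume g: "g \<in> Ar EV" "tgt EV g = src EV s"
  obtain a' b' n where n: "g = (a', b', n)" by (cases g)
  have "cmp EV s g \<in> Ar EV" using K.c_simps(6)[OF g(1) _ g(2)] sA(1) m by blast
  moreover have "cmp E f (cmp E m n) = cmp E (cmp E f m) n" "cmp E (cmp E f m) n \<in> R"
    using s g assms sieveD(3)[OF assms(1), of "cmp E f m" n] by (auto simp: lifted_sieve_def m n E_assoc)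
  ultimately show "cmp EV s g \<in> lifted_sieve R f v" using s by (auto simp: lifted_sieve_def m n)
qed

text \<open>Stability under pullback is built in by quantifying over all \<open>f\<close>. For
  transitivity, the quantification over the structure arrow \<open>v\<close> matters: after
  restricting along a member of the lifted sieve, the structure arrow becomes the source
  \<open>a\<close> of that member.\<close>

lemma topology_descended: "topology E descended_topology"
  unfolding topology_def
proof (intro conjI ballI allI impI; (elim conjE)?)
  fix W assume W: "W \<in> Ob E"
  show "{m \<in> Ar E. tgt E m = W} \<in> descended_topology W"
  proof -
    have "lifted_sieve {m \<in> Ar E. tgt E m = W} f v = {m \<in> Ar EV. tgt EV m = v}"
      if "f \<in> Ar E" "tgt E f = W" "v \<in> Ar E" "src E v = src E f" "tgt E v = V" for f v
      using that by (auto simp: lifted_sieve_def)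
    then show ?thesis using W K.max_cover by (auto simp: descended_topology_def sieve_def)
  qed
  fix R assume R: "R \<in> descended_topology W"
  show Rs: "sieve E W R" using R by (simp add: descended_topology_def)
  show "sieve_pull E R g \<in> descended_topology (src E g)" if g: "g \<in> Ar E" "tgt E g = W" for g
  proof -
    have "lifted_sieve (sieve_pull E R g) f v = lifted_sieve R (cmp E g f) v"
      if "f \<in> Ar E" "tgt E f = src E g" "v \<in> Ar E" "src E v = src E f" "tgt E v = V" for f v
      using that g by (auto simp: lifted_sieve_def sieve_pull_def E_assoc)
    then show ?thesis using R g E.sieve_sieve_pull[OF Rs g] by (simp add: descended_topology_def)
  qed
  show "R' \<in> descended_topology W" if R': "sieve E W R'"
    and loc: "\<forall>f\<in>R. sieve_pull E R' f \<in> descended_topology (src E f)" for R'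
    unfolding descended_topology_def mem_Collect_eq
  proof (intro conjI ballI impI W R'; elim conjE)
    fix f v assume f: "f \<in> Ar E" "tgt E f = W" and v: "v \<in> Ar E" "src E v = src E f" "tgt E v = V"
    have L: "lifted_sieve R f v \<in> coev Y v" using R f v by (simp add: descended_topology_def)
    show "lifted_sieve R' f v \<in> coev Y v"
    proof (rule K.local_cover[OF L sieve_lifted_sieve[OF R' f v]])
      fix s assume s: "s \<in> lifted_sieve R f v"
      obtain a b m where m: "s = (a, b, m)" by (cases s)
      have m': "b = v" "a \<in> Ar E" "tgt E a = V" "src E a = src E m" "m \<in> Ar E" "tgt E m = src E f" "cmp E v m = a"
        "cmp E f m \<in> R"
        using s v by (auto simp: lifted_sieve_def m)
      \<comment> \<open>The hypothesis at the member \<open>cmp E f m\<close> of \<open>R\<close> is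
        used at the identity of its source with structure arrow \<open>a\<close>, which yields a
        cover of \<open>a\<close> in the slice.\<close>
      have "sieve_pull E R' (cmp E f m) \<in> descended_topology (src E m)" using loc m' f by fastforce
      then have "lifted_sieve (sieve_pull E R' (cmp E f m)) (ide E (src E m)) a \<in> coev Y a"
        using m' unfolding descended_topology_def by simp
      moreover have "cmp EV s t \<in> lifted_sieve R' f v"
        if "t \<in> lifted_sieve (sieve_pull E R' (cmp E f m)) (ide E (src E m)) a" for t
      proof -
        obtain a' b' n where n: "t = (a', b', n)" by (cases t)
        have t: "t \<in> Ar EV" "b' = a" "n \<in> Ar E" "tgt E n = src E m" "cmp E (cmp E f m) n \<in> R'"
          using that m' by (auto simp: lifted_sieve_def n sieve_pull_def)
        have "cmp EV s t \<in> Ar EV" using K.c_simps(6)[of t s] s t by (auto simp: lifted_sieve_def m n)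
        then show ?thesis using t m' f by (simp add: lifted_sieve_def m n E_assoc)
      qed
      ultimately have "\<exists>T\<in>coev Y a. \<forall>g\<in>T. cmp EV s g \<in> lifted_sieve R' f v" by blast
      moreover have "src EV s = a" by (simp add: m)
      ultimately show "\<exists>T\<in>coev Y (src EV s). \<forall>g\<in>T. cmp EV s g \<in> lifted_sieve R' f v" by (simp only:)
    qed
  qed
qed (simp add: descended_topology_def)

lemma lifted_sieve_mem:
  assumes "f \<in> Ar E" "v \<in> Ar E" "src E v = src E f" "tgt E v = V" "m \<in> Ar E" "tgt E m = src E f" "cmp E f m \<in> R"
  shows "(cmp E v m, v, m) \<in> lifted_sieve R f v"
  using assms by (simp add: lifted_sieve_def)

text \<open>Along \<open>f\<close> over \<open>g\<close>, continuity of the inverse image functor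
  sends the vertical covering of \<open>W\<close> to one of its inverse image by \<open>g\<close>.
  Pulling this back along the vertical factor of \<open>f\<close> covers the source of
  \<open>f\<close> in its fibre, and so covers \<open>v\<close> vertically.\<close>

lemma vertical_families_descended:
  assumes "(W, S) \<in> vertical_families X" shows "covering_family E descended_topology W S"
proof -
  obtain i where i: "i \<in> Ob I" and S: "covering_family (fib X i) (ftop X i) W S"
    using assms by (auto simp: vertical_families_def)
  have W: "W \<in> Ob E" "p W = i" and S': "S \<subseteq> {m \<in> Ar (fib X i). tgt (fib X i) m = W}"
    using S by (auto simp: covering_family_iff)
  have sub: "S \<subseteq> {m \<in> Ar E. tgt E m = W}" using S' by auto
  let ?R = "generated_sieve E S"
  have R: "sieve E W ?R" by (rule sieve_generated_sieve[OF catE sub])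
  have "lifted_sieve ?R f v \<in> coev Y v"
    if f: "f \<in> Ar E" "tgt E f = W" and v: "v \<in> Ar E" "src E v = src E f" "tgt E v = V" for f v
  proof -
    let ?g = "q f" and ?j = "p (src E f)"
    have g: "?g \<in> Ar I" "src I ?g = ?j" "tgt I ?g = i" "?j \<in> Ob I" using f W by simp_all
    interpret F: site "fib X ?j" "ftop X ?j" by (rule site_fib[OF g(4)])
    have cont: "continuous el (fib X i) (ftop X i) (fib X ?j) (ftop X ?j) (fpull X ?g)"
      using fcont[OF g(1)] g by simp
    have cov: "covering_family (fib X ?j) (ftop X ?j) (src E (cl ?g W)) (far (fpull X ?g) ` S)"
      using continuous_covering_family[OF site_fib[OF i] F.site_axioms cont U_site_detecting[OF u U_site_fib[OF g(4)]] S]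
      by simp
    note vf = fvfac[OF f(1), unfolded f(2)]
    let ?T = "sieve_pull (fib X ?j) (generated_sieve (fib X ?j) (far (fpull X ?g) ` S)) (fvfac X f)"
    have T: "?T \<in> ftop X ?j (src E f)"
      using F.pull_cover[of "generated_sieve (fib X ?j) (far (fpull X ?g) ` S)" "src E (cl ?g W)" "fvfac X f"] cov vf by (simp add: covering_family_iff)
    have "cmp E f t \<in> ?R" "t \<in> Ar E" "tgt E t = src E f" if t: "t \<in> ?T" for t
    proof -
      have t': "t \<in> Ar E" "tgt E t = src E f" "cmp E (fvfac X f) t \<in> generated_sieve (fib X ?j) (far (fpull X ?g) ` S)"
        using t vf by (auto simp: sieve_pull_def)
      then show "t \<in> Ar E" "tgt E t = src E f" by simp_all
      obtain s r where s: "s \<in> S" "r \<in> Ar E" "tgt E r = src E (far (fpull X ?g) s)"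
        "cmp E (fvfac X f) t = cmp E (far (fpull X ?g) s) r"
        using t'(3) unfolding generated_sieve_def by auto
      have s': "s \<in> Ar E" "q s = ide I (tgt I ?g)" "tgt E s = W" using S' s(1) g by auto
      note fp = fpull_arrow[OF g(1) s'(1,2)]
      have ps: "p (src E s) = tgt I ?g" using vert[OF s'(1,2)] g i by simp
      have cs: "cl ?g (src E s) \<in> Ar E" "tgt E (cl ?g (src E s)) = src E s" using ps g s' by simp_all
      have cW: "cl ?g W \<in> Ar E" using g W by simp
      \<comment> \<open>The naturality square of the cartesian arrows over \<open>?g\<close> moves
        \<open>s\<close> to the left, showing that the composite of \<open>f\<close> and
        \<open>t\<close> factors through the original family.\<close>
      have "cmp E f t = cmp E (cmp E (cl ?g W) (fvfac X f)) t" using vf by simp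
      also have "\<dots> = cmp E (cl ?g W) (cmp E (fvfac X f) t)"
        using vf t' cW by (intro E_assoc) simp_all
      also have "\<dots> = cmp E (cl ?g W) (cmp E (far (fpull X ?g) s) r)" unfolding s(4) ..
      also have "\<dots> = cmp E (cmp E (cl ?g W) (far (fpull X ?g) s)) r"
        using fp s s' cW by (intro E_assoc[symmetric]) simp_all
      also have "\<dots> = cmp E (cmp E s (cl ?g (src E s))) r" using fp(5) s'(3) by simp
      also have "\<dots> = cmp E s (cmp E (cl ?g (src E s)) r)"
        using fp s s' cs by (intro E_assoc) simp_all
      finally have "cmp E f t = cmp E s (cmp E (cl ?g (src E s)) r)" .
      moreover have "cmp E (cl ?g (src E s)) r \<in> Ar E" "tgt E (cmp E (cl ?g (src E s)) r) = src E s"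
        using fp s cs by simp_all
      ultimately show "cmp E f t \<in> ?R" unfolding generated_sieve_def using s(1) by blast
    qed
    then have mem: "(cmp E v t, v, t) \<in> lifted_sieve ?R f v" if "t \<in> ?T" for t
      using lifted_sieve_mem f v that by blast
    show ?thesis
      by (rule coev_over_vertical[OF v(1,3) sieve_lifted_sieve[OF R f v], of ?T]) (use T mem v(2) in simp_all)
  qed
  then show ?thesis using W sub R by (simp add: covering_family_iff descended_topology_def)
qed

text \<open>Membership in the sieve generated by a cartesian family can be tested on images in
  \<open>I\<close>. Pulling the base covering back along \<open>q f\<close> therefore gives a
  cartesian covering of the source of \<open>f\<close> whose composites with \<open>f\<close> stay
  in the sieve.\<close>

lemma cartesian_families_descended:
  assumes "(W, S) \<in> cartesian_families X" shows "covering_family E descended_topology W S"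
proof -
  have W: "W \<in> Ob E" and sub: "S \<subseteq> {m \<in> Ar E. tgt E m = W}"
    and cov: "covering_family I (btop X) (p W) (q ` S)"
    and iso: "\<And>m. m \<in> S \<Longrightarrow> \<exists>\<phi>. is_iso (fib X (src I (q m))) \<phi> \<and> src E \<phi> = src E m \<and>
      tgt E \<phi> = src E (cl (q m) W) \<and> m = cmp E (cl (q m) W) \<phi>"
    using assms unfolding cartesian_families_def Let_def by auto
  let ?R = "generated_sieve E S"
  have R: "sieve E W ?R" by (rule sieve_generated_sieve[OF catE sub])
  \<comment> \<open>An arrow whose image factors through that of a member \<open>m\<close> factors
    through \<open>m\<close> itself, because \<open>m\<close> is cartesian up to an
    isomorphism.\<close>
  have n_mem: "n \<in> ?R" if n: "n \<in> Ar E" "tgt E n = W" "q n \<in> generated_sieve I (q ` S)" for n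
  proof -
    obtain m h where m: "m \<in> S" "q n = cmp I (q m) h" "h \<in> Ar I" "tgt I h = src I (q m)"
      using n(3) unfolding generated_sieve_def by blast
    have m': "m \<in> Ar E" "tgt E m = W" using sub m(1) by auto
    obtain \<phi> where ph: "is_iso (fib X (src I (q m))) \<phi>" "tgt E \<phi> = src E (cl (q m) W)" "m = cmp E (cl (q m) W) \<phi>"
      using iso[OF m(1)] by blast
    obtain \<psi> where ps: "\<phi> \<in> Ar E" "\<psi> \<in> Ar E" "src E \<psi> = tgt E \<phi>" "tgt E \<psi> = src E \<phi>" "cmp E \<phi> \<psi> = ide E (tgt E \<phi>)"
      using ph(1) unfolding is_iso_def by (auto simp: hom_iff)
    have "m \<in> ?R" by (rule mem_generated_sieve[OF catE m(1) m'(1)])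
    then have "cmp E (cl (q m) W) \<phi> \<in> ?R" using ph(3) by simp
    then show ?thesis
      by (rule sieve_cartesian_mem[OF R, of "q m" \<phi> \<psi> n h]) (use W m m' n ph(2) ps in simp_all)
  qed
  have "lifted_sieve ?R f v \<in> coev Y v"
    if f: "f \<in> Ar E" "tgt E f = W" and v: "v \<in> Ar E" "src E v = src E f" "tgt E v = V" for f v
  proof -
    let ?T = "sieve_pull I (generated_sieve I (q ` S)) (q f)"
    have T: "?T \<in> btop X (p (src E f))"
      using I.pull_cover[of "generated_sieve I (q ` S)" "p W" "q f"] cov f by (simp add: covering_family_iff)
    have mem: "(cmp E v (cl h (src E v)), v, cl h (src E v)) \<in> lifted_sieve ?R f v" if h: "h \<in> ?T" for h
    proof -
      have h': "h \<in> Ar I" "tgt I h = p (src E f)" "cmp I (q f) h \<in> generated_sieve I (q ` S)"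
        using h f by (auto simp: sieve_pull_def)
      have c: "cl h (src E f) \<in> Ar E" "tgt E (cl h (src E f)) = src E f" "q (cl h (src E f)) = h"
        using h' f by simp_all
      show ?thesis unfolding v(2)
        by (rule lifted_sieve_mem[OF f(1) v]) (use c n_mem f h' in simp_all)
    qed
    show ?thesis
      by (rule coev_over_cartesian[OF v(1,3) sieve_lifted_sieve[OF R f v], of ?T]) (use T mem v(2) in simp_all)
  qed
  then show ?thesis using W sub R by (simp add: covering_family_iff descended_topology_def)
qed

theorem coev_over: "coev Y = lift_topology EV (coev X) (slice_forget E)"
proof (intro ext equalityI subsetI)
  fix w R assume "R \<in> coev Y w"
  then show "R \<in> lift_topology EV (coev X) (slice_forget E) w"
    unfolding coev_def[of Y] Y_simps(1)
    by (rule generated_topology_least[OF _ EV.topology_lift])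
      (use vertical_families_lift cartesian_families_lift in blast)
next
  fix w R assume "R \<in> lift_topology EV (coev X) (slice_forget E) w"
  then have w: "w \<in> Ar E" "tgt E w = V" and R: "sieve EV w R" and "far (slice_forget E) ` R \<in> coev X (src E w)"
    by (simp_all add: lift_topology_def)
  then have "far (slice_forget E) ` R \<in> descended_topology (src E w)"
    unfolding coev_def[of X]
    by (intro generated_topology_least[OF _ topology_descended])
      (use vertical_families_descended cartesian_families_descended in blast)+
  \<comment> \<open>Membership in the descended topology is evaluated at the identity of the source,
    with \<open>w\<close> itself as structure arrow; by unique lifting this gives back only arrows
    of \<open>R\<close>.\<close>
  then have "lifted_sieve (far (slice_forget E) ` R) (ide E (src E w)) w \<in> coev Y w"
    using w by (simp add: descended_topology_def)
  moreover have "lifted_sieve (far (slice_forget E) ` R) (ide E (src E w)) w \<subseteq> R"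
  proof
    fix s assume s: "s \<in> lifted_sieve (far (slice_forget E) ` R) (ide E (src E w)) w"
    obtain a b m where m: "s = (a, b, m)" by (cases s)
    have a: "(a, b, m) \<in> Ar EV" "b = w" "cmp E (ide E (src E w)) m \<in> far (slice_forget E) ` R"
      using s unfolding lifted_sieve_def m by blast+
    moreover have "cmp E (ide E (src E w)) m = far (slice_forget E) s" using a(1,2) by (simp add: m)
    ultimately have "s \<in> Ar EV" "tgt EV s = w" "far (slice_forget E) s \<in> far (slice_forget E) ` R"
      by (simp_all add: m)
    then show "s \<in> R" using EV.mem_image_sieve[OF R] by blast
  qed
  ultimately show "R \<in> coev Y w" by (rule K.superset_cover[OF _ R])
qed

lemma coev_over_induced: "is_induced_topology el EV E (coev X) (slice_forget E) (coev Y)"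
  unfolding coev_over by (rule EV.is_induced_topology_lift[OF U_site_detecting[OF u U_site_E]])

end

section \<open>Equivalences of categories\<close>

lemma is_isoE:
  assumes "is_iso C m"
  obtains n where "m \<in> Ar C" "n \<in> Ar C" "src C n = tgt C m" "tgt C n = src C m"
    "cmp C n m = ide C (src C m)" "cmp C m n = ide C (tgt C m)"
  using assms unfolding is_iso_def by (auto simp: hom_iff)

lemma is_isoI:
  "m \<in> Ar C \<Longrightarrow> n \<in> Ar C \<Longrightarrow> src C n = tgt C m \<Longrightarrow> tgt C n = src C m \<Longrightarrow>
   cmp C n m = ide C (src C m) \<Longrightarrow> cmp C m n = ide C (tgt C m) \<Longrightarrow> is_iso C m"
  unfolding is_iso_def by (auto simp: hom_iff)

lemma isomorphic_functors_sym:
  assumes "isomorphic_functors C D F G" shows "isomorphic_functors C D G F"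
proof -
  have F: "is_functor C D F" and G: "is_functor C D G" using assms by (simp_all add: isomorphic_functors_def)
  note f = functor_simps[OF F] and g = functor_simps[OF G]
  note c = category_simps[OF f(1)] and d = category_simps[OF f(2)]
  obtain \<tau> where t: "\<And>X. X \<in> Ob C \<Longrightarrow> \<tau> X \<in> hom D (fob F X) (fob G X) \<and> is_iso D (\<tau> X)"
    "\<And>m. m \<in> Ar C \<Longrightarrow> cmp D (\<tau> (tgt C m)) (far F m) = cmp D (far G m) (\<tau> (src C m))"
    using assms unfolding isomorphic_functors_def by blast
  have "\<forall>X\<in>Ob C. \<exists>n. n \<in> Ar D \<and> src D n = fob G X \<and> tgt D n = fob F X \<and>
      cmp D n (\<tau> X) = ide D (fob F X) \<and> cmp D (\<tau> X) n = ide D (fob G X)"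
    using t(1) by (force simp: hom_iff elim!: is_isoE)
  then obtain \<sigma> where s: "\<forall>X\<in>Ob C. \<sigma> X \<in> Ar D \<and> src D (\<sigma> X) = fob G X \<and> tgt D (\<sigma> X) = fob F X \<and>
      cmp D (\<sigma> X) (\<tau> X) = ide D (fob F X) \<and> cmp D (\<tau> X) (\<sigma> X) = ide D (fob G X)"
    by (rule bchoice[THEN exE])
  have "cmp D (\<sigma> (tgt C m)) (far G m) = cmp D (far F m) (\<sigma> (src C m))" if m: "m \<in> Ar C" for m
  proof -
    let ?s = "\<sigma> (src C m)" and ?t = "\<sigma> (tgt C m)" and ?a = "\<tau> (src C m)" and ?b = "\<tau> (tgt C m)"
    have X: "src C m \<in> Ob C" "tgt C m \<in> Ob C" using c m by simp_all
    have ss: "?s \<in> Ar D" "src D ?s = fob G (src C m)" "tgt D ?s = fob F (src C m)" "cmp D ?a ?s = ide D (fob G (src C m))"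
      "?t \<in> Ar D" "src D ?t = fob G (tgt C m)" "tgt D ?t = fob F (tgt C m)" "cmp D ?t ?b = ide D (fob F (tgt C m))"
      using s X by blast+
    have tt: "?a \<in> Ar D" "src D ?a = fob F (src C m)" "tgt D ?a = fob G (src C m)"
      "?b \<in> Ar D" "src D ?b = fob F (tgt C m)" "tgt D ?b = fob G (tgt C m)"
      using t(1) X by (auto simp: hom_iff)
    have "cmp D ?t (far G m) = cmp D ?t (cmp D (far G m) (cmp D ?a ?s))"
      using ss g m by (simp add: d)
    also have "\<dots> = cmp D ?t (cmp D (cmp D (far G m) ?a) ?s)"
      using ss tt g m by (simp add: d cmp_assoc[OF f(2)])
    also have "\<dots> = cmp D ?t (cmp D (cmp D ?b (far F m)) ?s)" using t(2)[OF m] by simp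
    also have "\<dots> = cmp D (cmp D ?t ?b) (cmp D (far F m) ?s)"
      using ss(1-3,5-7) tt f m by (simp add: d cmp_assoc[OF f(2)])
    also have "\<dots> = cmp D (far F m) ?s" using ss f m by (simp add: d)
    finally show ?thesis .
  qed
  moreover have "\<sigma> X \<in> hom D (fob G X) (fob F X) \<and> is_iso D (\<sigma> X)" if X: "X \<in> Ob C" for X
    using bspec[OF s X] t(1)[OF X] is_isoI[of "\<sigma> X" D "\<tau> X"] by (auto simp: hom_iff)
  ultimately show ?thesis unfolding isomorphic_functors_def using F G by blast
qed

lemma is_iso_comp:
  assumes "category D" "is_iso D m" "is_iso D n" "tgt D m = src D n" shows "is_iso D (cmp D n m)"
proof -
  note d = category_simps[OF assms(1)] and a = cmp_assoc[OF assms(1)]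
  obtain m' where m: "m \<in> Ar D" "m' \<in> Ar D" "src D m' = tgt D m" "tgt D m' = src D m"
    "cmp D m' m = ide D (src D m)" "cmp D m m' = ide D (tgt D m)" using assms(2) by (rule is_isoE)
  obtain n' where n: "n \<in> Ar D" "n' \<in> Ar D" "src D n' = tgt D n" "tgt D n' = src D n"
    "cmp D n' n = ide D (src D n)" "cmp D n n' = ide D (tgt D n)" using assms(3) by (rule is_isoE)
  have "cmp D (cmp D m' n') (cmp D n m) = cmp D m' (cmp D (cmp D n' n) m)"
    using m(1-4) n(1-4) assms(4) by (simp add: d a)
  also have "\<dots> = ide D (src D m)" using m n assms(4) by (simp add: d)
  finally have 1: "cmp D (cmp D m' n') (cmp D n m) = ide D (src D m)" .
  have "cmp D (cmp D n m) (cmp D m' n') = cmp D n (cmp D (cmp D m m') n')"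
    using m(1-4) n(1-4) assms(4) by (simp add: d a)
  also have "\<dots> = ide D (tgt D n)" using m n assms(4) by (simp add: d)
  finally have 2: "cmp D (cmp D n m) (cmp D m' n') = ide D (tgt D n)" .
  show ?thesis
    by (rule is_isoI[of _ _ "cmp D m' n'"]) (use 1 2 m n assms(4) in \<open>simp_all add: d\<close>)
qed

lemma isomorphic_functors_trans:
  assumes "isomorphic_functors C D F G" "isomorphic_functors C D G H" shows "isomorphic_functors C D F H"
proof -
  have F: "is_functor C D F" and G: "is_functor C D G" and H: "is_functor C D H"
    using assms by (simp_all add: isomorphic_functors_def)
  note f = functor_simps[OF F] and g = functor_simps[OF G] and h = functor_simps[OF H]
  note c = category_simps[OF f(1)] and d = category_simps[OF f(2)]
  obtain \<tau> where t: "\<And>X. X \<in> Ob C \<Longrightarrow> \<tau> X \<in> hom D (fob F X) (fob G X) \<and> is_iso D (\<tau> X)"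
    "\<And>m. m \<in> Ar C \<Longrightarrow> cmp D (\<tau> (tgt C m)) (far F m) = cmp D (far G m) (\<tau> (src C m))"
    using assms(1) unfolding isomorphic_functors_def by blast
  obtain \<sigma> where s: "\<And>X. X \<in> Ob C \<Longrightarrow> \<sigma> X \<in> hom D (fob G X) (fob H X) \<and> is_iso D (\<sigma> X)"
    "\<And>m. m \<in> Ar C \<Longrightarrow> cmp D (\<sigma> (tgt C m)) (far G m) = cmp D (far H m) (\<sigma> (src C m))"
    using assms(2) unfolding isomorphic_functors_def by blast
  have ts: "\<tau> X \<in> Ar D" "src D (\<tau> X) = fob F X" "tgt D (\<tau> X) = fob G X"
    "\<sigma> X \<in> Ar D" "src D (\<sigma> X) = fob G X" "tgt D (\<sigma> X) = fob H X" if "X \<in> Ob C" for X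
    using t(1)[OF that] s(1)[OF that] by (simp_all add: hom_iff)
  have "cmp D (cmp D (\<sigma> (tgt C m)) (\<tau> (tgt C m))) (far F m) = cmp D (far H m) (cmp D (\<sigma> (src C m)) (\<tau> (src C m)))"
    if m: "m \<in> Ar C" for m
  proof -
    note x = ts[OF c(1)[OF m]] ts[OF c(2)[OF m]]
    have "cmp D (cmp D (\<sigma> (tgt C m)) (\<tau> (tgt C m))) (far F m) = cmp D (\<sigma> (tgt C m)) (cmp D (\<tau> (tgt C m)) (far F m))"
      using x f m by (intro cmp_assoc) simp_all
    also have "\<dots> = cmp D (\<sigma> (tgt C m)) (cmp D (far G m) (\<tau> (src C m)))" using t(2)[OF m] by simp
    also have "\<dots> = cmp D (cmp D (\<sigma> (tgt C m)) (far G m)) (\<tau> (src C m))"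
      using x f g m by (intro cmp_assoc[symmetric]) simp_all
    also have "\<dots> = cmp D (cmp D (far H m) (\<sigma> (src C m))) (\<tau> (src C m))" using s(2)[OF m] by simp
    also have "\<dots> = cmp D (far H m) (cmp D (\<sigma> (src C m)) (\<tau> (src C m)))"
      using x f h m by (intro cmp_assoc) simp_all
    finally show ?thesis .
  qed
  moreover have "cmp D (\<sigma> X) (\<tau> X) \<in> hom D (fob F X) (fob H X) \<and> is_iso D (cmp D (\<sigma> X) (\<tau> X))" if X: "X \<in> Ob C" for X
    using ts[OF X] t(1)[OF X] s(1)[OF X] by (simp add: hom_iff d is_iso_comp[OF f(2)])
  ultimately show ?thesis
    unfolding isomorphic_functors_def using F H by (intro conjI exI[of _ "\<lambda>X. cmp D (\<sigma> X) (\<tau> X)"]) auto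
qed

lemma isomorphic_functors_comp_right:
  assumes "isomorphic_functors C D F G" "is_functor B C L"
  shows "isomorphic_functors B D (comp_func F L) (comp_func G L)"
proof -
  have F: "is_functor C D F" and G: "is_functor C D G" using assms by (simp_all add: isomorphic_functors_def)
  obtain \<tau> where t: "\<forall>X\<in>Ob C. \<tau> X \<in> hom D (fob F X) (fob G X) \<and> is_iso D (\<tau> X)"
    "\<forall>m\<in>Ar C. cmp D (\<tau> (tgt C m)) (far F m) = cmp D (far G m) (\<tau> (src C m))"
    using assms unfolding isomorphic_functors_def by blast
  note l = functor_simps[OF assms(2)]
  have "cmp D (\<tau> (fob L (tgt B m))) (far F (far L m)) = cmp D (far G (far L m)) (\<tau> (fob L (src B m)))"
    if m: "m \<in> Ar B" for m using bspec[OF t(2) l(4)[OF m]] l m by simp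
  then show ?thesis unfolding isomorphic_functors_def
    using is_functor_comp[OF assms(2) F] is_functor_comp[OF assms(2) G] t(1) l(3)
    by (intro conjI exI[of _ "\<lambda>X. \<tau> (fob L X)"]) (simp_all add: comp_func_def)
qed

lemma functor_is_iso:
  assumes F: "is_functor C D F" and m: "is_iso C m" shows "is_iso D (far F m)"
proof -
  note f = functor_simps[OF F]
  note c = category_simps[OF f(1)]
  obtain n where n: "m \<in> Ar C" "n \<in> Ar C" "src C n = tgt C m" "tgt C n = src C m"
    "cmp C n m = ide C (src C m)" "cmp C m n = ide C (tgt C m)" using m by (rule is_isoE)
  show ?thesis
    by (rule is_isoI[of _ _ "far F n"]) (use n f(4-6) f(7)[symmetric] f(8)[symmetric] c in simp_all)
qed

lemma isomorphic_functors_comp_left: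
  assumes "isomorphic_functors C D F G" "is_functor D B L"
  shows "isomorphic_functors C B (comp_func L F) (comp_func L G)"
proof -
  have F: "is_functor C D F" and G: "is_functor C D G" using assms by (simp_all add: isomorphic_functors_def)
  note f = functor_simps[OF F] and g = functor_simps[OF G] and l = functor_simps[OF assms(2)]
  note c = category_simps[OF f(1)]
  obtain \<tau> where t: "\<forall>X\<in>Ob C. \<tau> X \<in> hom D (fob F X) (fob G X) \<and> is_iso D (\<tau> X)"
    "\<forall>m\<in>Ar C. cmp D (\<tau> (tgt C m)) (far F m) = cmp D (far G m) (\<tau> (src C m))"
    using assms unfolding isomorphic_functors_def by blast
  have "cmp B (far L (\<tau> (tgt C m))) (far L (far F m)) = cmp B (far L (far G m)) (far L (\<tau> (src C m)))"
    if m: "m \<in> Ar C" for m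
  proof -
    have "\<tau> (tgt C m) \<in> hom D (fob F (tgt C m)) (fob G (tgt C m))"
      "\<tau> (src C m) \<in> hom D (fob F (src C m)) (fob G (src C m))" using t(1) c m by simp_all
    then show ?thesis
      using l(8)[of "far F m" "\<tau> (tgt C m)"] l(8)[of "\<tau> (src C m)" "far G m"] f g m bspec[OF t(2) m]
      by (simp add: hom_iff)
  qed
  moreover have "far L (\<tau> X) \<in> hom B (fob L (fob F X)) (fob L (fob G X)) \<and> is_iso B (far L (\<tau> X))" if "X \<in> Ob C" for X
    using bspec[OF t(1) that] l functor_is_iso[OF assms(2)] by (simp add: hom_iff)
  ultimately show ?thesis unfolding isomorphic_functors_def
    using is_functor_comp[OF F assms(2)] is_functor_comp[OF G assms(2)]
    by (intro conjI exI[of _ "\<lambda>X. far L (\<tau> X)"]) (auto simp: comp_func_def)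
qed

text \<open>\<open>L\<close> is isomorphic to \<open>F\<close> after \<open>G\<close> after
  \<open>L\<close>, and the last two factors are replaced by \<open>M\<close>. In this way functors
  into the localized topos are compared after passing to sheaves on the slice.\<close>

lemma quasi_inverse_comp:
  assumes "quasi_inverse C D F G" "is_functor B D L" "isomorphic_functors B C (comp_func G L) M"
  shows "isomorphic_functors B D L (comp_func F M)"
proof -
  have F: "is_functor C D F" and FG: "isomorphic_functors D D (comp_func F G) idfunc"
    using assms(1) by (simp_all add: quasi_inverse_def)
  have "isomorphic_functors B D (comp_func (comp_func F G) L) (comp_func idfunc L)"
    by (rule isomorphic_functors_comp_right[OF FG assms(2)])
  then have "isomorphic_functors B D (comp_func F (comp_func G L)) L"
    by (cases L) (simp add: comp_func_def idfunc_def)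
  then have "isomorphic_functors B D L (comp_func F (comp_func G L))" by (rule isomorphic_functors_sym)
  then show ?thesis
    by (rule isomorphic_functors_trans[OF _ isomorphic_functors_comp_left[OF assms(3) F]])
qed

lemma fully_faithful_iso:
  assumes G: "is_functor D C G"
    and ff: "\<And>X Y. X \<in> Ob D \<Longrightarrow> Y \<in> Ob D \<Longrightarrow> bij_betw (far G) (hom D X Y) (hom C (fob G X) (fob G Y))"
    and m: "m \<in> Ar D" "is_iso C (far G m)"
  shows "is_iso D m"
proof -
  note g = functor_simps[OF G]
  note d = category_simps[OF g(1)]
  obtain k where k: "k \<in> Ar C" "src C k = tgt C (far G m)" "tgt C k = src C (far G m)"
    "cmp C k (far G m) = ide C (src C (far G m))" "cmp C (far G m) k = ide C (tgt C (far G m))"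
    using m(2) by (rule is_isoE)
  let ?X = "src D m" and ?Y = "tgt D m"
  have X: "?X \<in> Ob D" "?Y \<in> Ob D" using d m by simp_all
  have "k \<in> far G ` hom D ?Y ?X"
    using ff[OF X(2,1)] k g m unfolding bij_betw_def by (simp add: hom_iff)
  then obtain n where n: "n \<in> Ar D" "src D n = ?Y" "tgt D n = ?X" "far G n = k" by (auto simp: hom_iff)
  have inj: "x = y" if "x \<in> hom D Z W" "y \<in> hom D Z W" "far G x = far G y" "Z \<in> Ob D" "W \<in> Ob D" for x y Z W
    using ff[OF that(4,5)] that(1-3) unfolding bij_betw_def inj_on_def by blast
  have "cmp D n m = ide D ?X"
    by (rule inj[of _ ?X ?X]) (use n m k g X d in \<open>simp_all add: hom_iff\<close>)
  moreover have "cmp D m n = ide D ?Y"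
    by (rule inj[of _ ?Y ?Y]) (use n m k g X d in \<open>simp_all add: hom_iff\<close>)
  ultimately show ?thesis by (intro is_isoI[of m D n] m n)
qed

lemma fully_faithful_ess_surj_quasi_inverse:
  assumes G: "is_functor D C G"
    and ff: "\<And>X Y. X \<in> Ob D \<Longrightarrow> Y \<in> Ob D \<Longrightarrow> bij_betw (far G) (hom D X Y) (hom C (fob G X) (fob G Y))"
    and es: "\<And>Z. Z \<in> Ob C \<Longrightarrow> \<exists>X\<in>Ob D. \<exists>t. t \<in> hom C Z (fob G X) \<and> is_iso C t"
  shows "\<exists>F. quasi_inverse C D F G"
proof -
  note g = functor_simps[OF G]
  note d = category_simps[OF g(1)] and c = category_simps[OF g(2)] and ca = cmp_assoc[OF g(2)]
  \<comment> \<open>Object, isomorphism and inverse are packed into one triple, so that a single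
    choice selects them together.\<close>
  have "\<forall>Z\<in>Ob C. \<exists>z. fst z \<in> Ob D \<and> fst (snd z) \<in> hom C Z (fob G (fst z)) \<and>
     snd (snd z) \<in> hom C (fob G (fst z)) Z \<and> cmp C (snd (snd z)) (fst (snd z)) = ide C Z \<and>
     cmp C (fst (snd z)) (snd (snd z)) = ide C (fob G (fst z))"
  proof
    fix Z assume Z: "Z \<in> Ob C"
    obtain X t where X: "X \<in> Ob D" "t \<in> hom C Z (fob G X)" "is_iso C t" using es[OF Z] by blast
    obtain s where "s \<in> Ar C" "src C s = tgt C t" "tgt C s = src C t"
      "cmp C s t = ide C (src C t)" "cmp C t s = ide C (tgt C t)" using X(3) by (rule is_isoE)
    then show "\<exists>z. fst z \<in> Ob D \<and> fst (snd z) \<in> hom C Z (fob G (fst z)) \<and>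
     snd (snd z) \<in> hom C (fob G (fst z)) Z \<and> cmp C (snd (snd z)) (fst (snd z)) = ide C Z \<and>
     cmp C (fst (snd z)) (snd (snd z)) = ide C (fob G (fst z))"
      using X by (intro exI[of _ "(X, t, s)"]) (simp add: hom_iff)
  qed
  then obtain z where z: "\<forall>Z\<in>Ob C. fst (z Z) \<in> Ob D \<and> fst (snd (z Z)) \<in> hom C Z (fob G (fst (z Z))) \<and>
     snd (snd (z Z)) \<in> hom C (fob G (fst (z Z))) Z \<and> cmp C (snd (snd (z Z))) (fst (snd (z Z))) = ide C Z \<and>
     cmp C (fst (snd (z Z))) (snd (snd (z Z))) = ide C (fob G (fst (z Z)))"
    by (rule bchoice[THEN exE])
  define f t s where "f Z = fst (z Z)" and "t Z = fst (snd (z Z))" and "s Z = snd (snd (z Z))" for Z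
  have fts: "f Z \<in> Ob D" "t Z \<in> Ar C" "src C (t Z) = Z" "tgt C (t Z) = fob G (f Z)"
    "s Z \<in> Ar C" "src C (s Z) = fob G (f Z)" "tgt C (s Z) = Z" if "Z \<in> Ob C" for Z
    using bspec[OF z that] by (simp_all add: f_def t_def s_def hom_iff)
  have st: "cmp C (s Z) (t Z) = ide C Z" "cmp C (t Z) (s Z) = ide C (fob G (f Z))" if "Z \<in> Ob C" for Z
    using bspec[OF z that] by (simp_all add: f_def t_def s_def)
  \<comment> \<open>On arrows the quasi-inverse is forced: conjugate by the chosen isomorphisms and
    take the preimage under the fully faithful functor.\<close>
  define a where "a m = inv_into (hom D (f (src C m)) (f (tgt C m))) (far G) (cmp C (t (tgt C m)) (cmp C m (s (src C m))))" for m
  have am: "a m \<in> hom D (f (src C m)) (f (tgt C m))" "far G (a m) = cmp C (t (tgt C m)) (cmp C m (s (src C m)))"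
    if m: "m \<in> Ar C" for m
  proof -
    have X: "src C m \<in> Ob C" "tgt C m \<in> Ob C" using c m by simp_all
    have "cmp C (t (tgt C m)) (cmp C m (s (src C m))) \<in> hom C (fob G (f (src C m))) (fob G (f (tgt C m)))"
      using fts[OF X(1)] fts[OF X(2)] m c by (simp add: hom_iff)
    also have "\<dots> = far G ` hom D (f (src C m)) (f (tgt C m))"
      using ff fts(1) X by (simp add: bij_betw_def)
    finally show "a m \<in> hom D (f (src C m)) (f (tgt C m))" "far G (a m) = cmp C (t (tgt C m)) (cmp C m (s (src C m)))"
      unfolding a_def by (simp_all add: inv_into_into f_inv_into_f)
  qed
  have inj: "x = y" if "x \<in> hom D Z W" "y \<in> hom D Z W" "far G x = far G y" "Z \<in> Ob D" "W \<in> Ob D" for x y Z W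
    using ff[OF that(4,5)] that(1-3) unfolding bij_betw_def inj_on_def by blast
  have at: "cmp C (far G (a m)) (t (src C m)) = cmp C (t (tgt C m)) m" if m: "m \<in> Ar C" for m
  proof -
    have X: "src C m \<in> Ob C" "tgt C m \<in> Ob C" using c m by simp_all
    have "cmp C (far G (a m)) (t (src C m)) = cmp C (t (tgt C m)) (cmp C m (cmp C (s (src C m)) (t (src C m))))"
      using am[OF m] fts[OF X(1)] fts[OF X(2)] m c by (simp add: ca)
    then show ?thesis using st[OF X(1)] m c by simp
  qed
  define F where "F = \<lparr>fob = f, far = a\<rparr>"
  have F: "is_functor C D F"
  proof (rule is_functorI[OF g(2,1)])
    show "fob F X \<in> Ob D" if "X \<in> Ob C" for X using fts that by (simp add: F_def)
    show "far F m \<in> hom D (fob F (src C m)) (fob F (tgt C m))" if "m \<in> Ar C" for m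
      using am that by (simp add: F_def)
    show "far F (ide C X) = ide D (fob F X)" if X: "X \<in> Ob C" for X
    proof -
      have i: "ide C X \<in> Ar C" "src C (ide C X) = X" "tgt C (ide C X) = X" using X c by simp_all
      show ?thesis unfolding F_def func.simps
        by (rule inj[of _ "f X" "f X"]) (use am[OF i(1)] i fts[OF X] st[OF X] g d c X in \<open>simp_all add: hom_iff\<close>)
    qed
    fix m n assume m: "m \<in> Ar C" "n \<in> Ar C" "tgt C m = src C n"
    have X: "src C m \<in> Ob C" "src C n \<in> Ob C" "tgt C n \<in> Ob C" using c m by simp_all
    have nm: "cmp C n m \<in> Ar C" "src C (cmp C n m) = src C m" "tgt C (cmp C n m) = tgt C n" using m c by simp_all
    note A = am[OF m(1), unfolded hom_iff m(3)] am[OF m(2), unfolded hom_iff] am[OF nm(1), unfolded hom_iff nm]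
    note fX = fts[OF X(1)] fts[OF X(2)] fts[OF X(3)]
    have "far G (cmp D (a n) (a m)) = cmp C (far G (a n)) (cmp C (t (src C n)) (cmp C m (s (src C m))))"
      using A g by simp
    also have "\<dots> = cmp C (cmp C (far G (a n)) (t (src C n))) (cmp C m (s (src C m)))"
      using A(3) fX m c g by (intro ca[symmetric]) simp_all
    also have "\<dots> = cmp C (cmp C (t (tgt C n)) n) (cmp C m (s (src C m)))" using at[OF m(2)] by simp
    also have "\<dots> = far G (a (cmp C n m))" using A(6) fX m c by (simp add: ca)
    finally have "far G (a (cmp C n m)) = far G (cmp D (a n) (a m))" ..
    then show "far F (cmp C n m) = cmp D (far F n) (far F m)" unfolding F_def func.simps
      by (intro inj[of _ "f (src C m)" "f (tgt C n)"]) (use A fX d in \<open>simp_all add: hom_iff\<close>)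
  qed
  have t_iso: "is_iso C (t Z)" if "Z \<in> Ob C" for Z
    by (rule is_isoI[of _ _ "s Z"]) (use fts[OF that] st[OF that] in simp_all)
  have "isomorphic_functors C C idfunc (comp_func G F)"
    unfolding isomorphic_functors_def
    by (intro conjI is_functor_id is_functor_comp[OF F G] g(2) exI[of _ t])
      (auto simp: idfunc_def comp_func_def F_def hom_iff fts t_iso at)
  moreover have "isomorphic_functors D D idfunc (comp_func F G)"
  proof -
    define r where "r X = inv_into (hom D X (f (fob G X))) (far G) (t (fob G X))" for X
    have r: "r X \<in> hom D X (f (fob G X))" "far G (r X) = t (fob G X)" if X: "X \<in> Ob D" for X
    proof -
      have "t (fob G X) \<in> far G ` hom D X (f (fob G X))"
        using ff[OF X fts(1)[OF g(3)[OF X]]] fts[OF g(3)[OF X]] by (simp add: bij_betw_def hom_iff)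
      then show "r X \<in> hom D X (f (fob G X))" "far G (r X) = t (fob G X)"
        unfolding r_def by (simp_all add: inv_into_into f_inv_into_f)
    qed
    have "cmp D (r (tgt D m)) m = cmp D (a (far G m)) (r (src D m))" if m: "m \<in> Ar D" for m
    proof -
      have X: "src D m \<in> Ob D" "tgt D m \<in> Ob D" using d m by simp_all
      have gm: "far G m \<in> Ar C" "src C (far G m) = fob G (src D m)" "tgt C (far G m) = fob G (tgt D m)" using g m by simp_all
      note R = r[OF X(1), unfolded hom_iff] r[OF X(2), unfolded hom_iff] am[OF gm(1), unfolded hom_iff gm(2,3)]
      show ?thesis
      proof (rule inj[of _ "src D m" "f (fob G (tgt D m))"])
        show "far G (cmp D (r (tgt D m)) m) = far G (cmp D (a (far G m)) (r (src D m)))"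
          using R(1-5) at[OF gm(1)] gm g m by simp
      qed (use R m d X fts g in \<open>simp_all add: hom_iff\<close>)
    qed
    moreover have "is_iso D (r X)" if X: "X \<in> Ob D" for X
      by (rule fully_faithful_iso[OF G ff]) (use r[OF X] t_iso[OF g(3)[OF X]] in \<open>simp_all add: hom_iff\<close>)
    ultimately show ?thesis unfolding isomorphic_functors_def
      by (intro conjI is_functor_id is_functor_comp[OF G F] g(1) exI[of _ r])
        (auto simp: idfunc_def comp_func_def F_def r)
  qed
  ultimately have "quasi_inverse C D F G"
    unfolding quasi_inverse_def using F G by (intro conjI isomorphic_functors_sym[OF \<open>isomorphic_functors C C idfunc _\<close>]
        isomorphic_functors_sym[OF \<open>isomorphic_functors D D idfunc _\<close>])
  then show ?thesis ..
qed

section \<open>Categories of sheaves\<close>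

lemma Sh_simps [simp]:
  "F \<in> Ob (Sh el C J) \<longleftrightarrow> sheaf el C J F"
  "(F, G, \<alpha>) \<in> Ar (Sh el C J) \<longleftrightarrow> sheaf el C J F \<and> sheaf el C J G \<and> psh_mor C F G \<alpha>"
  "src (Sh el C J) (F, G, \<alpha>) = F" "tgt (Sh el C J) (F, G, \<alpha>) = G"
  "ide (Sh el C J) F = (F, F, \<lambda>X\<in>Ob C. \<lambda>x\<in>sec F X. x)"
  "cmp (Sh el C J) (G1, G2, \<beta>) (F1, F2, \<alpha>) = (F1, G2, \<lambda>X\<in>Ob C. \<lambda>x\<in>sec F1 X. \<beta> X (\<alpha> X x))"
  by (auto simp: Sh_def compose_def)

lemma sheaf_presheaf: "sheaf el C J F \<Longrightarrow> presheaf C F"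
  by (simp add: sheaf_def upresheaf_def)

lemma category_Sh:
  assumes C: "category C" shows "category (Sh el C J)"
proof -
  have id: "psh_mor C F F (\<lambda>X\<in>Ob C. \<lambda>x\<in>sec F X. x)" if "sheaf el C J F" for F
    by (rule psh_mor_id[OF C sheaf_presheaf[OF that]])
  have comp: "psh_mor C F H (\<lambda>X\<in>Ob C. \<lambda>x\<in>sec F X. \<beta> X (\<alpha> X x))"
    if "sheaf el C J F" "psh_mor C F G \<alpha>" "psh_mor C G H \<beta>" for F G H \<alpha> \<beta>
    by (rule psh_mor_comp[OF C sheaf_presheaf[OF that(1)] that(2,3)])
  have unit: "(\<lambda>X\<in>Ob C. \<lambda>x\<in>sec F X. \<alpha> X (restrict (\<lambda>X. \<lambda>x\<in>sec F X. x) (Ob C) X x)) = \<alpha>"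
    "(\<lambda>X\<in>Ob C. \<lambda>x\<in>sec F X. restrict (\<lambda>X. \<lambda>x\<in>sec G X. x) (Ob C) X (\<alpha> X x)) = \<alpha>"
    if "sheaf el C J F" "sheaf el C J G" "psh_mor C F G \<alpha>" for F G \<alpha>
    by (rule psh_mor_ext[OF comp[OF that(1) id[OF that(1)] that(3)] that(3)], simp)
      (rule psh_mor_ext[OF comp[OF that(1,3) id[OF that(2)]] that(3)],
        use psh_mor_simps(1)[OF that(3)] in simp)
  show ?thesis unfolding category_def
  proof (intro conjI ballI impI)
    fix m assume "m \<in> Ar (Sh el C J)"
    moreover obtain F G \<alpha> where m: "m = (F, G, \<alpha>)" by (cases m)
    ultimately have "sheaf el C J F" "sheaf el C J G" "psh_mor C F G \<alpha>" by simp_all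
    then show "src (Sh el C J) m \<in> Ob (Sh el C J)" "tgt (Sh el C J) m \<in> Ob (Sh el C J)"
      "cmp (Sh el C J) m (ide (Sh el C J) (src (Sh el C J) m)) = m"
      "cmp (Sh el C J) (ide (Sh el C J) (tgt (Sh el C J) m)) m = m"
      using unit by (simp_all only: m Sh_simps)
  next
    fix l m n assume "l \<in> Ar (Sh el C J)" "m \<in> Ar (Sh el C J)" "n \<in> Ar (Sh el C J)"
      "tgt (Sh el C J) l = src (Sh el C J) m \<and> tgt (Sh el C J) m = src (Sh el C J) n"
    then show "cmp (Sh el C J) n (cmp (Sh el C J) m l) = cmp (Sh el C J) (cmp (Sh el C J) n m) l"
      using psh_mor_simps(1) by (cases l; cases m; cases n) (fastforce simp: fun_eq_iff)
  next
    fix m n assume "m \<in> Ar (Sh el C J)" "n \<in> Ar (Sh el C J)" "tgt (Sh el C J) m = src (Sh el C J) n"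
    then show "cmp (Sh el C J) n m \<in> hom (Sh el C J) (src (Sh el C J) m) (tgt (Sh el C J) n)"
      by (cases m; cases n) (simp add: hom_iff comp)
  qed (simp add: hom_iff id)
qed

lemma Sh_isoI:
  assumes C: "category C" and F: "sheaf el C J F" "sheaf el C J G" "psh_mor C F G \<alpha>"
    and b: "\<And>X. X \<in> Ob C \<Longrightarrow> bij_betw (\<alpha> X) (sec F X) (sec G X)"
  shows "is_iso (Sh el C J) (F, G, \<alpha>)"
proof -
  let ?b = "\<lambda>X\<in>Ob C. \<lambda>y\<in>sec G X. inv_into (sec F X) (\<alpha> X) y"
  note p = sheaf_presheaf[OF F(1)] sheaf_presheaf[OF F(2)]
  have inv: "psh_mor C G F ?b" by (rule psh_mor_inverse[OF C p F(3) b])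
  have "(\<lambda>X\<in>Ob C. \<lambda>x\<in>sec F X. ?b X (\<alpha> X x)) = (\<lambda>X\<in>Ob C. \<lambda>x\<in>sec F X. x)"
    by (rule psh_mor_ext[OF psh_mor_comp[OF C p(1) F(3) inv] psh_mor_id[OF C p(1)]])
      (use b psh_mor_simps(1)[OF F(3)] in \<open>simp add: bij_betw_def\<close>)
  moreover have "(\<lambda>X\<in>Ob C. \<lambda>x\<in>sec G X. \<alpha> X (?b X x)) = (\<lambda>X\<in>Ob C. \<lambda>x\<in>sec G X. x)"
    by (rule psh_mor_ext[OF psh_mor_comp[OF C p(2) inv F(3)] psh_mor_id[OF C p(2)]])
      (use b in \<open>simp add: bij_betw_def f_inv_into_f\<close>)
  ultimately show ?thesis
    by (intro is_isoI[of _ _ "(G, F, ?b)"]) (use F inv in \<open>simp_all del: restrict_apply\<close>)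
qed

section \<open>Localization of a topos at a represented sheaf\<close>

locale localized_site = site C J for C :: "('o, 'm) cat" and J +
  fixes el :: "'u \<Rightarrow> 'u set" and V :: 'o
  assumes u: "universe el" and U_site: "U_site el C J" and V: "V \<in> Ob C"
begin

abbreviation "CV \<equiv> slice C V"
abbreviation "\<gamma> \<equiv> slice_forget C"
abbreviation "A \<equiv> eps el C J V"
abbreviation "\<eta> \<equiv> eps_unit el C J V"
abbreviation "JV \<equiv> lift_topology CV J \<gamma>"
abbreviation "SC \<equiv> Sh el C J"
abbreviation "SV \<equiv> Sh el CV JV"
abbreviation "over \<equiv> slice SC A"
abbreviation restr :: "('o, 'm, 'u) psh \<Rightarrow> ('m, 'm \<times> 'm \<times> 'm, 'u) psh" where
  "restr \<equiv> psh_pull CV \<gamma>"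

sublocale L: discrete_fibration_site C J CV \<gamma>
  by (rule site_slice_discrete_fibration[OF site_axioms])

lemma A: "sheaf el C J A" and A_presheaf: "presheaf C A" and A_glues: "glues C J A"
  and \<eta>: "loc_bij C J (represented C V) A \<eta>"
  using eps_sheaf[OF u U_site V] eps_loc_bij[OF u U_site V] by (auto simp: sheaf_iff_glues glues_presheaf)

lemma \<eta>_sec: "w \<in> Ar C \<Longrightarrow> tgt C w = V \<Longrightarrow> src C w = W \<Longrightarrow> \<eta> W w \<in> sec A W"
  using psh_mor_simps(1)[OF loc_bijD(1)[OF \<eta>], of W w] by (auto simp: hom_iff)

lemma \<eta>_cmp: "w \<in> Ar C \<Longrightarrow> tgt C w = V \<Longrightarrow> m \<in> Ar C \<Longrightarrow> tgt C m = src C w \<Longrightarrow>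
    \<eta> (src C m) (cmp C w m) = res A m (\<eta> (src C w) w)"
  using psh_mor_simps(2)[OF loc_bijD(1)[OF \<eta>], of m w] by (simp add: hom_iff)

text \<open>Local injectivity of the unit, spelled out for arrows into \<open>V\<close>. It will
  allow a change of structure arrow after passing to a cover.\<close>

lemma \<eta>_agree: "v \<in> Ar C \<Longrightarrow> w \<in> Ar C \<Longrightarrow> tgt C v = V \<Longrightarrow> tgt C w = V \<Longrightarrow> src C v = src C w \<Longrightarrow>
    \<eta> (src C w) v = \<eta> (src C w) w \<Longrightarrow> {m \<in> Ar C. tgt C m = src C w \<and> cmp C v m = cmp C w m} \<in> J (src C w)"
proof -
  assume a: "v \<in> Ar C" "w \<in> Ar C" "tgt C v = V" "tgt C w = V" "src C v = src C w" "\<eta> (src C w) v = \<eta> (src C w) w"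
  then have "agreement C (represented C V) (src C w) v w \<in> J (src C w)"
    by (intro loc_bijD(2)[OF \<eta>]) (simp_all add: hom_iff)
  moreover have "agreement C (represented C V) (src C w) v w = {m \<in> Ar C. tgt C m = src C w \<and> cmp C v m = cmp C w m}"
    unfolding agreement_def by (intro Collect_cong) (use a in \<open>auto simp: hom_iff\<close>)
  ultimately show ?thesis by simp
qed

lemma category_over: "category over"
  by (rule category_slice[OF category_Sh[OF cat]])

lemma over_ObE:
  assumes "x \<in> Ob over"
  obtains H \<pi> where "x = (H, A, \<pi>)" "sheaf el C J H" "psh_mor C H A \<pi>"
  using assms by (cases x) auto

lemma over_Ob [simp]: "(H, B, \<pi>) \<in> Ob over \<longleftrightarrow> B = A \<and> sheaf el C J H \<and> psh_mor C H A \<pi>"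
  using A by auto

lemma over_arrow_iff:
  assumes "x = (H, A, \<pi>)" "x' = (H', A, \<pi>')" "sheaf el C J H" "psh_mor C H A \<pi>" "sheaf el C J H'" "psh_mor C H' A \<pi>'"
  shows "(x, x', m) \<in> Ar over \<longleftrightarrow> (\<exists>\<alpha>. m = (H, H', \<alpha>) \<and> psh_mor C H H' \<alpha> \<and>
     (\<forall>W\<in>Ob C. \<forall>h\<in>sec H W. \<pi>' W (\<alpha> W h) = \<pi> W h))"
proof -
  have eq: "(\<lambda>X\<in>Ob C. \<lambda>h\<in>sec H X. \<pi>' X (\<alpha> X h)) = \<pi> \<longleftrightarrow> (\<forall>W\<in>Ob C. \<forall>h\<in>sec H W. \<pi>' W (\<alpha> W h) = \<pi> W h)"
    if a: "psh_mor C H H' \<alpha>" for \<alpha>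
  proof
    assume "(\<lambda>X\<in>Ob C. \<lambda>h\<in>sec H X. \<pi>' X (\<alpha> X h)) = \<pi>"
    then show "\<forall>W\<in>Ob C. \<forall>h\<in>sec H W. \<pi>' W (\<alpha> W h) = \<pi> W h" by auto
  next
    assume "\<forall>W\<in>Ob C. \<forall>h\<in>sec H W. \<pi>' W (\<alpha> W h) = \<pi> W h"
    then show "(\<lambda>X\<in>Ob C. \<lambda>h\<in>sec H X. \<pi>' X (\<alpha> X h)) = \<pi>"
      by (intro psh_mor_ext[OF psh_mor_comp[OF cat sheaf_presheaf[OF assms(3)] a assms(6)] assms(4)]) simp
  qed
  obtain H1 H2 \<alpha> where m: "m = (H1, H2, \<alpha>)" by (cases m)
  show ?thesis using assms A eq by (auto simp: m simp del: restrict_apply)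
qed

section \<open>The functor from sheaves over the sheaf associated to \<open>V\<close> to sheaves on
  the slice\<close>

definition fibre_sec :: "('o, 'm, 'u) psh \<Rightarrow> ('o \<Rightarrow> 'u \<Rightarrow> 'u) \<Rightarrow> 'm \<Rightarrow> 'u set" where
  "fibre_sec H \<pi> w = {h \<in> sec H (src C w). \<pi> (src C w) h = \<eta> (src C w) w}"

abbreviation "K \<equiv> slice_psh C V \<eta>"

lemma K_eq:
  "K (H, B, \<pi>) = \<lparr>sec = \<lambda>w\<in>Ob CV. fibre_sec H \<pi> w,
     res = \<lambda>t\<in>Ar CV. \<lambda>h\<in>fibre_sec H \<pi> (tgt CV t). res H (far \<gamma> t) h\<rparr>"
proof -
  have "restrict (\<lambda>t. case t of (w, w', m) \<Rightarrow> restrict (res H m) (restrict (fibre_sec H \<pi>) (Ob CV) w')) (Ar CV) =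
    (\<lambda>t\<in>Ar CV. \<lambda>h\<in>fibre_sec H \<pi> (tgt CV t). res H (far \<gamma> t) h)"
    by (rule restrict_ext) (auto simp: split_paired_all simp del: restrict_apply simp add: restrict_apply')
  then show ?thesis by (simp add: slice_psh_def Let_def fibre_sec_def[abs_def])
qed

lemma K_simps:
  "w \<in> Ob CV \<Longrightarrow> sec (K (H, B, \<pi>)) w = fibre_sec H \<pi> w"
  "t \<in> Ar CV \<Longrightarrow> h \<in> fibre_sec H \<pi> (tgt CV t) \<Longrightarrow> res (K (H, B, \<pi>)) t h = res H (far \<gamma> t) h"
  unfolding K_eq by simp_all

lemma fibre_sec_res:
  assumes p: "psh_mor C H A \<pi>" and H: "presheaf C H" and w: "w \<in> Ar C" "tgt C w = V"
    and m: "m \<in> Ar C" "tgt C m = src C w" and h: "h \<in> fibre_sec H \<pi> w"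
  shows "res H m h \<in> fibre_sec H \<pi> (cmp C w m)"
  using h w m presheaf_simps(1)[OF H m(1), of h] psh_mor_simps(2)[OF p m(1), of h] \<eta>_cmp[OF w m]
  by (simp add: fibre_sec_def)

text \<open>The values form a subpresheaf of the restriction of \<open>H\<close>, so sections glue
  there. The condition cutting it out is an equation between sections of the sheaf \<open>A\<close>,
  hence may be checked on the cover.\<close>

lemma K_sheaf:
  assumes H: "sheaf el C J H" and p: "psh_mor C H A \<pi>" shows "sheaf el CV JV (K (H, A, \<pi>))"
proof -
  note Hp = sheaf_presheaf[OF H]
  have Hg: "glues CV JV (restr H)"
    using H by (intro L.glues_psh_pull) (simp add: sheaf_iff_glues)
  have pres: "presheaf CV (K (H, A, \<pi>))" unfolding K_eq
  proof (rule presheafI[OF category_slice[OF cat]])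
    fix t h assume t: "t \<in> Ar CV" "h \<in> fibre_sec H \<pi> (tgt CV t)"
    obtain a w m where "t = (a, w, m)" by (cases t)
    then show "res H (far \<gamma> t) h \<in> fibre_sec H \<pi> (src CV t)" using t fibre_sec_res[OF p Hp, of w m h] by auto
  next
    fix w h assume "w \<in> Ob CV" "h \<in> fibre_sec H \<pi> w"
    then show "res H (far \<gamma> (ide CV w)) h = h" using presheaf_simps(2)[OF Hp] by (simp add: fibre_sec_def)
  next
    fix s t h assume a: "s \<in> Ar CV" "t \<in> Ar CV" "tgt CV s = src CV t" "h \<in> fibre_sec H \<pi> (tgt CV t)"
    obtain x y m x' y' n where "s = (x, y, m)" "t = (x', y', n)" by (cases s; cases t)
    then show "res H (far \<gamma> (cmp CV t s)) h = res H (far \<gamma> s) (res H (far \<gamma> t) h)"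
      using a presheaf_simps(3)[OF Hp, of m n h] by (auto simp: fibre_sec_def)
  qed
  have glues: "glues CV JV (K (H, A, \<pi>))"
  proof (rule L.lift.gluesI[OF pres])
    fix w R assume R: "R \<in> JV w" and w: "w \<in> Ob CV"
    note s = sieveD[OF L.lift.cover_sieve[OF R]]
    have sub: "h \<in> sec (restr H) v" "res (restr H) t h = res (K (H, A, \<pi>)) t h"
      if "h \<in> sec (K (H, A, \<pi>)) v" "v \<in> Ob CV" "t \<in> Ar CV" "tgt CV t = v" for h v t
      using that by (simp_all add: K_simps fibre_sec_def)
    show "x = y" if x: "x \<in> sec (K (H, A, \<pi>)) w" "y \<in> sec (K (H, A, \<pi>)) w"
      "\<And>t. t \<in> R \<Longrightarrow> res (K (H, A, \<pi>)) t x = res (K (H, A, \<pi>)) t y" for x y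
    proof (rule L.lift.glues_separated[OF Hg R])
      show "x \<in> sec (restr H) w" "y \<in> sec (restr H) w"
        using x(1,2) w by (simp_all add: K_simps fibre_sec_def)
      show "res (restr H) t x = res (restr H) t y" if "t \<in> R" for t
        using sub(2)[OF x(1) w s(1,2)] sub(2)[OF x(2) w s(1,2)] x(3) that by metis
    qed
    fix k assume k: "\<And>t. t \<in> R \<Longrightarrow> k t \<in> sec (K (H, A, \<pi>)) (src CV t)"
      "\<And>t g. t \<in> R \<Longrightarrow> g \<in> Ar CV \<Longrightarrow> tgt CV g = src CV t \<Longrightarrow> k (cmp CV t g) = res (K (H, A, \<pi>)) g (k t)"
    have sO: "src CV t \<in> Ob CV" if "t \<in> R" for t using s(1)[OF that] by (rule L.c'_simps(1))
    obtain x where x: "x \<in> sec (restr H) w" "\<And>t. t \<in> R \<Longrightarrow> res (restr H) t x = k t"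
    proof (rule L.lift.glues_glue[OF Hg R, of k])
      show "k t \<in> sec (restr H) (src CV t)" if "t \<in> R" for t
        using k(1)[OF that] sO[OF that] by (simp add: K_simps fibre_sec_def)
      show "k (cmp CV t g) = res (restr H) g (k t)"
        if "t \<in> R" "g \<in> Ar CV" "tgt CV g = src CV t" for t g
        using k(2)[OF that] sub(2)[OF k(1)[OF that(1)] sO[OF that(1)] that(2,3)] by simp
    qed blast
    have J: "far \<gamma> ` R \<in> J (src C w)" using R by (simp add: lift_topology_def)
    \<comment> \<open>The glued section stays in the subpresheaf: along the cover both sides
      restrict to the section of \<open>A\<close> defined by the composite arrow.\<close>
    have "\<pi> (src C w) x = \<eta> (src C w) w"
    proof (rule glues_separated[OF A_glues J])
      show "\<pi> (src C w) x \<in> sec A (src C w)" "\<eta> (src C w) w \<in> sec A (src C w)"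
        using x(1) w psh_mor_simps(1)[OF p] \<eta>_sec by auto
      fix m assume "m \<in> far \<gamma> ` R"
      then obtain a where t: "(a, w, m) \<in> R" using s(2) by (force simp: slice_forget_def)
      have m: "m \<in> Ar C" "tgt C m = src C w" "a = cmp C w m" using s(1)[OF t] by auto
      have "k (a, w, m) \<in> fibre_sec H \<pi> a" using k(1)[OF t] sO[OF t] by (simp add: K_simps)
      then have "\<pi> (src C m) (k (a, w, m)) = \<eta> (src C m) (cmp C w m)" using m w by (simp add: fibre_sec_def)
      moreover have "res H m x = k (a, w, m)" using x(2)[OF t] s(1)[OF t] by simp
      ultimately show "res A m (\<pi> (src C w) x) = res A m (\<eta> (src C w) w)"
        using psh_mor_simps(2)[OF p m(1), of x] x(1) w m \<eta>_cmp[of w m] by simp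
    qed
    then have xk: "x \<in> fibre_sec H \<pi> w" using x(1) w by (simp add: fibre_sec_def)
    show "\<exists>x\<in>sec (K (H, A, \<pi>)) w. \<forall>t\<in>R. res (K (H, A, \<pi>)) t x = k t"
    proof (intro bexI ballI)
      show x': "x \<in> sec (K (H, A, \<pi>)) w" using xk w by (simp add: K_simps)
      show "res (K (H, A, \<pi>)) t x = k t" if "t \<in> R" for t
        using sub(2)[OF x' w s(1,2)[OF that]] x(2)[OF that] by simp
    qed
  qed
  have "sec (K (H, A, \<pi>)) w \<in> range el" if w: "w \<in> Ob CV" for w
    using w H universe_subset[OF u, of "sec H (src C w)" "fibre_sec H \<pi> w"]
    by (auto simp: K_simps fibre_sec_def sheaf_iff_glues)
  then show ?thesis using glues by (simp add: sheaf_iff_glues)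
qed

abbreviation "KF \<equiv> slice_sections el C J V"

definition K_mor :: "('o, 'm, 'u) psh \<Rightarrow> ('o \<Rightarrow> 'u \<Rightarrow> 'u) \<Rightarrow> ('o \<Rightarrow> 'u \<Rightarrow> 'u) \<Rightarrow> 'm \<Rightarrow> 'u \<Rightarrow> 'u" where
  "K_mor H \<pi> \<alpha> = (\<lambda>w\<in>Ob CV. \<lambda>h\<in>fibre_sec H \<pi> w. \<alpha> (src C w) h)"

lemma KF_simps:
  "fob KF x = K x"
  "far KF ((H, A, \<pi>), y, (H1, H2, \<alpha>)) = (K (H, A, \<pi>), K y, K_mor H \<pi> \<alpha>)"
proof -
  have "(\<lambda>w\<in>Ob CV. restrict (\<alpha> (src C w)) (sec (K (H, A, \<pi>)) w)) = K_mor H \<pi> \<alpha>"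
    unfolding K_mor_def by (rule restrict_ext) (simp add: K_simps)
  then show "far KF ((H, A, \<pi>), y, (H1, H2, \<alpha>)) = (K (H, A, \<pi>), K y, K_mor H \<pi> \<alpha>)"
    by (simp add: slice_sections_def Let_def)
qed (simp add: slice_sections_def Let_def)

lemma K_mor:
  assumes H: "presheaf C H" "psh_mor C H A \<pi>" and a: "psh_mor C H H' \<alpha>"
    and o: "\<And>W h. W \<in> Ob C \<Longrightarrow> h \<in> sec H W \<Longrightarrow> \<pi>' W (\<alpha> W h) = \<pi> W h"
  shows "psh_mor CV (K (H, A, \<pi>)) (K (H', A, \<pi>')) (K_mor H \<pi> \<alpha>)"
proof -
  note as = psh_mor_simps[OF a]
  have 1: "\<alpha> (src C w) h \<in> fibre_sec H' \<pi>' w" if "w \<in> Ob CV" "h \<in> fibre_sec H \<pi> w" for w h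
    using that as(1) o by (simp add: fibre_sec_def)
  have "psh_mor CV (K (H, A, \<pi>)) (K (H', A, \<pi>')) (\<lambda>w\<in>Ob CV. \<lambda>h\<in>sec (K (H, A, \<pi>)) w. \<alpha> (src C w) h)"
  proof (rule psh_morI[OF _ _ category_slice[OF cat]])
    fix w h assume w: "w \<in> Ob CV" "h \<in> sec (K (H, A, \<pi>)) w"
    then show "\<alpha> (src C w) h \<in> sec (K (H', A, \<pi>')) w" using 1 by (simp add: K_simps)
  next
    fix t h assume t: "t \<in> Ar CV" "src CV t \<in> Ob CV" "tgt CV t \<in> Ob CV" "h \<in> sec (K (H, A, \<pi>)) (tgt CV t)"
    obtain a w m where tm: "t = (a, w, m)" by (cases t)
    have m: "w \<in> Ar C" "tgt C w = V" "m \<in> Ar C" "tgt C m = src C w" "a = cmp C w m" using t(1) by (auto simp: tm)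
    have h: "h \<in> fibre_sec H \<pi> w" using t(3,4) by (simp add: K_simps tm)
    then have h': "\<alpha> (src C w) h \<in> fibre_sec H' \<pi>' w" using 1 m by simp
    have "res H m h \<in> fibre_sec H \<pi> a" unfolding m(5) by (rule fibre_sec_res[OF H(2,1) m(1-4) h])
    moreover have "\<alpha> (src C m) (res H m h) = res H' m (\<alpha> (src C w) h)"
      using as(2)[OF m(3), of h] h m by (simp add: fibre_sec_def)
    ultimately show "res (K (H, A, \<pi>)) t h \<in> sec (K (H, A, \<pi>)) (src CV t) \<and>
        \<alpha> (src C (src CV t)) (res (K (H, A, \<pi>)) t h) = res (K (H', A, \<pi>')) t (\<alpha> (src C (tgt CV t)) h)"
      using t m h h' K_simps(2)[OF t(1), of h H \<pi>] K_simps(2)[OF t(1), of "\<alpha> (src C w) h" H' \<pi>'] K_simps(1)[OF t(2)]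
      by (simp add: tm)
  qed
  also have "(\<lambda>w\<in>Ob CV. \<lambda>h\<in>sec (K (H, A, \<pi>)) w. \<alpha> (src C w) h) = K_mor H \<pi> \<alpha>"
    unfolding K_mor_def by (rule restrict_ext) (simp add: K_simps)
  finally show ?thesis .
qed

lemma KF_functor: "is_functor over SV KF"
proof (rule is_functorI[OF category_over category_Sh[OF category_slice[OF cat]]])
  fix x assume x: "x \<in> Ob over"
  then obtain H \<pi> where xH: "x = (H, A, \<pi>)" "sheaf el C J H" "psh_mor C H A \<pi>" by (rule over_ObE)
  then show "fob KF x \<in> Ob SV" using K_sheaf by (simp add: KF_simps)
  have "K_mor H \<pi> (\<lambda>X\<in>Ob C. \<lambda>x\<in>sec H X. x) = (\<lambda>w\<in>Ob CV. \<lambda>h\<in>sec (K x) w. h)"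
    unfolding K_mor_def by (rule restrict_ext) (auto simp: xH K_simps fibre_sec_def intro!: restrict_ext)
  then show "far KF (ide over x) = ide SV (fob KF x)" by (simp add: KF_simps xH(1))
next
  fix f assume f: "f \<in> Ar over"
  obtain x y m where fm: "f = (x, y, m)" by (cases f)
  have xy: "x \<in> Ob over" "y \<in> Ob over" using category_simps(1,2)[OF category_over f] by (simp_all only: fm slice_simps(3,4))
  obtain H \<pi> where x: "x = (H, A, \<pi>)" "sheaf el C J H" "psh_mor C H A \<pi>" using xy(1) by (rule over_ObE)
  obtain H' \<pi>' where y: "y = (H', A, \<pi>')" "sheaf el C J H'" "psh_mor C H' A \<pi>'" using xy(2) by (rule over_ObE)
  obtain \<alpha> where m: "m = (H, H', \<alpha>)" "psh_mor C H H' \<alpha>" "\<forall>W\<in>Ob C. \<forall>h\<in>sec H W. \<pi>' W (\<alpha> W h) = \<pi> W h"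
    using f over_arrow_iff[OF x(1) y(1) x(2,3) y(2,3)] unfolding fm by blast
  show "far KF f \<in> hom SV (fob KF (src over f)) (fob KF (tgt over f))"
    using K_mor[OF sheaf_presheaf[OF x(2)] x(3) m(2), of \<pi>'] m(3) K_sheaf x y
    by (simp add: fm m(1) KF_simps hom_iff)
next
  fix f g assume f: "f \<in> Ar over" and g: "g \<in> Ar over" and fg: "tgt over f = src over g"
  obtain x y m where fm: "f = (x, y, m)" by (cases f)
  obtain y' z n where gn: "g = (y', z, n)" by (cases g)
  have yy: "y' = y" using fg by (simp add: fm gn)
  have xy: "x \<in> Ob over" "y \<in> Ob over" "z \<in> Ob over"
    using category_simps(1,2)[OF category_over f] category_simps(2)[OF category_over g]
    by (simp_all only: fm gn slice_simps(3,4))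
  obtain H \<pi> where x: "x = (H, A, \<pi>)" "sheaf el C J H" "psh_mor C H A \<pi>" using xy(1) by (rule over_ObE)
  obtain H' \<pi>' where y: "y = (H', A, \<pi>')" "sheaf el C J H'" "psh_mor C H' A \<pi>'" using xy(2) by (rule over_ObE)
  obtain H'' \<pi>'' where z: "z = (H'', A, \<pi>'')" "sheaf el C J H''" "psh_mor C H'' A \<pi>''" using xy(3) by (rule over_ObE)
  obtain \<alpha> where m: "m = (H, H', \<alpha>)" "psh_mor C H H' \<alpha>" "\<forall>W\<in>Ob C. \<forall>h\<in>sec H W. \<pi>' W (\<alpha> W h) = \<pi> W h"
    using f over_arrow_iff[OF x(1) y(1) x(2,3) y(2,3)] unfolding fm by blast
  obtain \<beta> where n: "n = (H', H'', \<beta>)"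
    using g over_arrow_iff[OF y(1) z(1) y(2,3) z(2,3)] unfolding gn yy by blast
  have "K_mor H \<pi> (\<lambda>X\<in>Ob C. \<lambda>x\<in>sec H X. \<beta> X (\<alpha> X x)) =
    (\<lambda>w\<in>Ob CV. \<lambda>h\<in>sec (K x) w. K_mor H' \<pi>' \<beta> w (K_mor H \<pi> \<alpha> w h))"
    unfolding K_mor_def x(1)
    by (rule restrict_ext) (use m(3) psh_mor_simps(1)[OF m(2)] in \<open>auto simp: K_simps fibre_sec_def intro!: restrict_ext\<close>)
  then show "far KF (cmp over g f) = cmp SV (far KF g) (far KF f)"
    by (simp add: fm gn yy m(1) n KF_simps x(1) y(1) del: restrict_apply)
qed

text \<open>The presheaf \<open>H \<times>\<^bsub>A\<^esub> V\<close>; being locally isomorphic to \<open>H\<close>, it determines the morphisms out of \<open>H\<close>.\<close>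

definition pairs :: "('o, 'm, 'u) psh \<Rightarrow> ('o \<Rightarrow> 'u \<Rightarrow> 'u) \<Rightarrow> ('o, 'm, 'm \<times> 'u) psh" where
  "pairs H \<pi> = (let S = \<lambda>W. {(v, h). v \<in> hom C W V \<and> h \<in> sec H W \<and> \<pi> W h = \<eta> W v} in
     \<lparr>sec = \<lambda>W\<in>Ob C. S W, res = \<lambda>m\<in>Ar C. \<lambda>z\<in>S (tgt C m). (cmp C (fst z) m, res H m (snd z))\<rparr>)"

lemma pairs_simps:
  "W \<in> Ob C \<Longrightarrow> sec (pairs H \<pi>) W = {(v, h). v \<in> hom C W V \<and> h \<in> sec H W \<and> \<pi> W h = \<eta> W v}"
  "m \<in> Ar C \<Longrightarrow> v \<in> hom C (tgt C m) V \<Longrightarrow> h \<in> sec H (tgt C m) \<Longrightarrow> \<pi> (tgt C m) h = \<eta> (tgt C m) v \<Longrightarrow>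
     res (pairs H \<pi>) m (v, h) = (cmp C v m, res H m h)"
  by (simp_all add: pairs_def Let_def)

lemma pairs_presheaf:
  assumes H: "presheaf C H" "psh_mor C H A \<pi>" shows "presheaf C (pairs H \<pi>)"
  unfolding pairs_def Let_def
proof (rule presheafI[OF cat], goal_cases)
  case (1 m z)
  then show ?case
    using \<eta>_cmp[of "fst z" m] psh_mor_simps(2)[OF H(2), of m "snd z"] presheaf_simps(1)[OF H(1)]
    by (cases z) (simp add: hom_iff)
qed (auto simp: hom_iff assoc presheaf_simps[OF H(1)])

text \<open>This projection is the base change of the unit \<open>\<eta>\<close> along
  \<open>\<pi>\<close>, and both halves of local bijectivity are inherited from
  \<open>\<eta>\<close>.\<close>

lemma pairs_loc_bij:
  assumes H: "presheaf C H" and p: "psh_mor C H A \<pi>"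
  shows "loc_bij C J (pairs H \<pi>) H (\<lambda>W\<in>Ob C. \<lambda>z\<in>sec (pairs H \<pi>) W. snd z)"
  unfolding loc_bij_def
proof (intro conjI ballI impI)
  note Pp = pairs_presheaf[OF H p]
  show "psh_mor C (pairs H \<pi>) H (\<lambda>W\<in>Ob C. \<lambda>z\<in>sec (pairs H \<pi>) W. snd z)"
  proof (rule psh_morI[OF _ _ cat])
    show "snd z \<in> sec H W" if "W \<in> Ob C" "z \<in> sec (pairs H \<pi>) W" for W z using that by (auto simp: pairs_simps)
    show "res (pairs H \<pi>) m z \<in> sec (pairs H \<pi>) (src C m) \<and> snd (res (pairs H \<pi>) m z) = res H m (snd z)"
      if "m \<in> Ar C" "tgt C m \<in> Ob C" "z \<in> sec (pairs H \<pi>) (tgt C m)" for m z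
      using presheaf_simps(1)[OF Pp that(1,3)] that by (auto simp: pairs_simps)
  qed
  fix W assume W: "W \<in> Ob C"
  show "agreement C (pairs H \<pi>) W z z' \<in> J W" if z: "z \<in> sec (pairs H \<pi>) W" "z' \<in> sec (pairs H \<pi>) W"
    and e: "(\<lambda>W\<in>Ob C. \<lambda>z\<in>sec (pairs H \<pi>) W. snd z) W z = (\<lambda>W\<in>Ob C. \<lambda>z\<in>sec (pairs H \<pi>) W. snd z) W z'" for z z'
  proof -
    obtain v h v' where v: "z = (v, h)" "z' = (v', h)" using e z W by (cases z; cases z') simp
    have vv: "v \<in> hom C W V" "v' \<in> hom C W V" "\<eta> W v = \<eta> W v'" "h \<in> sec H W" "\<pi> W h = \<eta> W v"
      using z W by (auto simp: pairs_simps v)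
    have "{m \<in> Ar C. tgt C m = W \<and> cmp C v m = cmp C v' m} \<in> J W"
      using \<eta>_agree[of v v'] vv by (simp add: hom_iff)
    moreover have "{m \<in> Ar C. tgt C m = W \<and> cmp C v m = cmp C v' m} \<subseteq> agreement C (pairs H \<pi>) W z z'"
      using vv by (auto simp: agreement_def pairs_simps v)
    ultimately show ?thesis by (rule superset_cover[OF _ sieve_agreement[OF Pp z]])
  qed
  fix h assume h: "h \<in> sec H W"
  have "{m \<in> Ar C. tgt C m = W \<and> (\<exists>v\<in>sec (represented C V) (src C m). \<eta> (src C m) v = res A m (\<pi> W h))} \<in> J W"
    by (rule loc_bijD(3)[OF \<eta> W]) (rule psh_mor_simps(1)[OF p W h])
  moreover have "(\<exists>v\<in>sec (represented C V) (src C m). \<eta> (src C m) v = res A m (\<pi> W h)) \<longleftrightarrow>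
    (\<exists>z\<in>sec (pairs H \<pi>) (src C m). (\<lambda>W\<in>Ob C. \<lambda>z\<in>sec (pairs H \<pi>) W. snd z) (src C m) z = res H m h)"
    if m: "m \<in> Ar C" "tgt C m = W" for m
  proof -
    have "\<pi> (src C m) (res H m h) = res A m (\<pi> W h)" "res H m h \<in> sec H (src C m)"
      using psh_mor_simps(2)[OF p m(1)] presheaf_simps(1)[OF H m(1)] h m(2) by simp_all
    then show ?thesis using m by (force simp: pairs_simps)
  qed
  ultimately show "{m \<in> Ar C. tgt C m = W \<and>
      (\<exists>z\<in>sec (pairs H \<pi>) (src C m). (\<lambda>W\<in>Ob C. \<lambda>z\<in>sec (pairs H \<pi>) W. snd z) (src C m) z = res H m h)} \<in> J W"
    by (simp cong: conj_cong)
qed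

text \<open>Two morphisms that agree on all \<open>fibre_sec\<close> agree after composition with
  the locally bijective projection from \<open>pairs H \<pi>\<close>; the uniqueness in
  \<open>loc_bij_extend\<close> identifies them.\<close>

lemma pairs_unique:
  assumes H: "presheaf C H" "psh_mor C H A \<pi>" and F: "glues C J F" and a: "psh_mor C H F \<alpha>" "psh_mor C H F \<beta>"
    and e: "\<And>v h. v \<in> Ob CV \<Longrightarrow> h \<in> fibre_sec H \<pi> v \<Longrightarrow> \<alpha> (src C v) h = \<beta> (src C v) h"
  shows "\<alpha> = \<beta>"
proof -
  let ?\<rho> = "\<lambda>W\<in>Ob C. \<lambda>z\<in>sec (pairs H \<pi>) W. snd z"
  let ?\<zeta> = "\<lambda>W\<in>Ob C. \<lambda>z\<in>sec (pairs H \<pi>) W. \<alpha> W (?\<rho> W z)"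
  have lb: "loc_bij C J (pairs H \<pi>) H ?\<rho>" by (rule pairs_loc_bij[OF H])
  define P where "P \<phi> \<longleftrightarrow> psh_mor C H F \<phi> \<and>
    (\<forall>X\<in>Ob C. \<forall>x\<in>sec (pairs H \<pi>) X. \<phi> X (?\<rho> X x) = ?\<zeta> X x)" for \<phi>
  have "\<exists>!\<phi>. P \<phi>" unfolding P_def
    by (rule loc_bij_extend[OF lb pairs_presheaf[OF H] H(1) F])
      (rule psh_mor_comp[OF cat pairs_presheaf[OF H] loc_bijD(1)[OF lb] a(1)])
  moreover have "P \<alpha>" using a(1) by (simp add: P_def)
  moreover have "\<beta> W (?\<rho> W z) = ?\<zeta> W z" if "W \<in> Ob C" "z \<in> sec (pairs H \<pi>) W" for W z
    using that e by (auto simp: pairs_simps hom_iff fibre_sec_def)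
  then have "P \<beta>" using a(2) by (simp add: P_def)
  ultimately show ?thesis by blast
qed

text \<open>Faithfulness is \<open>pairs_unique\<close>. For fullness, a morphism on the slice is
  the same datum as a morphism out of the pairs, and this extends to \<open>H\<close>.\<close>

lemma KF_fully_faithful:
  assumes x: "x \<in> Ob over" and y: "y \<in> Ob over"
  shows "bij_betw (far KF) (hom over x y) (hom SV (fob KF x) (fob KF y))"
proof -
  obtain H \<pi> where x: "x = (H, A, \<pi>)" "sheaf el C J H" "psh_mor C H A \<pi>" using x by (rule over_ObE)
  obtain H' \<pi>' where y: "y = (H', A, \<pi>')" "sheaf el C J H'" "psh_mor C H' A \<pi>'" using y by (rule over_ObE)
  note Hp = sheaf_presheaf[OF x(2)] and H'p = sheaf_presheaf[OF y(2)]
  have H'g: "glues C J H'" using y(2) by (simp add: sheaf_iff_glues)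
  have arr: "f \<in> hom over x y \<longleftrightarrow> (\<exists>\<alpha>. f = (x, y, (H, H', \<alpha>)) \<and> psh_mor C H H' \<alpha> \<and>
     (\<forall>W\<in>Ob C. \<forall>h\<in>sec H W. \<pi>' W (\<alpha> W h) = \<pi> W h))" for f
  proof -
    obtain x1 y1 m where f: "f = (x1, y1, m)" by (cases f)
    show ?thesis unfolding hom_iff f slice_simps(3,4) using over_arrow_iff[OF x(1) y(1) x(2,3) y(2,3), of m] by blast
  qed
  show ?thesis unfolding bij_betw_def
  proof (intro conjI inj_onI equalityI image_subsetI)
    fix f g assume f: "f \<in> hom over x y" and g: "g \<in> hom over x y" and e: "far KF f = far KF g"
    obtain \<alpha> \<beta> where a: "f = (x, y, (H, H', \<alpha>))" "psh_mor C H H' \<alpha>" and b: "g = (x, y, (H, H', \<beta>))" "psh_mor C H H' \<beta>"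
      using f g unfolding arr by blast
    have K: "K_mor H \<pi> \<alpha> = K_mor H \<pi> \<beta>" using e by (simp add: a(1) b(1) x(1) KF_simps)
    have "\<alpha> (src C v) h = \<beta> (src C v) h" if "v \<in> Ob CV" "h \<in> fibre_sec H \<pi> v" for v h
      using fun_cong[OF fun_cong[OF K, of v], of h] that by (simp add: K_mor_def)
    then show "f = g" using pairs_unique[OF Hp x(3) H'g a(2) b(2)] a b by simp
  next
    fix f assume "f \<in> hom over x y"
    then show "far KF f \<in> hom SV (fob KF x) (fob KF y)"
      using functor_simps(4-6)[OF KF_functor] by (simp add: hom_iff)
  next
    show "hom SV (fob KF x) (fob KF y) \<subseteq> far KF ` hom over x y"
    proof
      fix f assume f: "f \<in> hom SV (fob KF x) (fob KF y)"
      obtain F G \<beta> where fb: "f = (F, G, \<beta>)" by (cases f)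
      have b: "F = K x" "G = K y" "psh_mor CV (K x) (K y) \<beta>" using f by (auto simp: fb hom_iff KF_simps)
      note bs = psh_mor_simps[OF b(3)]
      have b1: "\<beta> v h \<in> fibre_sec H' \<pi>' v" if "v \<in> Ob CV" "h \<in> fibre_sec H \<pi> v" for v h
        using bs(1)[OF that(1)] that by (simp add: K_simps x(1) y(1))
      have b2: "\<beta> (cmp C v m) (res H m h) = res H' m (\<beta> v h)"
        if v: "v \<in> Ar C" "tgt C v = V" and m: "m \<in> Ar C" "tgt C m = src C v" and h: "h \<in> fibre_sec H \<pi> v" for v m h
      proof -
        have t: "(cmp C v m, v, m) \<in> Ar CV" using v m by simp
        have "\<beta> (cmp C v m) (res (K x) (cmp C v m, v, m) h) = res (K y) (cmp C v m, v, m) (\<beta> v h)"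
          using bs(2)[OF t, of h] h v by (simp add: K_simps x(1))
        then show ?thesis
          using K_simps(2)[OF t, of h H \<pi>] K_simps(2)[OF t, of "\<beta> v h" H' \<pi>'] h b1 v by (simp add: x(1) y(1))
      qed
      let ?\<rho> = "\<lambda>W\<in>Ob C. \<lambda>z\<in>sec (pairs H \<pi>) W. snd z"
      let ?\<zeta> = "\<lambda>W\<in>Ob C. \<lambda>z\<in>sec (pairs H \<pi>) W. \<beta> (fst z) (snd z)"
      have pf: "v \<in> Ar C" "tgt C v = V" "src C v = W" "h \<in> fibre_sec H \<pi> v"
        if "W \<in> Ob C" "(v, h) \<in> sec (pairs H \<pi>) W" for W v h
        using that by (auto simp: pairs_simps hom_iff fibre_sec_def)
      \<comment> \<open>The family \<open>\<beta>\<close>, indexed by structure arrows, becomes a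
        single morphism by letting the first component of a pair select the index.\<close>
      have z: "psh_mor C (pairs H \<pi>) H' ?\<zeta>"
      proof (rule psh_morI[OF _ _ cat])
        fix W z assume W: "W \<in> Ob C" "z \<in> sec (pairs H \<pi>) W"
        obtain v h where vh: "z = (v, h)" by (cases z)
        show "\<beta> (fst z) (snd z) \<in> sec H' W"
          using pf[OF W(1)] W(2) b1[of v h] by (auto simp: vh fibre_sec_def)
      next
        fix m z assume m: "m \<in> Ar C" "src C m \<in> Ob C" "tgt C m \<in> Ob C" and W: "z \<in> sec (pairs H \<pi>) (tgt C m)"
        obtain v h where vh: "z = (v, h)" by (cases z)
        note p = pf[OF m(3) W[unfolded vh]]
        have "res (pairs H \<pi>) m z = (cmp C v m, res H m h)"
          using W m by (simp add: vh pairs_simps)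
        then show "res (pairs H \<pi>) m z \<in> sec (pairs H \<pi>) (src C m) \<and>
          \<beta> (fst (res (pairs H \<pi>) m z)) (snd (res (pairs H \<pi>) m z)) = res H' m (\<beta> (fst z) (snd z))"
          using b2[OF p(1,2) m(1) p(3)[symmetric] p(4)] presheaf_simps(1)[OF pairs_presheaf[OF Hp x(3)] m(1) W]
          by (simp add: vh)
      qed
      obtain \<alpha> where al: "psh_mor C H H' \<alpha>" "\<forall>W\<in>Ob C. \<forall>z\<in>sec (pairs H \<pi>) W. \<alpha> W (?\<rho> W z) = ?\<zeta> W z"
        using loc_bij_extend[OF pairs_loc_bij[OF Hp x(3)] pairs_presheaf[OF Hp x(3)] Hp H'g z] by blast
      have ab: "\<alpha> (src C v) h = \<beta> v h" if v: "v \<in> Ob CV" "h \<in> fibre_sec H \<pi> v" for v h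
      proof -
        have W: "src C v \<in> Ob C" "(v, h) \<in> sec (pairs H \<pi>) (src C v)"
          using v by (auto simp: pairs_simps hom_iff fibre_sec_def)
        show ?thesis using al(2)[rule_format, OF W] W by simp
      qed
      \<comment> \<open>That the extension commutes with the maps to \<open>A\<close> is again an
        equality of morphisms out of \<open>H\<close>, now with the sheaf \<open>A\<close> as
        target, so it too is tested on the pairs.\<close>
      have e: "(\<lambda>W\<in>Ob C. \<lambda>h\<in>sec H W. \<pi>' W (\<alpha> W h)) = \<pi>"
      proof (rule pairs_unique[OF Hp x(3) A_glues psh_mor_comp[OF cat Hp al(1) y(3)] x(3)])
        fix v h assume v: "v \<in> Ob CV" "h \<in> fibre_sec H \<pi> v"
        then show "(\<lambda>W\<in>Ob C. \<lambda>h\<in>sec H W. \<pi>' W (\<alpha> W h)) (src C v) h = \<pi> (src C v) h"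
          using ab[OF v] b1[OF v] by (simp add: fibre_sec_def)
      qed
      have "\<pi>' W (\<alpha> W h) = \<pi> W h" if "W \<in> Ob C" "h \<in> sec H W" for W h
        using fun_cong[OF fun_cong[OF e, of W], of h] that by simp
      then have "(x, y, (H, H', \<alpha>)) \<in> hom over x y" unfolding arr using al(1) by blast
      moreover have "K_mor H \<pi> \<alpha> = \<beta>"
      proof (rule psh_mor_ext[OF _ b(3)])
        show "psh_mor CV (K x) (K y) (K_mor H \<pi> \<alpha>)"
          unfolding x(1) y(1) by (rule K_mor[OF Hp x(3) al(1)]) fact
        show "K_mor H \<pi> \<alpha> v h = \<beta> v h" if "v \<in> Ob CV" "h \<in> sec (K x) v" for v h
          using that ab by (simp add: K_mor_def K_simps x(1))
      qed
      ultimately show "f \<in> far KF ` hom over x y"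
        by (intro image_eqI[of _ _ "(x, y, (H, H', \<alpha>))"]) (simp_all add: fb b(1,2) x(1) KF_simps)
    qed
  qed
qed

lemma lift_cover:
  assumes w: "w \<in> Ar C" "tgt C w = V" and R: "R \<in> J (src C w)"
  shows "(\<lambda>m. (cmp C w m, w, m)) ` R \<in> JV w"
proof -
  note s = sieveD[OF cover_sieve[OF R]]
  have "sieve CV w ((\<lambda>m. (cmp C w m, w, m)) ` R)" unfolding sieve_def
  proof (intro conjI ballI impI subsetI)
    fix t assume "t \<in> (\<lambda>m. (cmp C w m, w, m)) ` R"
    then obtain m where m: "t = (cmp C w m, w, m)" "m \<in> R" by blast
    then show "t \<in> {m \<in> Ar CV. tgt CV m = w}" using s(1,2)[OF m(2)] w by simp
    fix g assume g: "g \<in> Ar CV" "tgt CV g = src CV t"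
    obtain a b n where n: "g = (a, b, n)" by (cases g)
    have n': "n \<in> Ar C" "tgt C n = src C m" "a = cmp C (cmp C w m) n"
      using g s(1,2)[OF m(2)] w by (auto simp: n m(1))
    then have "cmp CV t g = (cmp C w (cmp C m n), w, cmp C m n)"
      using s(1,2)[OF m(2)] w by (simp add: n m(1) assoc)
    then show "cmp CV t g \<in> (\<lambda>m. (cmp C w m, w, m)) ` R" using s(3)[OF m(2) n'(1,2)] by blast
  qed
  moreover have "far \<gamma> ` (\<lambda>m. (cmp C w m, w, m)) ` R = R" by (simp add: image_image)
  ultimately show ?thesis using w R by (simp add: lift_topology_def)
qed

text \<open>The presheaf \<open>W \<mapsto> \<Coprod>\<^bsub>v: W \<rightarrow> V\<^esub> F(v)\<close>; the sheaf associated to it is the object over \<open>\<epsilon>(V)\<close>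
  corresponding to \<open>F\<close>.\<close>

definition total_psh :: "('m, 'm \<times> 'm \<times> 'm, 'u) psh \<Rightarrow> ('o, 'm, 'm \<times> 'u) psh" where
  "total_psh F = (let S = \<lambda>W. {(v, x). v \<in> hom C W V \<and> x \<in> sec F v} in
     \<lparr>sec = \<lambda>W\<in>Ob C. S W,
      res = \<lambda>m\<in>Ar C. \<lambda>z\<in>S (tgt C m). (cmp C (fst z) m, res F (cmp C (fst z) m, fst z, m) (snd z))\<rparr>)"

lemma total_psh_simps:
  "W \<in> Ob C \<Longrightarrow> sec (total_psh F) W = {(v, x). v \<in> hom C W V \<and> x \<in> sec F v}"
  "m \<in> Ar C \<Longrightarrow> v \<in> Ar C \<Longrightarrow> src C v = tgt C m \<Longrightarrow> tgt C v = V \<Longrightarrow> x \<in> sec F v \<Longrightarrow>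
     res (total_psh F) m (v, x) = (cmp C v m, res F (cmp C v m, v, m) x)"
  by (simp_all add: total_psh_def Let_def hom_iff)

lemma total_psh_presheaf:
  assumes F: "presheaf CV F" shows "presheaf C (total_psh F)"
  unfolding total_psh_def Let_def
proof (rule presheafI[OF cat], goal_cases)
  case (1 m z)
  then show ?case using presheaf_simps(1)[OF F, of "(cmp C (fst z) m, fst z, m)" "snd z"]
    by (cases z) (simp add: hom_iff)
next
  case (2 W z)
  then show ?case using presheaf_simps(2)[OF F, of "fst z" "snd z"] by (cases z) (simp add: hom_iff)
next
  case (3 m n z)
  then show ?case
    using presheaf_simps(3)[OF F, of "(cmp C (cmp C (fst z) n) m, cmp C (fst z) n, m)" "(cmp C (fst z) n, fst z, n)" "snd z"]
    by (cases z) (simp add: hom_iff assoc)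
qed

text \<open>The difficulty is surjectivity: a section of \<open>H\<close> above the one defined by
  \<open>w\<close> has local representatives \<open>(v, x)\<close> whose index \<open>v\<close> may
  differ from the restriction of \<open>w\<close>. Both indices define the same section of
  \<open>A\<close>, so they coincide after a further refinement.\<close>

lemma KF_essentially_surjective:
  assumes F: "sheaf el CV JV F"
  shows "\<exists>x\<in>Ob over. \<exists>t. t \<in> hom SV F (fob KF x) \<and> is_iso SV t"
proof -
  note Fp = sheaf_presheaf[OF F] and Pp = total_psh_presheaf[OF sheaf_presheaf[OF F]]
  have Fg: "glues CV JV F" using F by (simp add: sheaf_iff_glues)
  let ?P = "total_psh F"
  have "U_small el (sec ?P W)" if W: "W \<in> Ob C" for W
  proof -
    have "U_small el (Sigma (hom C W V) (sec F))"
      using U_site V W F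
      by (intro U_small_Sigma[OF u] U_small_range_el) (auto simp: U_site_def sheaf_iff_glues hom_iff)
    moreover have "sec ?P W = Sigma (hom C W V) (sec F)" using W by (auto simp: total_psh_simps)
    ultimately show ?thesis by simp
  qed
  then obtain H :: "('o, 'm, 'u) psh" and \<theta> where H: "sheaf el C J H" and lb: "loc_bij C J ?P H \<theta>"
    using associated_sheaf_exists[OF u U_site Pp] by blast
  note Hp = sheaf_presheaf[OF H] and t = psh_mor_simps[OF loc_bijD(1)[OF lb]]
  have Hg: "glues C J H" using H by (simp add: sheaf_iff_glues)
  \<comment> \<open>Only the index matters for the map to \<open>A\<close>; extended to
    \<open>H\<close> it makes \<open>H\<close> an object over the associated sheaf of
    \<open>V\<close>.\<close>
  have z: "psh_mor C ?P A (\<lambda>W\<in>Ob C. \<lambda>z\<in>sec ?P W. \<eta> W (fst z))"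
  proof (rule psh_morI[OF _ _ cat])
    show "\<eta> W (fst z) \<in> sec A W" if "W \<in> Ob C" "z \<in> sec ?P W" for W z
      using that \<eta>_sec by (auto simp: total_psh_simps hom_iff)
    show "res ?P m z \<in> sec ?P (src C m) \<and> \<eta> (src C m) (fst (res ?P m z)) = res A m (\<eta> (tgt C m) (fst z))"
      if m: "m \<in> Ar C" "tgt C m \<in> Ob C" "z \<in> sec ?P (tgt C m)" for m z
    proof -
      obtain v x where vx: "z = (v, x)" by (cases z)
      have v: "v \<in> Ar C" "src C v = tgt C m" "tgt C v = V" "x \<in> sec F v"
        using m by (auto simp: total_psh_simps hom_iff vx)
      show ?thesis using presheaf_simps(1)[OF Pp m(1,3)] \<eta>_cmp[OF v(1,3) m(1)] v m(1)
        by (simp add: vx total_psh_simps(2)[OF m(1) v])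
    qed
  qed
  obtain \<pi> where p: "psh_mor C H A \<pi>"
    and p2: "\<forall>W\<in>Ob C. \<forall>z\<in>sec ?P W. \<pi> W (\<theta> W z) = (\<lambda>W\<in>Ob C. \<lambda>z\<in>sec ?P W. \<eta> W (fst z)) W z"
    using loc_bij_extend[OF lb Pp Hp A_glues z] by blast
  have mem: "(v, x) \<in> sec ?P (src C v)" if "v \<in> Ar C" "tgt C v = V" "x \<in> sec F v" for v x
    using that by (simp add: total_psh_simps hom_iff)
  have p\<theta>: "\<pi> (src C v) (\<theta> (src C v) (v, x)) = \<eta> (src C v) v" if "v \<in> Ar C" "tgt C v = V" "x \<in> sec F v" for v x
    using p2 mem[OF that] that by simp
  let ?K = "K (H, A, \<pi>)"
  note s = K_sheaf[OF H p]
  define \<tau> where "\<tau> = (\<lambda>w\<in>Ob CV. \<lambda>x\<in>sec F w. \<theta> (src C w) (w, x))"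
  have tau_sec: "\<theta> (src C w) (w, x) \<in> fibre_sec H \<pi> w" if "w \<in> Ar C" "tgt C w = V" "x \<in> sec F w" for w x
    using t(1)[OF _ mem[OF that]] p\<theta>[OF that] that by (simp add: fibre_sec_def)
  have tau_res: "res H m (\<theta> (src C w) (w, x)) = \<theta> (src C m) (cmp C w m, res F (cmp C w m, w, m) x)"
    if "w \<in> Ar C" "tgt C w = V" "x \<in> sec F w" "m \<in> Ar C" "tgt C m = src C w" for w x m
    using t(2)[of m "(w, x)"] mem[OF that(1-3)] that by (simp add: total_psh_simps(2))
  have tau: "psh_mor CV F ?K \<tau>" unfolding \<tau>_def
  proof (rule psh_morI[OF _ _ category_slice[OF cat]])
    show "\<theta> (src C w) (w, x) \<in> sec ?K w" if "w \<in> Ob CV" "x \<in> sec F w" for w x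
      using tau_sec that by (simp add: K_simps)
    fix g x assume g: "g \<in> Ar CV" "src CV g \<in> Ob CV" "tgt CV g \<in> Ob CV" "x \<in> sec F (tgt CV g)"
    obtain a w m where gm: "g = (a, w, m)" by (cases g)
    have m: "w \<in> Ar C" "tgt C w = V" "m \<in> Ar C" "tgt C m = src C w" "a = cmp C w m" "x \<in> sec F w"
      using g by (auto simp: gm)
    have "res ?K g (\<theta> (src C w) (w, x)) = res H m (\<theta> (src C w) (w, x))"
      using K_simps(2)[OF g(1), of "\<theta> (src C w) (w, x)" H \<pi>] tau_sec[OF m(1,2,6)] by (simp add: gm)
    then show "res F g x \<in> sec F (src CV g) \<and>
        \<theta> (src C (src CV g)) (src CV g, res F g x) = res ?K g (\<theta> (src C (tgt CV g)) (tgt CV g, x))"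
      using presheaf_simps(1)[OF Fp g(1,4)] tau_res[OF m(1,2,6,3,4)] m by (simp add: gm)
  qed
  \<comment> \<open>Equal images give pairs that agree locally in the coproduct. With the same index
    \<open>w\<close> on both sides, this is local equality in \<open>F\<close>, which is
    separated.\<close>
  have inj: "x = y" if w: "w \<in> Ar C" "tgt C w = V" and x: "x \<in> sec F w" "y \<in> sec F w"
    and e: "\<theta> (src C w) (w, x) = \<theta> (src C w) (w, y)" for w x y
  proof (rule L.lift.glues_separated[OF Fg lift_cover[OF w] x])
    show "agreement C ?P (src C w) (w, x) (w, y) \<in> J (src C w)"
      by (rule loc_bijD(2)[OF lb _ mem[OF w x(1)] mem[OF w x(2)] e]) (use w in simp)
    fix k assume "k \<in> (\<lambda>m. (cmp C w m, w, m)) ` agreement C ?P (src C w) (w, x) (w, y)"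
    then obtain m where m: "k = (cmp C w m, w, m)" "m \<in> Ar C" "tgt C m = src C w" "res ?P m (w, x) = res ?P m (w, y)"
      by (auto simp: agreement_def)
    then show "res F k x = res F k y"
      using total_psh_simps(2)[OF m(2) w(1) m(3)[symmetric] w(2)] x by simp
  qed
  have surj: "\<exists>x\<in>sec F w. \<theta> (src C w) (w, x) = h"
    if w: "w \<in> Ar C" "tgt C w = V" and h: "h \<in> fibre_sec H \<pi> w" for w h
  proof -
    let ?W = "src C w"
    have W: "?W \<in> Ob C" and h': "h \<in> sec H ?W" "\<pi> ?W h = \<eta> ?W w" using w h by (simp_all add: fibre_sec_def)
    \<comment> \<open>The local representatives of \<open>h\<close> whose index is the restriction
      of \<open>w\<close> itself; only these can be glued to a section of \<open>F\<close> over
      \<open>w\<close>.\<close>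
    define Q where "Q m x \<longleftrightarrow> x \<in> sec F (cmp C w m) \<and> \<theta> (src C m) (cmp C w m, x) = res H m h" for m x
    define D where "D = {m \<in> Ar C. tgt C m = ?W \<and> (\<exists>x. Q m x)}"
    have Q_res: "Q (cmp C m n) (res F (cmp C w (cmp C m n), cmp C w m, n) x)"
      if m: "m \<in> Ar C" "tgt C m = ?W" and n: "n \<in> Ar C" "tgt C n = src C m" and x: "Q m x" for m n x
    proof -
      have wm: "cmp C w m \<in> Ar C" "tgt C (cmp C w m) = V" "src C (cmp C w m) = src C m" using w m by simp_all
      have k: "(cmp C (cmp C w m) n, cmp C w m, n) \<in> Ar CV" using wm n by simp
      have "res F (cmp C (cmp C w m) n, cmp C w m, n) x \<in> sec F (cmp C (cmp C w m) n)"
        using presheaf_simps(1)[OF Fp k] x by (simp add: Q_def)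
      moreover have "res H n (\<theta> (src C m) (cmp C w m, x)) = \<theta> (src C n) (cmp C (cmp C w m) n, res F (cmp C (cmp C w m) n, cmp C w m, n) x)"
        using tau_res[OF wm(1,2) _ n(1), of x] x n wm(3) by (simp add: Q_def)
      moreover have "res H n (res H m h) = res H (cmp C m n) h"
        using presheaf_simps(3)[OF Hp n(1) m(1), of h] n m h' by simp
      ultimately show ?thesis using x w m n by (simp add: Q_def assoc)
    qed
    have D: "D \<in> J ?W"
    proof (rule local_cover[OF loc_bijD(3)[OF lb W h'(1)]])
      show "sieve C ?W D" unfolding sieve_def using Q_res by (auto simp: D_def)
      fix m assume "m \<in> {m \<in> Ar C. tgt C m = ?W \<and> (\<exists>z\<in>sec ?P (src C m). \<theta> (src C m) z = res H m h)}"
      then obtain v x where m: "m \<in> Ar C" "tgt C m = ?W" and vx: "(v, x) \<in> sec ?P (src C m)" "\<theta> (src C m) (v, x) = res H m h"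
        by auto
      have v: "v \<in> Ar C" "src C v = src C m" "tgt C v = V" "x \<in> sec F v"
        using vx(1) m by (auto simp: total_psh_simps hom_iff)
      have "\<eta> (src C m) v = \<pi> (src C m) (res H m h)" using p\<theta>[OF v(1,3,4)] v(2) vx(2) by simp
      also have "\<dots> = \<eta> (src C m) (cmp C w m)"
        using psh_mor_simps(2)[OF p m(1), of h] h' m \<eta>_cmp[OF w m] by simp
      \<comment> \<open>On this covering sieve the index \<open>v\<close> of the representative
        becomes the restriction of \<open>w\<close>, so the representative moves into the right
        summand.\<close>
      finally have T: "{n \<in> Ar C. tgt C n = src C m \<and> cmp C v n = cmp C (cmp C w m) n} \<in> J (src C m)"
        using \<eta>_agree[of v "cmp C w m"] v w m by simp
      have "cmp C m n \<in> D" if n: "n \<in> Ar C" "tgt C n = src C m" "cmp C v n = cmp C (cmp C w m) n" for n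
      proof -
        have wn: "cmp C w (cmp C m n) = cmp C v n" using n w m by (simp add: assoc)
        have "(cmp C v n, v, n) \<in> Ar CV" using v n(1,2) by simp
        from presheaf_simps(1)[OF Fp this] have "res F (cmp C v n, v, n) x \<in> sec F (cmp C v n)" using v by simp
        moreover have "\<theta> (src C n) (cmp C v n, res F (cmp C v n, v, n) x) = res H (cmp C m n) h"
          using tau_res[OF v(1,3,4) n(1)] v n vx(2) m presheaf_simps(3)[OF Hp n(1) m(1), of h] h' by simp
        ultimately have "Q (cmp C m n) (res F (cmp C v n, v, n) x)" using n m by (simp add: Q_def wn)
        then show ?thesis using n m by (auto simp: D_def)
      qed
      then show "\<exists>T\<in>J (src C m). \<forall>n\<in>T. cmp C m n \<in> D" by (intro bexI[OF _ T]) simp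
    qed
    \<comment> \<open>Injectivity makes representatives with a fixed index unique, so the local ones
      are automatically compatible.\<close>
    have Q_unique: "x = y" if "Q m x" "Q m y" "m \<in> Ar C" "tgt C m = ?W" for m x y
      using inj[of "cmp C w m" x y] that w by (simp add: Q_def)
    define k where "k t = (THE x. Q (snd (snd t)) x)" for t :: "'m \<times> 'm \<times> 'm"
    have k: "Q m (k (cmp C w m, w, m))" if "m \<in> D" for m
    proof -
      have "\<exists>!x. Q m x" using that Q_unique by (auto simp: D_def)
      then show ?thesis unfolding k_def by (simp add: theI')
    qed
    obtain x where x: "x \<in> sec F w" "\<And>g. g \<in> (\<lambda>m. (cmp C w m, w, m)) ` D \<Longrightarrow> res F g x = k g"
    proof (rule L.lift.glues_glue[OF Fg lift_cover[OF w D], of k])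
      fix g assume "g \<in> (\<lambda>m. (cmp C w m, w, m)) ` D"
      then obtain m where m: "g = (cmp C w m, w, m)" "m \<in> D" by blast
      show "k g \<in> sec F (src CV g)" using k[OF m(2)] by (simp add: m(1) Q_def)
      fix r assume r: "r \<in> Ar CV" "tgt CV r = src CV g"
      obtain a b n where rn: "r = (a, b, n)" by (cases r)
      have m': "m \<in> Ar C" "tgt C m = ?W" using m(2) by (simp_all add: D_def)
      have n: "n \<in> Ar C" "tgt C n = src C m" "a = cmp C w (cmp C m n)" "b = cmp C w m"
        using r w m' by (auto simp: rn m(1) assoc)
      have mn: "cmp C m n \<in> D" using sieveD(3)[OF cover_sieve[OF D] m(2) n(1,2)] .
      have "k (cmp C w (cmp C m n), w, cmp C m n) = res F r (k g)"
        by (rule Q_unique[OF k[OF mn]])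
          (use Q_res[OF m' n(1,2) k[OF m(2)]] m' n in \<open>simp_all add: rn m(1)\<close>)
      then show "k (cmp CV g r) = res F r (k g)" using n by (simp add: m(1) rn)
    qed blast
    have "\<theta> ?W (w, x) = h"
    proof (rule glues_separated[OF Hg D])
      show "\<theta> ?W (w, x) \<in> sec H ?W" using tau_sec[OF w x(1)] by (simp add: fibre_sec_def)
      fix m assume m: "m \<in> D"
      then have m': "m \<in> Ar C" "tgt C m = ?W" by (simp_all add: D_def)
      have "res F (cmp C w m, w, m) x = k (cmp C w m, w, m)" using x(2) m by blast
      then show "res H m (\<theta> ?W (w, x)) = res H m h"
        using tau_res[OF w x(1) m'] k[OF m] by (simp add: Q_def)
    qed (rule h'(1))
    then show ?thesis using x(1) by blast
  qed
  have "bij_betw (\<tau> w) (sec F w) (sec ?K w)" if "w \<in> Ob CV" for w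
    unfolding bij_betw_def
  proof (intro conjI inj_onI equalityI subsetI)
    have w: "w \<in> Ar C" "tgt C w = V" using that by simp_all
    show "x = y" if "x \<in> sec F w" "y \<in> sec F w" "\<tau> w x = \<tau> w y" for x y
      using inj[OF w] that w by (simp add: \<tau>_def)
    show "h \<in> sec ?K w" if "h \<in> \<tau> w ` sec F w" for h
      using that tau_sec[OF w] w by (auto simp: \<tau>_def K_simps)
    show "h \<in> \<tau> w ` sec F w" if h: "h \<in> sec ?K w" for h
    proof -
      have "h \<in> fibre_sec H \<pi> w" using h w by (simp add: K_simps)
      then obtain x where "x \<in> sec F w" "\<theta> (src C w) (w, x) = h" using surj[OF w] by blast
      then show ?thesis using w by (intro image_eqI[of _ _ x]) (simp_all add: \<tau>_def)
    qed
  qed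
  then have "is_iso SV (F, ?K, \<tau>)"
    by (rule Sh_isoI[OF category_slice[OF cat] F s tau])
  moreover have "(F, ?K, \<tau>) \<in> hom SV F (fob KF (H, A, \<pi>))"
    using F s tau by (simp add: hom_iff KF_simps)
  moreover have "(H, A, \<pi>) \<in> Ob over" using H p A by simp
  ultimately show ?thesis by blast
qed

theorem KF_quasi_inverse: "\<exists>e. quasi_inverse SV over e KF"
  by (rule fully_faithful_ess_surj_quasi_inverse[OF KF_functor KF_fully_faithful])
    (use KF_essentially_surjective in simp_all)

end

section \<open>Products with the localizing sheaf\<close>

lemma psh_prod_simps:
  "W \<in> Ob C \<Longrightarrow> sec (psh_prod el C F G) W = {kpair el x y | x y. x \<in> sec F W \<and> y \<in> sec G W}"
  "universe el \<Longrightarrow> m \<in> Ar C \<Longrightarrow> x \<in> sec F (tgt C m) \<Longrightarrow> y \<in> sec G (tgt C m) \<Longrightarrow>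
     res (psh_prod el C F G) m (kpair el x y) = kpair el (res F m x) (res G m y)"
  by (auto simp: psh_prod_def)

lemma presheaf_psh_prod:
  assumes "universe el" "category C" "presheaf C F" "presheaf C G" shows "presheaf C (psh_prod el C F G)"
  unfolding psh_prod_def
  by (rule presheafI[OF assms(2)])
    (use assms(1) presheaf_simps[OF assms(3)] presheaf_simps[OF assms(4)] in \<open>auto simp: category_simps[OF assms(2)]\<close>)

lemma psh_mor_snd:
  assumes "universe el" "category C" "presheaf C F" "presheaf C G"
  shows "psh_mor C (psh_prod el C F G) G (psh_snd el C F G)"
  unfolding psh_snd_def
proof (rule psh_morI[OF _ _ assms(2)])
  show "usnd el z \<in> sec G W" if "W \<in> Ob C" "z \<in> sec (psh_prod el C F G) W" for W z
    using that assms(1) by (auto simp: psh_prod_simps)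
  show "res (psh_prod el C F G) m z \<in> sec (psh_prod el C F G) (src C m) \<and>
      usnd el (res (psh_prod el C F G) m z) = res G m (usnd el z)"
    if "m \<in> Ar C" "tgt C m \<in> Ob C" "z \<in> sec (psh_prod el C F G) (tgt C m)" for m z
    using presheaf_simps(1)[OF presheaf_psh_prod[OF assms] that(1,3)] that assms(1)
    by (auto simp: psh_prod_simps)
qed

context site begin

lemma sheaf_psh_prod:
  assumes u: "universe el" and F: "sheaf el C J F" and G: "sheaf el C J G"
  shows "sheaf el C J (psh_prod el C F G)"
proof -
  let ?P = "psh_prod el C F G"
  note Fp = sheaf_presheaf[OF F] and Gp = sheaf_presheaf[OF G]
  note pp = presheaf_psh_prod[OF u cat Fp Gp]
  have Fg: "glues C J F" and Gg: "glues C J G" using F G by (simp_all add: sheaf_iff_glues)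
  have comp: "ufst el z \<in> sec F W" "usnd el z \<in> sec G W" "kpair el (ufst el z) (usnd el z) = z"
    if "W \<in> Ob C" "z \<in> sec ?P W" for W z using that u by (auto simp: psh_prod_simps)
  have compr: "ufst el (res ?P m z) = res F m (ufst el z)" "usnd el (res ?P m z) = res G m (usnd el z)"
    if "m \<in> Ar C" "z \<in> sec ?P (tgt C m)" for m z
    using that u by (auto simp: psh_prod_simps)
  have "glues C J ?P"
  proof (rule gluesI[OF pp])
    fix X R assume R: "R \<in> J X" and X: "X \<in> Ob C"
    note s = sieveD[OF cover_sieve[OF R]]
    show "x = y" if x: "x \<in> sec ?P X" "y \<in> sec ?P X" "\<And>m. m \<in> R \<Longrightarrow> res ?P m x = res ?P m y" for x y
    proof -
      have "ufst el x = ufst el y"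
        by (rule glues_separated[OF Fg R comp(1)[OF X x(1)] comp(1)[OF X x(2)]])
          (use x s compr(1) in metis)
      moreover have "usnd el x = usnd el y"
        by (rule glues_separated[OF Gg R comp(2)[OF X x(1)] comp(2)[OF X x(2)]])
          (use x s compr(2) in metis)
      ultimately show ?thesis using comp(3) X x by metis
    qed
    fix t assume t: "\<And>m. m \<in> R \<Longrightarrow> t m \<in> sec ?P (src C m)"
      "\<And>m g. m \<in> R \<Longrightarrow> g \<in> Ar C \<Longrightarrow> tgt C g = src C m \<Longrightarrow> t (cmp C m g) = res ?P g (t m)"
    have so: "src C m \<in> Ob C" if "m \<in> R" for m using s(1)[OF that] by simp
    obtain x where x: "x \<in> sec F X" "\<And>m. m \<in> R \<Longrightarrow> res F m x = ufst el (t m)"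
      by (rule glues_glue[OF Fg R, of "\<lambda>m. ufst el (t m)"]) (use t s so comp(1) compr(1) in auto)
    obtain y where y: "y \<in> sec G X" "\<And>m. m \<in> R \<Longrightarrow> res G m y = usnd el (t m)"
      by (rule glues_glue[OF Gg R, of "\<lambda>m. usnd el (t m)"]) (use t s so comp(2) compr(2) in auto)
    have "res ?P m (kpair el x y) = t m" if "m \<in> R" for m
      using x y s(1,2)[OF that] that comp(3)[OF so t(1)] by (simp add: psh_prod_simps u)
    then show "\<exists>x\<in>sec ?P X. \<forall>m\<in>R. res ?P m x = t m"
      using x(1) y(1) X by (intro bexI[of _ "kpair el x y"]) (auto simp: psh_prod_simps)
  qed
  moreover have "sec ?P W \<in> range el" if "W \<in> Ob C" for W
    using universe_kpairs[OF u, of "sec F W" "\<lambda>_. sec G W"] F G that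
    by (simp add: psh_prod_simps sheaf_iff_glues)
  ultimately show ?thesis by (simp add: sheaf_iff_glues)
qed

end

section \<open>The localization functor and its comparison with restriction to the slice\<close>

context localized_site begin

abbreviation "prodA F \<equiv> psh_prod el C F A"
abbreviation "sndA F \<equiv> psh_snd el C F A"
abbreviation "prod_map F \<alpha> \<equiv> \<lambda>X\<in>Ob C. \<lambda>z\<in>sec (prodA F) X. kpair el (\<alpha> X (ufst el z)) (usnd el z)"

lemma localize_simps:
  "fob (localize el C A) F = (prodA F, A, sndA F)"
  "far (localize el C A) (F, G, \<alpha>) = ((prodA F, A, sndA F), (prodA G, A, sndA G),
     (prodA F, prodA G, prod_map F \<alpha>))"
  by (simp_all add: localize_def Let_def)

lemma localize_Ob: "sheaf el C J F \<Longrightarrow> (prodA F, A, sndA F) \<in> Ob over"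
  using sheaf_psh_prod[OF u _ A] psh_mor_snd[OF u cat sheaf_presheaf A_presheaf] A by simp

lemma localize_functor: "is_functor SC over (localize el C A)"
proof (rule is_functorI[OF category_Sh[OF cat] category_over])
  have snd: "sndA F W z = usnd el z" if "W \<in> Ob C" "z \<in> sec (prodA F) W" for F W z
    using that by (simp add: psh_snd_def)
  have map: "kpair el (\<alpha> W (ufst el z)) (usnd el z) \<in> sec (prodA G) W"
    if "psh_mor C F G \<alpha>" "W \<in> Ob C" "z \<in> sec (prodA F) W" for F G \<alpha> W z
    using that u psh_mor_simps(1)[OF that(1)] by (auto simp: psh_prod_simps)
  show "fob (localize el C A) F \<in> Ob over" if "F \<in> Ob SC" for F
    using localize_Ob that unfolding localize_simps by simp
  show "far (localize el C A) f \<in> hom over (fob (localize el C A) (src SC f)) (fob (localize el C A) (tgt SC f))"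
    if f: "f \<in> Ar SC" for f
  proof -
    obtain F G \<alpha> where fa: "f = (F, G, \<alpha>)" by (cases f)
    have F: "sheaf el C J F" "sheaf el C J G" "psh_mor C F G \<alpha>" using f by (simp_all add: fa)
    note pF = sheaf_presheaf[OF F(1)] and pG = sheaf_presheaf[OF F(2)]
    have "psh_mor C (prodA F) (prodA G)
      (prod_map F \<alpha>)"
    proof (rule psh_morI[OF map[OF F(3)] _ cat])
      fix m z assume m: "m \<in> Ar C" "src C m \<in> Ob C" "tgt C m \<in> Ob C" "z \<in> sec (prodA F) (tgt C m)"
      then obtain x y where xy: "z = kpair el x y" "x \<in> sec F (tgt C m)" "y \<in> sec A (tgt C m)"
        by (auto simp: psh_prod_simps)
      then show "res (prodA F) m z \<in> sec (prodA F) (src C m) \<and>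
        kpair el (\<alpha> (src C m) (ufst el (res (prodA F) m z))) (usnd el (res (prodA F) m z)) =
        res (prodA G) m (kpair el (\<alpha> (tgt C m) (ufst el z)) (usnd el z))"
        using presheaf_simps(1)[OF presheaf_psh_prod[OF u cat pF A_presheaf] m(1,4)] m
          psh_mor_simps[OF F(3)] by (simp add: psh_prod_simps(2) u)
    qed
    moreover have "sndA G W (kpair el (\<alpha> W (ufst el z)) (usnd el z)) = sndA F W z"
      if "W \<in> Ob C" "z \<in> sec (prodA F) W" for W z
      using snd[OF that] snd[OF that(1) map[OF F(3) that]] by (simp add: u)
    ultimately show ?thesis
      unfolding hom_iff fa localize_simps Sh_simps slice_simps(3,4)
      by (subst over_arrow_iff[OF refl refl sheaf_psh_prod[OF u F(1) A] psh_mor_snd[OF u cat pF A_presheaf]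
          sheaf_psh_prod[OF u F(2) A] psh_mor_snd[OF u cat pG A_presheaf]]) simp
  qed
  show "far (localize el C A) (ide SC F) = ide over (fob (localize el C A) F)"
    if "F \<in> Ob SC" for F
  proof -
    have "(\<lambda>X\<in>Ob C. \<lambda>z\<in>sec (prodA F) X. kpair el ((\<lambda>X\<in>Ob C. \<lambda>x\<in>sec F X. x) X (ufst el z)) (usnd el z)) =
      (\<lambda>X\<in>Ob C. \<lambda>z\<in>sec (prodA F) X. z)"
      by (intro restrict_ext) (auto simp: psh_prod_simps u)
    then show ?thesis by (simp add: localize_simps del: restrict_apply)
  qed
  fix f g assume fg: "f \<in> Ar SC" "g \<in> Ar SC" "tgt SC f = src SC g"
  obtain F G \<alpha> where f: "f = (F, G, \<alpha>)" by (cases f)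
  obtain G' H \<beta> where g: "g = (G', H, \<beta>)" by (cases g)
  have G': "G' = G" and a: "psh_mor C F G \<alpha>" using fg by (simp_all add: f g)
  have "(\<lambda>X\<in>Ob C. \<lambda>z\<in>sec (prodA F) X.
      kpair el ((\<lambda>X\<in>Ob C. \<lambda>x\<in>sec F X. \<beta> X (\<alpha> X x)) X (ufst el z)) (usnd el z)) =
    (\<lambda>X\<in>Ob C. \<lambda>z\<in>sec (prodA F) X.
      (prod_map G \<beta>) X
        ((prod_map F \<alpha>) X z))"
    by (intro restrict_ext) (use map[OF a] in \<open>auto simp: psh_prod_simps(1) u psh_mor_simps(1)[OF a]\<close>)
  then show "far (localize el C A) (cmp SC g f) = cmp over (far (localize el C A) g) (far (localize el C A) f)"
    by (simp add: localize_simps f g G' del: restrict_apply)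
qed

text \<open>Localizing \<open>F\<close> and forming \<open>{(i, f) \<mapsto> F\<^sub>i \<times> f\<^sup>*(V)}\<close> both lead to presheaves of this form on \<open>C\<^bsub>/V\<^esub>\<close>: over \<open>w\<close>,
  the second component of a section is forced to be the section \<open>\<kappa> w\<close> defined by \<open>w\<close>.\<close>

definition tagged :: "('m \<Rightarrow> 'u) \<Rightarrow> ('o, 'm, 'u) psh \<Rightarrow> ('m, 'm \<times> 'm \<times> 'm, 'u) psh" where
  "tagged \<kappa> F = \<lparr>sec = \<lambda>w\<in>Ob CV. (\<lambda>x. kpair el x (\<kappa> w)) ` sec F (src C w),
     res = \<lambda>t\<in>Ar CV. \<lambda>z\<in>(\<lambda>x. kpair el x (\<kappa> (tgt CV t))) ` sec F (src C (tgt CV t)).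
       kpair el (res F (far \<gamma> t) (ufst el z)) (\<kappa> (src CV t))\<rparr>"

abbreviation "tagged_map \<kappa> F \<alpha> \<equiv>
  \<lambda>w\<in>Ob CV. \<lambda>z\<in>sec (tagged \<kappa> F) w. kpair el (\<alpha> (src C w) (ufst el z)) (\<kappa> w)"

lemma tagged_simps:
  "w \<in> Ob CV \<Longrightarrow> sec (tagged \<kappa> F) w = (\<lambda>x. kpair el x (\<kappa> w)) ` sec F (src C w)"
  "t \<in> Ar CV \<Longrightarrow> x \<in> sec F (src C (tgt CV t)) \<Longrightarrow>
     res (tagged \<kappa> F) t (kpair el x (\<kappa> (tgt CV t))) = kpair el (res F (far \<gamma> t) x) (\<kappa> (src CV t))"
  by (simp_all add: tagged_def u)

text \<open>Restriction overwrites the tag of the target by that of the source, so functoriality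
  holds for an arbitrary function \<open>\<kappa>\<close>.\<close>

lemma presheaf_tagged:
  assumes F: "presheaf C F" shows "presheaf CV (tagged \<kappa> F)"
  unfolding tagged_def
proof (rule presheafI[OF category_slice[OF cat]], goal_cases)
  case (1 t z)
  then obtain x where x: "z = kpair el x (\<kappa> (tgt CV t))" "x \<in> sec F (src C (tgt CV t))" by blast
  show ?case
    using presheaf_simps(1)[OF F, of "far \<gamma> t" x] L.u_simps(4-6)[OF 1(1)] x(2) by (simp add: x(1) u)
next
  case (2 w z)
  then show ?case using presheaf_simps(2)[OF F, of "src C w"] by (auto simp: u)
next
  case (3 s t z)
  then obtain x where x: "z = kpair el x (\<kappa> (tgt CV t))" "x \<in> sec F (src C (tgt CV t))" by blast
  have g: "far \<gamma> (cmp CV t s) = cmp C (far \<gamma> t) (far \<gamma> s)" "src CV (cmp CV t s) = src CV s"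
    using L.u_simps(8)[OF 3(1-3)] L.c'_simps(7)[OF 3(1-3)] by simp_all
  show ?case
    using presheaf_simps(3)[OF F, of "far \<gamma> s" "far \<gamma> t" x] L.u_simps(4-6)[OF 3(1)] L.u_simps(4-6)[OF 3(2)] 3(3) x(2)
    by (simp add: x(1) u g)
qed

definition tag :: "('m \<Rightarrow> 'u) \<Rightarrow> ('o, 'm, 'u) psh \<Rightarrow> 'm \<Rightarrow> 'u \<Rightarrow> 'u" where
  "tag \<kappa> F = (\<lambda>w\<in>Ob CV. \<lambda>x\<in>sec (restr F) w. kpair el x (\<kappa> w))"

lemma tag_psh_mor:
  assumes F: "presheaf C F" shows "psh_mor CV (restr F) (tagged \<kappa> F) (tag \<kappa> F)"
  unfolding tag_def
proof (rule psh_morI[OF _ _ category_slice[OF cat]])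
  fix t x assume t: "t \<in> Ar CV" "src CV t \<in> Ob CV" "tgt CV t \<in> Ob CV" "x \<in> sec (restr F) (tgt CV t)"
  then show "res (restr F) t x \<in> sec (restr F) (src CV t) \<and>
    kpair el (res (restr F) t x) (\<kappa> (src CV t)) = res (tagged \<kappa> F) t (kpair el x (\<kappa> (tgt CV t)))"
    using presheaf_simps(1)[OF presheaf_psh_pull[OF L.u_functor F] t(1,4)] tagged_simps(2)[OF t(1), of x F \<kappa>] by simp
qed (simp add: tagged_simps)

lemma tag_bij: "w \<in> Ob CV \<Longrightarrow> bij_betw (tag \<kappa> F w) (sec (restr F) w) (sec (tagged \<kappa> F) w)"
  by (auto simp: bij_betw_def inj_on_def tag_def tagged_simps u)

text \<open>Attaching the tag is a bijection on sections and natural, so the sheaf condition is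
  carried over from the restriction of \<open>F\<close>.\<close>

lemma sheaf_tagged:
  assumes F: "sheaf el C J F" shows "sheaf el CV JV (tagged \<kappa> F)"
proof -
  note p = sheaf_presheaf[OF F]
  have "glues CV JV (restr F)" using L.sheaf_psh_pull[OF F] by (simp add: sheaf_iff_glues)
  then have "glues CV JV (tagged \<kappa> F)"
    by (rule L.lift.glues_iso[OF _ presheaf_tagged[OF p] tag_psh_mor[OF p] tag_bij])
  moreover have "sec (tagged \<kappa> F) w \<in> range el" if "w \<in> Ob CV" for w
    using universe_image[OF u] F that by (simp add: tagged_simps sheaf_iff_glues)
  ultimately show ?thesis by (simp add: sheaf_iff_glues)
qed

lemma pull_functor_simps:
  "fob (pull_functor CV \<gamma>) F = restr F"
  "far (pull_functor CV \<gamma>) (F, G, \<alpha>) = (restr F, restr G, \<lambda>w\<in>Ob CV. \<alpha> (src C w))"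
  by (simp_all add: pull_functor_def)

text \<open>Components of a presheaf morphism are already extensional on sections; this reconciles
  \<open>pull_functor\<close> with the doubly restricted form produced by
  \<open>psh_morI\<close>.\<close>

lemma pull_functor_eq:
  assumes "psh_mor C F G \<alpha>"
  shows "(\<lambda>w\<in>Ob CV. \<alpha> (src C w)) = (\<lambda>w\<in>Ob CV. \<lambda>x\<in>sec (restr F) w. \<alpha> (src C w) x)"
proof (rule restrict_ext)
  fix w assume w: "w \<in> Ob CV"
  then have "src C w \<in> Ob C" by simp
  then have "\<alpha> (src C w) \<in> sec F (src C w) \<rightarrow>\<^sub>E sec G (src C w)"
    using assms PiE_mem[of \<alpha> "Ob C"] unfolding psh_mor_def by blast
  then show "\<alpha> (src C w) = (\<lambda>x\<in>sec (restr F) w. \<alpha> (src C w) x)"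
    using w by (auto simp: PiE_def extensional_restrict)
qed

lemma psh_mor_pull:
  assumes F: "presheaf C F" and a: "psh_mor C F G \<alpha>"
  shows "psh_mor CV (restr F) (restr G) (\<lambda>w\<in>Ob CV. \<alpha> (src C w))"
  unfolding pull_functor_eq[OF a]
proof (rule psh_morI[OF _ _ category_slice[OF cat]])
  show "\<alpha> (src C w) x \<in> sec (restr G) w" if "w \<in> Ob CV" "x \<in> sec (restr F) w" for w x
    using that psh_mor_simps(1)[OF a] by simp
  fix t x assume t: "t \<in> Ar CV" "src CV t \<in> Ob CV" "tgt CV t \<in> Ob CV" "x \<in> sec (restr F) (tgt CV t)"
  have "src C (far \<gamma> t) = src C (src CV t)" "tgt C (far \<gamma> t) = src C (tgt CV t)" "far \<gamma> t \<in> Ar C"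
    using L.u_simps(4-6)[OF t(1)] by simp_all
  then show "res (restr F) t x \<in> sec (restr F) (src CV t) \<and>
      \<alpha> (src C (src CV t)) (res (restr F) t x) = res (restr G) t (\<alpha> (src C (tgt CV t)) x)"
    using presheaf_simps(1)[OF presheaf_psh_pull[OF L.u_functor F] t(1,4)] psh_mor_simps(2)[OF a, of "far \<gamma> t" x] t
    by simp
qed

lemma pull_functor_functor: "is_functor SC SV (pull_functor CV \<gamma>)"
proof (rule is_functorI[OF category_Sh[OF cat] category_Sh[OF category_slice[OF cat]]])
  show "fob (pull_functor CV \<gamma>) F \<in> Ob SV" if "F \<in> Ob SC" for F
    using that L.sheaf_psh_pull by (simp add: pull_functor_simps)
  show "far (pull_functor CV \<gamma>) f \<in> hom SV (fob (pull_functor CV \<gamma>) (src SC f))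
      (fob (pull_functor CV \<gamma>) (tgt SC f))" if "f \<in> Ar SC" for f
  proof -
    obtain F G \<alpha> where f: "f = (F, G, \<alpha>)" by (cases f)
    have F: "sheaf el C J F" "sheaf el C J G" "psh_mor C F G \<alpha>" using that by (simp_all add: f)
    show ?thesis using L.sheaf_psh_pull[OF F(1)] L.sheaf_psh_pull[OF F(2)] psh_mor_pull[OF sheaf_presheaf[OF F(1)] F(3)]
      by (simp add: f pull_functor_simps hom_iff del: restrict_apply)
  qed
  show "far (pull_functor CV \<gamma>) (ide SC F) = ide SV (fob (pull_functor CV \<gamma>) F)"
    if "F \<in> Ob SC" for F
    by (auto simp: pull_functor_simps intro!: restrict_ext)
  fix f g assume fg: "f \<in> Ar SC" "g \<in> Ar SC" "tgt SC f = src SC g"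
  obtain F G \<alpha> where f: "f = (F, G, \<alpha>)" by (cases f)
  obtain G' H \<beta> where g: "g = (G', H, \<beta>)" by (cases g)
  show "far (pull_functor CV \<gamma>) (cmp SC g f) =
      cmp SV (far (pull_functor CV \<gamma>) g) (far (pull_functor CV \<gamma>) f)"
    using fg by (auto simp: f g pull_functor_simps intro!: restrict_ext)
qed

text \<open>Serves two functors with different tags: localization followed by passage to the slice,
  and the fibrewise product. Each is isomorphic to plain restriction, since forgetting the tag is
  natural; so they are isomorphic to each other whatever the tags are.\<close>

lemma
  assumes fob: "\<And>F. sheaf el C J F \<Longrightarrow> fob \<Phi> F = tagged \<kappa> F"
    and far: "\<And>F G \<alpha>. (F, G, \<alpha>) \<in> Ar SC \<Longrightarrow> far \<Phi> (F, G, \<alpha>) =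
      (tagged \<kappa> F, tagged \<kappa> G, tagged_map \<kappa> F \<alpha>)"
  shows tagged_functor: "is_functor SC SV \<Phi>"
    and tagged_functor_iso: "isomorphic_functors SC SV \<Phi> (pull_functor CV \<gamma>)"
proof -
  note cS = category_Sh[OF cat, of el J] and cV = category_slice[OF cat, of V]
  have map: "psh_mor CV (tagged \<kappa> F) (tagged \<kappa> G)
      (tagged_map \<kappa> F \<alpha>)"
    if F: "presheaf C F" and a: "psh_mor C F G \<alpha>" for F G \<alpha>
  proof (rule psh_morI[OF _ _ cV])
    show "kpair el (\<alpha> (src C w) (ufst el z)) (\<kappa> w) \<in> sec (tagged \<kappa> G) w"
      if "w \<in> Ob CV" "z \<in> sec (tagged \<kappa> F) w" for w z
      using that psh_mor_simps(1)[OF a] by (auto simp: tagged_simps u)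
    fix t z assume t: "t \<in> Ar CV" "src CV t \<in> Ob CV" "tgt CV t \<in> Ob CV" "z \<in> sec (tagged \<kappa> F) (tgt CV t)"
    then obtain x where x: "z = kpair el x (\<kappa> (tgt CV t))" "x \<in> sec F (src C (tgt CV t))"
      by (auto simp: tagged_simps)
    have g: "src C (far \<gamma> t) = src C (src CV t)" "tgt C (far \<gamma> t) = src C (tgt CV t)" "far \<gamma> t \<in> Ar C"
      using L.u_simps(4-6)[OF t(1)] by simp_all
    have ax: "\<alpha> (src C (tgt CV t)) x \<in> sec G (src C (tgt CV t))"
      using psh_mor_simps(1)[OF a _ x(2)] g(2,3) c_simps(2)[OF g(3)] by simp
    show "res (tagged \<kappa> F) t z \<in> sec (tagged \<kappa> F) (src CV t) \<and>
      kpair el (\<alpha> (src C (src CV t)) (ufst el (res (tagged \<kappa> F) t z))) (\<kappa> (src CV t)) =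
      res (tagged \<kappa> G) t (kpair el (\<alpha> (src C (tgt CV t)) (ufst el z)) (\<kappa> (tgt CV t)))"
      using presheaf_simps(1)[OF presheaf_tagged[OF F] t(1,4)] psh_mor_simps(2)[OF a g(3), of x] x ax g
        tagged_simps(2)[OF t(1)] by (simp add: u)
  qed
  show \<Phi>: "is_functor SC SV \<Phi>"
  proof (rule is_functorI[OF cS category_Sh[OF cV]])
    show "fob \<Phi> F \<in> Ob SV" if "F \<in> Ob SC" for F
      using that fob sheaf_tagged by simp
    show "far \<Phi> f \<in> hom SV (fob \<Phi> (src SC f)) (fob \<Phi> (tgt SC f))"
      if "f \<in> Ar SC" for f
    proof -
      obtain F G \<alpha> where f: "f = (F, G, \<alpha>)" by (cases f)
      have F: "sheaf el C J F" "sheaf el C J G" "psh_mor C F G \<alpha>" using that by (simp_all add: f)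
      show ?thesis using F map[OF sheaf_presheaf[OF F(1)] F(3)] fob sheaf_tagged
        unfolding f far[OF that[unfolded f]] by (simp add: hom_iff del: restrict_apply)
    qed
    show "far \<Phi> (ide SC F) = ide SV (fob \<Phi> F)" if F: "F \<in> Ob SC" for F
    proof -
      have i: "(F, F, \<lambda>X\<in>Ob C. \<lambda>x\<in>sec F X. x) \<in> Ar SC"
        using category_simps(3)[OF cS F] by simp
      have "(\<lambda>w\<in>Ob CV. \<lambda>z\<in>sec (tagged \<kappa> F) w. kpair el ((\<lambda>X\<in>Ob C. \<lambda>x\<in>sec F X. x) (src C w) (ufst el z)) (\<kappa> w)) =
        (\<lambda>w\<in>Ob CV. \<lambda>z\<in>sec (tagged \<kappa> F) w. z)"
        by (intro restrict_ext) (auto simp: tagged_simps u)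
      then show ?thesis using F fob far[OF i] by (simp del: restrict_apply)
    qed
    fix f g assume fg: "f \<in> Ar SC" "g \<in> Ar SC" "tgt SC f = src SC g"
    obtain F G \<alpha> where f: "f = (F, G, \<alpha>)" by (cases f)
    obtain G' H \<beta> where g: "g = (G', H, \<beta>)" by (cases g)
    have G': "G' = G" and a: "psh_mor C F G \<alpha>" using fg by (simp_all add: f g)
    have gf: "(F, H, \<lambda>X\<in>Ob C. \<lambda>x\<in>sec F X. \<beta> X (\<alpha> X x)) \<in> Ar SC"
      using category_simps(6)[OF cS fg] by (simp only: f g G' Sh_simps(6))
    have "(\<lambda>w\<in>Ob CV. \<lambda>z\<in>sec (tagged \<kappa> F) w.
        kpair el ((\<lambda>X\<in>Ob C. \<lambda>x\<in>sec F X. \<beta> X (\<alpha> X x)) (src C w) (ufst el z)) (\<kappa> w)) =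
      (\<lambda>w\<in>Ob CV. \<lambda>z\<in>sec (tagged \<kappa> F) w.
        (tagged_map \<kappa> G \<beta>) w
        ((tagged_map \<kappa> F \<alpha>) w z))"
      by (intro restrict_ext) (use psh_mor_simps(1)[OF a] in \<open>auto simp: tagged_simps u\<close>)
    then show "far \<Phi> (cmp SC g f) = cmp SV (far \<Phi> g) (far \<Phi> f)"
      using far[OF fg(1)[unfolded f]] far[OF fg(2)[unfolded g G']] far[OF gf]
      by (simp add: f g G' del: restrict_apply)
  qed
  have "isomorphic_functors SC SV (pull_functor CV \<gamma>) \<Phi>"
    unfolding isomorphic_functors_def
  proof (intro conjI pull_functor_functor \<Phi> exI[of _ "\<lambda>F. (restr F, tagged \<kappa> F, tag \<kappa> F)"] ballI)
    fix F assume "F \<in> Ob SC"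
    then have F: "sheaf el C J F" by simp
    note t = L.sheaf_psh_pull[OF F] sheaf_tagged[OF F] tag_psh_mor[OF sheaf_presheaf[OF F]]
    show "(restr F, tagged \<kappa> F, tag \<kappa> F) \<in> hom SV (fob (pull_functor CV \<gamma>) F) (fob \<Phi> F)"
      using t by (simp add: hom_iff fob[OF F] pull_functor_simps)
    show "is_iso SV (restr F, tagged \<kappa> F, tag \<kappa> F)"
      by (rule Sh_isoI[OF cV t tag_bij])
  next
    fix f assume fA: "f \<in> Ar SC"
    obtain F G \<alpha> where f: "f = (F, G, \<alpha>)" by (cases f)
    have a: "psh_mor C F G \<alpha>" using fA by (simp add: f)
    have "(\<lambda>w\<in>Ob CV. \<lambda>x\<in>sec (restr F) w. tag \<kappa> G w ((\<lambda>w\<in>Ob CV. \<alpha> (src C w)) w x)) =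
      (\<lambda>w\<in>Ob CV. \<lambda>x\<in>sec (restr F) w.
        (tagged_map \<kappa> F \<alpha>) w (tag \<kappa> F w x))"
      by (intro restrict_ext) (use psh_mor_simps(1)[OF a] in \<open>auto simp: tag_def tagged_simps u\<close>)
    then show "cmp SV (restr (tgt SC f), tagged \<kappa> (tgt SC f), tag \<kappa> (tgt SC f))
        (far (pull_functor CV \<gamma>) f) =
      cmp SV (far \<Phi> f) (restr (src SC f), tagged \<kappa> (src SC f), tag \<kappa> (src SC f))"
      unfolding f far[OF fA[unfolded f]] pull_functor_simps by (simp del: restrict_apply)
  qed
  then show "isomorphic_functors SC SV \<Phi> (pull_functor CV \<gamma>)" by (rule isomorphic_functors_sym)
qed

lemma fibre_sec_psh_prod:
  assumes "w \<in> Ar C" "tgt C w = V"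
  shows "fibre_sec (prodA F) (sndA F) w = (\<lambda>x. kpair el x (\<eta> (src C w) w)) ` sec F (src C w)"
  using assms \<eta>_sec[OF assms refl] by (auto simp: fibre_sec_def psh_prod_simps psh_snd_def u)

text \<open>An equality, not merely an isomorphism. Lying above the section defined by
  \<open>w\<close> fixes the second component, and \<open>\<eta>_cmp\<close> says that restricting
  it along \<open>m\<close> gives the tag of the composite.\<close>

lemma K_localize: "K (prodA F, A, sndA F) = tagged (\<lambda>w. \<eta> (src C w) w) F"
proof -
  have e1: "(\<lambda>w\<in>Ob CV. fibre_sec (prodA F) (sndA F) w) =
      (\<lambda>w\<in>Ob CV. (\<lambda>x. kpair el x (\<eta> (src C w) w)) ` sec F (src C w))"
    by (rule restrict_ext) (simp add: fibre_sec_psh_prod)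
  have e2: "(\<lambda>t\<in>Ar CV. \<lambda>h\<in>fibre_sec (prodA F) (sndA F) (tgt CV t).
        res (prodA F) (far \<gamma> t) h) =
     (\<lambda>t\<in>Ar CV. \<lambda>z\<in>(\<lambda>x. kpair el x (\<eta> (src C (tgt CV t)) (tgt CV t))) ` sec F (src C (tgt CV t)).
        kpair el (res F (far \<gamma> t) (ufst el z)) (\<eta> (src C (src CV t)) (src CV t)))"
  proof (rule restrict_ext)
    fix t assume t: "t \<in> Ar CV"
    obtain a w m where tm: "t = (a, w, m)" by (cases t)
    have m: "w \<in> Ar C" "tgt C w = V" "m \<in> Ar C" "tgt C m = src C w" "a = cmp C w m" using t by (auto simp: tm)
    show "(\<lambda>h\<in>fibre_sec (prodA F) (sndA F) (tgt CV t). res (prodA F) (far \<gamma> t) h) =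
     (\<lambda>z\<in>(\<lambda>x. kpair el x (\<eta> (src C (tgt CV t)) (tgt CV t))) ` sec F (src C (tgt CV t)).
        kpair el (res F (far \<gamma> t) (ufst el z)) (\<eta> (src C (src CV t)) (src CV t)))"
      unfolding tm slice_simps(3,4) fibre_sec_psh_prod[OF m(1,2)]
      by (rule restrict_ext) (use m \<eta>_cmp[OF m(1-4)] \<eta>_sec[OF m(1,2) refl] in \<open>auto simp: psh_prod_simps u\<close>)
  qed
  show ?thesis unfolding K_eq tagged_def e1 e2 ..
qed

lemma KF_localize:
  "isomorphic_functors SC SV (comp_func KF (localize el C A)) (pull_functor CV \<gamma>)"
proof (rule tagged_functor_iso[where \<kappa> = "\<lambda>w. \<eta> (src C w) w"])
  show "fob (comp_func KF (localize el C A)) F = tagged (\<lambda>w. \<eta> (src C w) w) F" for F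
    by (simp add: comp_func_def localize_simps KF_simps K_localize)
  fix F G \<alpha>
  have "K_mor (prodA F) (sndA F)
      (prod_map F \<alpha>) =
    (\<lambda>w\<in>Ob CV. \<lambda>z\<in>sec (tagged (\<lambda>w. \<eta> (src C w) w) F) w. kpair el (\<alpha> (src C w) (ufst el z)) (\<eta> (src C w) w))"
    unfolding K_mor_def
  proof (rule restrict_ext)
    fix w assume w: "w \<in> Ob CV"
    then have w': "w \<in> Ar C" "tgt C w = V" by simp_all
    show "(\<lambda>h\<in>fibre_sec (prodA F) (sndA F) w.
        (prod_map F \<alpha>) (src C w) h) =
      (\<lambda>z\<in>sec (tagged (\<lambda>w. \<eta> (src C w) w) F) w. kpair el (\<alpha> (src C w) (ufst el z)) (\<eta> (src C w) w))"
      unfolding fibre_sec_psh_prod[OF w'] tagged_simps(1)[OF w]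
      by (rule restrict_ext) (use w' \<eta>_sec[OF w' refl] in \<open>auto simp: psh_prod_simps u\<close>)
  qed
  then show "far (comp_func KF (localize el C A)) (F, G, \<alpha>) =
    (tagged (\<lambda>w. \<eta> (src C w) w) F, tagged (\<lambda>w. \<eta> (src C w) w) G,
     \<lambda>w\<in>Ob CV. \<lambda>z\<in>sec (tagged (\<lambda>w. \<eta> (src C w) w) F) w. kpair el (\<alpha> (src C w) (ufst el z)) (\<eta> (src C w) w))"
    by (simp add: comp_func_def localize_simps KF_simps K_localize del: restrict_apply)
qed

end

section \<open>The fibrewise product functor and the final comparison\<close>

context cleaved_site_over begin

sublocale Loc: localized_site E "coev X" el V
  by unfold_locales (rule u, rule U_site_E, rule V)

lemma localized_site_fib:
  assumes f: "f \<in> Ar I" "tgt I f = p V"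
  shows "localized_site (fib X (src I f)) (ftop X (src I f)) el (src E (cl f V))"
proof -
  interpret site "fib X (src I f)" "ftop X (src I f)" by (rule site_fib) (use f in simp)
  show ?thesis
    by unfold_locales (use u U_site_fib f V in simp_all)
qed

lemma inv_im_eq:
  "inv_im el X V f = eps el (fib X (src I f)) (ftop X (src I f)) (src E (cl f V))"
  "inv_im_unit el X V f = eps_unit el (fib X (src I f)) (ftop X (src I f)) (src E (cl f V))"
  by (simp_all add: inv_im_def inv_im_unit_def Let_def)

text \<open>The tag of the fibrewise product: the vertical factor of \<open>w\<close> is an arrow
  into the inverse image of \<open>V\<close>, and the unit of the associated sheaf on that fibre
  turns it into a section.\<close>

definition unit_section :: "'m \<Rightarrow> 'u" where
  "unit_section w = inv_im_unit el X V (q w) (src E w) (fvfac X w)"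

text \<open>Each fibre, with the inverse image of \<open>V\<close>, is itself a localized site. Thus
  \<open>K_localize\<close> applies there, and \<open>fibre_to_slice\<close> transports the result
  to the fibre of the slice.\<close>

lemma
  assumes f: "f \<in> Ar I" "tgt I f = p V"
  shows component_sec: "w \<in> Ob (fib Y f) \<Longrightarrow>
      sec (prod_component el X V F f) w = (\<lambda>x. kpair el x (unit_section w)) ` sec F (src E w)"
    and component_res: "(w', w, m) \<in> Ar (fib Y f) \<Longrightarrow> x \<in> sec F (src E w) \<Longrightarrow>
      res (prod_component el X V F f) (w', w, m) (kpair el x (unit_section w)) =
      kpair el (res F m x) (unit_section w')"
proof -
  let ?i = "src I f"
  interpret M: localized_site "fib X ?i" "ftop X ?i" el "src E (cl f V)" by (rule localized_site_fib[OF f])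
  have pc: "prod_component el X V F f = psh_pull (fib Y f) (fibre_to_slice X)
      (M.tagged (\<lambda>v. inv_im_unit el X V f (src E v) v) (restr_fib X F ?i))"
    by (simp add: prod_component_def Let_def inv_im_eq M.localize_simps M.KF_simps M.K_localize)
  have D: "discrete_fibration (fib Y f) M.CV (fibre_to_slice X)"
    by (rule fibre_to_slice_discrete_fibration[OF f])
  then have ffun: "is_functor (fib Y f) M.CV (fibre_to_slice X)" by (simp add: discrete_fibration_def)
  have ob: "w \<in> Ar E" "tgt E w = V" "q w = f" "p (src E w) = ?i" if "w \<in> Ob (fib Y f)" for w
    using that by auto
  have v: "fvfac X w \<in> Ob M.CV" "src E (fvfac X w) = src E w"
    "inv_im_unit el X V f (src E (fvfac X w)) (fvfac X w) = unit_section w" if w: "w \<in> Ob (fib Y f)" for w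
    using functor_simps(3)[OF ffun w] fvfac_over(3)[OF ob(1,2)[OF w]] ob(3)[OF w] by (simp_all add: unit_section_def)
  have r: "sec (restr_fib X F ?i) W = sec F W" if "W \<in> Ob E" "p W = ?i" for W
    using that by (simp add: restr_fib_def idfunc_def)
  show "sec (prod_component el X V F f) w = (\<lambda>x. kpair el x (unit_section w)) ` sec F (src E w)"
    if w: "w \<in> Ob (fib Y f)"
    using M.tagged_simps(1)[OF v(1)[OF w]] v(2,3)[OF w] r[of "src E w"] ob[OF w] w unfolding pc by simp
  show "res (prod_component el X V F f) (w', w, m) (kpair el x (unit_section w)) =
      kpair el (res F m x) (unit_section w')"
    if t: "(w', w, m) \<in> Ar (fib Y f)" and x: "x \<in> sec F (src E w)"
  proof -
    have w: "w \<in> Ob (fib Y f)" "w' \<in> Ob (fib Y f)" and m: "m \<in> Ar E" "q m = ide I ?i" using t by auto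
    have t': "(fvfac X w', fvfac X w, m) \<in> Ar M.CV" using functor_simps(4)[OF ffun t] by simp
    have "res (restr_fib X F ?i) m = res F m" using m by (simp add: restr_fib_def idfunc_def)
    moreover have "x \<in> sec (restr_fib X F ?i) (src E (fvfac X w))"
      using x r[of "src E w"] v(2)[OF w(1)] ob[OF w(1)] by simp
    ultimately show ?thesis
      using M.tagged_simps(2)[OF t', of x "restr_fib X F ?i" "\<lambda>v. inv_im_unit el X V f (src E v) v"]
        v(3)[OF w(1)] v(3)[OF w(2)] t by (simp add: pc)
  qed
qed

text \<open>The transition is given by a definite description, so existence and uniqueness have to
  be supplied. They come from the universal property of the associated sheaf, applied to the formula
  on arrows into the inverse image of \<open>V\<close>.\<close>

lemma inv_im_trans_unit:
  assumes g: "(f1, f2, g) \<in> Ar Ic" and W: "W \<in> Ob E" "p W = src I f2"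
    and v: "v \<in> Ar E" "q v = ide I (src I f2)" "src E v = W" "tgt E v = src E (cl f2 V)"
  shows "inv_im_trans el X V (f1, f2, g) W (inv_im_unit el X V f2 W v) =
    inv_im_unit el X V f1 (src E (cl g W)) (fvfac X (cmp E (cmp E (cl f2 V) v) (cl g W)))"
proof -
  have f: "f1 \<in> Ar I" "tgt I f1 = p V" "f2 \<in> Ar I" "tgt I f2 = p V" "g \<in> Ar I" "src I g = src I f1" "tgt I g = src I f2"
    "cmp I f2 g = f1" using g by auto
  let ?C = "fib X (src I f2)" and ?i = "src I f1"
  let ?P = "represented ?C (src E (cl f2 V))"
  let ?B = "psh_pull ?C (fpull X g) (inv_im el X V f1)"
  interpret M1: localized_site "fib X ?i" "ftop X ?i" el "src E (cl f1 V)" by (rule localized_site_fib[OF f(1,2)])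
  interpret M2: localized_site ?C "ftop X (src I f2)" el "src E (cl f2 V)" by (rule localized_site_fib[OF f(3,4)])
  \<comment> \<open>The target is a sheaf by continuity of the inverse image functor of
    \<open>g\<close>, as the universal property demands.\<close>
  have B: "sheaf el ?C (ftop X (src I f2)) ?B"
    using fcont[OF f(5)] M1.A unfolding continuous_def f(6,7) inv_im_eq by blast
  let ?z = "\<lambda>U v. inv_im_unit el X V f1 (src E (cl g U)) (fvfac X (cmp E (cmp E (cl f2 V) v) (cl g U)))"
  have c2: "cl f2 V \<in> Ar E" "tgt E (cl f2 V) = V" "q (cl f2 V) = f2" "p (src E (cl f2 V)) = src I f2" using f V by simp_all
  have arr: "cmp E (cmp E (cl f2 V) v) (cl g U) \<in> Ar E" "tgt E (cmp E (cmp E (cl f2 V) v) (cl g U)) = V"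
    "q (cmp E (cmp E (cl f2 V) v) (cl g U)) = f1" "src E (cmp E (cmp E (cl f2 V) v) (cl g U)) = src E (cl g U)"
    if "U \<in> Ob ?C" "v \<in> hom ?C U (src E (cl f2 V))" for U v
    using that f c2 by (simp_all add: hom_iff)
  have z_sec: "?z U v \<in> sec ?B U" if U: "U \<in> Ob ?C" and v: "v \<in> hom ?C U (src E (cl f2 V))" for U v
  proof -
    note a = arr[OF U v] and o = fvfac_over[OF arr(1,2)[OF U v]]
    have "inv_im_unit el X V f1 (src E (cl g U)) (fvfac X (cmp E (cmp E (cl f2 V) v) (cl g U))) \<in>
        sec (inv_im el X V f1) (src E (cl g U))"
      unfolding inv_im_eq by (rule M1.\<eta>_sec) (use o a in simp_all)
    then show ?thesis using U by simp
  qed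
  have z: "psh_mor ?C ?P ?B (\<lambda>U\<in>Ob ?C. \<lambda>v\<in>sec ?P U. ?z U v)"
  proof (rule psh_morI[OF _ _ M2.cat])
    show "?z U v \<in> sec ?B U" if "U \<in> Ob ?C" "v \<in> sec ?P U" for U v using z_sec that by simp
    fix r v assume r: "r \<in> Ar ?C" "src ?C r \<in> Ob ?C" "tgt ?C r \<in> Ob ?C" "v \<in> sec ?P (tgt ?C r)"
    let ?U = "src E r" and ?W = "tgt E r"
    have v: "v \<in> hom ?C ?W (src E (cl f2 V))" using r by simp
    have v': "v \<in> Ar E" "q v = ide I (src I f2)" "src E v = ?W" "tgt E v = src E (cl f2 V)" using v by (simp_all add: hom_iff)
    have r': "r \<in> Ar E" "q r = ide I (tgt I g)" using r(1) f by simp_all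
    note fp = fpull_arrow[OF f(5) r']
    let ?gr = "fvfac X (cmp E r (cl g (src E r)))" and ?a = "cmp E (cmp E (cl f2 V) v) (cl g ?W)"
    have UW: "?U \<in> Ob E" "?W \<in> Ob E" "p ?U = tgt I g" "p ?W = tgt I g" using r(2,3) f by simp_all
    have cg: "cl g ?W \<in> Ar E" "tgt E (cl g ?W) = ?W" "cl g ?U \<in> Ar E" "tgt E (cl g ?U) = ?U" using UW f by simp_all
    have vr: "cmp E v r \<in> hom ?C ?U (src E (cl f2 V))" using M2.c_simps(6-8)[of r v] r(1) v by (simp add: hom_iff)
    \<comment> \<open>Naturality of the formula: the square from \<open>fpull_arrow\<close>
      exchanges the vertical arrow \<open>r\<close> with the cartesian arrows over
      \<open>g\<close>.\<close>
    have "cmp E (cmp E (cl f2 V) (cmp E v r)) (cl g ?U) = cmp E (cmp E (cl f2 V) v) (cmp E r (cl g ?U))"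
      using v' r' cg c2 by (simp add: E_assoc)
    also have "\<dots> = cmp E (cmp E (cl f2 V) v) (cmp E (cl g ?W) ?gr)" using fp(5) by simp
    also have "\<dots> = cmp E ?a ?gr" using v' fp cg c2 by (intro E_assoc[symmetric]) simp_all
    finally have e: "cmp E (cmp E (cl f2 V) (cmp E v r)) (cl g ?U) = cmp E ?a ?gr" .
    have W: "?W \<in> Ob ?C" using r(3) by simp
    note a = arr[OF W v] and o = fvfac_over[OF arr(1,2)[OF W v]]
    have "fvfac X (cmp E ?a ?gr) = cmp E (fvfac X ?a) ?gr"
      by (rule fvfac_over_comp[OF a(1,2)]) (use fp a f in simp_all)
    moreover have "inv_im_unit el X V f1 (src E ?gr) (cmp E (fvfac X ?a) ?gr) =
        res (inv_im el X V f1) ?gr (inv_im_unit el X V f1 (src E (cl g ?W)) (fvfac X ?a))"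
      using M1.\<eta>_cmp[of "fvfac X ?a" ?gr] o a fp f(6) unfolding inv_im_eq by simp
    ultimately have "?z ?U (cmp E v r) = res ?B r (?z ?W v)"
      using fp(3) r(1) by (simp add: e)
    then show "res ?P r v \<in> sec ?P (src ?C r) \<and> ?z (src ?C r) (res ?P r v) = res ?B r (?z (tgt ?C r) v)"
      using represented_simps(2)[OF r(1), of v] represented_simps(1)[OF r(2)] v vr by simp
  qed
  let ?Q = "\<lambda>\<theta>. psh_mor ?C (inv_im el X V f2) ?B \<theta> \<and>
       (\<forall>W\<in>Ob ?C. \<forall>v\<in>hom ?C W (src E (cl f2 V)). \<theta> W (inv_im_unit el X V f2 W v) = ?z W v)"
  have "is_assoc_sheaf el ?C (ftop X (src I f2)) ?P (inv_im el X V f2) (inv_im_unit el X V f2)"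
    unfolding inv_im_eq by (rule eps_is_assoc_sheaf[OF u M2.U_site M2.V])
  then have "\<exists>!\<theta>. psh_mor ?C (inv_im el X V f2) ?B \<theta> \<and>
      (\<forall>U\<in>Ob ?C. \<forall>v\<in>sec ?P U. \<theta> U (inv_im_unit el X V f2 U v) = (\<lambda>U\<in>Ob ?C. \<lambda>v\<in>sec ?P U. ?z U v) U v)"
    using B z unfolding is_assoc_sheaf_def by blast
  then have ex: "\<exists>!\<theta>. ?Q \<theta>" by (simp only: restrict_apply' represented_simps(1) cong: ball_cong)
  have eq: "inv_im_trans el X V (f1, f2, g) = (THE \<theta>. ?Q \<theta>)"
    using f(7) by (simp add: inv_im_trans_def Let_def)
  have "?Q (inv_im_trans el X V (f1, f2, g))" unfolding eq by (rule theI'[OF ex])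
  moreover have "W \<in> Ob ?C" "v \<in> hom ?C W (src E (cl f2 V))" using W v by (simp_all add: hom_iff)
  ultimately show ?thesis by blast
qed

text \<open>The vertical factor in the slice has the vertical factor in \<open>E\<close> as
  underlying arrow, because the structure arrow of the middle object is forced. Uniqueness likewise
  reduces to \<open>E\<close>.\<close>

lemma fvfac_slice:
  assumes t: "(w', w, m) \<in> Ar EV"
  shows "vfac EV Ic (slice_proj X) (slice_clv X) (w', w, m) = (w', cmp E w (cl (q m) (src E w)), fvfac X m)"
proof -
  let ?k = "cl (q m) (src E w)"
  have m: "w' \<in> Ar E" "w \<in> Ar E" "tgt E w = V" "m \<in> Ar E" "tgt E m = src E w" "w' = cmp E w m" "src E w' = src E m" "tgt E w' = V"
    using t by auto
  have k: "?k \<in> Ar E" "tgt E ?k = src E w" "q ?k = q m" using m by simp_all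
  note v = fvfac[OF m(4), unfolded m(5)]
  have i: "ide Ic (q w') = (q w', q w', ide I (p (src E m)))" using m by simp
  show ?thesis unfolding vfac_def[of EV] Let_def
  proof (rule the_equality)
    have "cmp E (cmp E w ?k) (fvfac X m) = w'" using E_assoc[of "fvfac X m" ?k w] v k m by simp
    then show "(w', cmp E w ?k, fvfac X m) \<in> hom (fibre EV Ic (slice_proj X) (fob (slice_proj X) (src EV (w', w, m)))) (src EV (w', w, m))
          (src EV (slice_clv X (far (slice_proj X) (w', w, m)) (tgt EV (w', w, m)))) \<and>
        cmp EV (slice_clv X (far (slice_proj X) (w', w, m)) (tgt EV (w', w, m))) (w', cmp E w ?k, fvfac X m) = (w', w, m)"
      using v k m by (simp add: hom_iff)
  next
    fix h assume h: "h \<in> hom (fibre EV Ic (slice_proj X) (fob (slice_proj X) (src EV (w', w, m)))) (src EV (w', w, m))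
          (src EV (slice_clv X (far (slice_proj X) (w', w, m)) (tgt EV (w', w, m)))) \<and>
        cmp EV (slice_clv X (far (slice_proj X) (w', w, m)) (tgt EV (w', w, m))) h = (w', w, m)"
    obtain a b r where hr: "h = (a, b, r)" by (cases h)
    have r: "a = w'" "b = cmp E w ?k" "cmp E ?k r = m" using h by (simp_all add: hr hom_iff)
    have "r \<in> Ar E" "tgt E r = src E ?k" "q r = ide I (p (src E m))"
      using h m k by (auto simp: hr hom_iff)
    then have "fvfac X m = r"
      by (intro fvfac_eq[of "q m" "src E w"]) (use m r(3) in simp_all)
    then show "h = (w', cmp E w ?k, fvfac X m)" by (simp add: hr r(1,2))
  qed
qed

text \<open>A restriction along \<open>m\<close> is the transition over \<open>q m\<close> followed
  by a vertical restriction. Each step sends tags to tags, and on first components the two steps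
  compose to the restriction of \<open>F\<close> along \<open>m\<close>.\<close>

lemma prod_glue_eq:
  assumes F: "presheaf E F"
  shows "glue Y (prod_component el X V F) (prod_trans el X V F) = Loc.tagged unit_section F"
proof -
  have sc: "sec (prod_component el X V F (q w)) w = (\<lambda>x. kpair el x (unit_section w)) ` sec F (src E w)"
    if "w \<in> Ob EV" for w
    by (rule component_sec) (use that in auto)
  have res: "res (prod_component el X V F (q w')) (vfac EV Ic (slice_proj X) (slice_clv X) (w', w, m))
      (prod_trans el X V F (q w', q w, q m) w (kpair el x (unit_section w))) = kpair el (res F m x) (unit_section w')"
    if t: "(w', w, m) \<in> Ar EV" and x: "x \<in> sec F (src E w)" for w' w m x
  proof -
    let ?W = "src E w" and ?g = "q m"
    let ?k = "cl ?g ?W"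
    have m: "w' \<in> Ar E" "w \<in> Ar E" "tgt E w = V" "m \<in> Ar E" "tgt E m = ?W" "w' = cmp E w m" "src E w' = src E m" "tgt E w' = V"
      using t by auto
    have k: "?k \<in> Ar E" "tgt E ?k = ?W" "q ?k = ?g" using m by simp_all
    note v = fvfac[OF m(4), unfolded m(5)] and o = fvfac_over[OF m(2,3)]
    have pg: "(q w', q w, ?g) \<in> Ar Ic" using functor_simps(4)[OF slice_proj_functor t] by simp
    have wk: "cmp E w ?k \<in> Ar E" "tgt E (cmp E w ?k) = V" "src E (cmp E w ?k) = src E ?k" "q (cmp E w ?k) = q w'"
      using m k by simp_all
    \<comment> \<open>The composite of the cartesian arrow with the vertical factor of
      \<open>w\<close> is \<open>w\<close> again, so the transition sends the tag of
      \<open>w\<close> to that of its composite with \<open>?k\<close>.\<close>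
    have "inv_im_trans el X V (q w', q w, ?g) ?W (unit_section w) = unit_section (cmp E w ?k)"
      unfolding unit_section_def wk(3,4)
      using inv_im_trans_unit[OF pg, of ?W "fvfac X w"] o m by simp
    then have tr: "prod_trans el X V F (q w', q w, ?g) w (kpair el x (unit_section w)) =
        kpair el (res F ?k x) (unit_section (cmp E w ?k))"
      by (simp add: prod_trans_def Let_def u)
    have "(w', cmp E w ?k, fvfac X m) \<in> Ar (fib Y (q w'))"
      using v k m wk E_assoc[of "fvfac X m" ?k w] by simp
    moreover have "res F ?k x \<in> sec F (src E (cmp E w ?k))"
      using presheaf_simps(1)[OF F k(1)] x k wk by simp
    ultimately have "res (prod_component el X V F (q w')) (w', cmp E w ?k, fvfac X m)
        (kpair el (res F ?k x) (unit_section (cmp E w ?k))) = kpair el (res F (fvfac X m) (res F ?k x)) (unit_section w')"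
      by (intro component_res) (use m in simp_all)
    moreover have "res F (fvfac X m) (res F ?k x) = res F m x"
      using presheaf_simps(3)[OF F v(1) k(1), of x] v x k by simp
    ultimately show ?thesis by (simp add: fvfac_slice[OF t] tr)
  qed
  have e1: "(\<lambda>w\<in>Ob EV. sec (prod_component el X V F (q w)) w) =
      (\<lambda>w\<in>Ob EV. (\<lambda>x. kpair el x (unit_section w)) ` sec F (src E w))"
    by (rule restrict_ext) (rule sc)
  have e2: "(\<lambda>t\<in>Ar EV. \<lambda>z\<in>sec (prod_component el X V F (q (tgt EV t))) (tgt EV t).
        res (prod_component el X V F (q (src EV t))) (vfac EV Ic (slice_proj X) (slice_clv X) t)
          (prod_trans el X V F (far (slice_proj X) t) (tgt EV t) z)) =
      (\<lambda>t\<in>Ar EV. \<lambda>z\<in>(\<lambda>x. kpair el x (unit_section (tgt EV t))) ` sec F (src E (tgt EV t)).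
         kpair el (res F (far (slice_forget E) t) (ufst el z)) (unit_section (src EV t)))"
  proof (rule restrict_ext)
    fix t assume t: "t \<in> Ar EV"
    obtain w' w m where tm: "t = (w', w, m)" by (cases t)
    have w: "w \<in> Ob EV" using t by (auto simp: tm)
    show "(\<lambda>z\<in>sec (prod_component el X V F (q (tgt EV t))) (tgt EV t).
        res (prod_component el X V F (q (src EV t))) (vfac EV Ic (slice_proj X) (slice_clv X) t)
          (prod_trans el X V F (far (slice_proj X) t) (tgt EV t) z)) =
      (\<lambda>z\<in>(\<lambda>x. kpair el x (unit_section (tgt EV t))) ` sec F (src E (tgt EV t)).
         kpair el (res F (far (slice_forget E) t) (ufst el z)) (unit_section (src EV t)))"
      unfolding tm slice_simps(3,4) slice_proj_simps slice_forget_simps(2) sc[OF w]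
      by (rule restrict_ext) (use res[OF t[unfolded tm]] in \<open>auto simp: u\<close>)
  qed
  show ?thesis unfolding glue_def Loc.tagged_def Y_simps slice_proj_simps(1) e1 e2 ..
qed

lemma
  shows prod_functor_functor: "is_functor (Sh el E (coev X)) (Sh el EV (coev Y)) (prod_functor el X V)"
    and prod_functor_iso: "isomorphic_functors (Sh el E (coev X)) (Sh el EV (coev Y))
      (prod_functor el X V) (pull_functor EV (slice_forget E))"
proof -
  have fob: "fob (prod_functor el X V) F = Loc.tagged unit_section F" if "sheaf el E (coev X) F" for F
    using prod_glue_eq[OF sheaf_presheaf[OF that]] by (simp add: prod_functor_def Let_def)
  have far: "far (prod_functor el X V) (F, G, \<alpha>) = (Loc.tagged unit_section F, Loc.tagged unit_section G,
      \<lambda>w\<in>Ob EV. \<lambda>z\<in>sec (Loc.tagged unit_section F) w. kpair el (\<alpha> (src E w) (ufst el z)) (unit_section w))"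
    if "(F, G, \<alpha>) \<in> Ar (Sh el E (coev X))" for F G \<alpha>
  proof -
    have F: "sheaf el E (coev X) F" "sheaf el E (coev X) G" using that by simp_all
    have "(\<lambda>w\<in>Ob EV. \<lambda>z\<in>sec (Loc.tagged unit_section F) w. kpair el (\<alpha> (src E w) (ufst el z)) (usnd el z)) =
      (\<lambda>w\<in>Ob EV. \<lambda>z\<in>sec (Loc.tagged unit_section F) w. kpair el (\<alpha> (src E w) (ufst el z)) (unit_section w))"
      by (intro restrict_ext) (auto simp: Loc.tagged_simps(1) u)
    then show ?thesis
      using fob[OF F(1)] fob[OF F(2)] by (simp add: prod_functor_def Let_def del: restrict_apply)
  qed
  show "is_functor (Sh el E (coev X)) (Sh el EV (coev Y)) (prod_functor el X V)"
    "isomorphic_functors (Sh el E (coev X)) (Sh el EV (coev Y)) (prod_functor el X V) (pull_functor EV (slice_forget E))"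
    unfolding coev_over
    by (rule Loc.tagged_functor[OF fob far], assumption+) (rule Loc.tagged_functor_iso[OF fob far], assumption+)
qed

text \<open>One quasi-inverse \<open>e\<close> serves both comparisons: after passage to sheaves on
  the slice, the localization functor becomes isomorphic to restriction, and hence to the fibrewise
  product, and \<open>quasi_inverse_comp\<close> carries this back.\<close>

theorem localization:
  "\<exists>e. quasi_inverse (Sh el EV (coev Y)) Loc.over e (slice_sections el E (coev X) V) \<and>
     isomorphic_functors (Sh el E (coev X)) Loc.over (localize el E Loc.A)
       (comp_func e (pull_functor EV (slice_forget E))) \<and>
     is_functor (Sh el E (coev X)) (Sh el EV (coev Y)) (prod_functor el X V) \<and>
     isomorphic_functors (Sh el E (coev X)) Loc.over (localize el E Loc.A) (comp_func e (prod_functor el X V))"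
proof -
  obtain e where e: "quasi_inverse (Sh el EV (coev Y)) Loc.over e (slice_sections el E (coev X) V)"
    using Loc.KF_quasi_inverse unfolding coev_over by blast
  note l = Loc.KF_localize[folded coev_over]
  note p = isomorphic_functors_trans[OF l isomorphic_functors_sym[OF prod_functor_iso]]
  show ?thesis
    using e prod_functor_functor quasi_inverse_comp[OF e Loc.localize_functor l]
      quasi_inverse_comp[OF e Loc.localize_functor p] by blast
qed

end

theorem proposition5p38:
  fixes el :: "'u \<Rightarrow> 'u set"
    and X :: "('o, 'm, 'p, 'n) fsite"
    and V :: 'o
  assumes "universe el" and "fibred_site el X" and "V \<in> Ob (tot X)"
  defines "E \<equiv> tot X" and "Y \<equiv> slice_fsite el X V"
  defines "\<gamma> \<equiv> slice_forget E"
  defines "\<epsilon>V \<equiv> eps el E (coev X) V"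
  defines "T \<equiv> Sh el E (coev X)" and "T' \<equiv> Sh el (slice E V) (coev Y)"
  shows "is_induced_topology el (slice E V) E (coev X) \<gamma> (coev Y) \<and>
    (\<exists>e. quasi_inverse T' (slice T \<epsilon>V) e (slice_sections el E (coev X) V) \<and>
       isomorphic_functors T (slice T \<epsilon>V) (localize el E \<epsilon>V) (comp_func e (pull_functor (slice E V) \<gamma>)) \<and>
       is_functor T T' (prod_functor el X V) \<and>
       isomorphic_functors T (slice T \<epsilon>V) (localize el E \<epsilon>V) (comp_func e (prod_functor el X V)))"
proof -
  interpret S: cleaved_site_over el X V
    using assms(1-3) by unfold_locales
  show ?thesis
    unfolding E_def Y_def \<gamma>_def \<epsilon>V_def T_def T'_def
    using S.coev_over_induced S.localization by blast
qed

end
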